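(* Let $\lambda_0\in\mathbb R$, let $v$ satisfy Assumptions A and B at $\lambda_0$ (see context), with exponent $\rho_0>1$ in Assumption A, and put $\rho=\tfrac32\min\{\rho_0-1,1\}$. Let $x_1\in(x_-(\lambda_0),x_+(\lambda_0))$. Then there are a neighborhood $U$ of $\lambda_0$ (with $x_1\in(x_-(\lambda),x_+(\lambda))$ for $\lambda\in U$) and constants $\hbar_0,C,\kappa>0$ such that for every $\hbar\in(0,\hbar_0]$ and every eigenvalue $\lambda=\lambda(\hbar)\in U$ of $H_\hbar$, the real normalized eigenfunction $\psi(x)=\psi(x;\lambda,\hbar)$ (i.e. $\int_{-\infty}^{\infty}\psi^2dx=1$; it is defined up to a sign) has the following properties. (i) $\psi(x)=c_\pm u_\pm(x;\lambda,\hbar)$ with constants $c_\pm=c_\pm(\lambda,\hbar)$ such that $$\Big||c_\pm(\lambda,\hbar)|-2^{1/2}\pi^{1/2}\hbar^{-1/6}\Big(\int_{x_-(\lambda)}^{x_+(\lambda)}(\lambda-v(x))^{-1/2}dx\Big)^{-1/2}\Big|\le C\hbar^{1/6}.$$ (ii) The asymptotics of $\psi$ for $x\in(x_1,\infty)$ is given by $\psi=c_+u_+$ and the formulas below with the sign "$+$", and for $x\in(-\infty,x_1)$ by $\psi=c_-u_-$ and the formulas below with the sign "$-$": for $\pm x\ge\pm x_\pm(\lambda)$, $$u_\pm(x)=|\xi_\pm'(x)|^{-1/2}\mathrm{Ai}\big(\hbar^{-2/3}\xi_\pm(x)\big)(1+\varepsilon_\pm(x)),\qquad|\varepsilon_\pm(x)|\le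 C\hbar(1+|\xi_\pm(x)|)^{-\rho},$$ and for $x$ between $x_1$ and $x_\pm(\lambda)$, $$\Big|u_\pm(x)-|\xi_\pm'(x)|^{-1/2}\mathrm{Ai}\big(\hbar^{-2/3}\xi_\pm(x)\big)\Big|\le C\hbar^{7/6}\big(\hbar^{2/3}+|x-x_\pm(\lambda)|\big)^{-1/4}.$$ (iii) In the neighborhoods $|x-x_\pm(\lambda)|\le\kappa$ of the turning points, $$|\psi(x;\lambda,\hbar)|\le C\big(\hbar^{2/3}+|x-x_\pm(\lambda)|\big)^{-1/4}.$$
   Context: Let $v:\mathbb R\to\mathbb R$ and, for $\lambda\in\mathbb R$, $q(x)=q(x;\lambda)=v(x)-\lambda$. Assumption A at $\lambda$: $v\in C^2(\mathbb R)$ and, for some $\rho_0>1$, the function $\big(|q(x)|^{-3}q'(x)^2+q(x)^{-2}|q''(x)|\big)\big|\int_0^x|q(y)|^{1/2}dy\big|^{\rho_0}$ is bounded for sufficiently large $|x|$. Assumption B at $\lambda$: the equation $v(x)=\lambda$ has exactly two solutions $x_-(\lambda)<x_+(\lambda)$ (abbreviated $x_\pm$); $v(x)<\lambda$ for $x\in(x_-,x_+)$, $v(x)>\lambda$ for $x\notin[x_-,x_+]$, $\liminf_{|x|\to\infty}v(x)>\lambda$; $v$ is of class $C^3$ in some neighborhoods of $x_\pm$ and $\pm v'(x_\pm)>0$. (If B holds at $\lambda_0$, it holds for all $\lambda$ in a neighborhood of $\lambda_0$.) $H_\hbar=-\hbar^2\frac{d^2}{dx^2}+v(x)$ is the Schrödinger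 operator in $L^2(\mathbb R)$, $\hbar>0$; $\lambda$ is an eigenvalue if $-\hbar^2\psi''+v\psi=\lambda\psi$ has a nonzero solution $\psi\in L^2(\mathbb R)$. $u_\pm(x)=u_\pm(x;\lambda,\hbar)$ denotes the unique solution of $-u''+\hbar^{-2}q(x;\lambda)u=0$ on $\mathbb R$ such that $u_\pm(x)=2^{-1}\pi^{-1/2}\hbar^{1/6}q(x)^{-1/4}\exp\big(\mp\hbar^{-1}\int_{x_\pm}^xq(y)^{1/2}dy\big)(1+o(1))$ as $x\to\pm\infty$. The functions $\xi_\pm(x)=\xi_\pm(x;\lambda)$ are defined by $\xi_+(x)=\big(\tfrac32\int_{x_+}^x q(y)^{1/2}dy\big)^{2/3}$ for $x\ge x_+$, $\xi_+(x)=-\big(\tfrac32\int_x^{x_+}|q(y)|^{1/2}dy\big)^{2/3}$ for $x_-<x\le x_+$; $\xi_-(x)=\big(\tfrac32\int_x^{x_-}q(y)^{1/2}dy\big)^{2/3}$ for $x\le x_-$, $\xi_-(x)=-\big(\tfrac32\int_{x_-}^x|q(y)|^{1/2}dy\big)^{2/3}$ for $x_-\le x<x_+$. $\mathrm{Ai}$ is the standard Airy function. *)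

theory Defs
  imports "HOL-Analysis.Analysis" "HOL-Library.Landau_Symbols"
begin

text \<open>
  Throughout, \<open>h\<close> is the semiclassical parameter and \<open>lam\<close> the spectral parameter. Integrals
  \<open>LBINT t=a..b. f t\<close> are oriented: exchanging the endpoints changes the sign.
\<close>

text \<open>\<open>C\<^sup>k\<close> regularity, meant for open sets \<open>S\<close>.\<close>

definition Ck_on :: "nat \<Rightarrow> (real \<Rightarrow> real) \<Rightarrow> real set \<Rightarrow> bool" where
  "Ck_on k f S \<longleftrightarrow>
     (\<forall>i<k. \<forall>x\<in>S. (deriv ^^ i) f differentiable at x) \<and> continuous_on S ((deriv ^^ k) f)"

definition q :: "(real \<Rightarrow> real) \<Rightarrow> real \<Rightarrow> real \<Rightarrow> real" where
  "q v lam x = v x - lam"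

definition assumption_A :: "(real \<Rightarrow> real) \<Rightarrow> real \<Rightarrow> real \<Rightarrow> bool" where
  "assumption_A v lam \<rho>0 \<longleftrightarrow>
     Ck_on 2 v UNIV \<and> \<rho>0 > 1 \<and>
     (\<exists>B R. \<forall>x. \<bar>x\<bar> \<ge> R \<longrightarrow>
        \<bar>((deriv (q v lam) x)\<^sup>2 / \<bar>q v lam x\<bar> ^ 3 + \<bar>deriv (deriv (q v lam)) x\<bar> / (q v lam x)\<^sup>2)
         * \<bar>LBINT y=0..x. sqrt \<bar>q v lam y\<bar>\<bar> powr \<rho>0\<bar> \<le> B)"

text \<open>
  The turning points. They are meaningful only when \<open>v x = lam\<close> has exactly two solutions, as
  required by \<open>assumption_B\<close> below.
\<close>

definition x_minus :: "(real \<Rightarrow> real) \<Rightarrow> real \<Rightarrow> real" where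
  "x_minus v lam = Min {x. v x = lam}"

definition x_plus :: "(real \<Rightarrow> real) \<Rightarrow> real \<Rightarrow> real" where
  "x_plus v lam = Max {x. v x = lam}"

definition assumption_B :: "(real \<Rightarrow> real) \<Rightarrow> real \<Rightarrow> bool" where
  "assumption_B v lam \<longleftrightarrow>
     card {x. v x = lam} = 2 \<and>
     (\<forall>x\<in>{x_minus v lam<..<x_plus v lam}. v x < lam) \<and>
     (\<forall>x. x \<notin> {x_minus v lam..x_plus v lam} \<longrightarrow> v x > lam) \<and>
     Liminf at_infinity (\<lambda>x. ereal (v x)) > ereal lam \<and>
     (\<exists>S. open S \<and> x_minus v lam \<in> S \<and> Ck_on 3 v S) \<and>
     (\<exists>S. open S \<and> x_plus v lam \<in> S \<and> Ck_on 3 v S) \<and>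
     deriv v (x_plus v lam) > 0 \<and> - deriv v (x_minus v lam) > 0"

definition has_second_deriv ::
    "(real \<Rightarrow> 'a::real_normed_vector) \<Rightarrow> (real \<Rightarrow> 'a) \<Rightarrow> bool" where
  "has_second_deriv f f'' \<longleftrightarrow>
     (\<exists>f'. \<forall>x. (f has_vector_derivative f' x) (at x) \<and> (f' has_vector_derivative f'' x) (at x))"

text \<open>Nonzero square integrable solutions of \<open>- h\<^sup>2 \<psi>'' + v \<psi> = lam \<psi>\<close>, real or complex valued.\<close>

definition eigenfunction ::
    "(real \<Rightarrow> real) \<Rightarrow> real \<Rightarrow> real \<Rightarrow> (real \<Rightarrow> 'a::real_normed_vector) \<Rightarrow> bool" where
  "eigenfunction v lam h \<psi> \<longleftrightarrow>
     (\<exists>\<psi>''. has_second_deriv \<psi> \<psi>'' \<and>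
        (\<forall>x. - ((h\<^sup>2) *\<^sub>R \<psi>'' x) + v x *\<^sub>R \<psi> x = lam *\<^sub>R \<psi> x)) \<and>
     (\<exists>x. \<psi> x \<noteq> 0) \<and>
     \<psi> \<in> borel_measurable lborel \<and> integrable lborel (\<lambda>x. (norm (\<psi> x))\<^sup>2)"

definition is_eigenvalue :: "(real \<Rightarrow> real) \<Rightarrow> real \<Rightarrow> real \<Rightarrow> bool" where
  "is_eigenvalue v h lam \<longleftrightarrow> (\<exists>\<psi> :: real \<Rightarrow> complex. eigenfunction v lam h \<psi>)"

definition normalized_eigenfunction ::
    "(real \<Rightarrow> real) \<Rightarrow> real \<Rightarrow> real \<Rightarrow> (real \<Rightarrow> real) \<Rightarrow> bool" where
  "normalized_eigenfunction v lam h \<psi> \<longleftrightarrow>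
     eigenfunction v lam h \<psi> \<and> (LBINT x. (\<psi> x)\<^sup>2) = 1"

text \<open>The solutions of \<open>- u'' + h\<^sup>-\<^sup>2 q u = 0\<close> decaying at plus and minus infinity respectively.\<close>

definition homogeneous_solution ::
    "(real \<Rightarrow> real) \<Rightarrow> real \<Rightarrow> real \<Rightarrow> (real \<Rightarrow> real) \<Rightarrow> bool" where
  "homogeneous_solution v lam h u \<longleftrightarrow>
     (\<exists>u''. has_second_deriv u u'' \<and> (\<forall>x. - u'' x + q v lam x / h\<^sup>2 * u x = 0))"

definition u_plus :: "(real \<Rightarrow> real) \<Rightarrow> real \<Rightarrow> real \<Rightarrow> real \<Rightarrow> real" where
  "u_plus v lam h = (THE u. homogeneous_solution v lam h u \<and>
     u \<sim>[at_top] (\<lambda>x. 1 / (2 * sqrt pi) * h powr (1/6) * q v lam x powr (-1/4) *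
        exp (- (1 / h) * (LBINT y=x_plus v lam..x. sqrt (q v lam y)))))"

definition u_minus :: "(real \<Rightarrow> real) \<Rightarrow> real \<Rightarrow> real \<Rightarrow> real \<Rightarrow> real" where
  "u_minus v lam h = (THE u. homogeneous_solution v lam h u \<and>
     u \<sim>[at_bot] (\<lambda>x. 1 / (2 * sqrt pi) * h powr (1/6) * q v lam x powr (-1/4) *
        exp ((1 / h) * (LBINT y=x_minus v lam..x. sqrt (q v lam y)))))"

text \<open>
  The mathematical domain of \<open>xi_plus\<close> is \<open>x > x_minus\<close>, that of \<open>xi_minus\<close> is \<open>x < x_plus\<close>.
\<close>

definition xi_plus :: "(real \<Rightarrow> real) \<Rightarrow> real \<Rightarrow> real \<Rightarrow> real" where
  "xi_plus v lam x =
     (if x \<ge> x_plus v lam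
      then (3/2 * (LBINT y=x_plus v lam..x. sqrt (q v lam y))) powr (2/3)
      else - ((3/2 * (LBINT y=x..x_plus v lam. sqrt \<bar>q v lam y\<bar>)) powr (2/3)))"

definition xi_minus :: "(real \<Rightarrow> real) \<Rightarrow> real \<Rightarrow> real \<Rightarrow> real" where
  "xi_minus v lam x =
     (if x \<le> x_minus v lam
      then (3/2 * (LBINT y=x..x_minus v lam. sqrt (q v lam y))) powr (2/3)
      else - ((3/2 * (LBINT y=x_minus v lam..x. sqrt \<bar>q v lam y\<bar>)) powr (2/3)))"

text \<open>
  The integral below converges only conditionally, hence the Henstock-Kurzweil integral (which
  covers improper integrals) instead of the Lebesgue integral.
\<close>

definition Airy_Ai :: "real \<Rightarrow> real" where
  "Airy_Ai x = 1 / pi * integral {0..} (\<lambda>t. cos (t ^ 3 / 3 + x * t))"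

end

theory Submission
  imports Defs "HOL-Complex_Analysis.Cauchy_Integral_Theorem" "HOL-Probability.Distributions"
    "HOL-Real_Asymp.Real_Asymp"
begin

text \<open>
  An eigenvalue comes with a square integrable solution, which has to be a multiple of the decaying
  solution at each end. Langer's change of variables \<open>xi\<close> turns the equation into a perturbed Airy
  equation. To the right of the turning point the solution is compared with the Airy ansatz through
  monotonicity of the Wronskian, to the left through an energy adapted to the oscillatory region.
  The energy of the two representations at \<open>x1\<close> and the normalization then determine
  both amplitudes. The left turning point is reduced to the right one by the reflection
  \<open>x \<mapsto> - x\<close>.
\<close>

text \<open>Errors must be relative to the amplitude and uniform in \<open>h\<close> and
  \<open>lam\<close>. On the decaying side this rules out absolute estimates, because the solution
  is exponentially small; on the oscillatory side it rules out quotients, because the ansatz has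
  zeros. So on the right the logarithm of the quotient of two positive functions is estimated, and
  on the left the difference from Ai, in a quadratic form that stays bounded on Ai itself. Value and
  Wronskian at the turning point carry the first estimate over to the second.

  No quantization condition is needed for the amplitudes. Energy at \<open>x1\<close> and mass to
  the right of \<open>x1\<close> both inherit their leading coefficient from one number, the limit
  1/pi of the energy of Ai at minus infinity. Equal energies make the two squared amplitudes agree
  up to a relative error of order \<open>h\<close> to the power 1/3; the normalization fixes their
  common value.

  Two technical obstacles shape the rest. The integral for Ai converges only conditionally, so its
  equation and asymptotics are read off shifted contours with absolute convergence. And
  \<open>v\<close> is only C^3 near a turning point, so \<open>xi\<close> must be shown to be as
  smooth as \<open>q\<close> although its formula contains fractional powers.\<close>

section \<open>Contour deformation for the Airy integral\<close>

definition airy_exp :: "real => complex => complex" where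
 "airy_exp x z = exp (\<i> * (z ^ 3 / 3 + of_real x * z))"

text \<open>With an entire primitive at hand, every deformation of contours reduces to comparing the
  values of the primitive at end points.\<close>

lemma airy_exp_primitive:
 obtains P where "!!z. (P has_field_derivative airy_exp x z) (at z)"
proof -
 have "airy_exp x holomorphic_on UNIV"
 unfolding airy_exp_def by (intro holomorphic_intros) auto
 from holomorphic_convex_primitive'[OF convex_UNIV open_UNIV this]
 obtain P where "!!z. (P has_field_derivative airy_exp x z) (at z)" by auto
 then show ?thesis using that by blast
qed

lemma norm_airy_exp:
 "norm (airy_exp x z) = exp (- (Re z)\<^sup>2 * Im z + (Im z) ^ 3 / 3 - x * Im z)"
proof -
 have "Im (z ^ 3) = 3 * (Re z)\<^sup>2 * Im z - (Im z) ^ 3" by (simp add: power3_eq_cube power2_eq_square algebra_simps)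
 then show ?thesis
 unfolding airy_exp_def by (simp add: norm_exp_eq_Re algebra_simps)
qed

text \<open>Going up from the real point \<open>R\<close>, the exponent is -R^2 y + y^3/3 - x y. The
  two hypotheses allow the last two terms to spoil at most the fractions 1/3 and 1/6 of R^2 y, so
  half of the decay survives and integrates to 2/R^2. Hence end points with 0 <= Im <= Re may be
  projected to the real axis with a vanishing error.\<close>

lemma airy_primitive_vertical:
 assumes P: "!!z. (P has_field_derivative airy_exp x z) (at z)"
 and R: "R > 0" "6 * \<bar>x\<bar> <= R\<^sup>2" and b: "0 <= b" "b <= R"
 shows "norm (P (Complex R b) - P (of_real R)) <= 2 / R\<^sup>2"
proof (cases "b = 0")
 case True
 then show ?thesis by (simp add: complex_of_real_def)
next
 case False
 with b have b0: "0 < b" by auto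
 have cplx: "Complex R y = of_real R + \<i> * of_real y" for y by (simp add: complex_eq_iff)
 have d: "((%y. P (Complex R y)) has_vector_derivative \<i> * airy_exp x (Complex R y)) (at y)" for y
 proof -
 have "((%y. of_real R + \<i> * of_real y) has_vector_derivative \<i>) (at y)" by (auto intro!: derivative_eq_intros)
 from field_vector_diff_chain_at[OF this P]
 show ?thesis by (simp add: cplx o_def)
 qed
 have "norm (P (Complex R b) - P (Complex R 0)) <=
 - 2 / R\<^sup>2 * exp (- R\<^sup>2 / 2 * b) - (- 2 / R\<^sup>2 * exp (- R\<^sup>2 / 2 * 0))"
 proof (rule differentiable_bound_general[OF b0, where f = "%y. P (Complex R y)"
 and \<phi> = "%y. - 2 / R\<^sup>2 * exp (- R\<^sup>2 / 2 * y)"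
 and f' = "%y. \<i> * airy_exp x (Complex R y)" and \<phi>' = "%y. exp (- R\<^sup>2 / 2 * y)"])
 show "continuous_on {0..b} (%y. P (Complex R y))" using d by (meson continuous_at_imp_continuous_on has_vector_derivative_continuous)
 show "continuous_on {0..b} (%y. - 2 / R\<^sup>2 * exp (- R\<^sup>2 / 2 * y))" by (intro continuous_intros)
 fix y assume y: "0 < y" "y < b"
 show "((%y. P (Complex R y)) has_vector_derivative \<i> * airy_exp x (Complex R y)) (at y)" by (rule d)
 show "((%y. - 2 / R\<^sup>2 * exp (- R\<^sup>2 / 2 * y)) has_vector_derivative exp (- R\<^sup>2 / 2 * y)) (at y)"
 using R by (auto intro!: derivative_eq_intros simp: has_real_derivative_iff_has_vector_derivative[symmetric] field_simps)
 have "y ^ 3 / 3 <= R\<^sup>2 * y / 3" using y b by (simp add: power3_eq_cube power2_eq_square mult_mono)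
 moreover have "- x * y <= R\<^sup>2 * y / 6"
 proof -
 have "- x <= R\<^sup>2 / 6" using R by linarith
 from mult_right_mono[OF this, of y] y show ?thesis by simp
 qed
 ultimately have "- R\<^sup>2 * y + y ^ 3 / 3 - x * y <= - R\<^sup>2 / 2 * y" by (simp add: algebra_simps)
 then show "norm (\<i> * airy_exp x (Complex R y)) <= exp (- R\<^sup>2 / 2 * y)" by (simp add: norm_mult norm_airy_exp)
 qed
 also have "... <= 2 / R\<^sup>2" by simp
 finally show ?thesis by (simp add: complex_of_real_def)
qed

lemma airy_primitive_line:
 assumes P: "!!z. (P has_field_derivative airy_exp x z) (at z)"
 and int: "set_integrable lborel {T0..} (%t. airy_exp x (z0 + d * of_real t))"
 shows "((%T. P (z0 + d * of_real T)) \<longlongrightarrow>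
 P (z0 + d * of_real T0) + d * (LINT t:{T0..}|lborel. airy_exp x (z0 + d * of_real t))) at_top"
proof -
 have dv: "((%t. P (z0 + d * of_real t)) has_vector_derivative d * airy_exp x (z0 + d * of_real t)) (at t)" for t
 proof -
 have "((%t. z0 + d * of_real t) has_vector_derivative d) (at t)" by (auto intro!: derivative_eq_intros)
 from field_vector_diff_chain_at[OF this P]
 show ?thesis by (simp add: o_def)
 qed
 have eq: "P (z0 + d * of_real T0) + d * (LINT t:{T0..T}|lborel. airy_exp x (z0 + d * of_real t))
 = P (z0 + d * of_real T)" if "T0 <= T" for T
 proof -
 have "(LINT t:{T0..T}|lborel. d * airy_exp x (z0 + d * of_real t)) =
 P (z0 + d * of_real T) - P (z0 + d * of_real T0)"
 unfolding set_lebesgue_integral_def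
 proof (rule integral_FTC_atLeastAtMost[OF that])
 show "continuous_on {T0..T} (%t. d * airy_exp x (z0 + d * of_real t))"
 unfolding airy_exp_def by (intro continuous_intros) auto
 qed (use dv in \<open>auto intro: has_vector_derivative_at_within\<close>)
 then show ?thesis by simp
 qed
 have "((%T. P (z0 + d * of_real T0) + d * (LINT t:{T0..T}|lborel. airy_exp x (z0 + d * of_real t))) \<longlongrightarrow>
 P (z0 + d * of_real T0) + d * (LINT t:{T0..}|lborel. airy_exp x (z0 + d * of_real t))) at_top"
 by (intro tendsto_intros tendsto_set_lebesgue_integral_at_top int) auto
 then show ?thesis by (rule Lim_transform_eventually) (use eq in \<open>auto simp: eventually_at_top_linorder\<close>)
qed

lemma gaussian_integrable: "c > 0 ==> integrable lborel (%t::real. exp (- c * t\<^sup>2))"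
proof -
 assume c: "c > 0"
 have "integrable lborel (%x::real. exp (- x\<^sup>2))"
 using has_bochner_integral_even_function[OF gaussian_moment_0] by (auto simp: has_bochner_integral_iff)
 from lborel_integrable_real_affine[OF this, of "sqrt c" 0] c
 show ?thesis by (simp add: power_mult_distrib)
qed

lemma set_integrable_complex_bound:
 fixes f :: "real => complex"
 assumes "continuous_on UNIV f" "c > 0" "!!t. t >= a ==> norm (f t) <= C * exp (- c * t\<^sup>2)"
 shows "set_integrable lborel {a..} f"
 unfolding set_integrable_def
proof (rule Bochner_Integration.integrable_bound)
 show "integrable lborel (%t. C * exp (- c * t\<^sup>2))" using gaussian_integrable[OF assms(2)] by simp
 show "(%x. indicat_real {a..} x *\<^sub>R f x) \<in> borel_measurable lborel" using borel_measurable_continuous_onI[OF assms(1)] by simp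
 show "AE x in lborel. norm (indicat_real {a..} x *\<^sub>R f x) <= norm (C * exp (- c * x\<^sup>2))"
 using assms(3) by (intro AE_I2) (fastforce simp: indicator_def intro: order_trans[OF _ abs_ge_self])
qed

lemma continuous_on_airy_exp_line: "continuous_on S (%t. airy_exp x (z0 + d * of_real t))"
 unfolding airy_exp_def by (intro continuous_intros) auto

text \<open>Along Im = 1 the integrand is Gaussian and the primitive converges; the vertical
  estimate brings the limit down to the real axis. This is the convergence of the improper Airy
  integral.\<close>

lemma airy_primitive_limit:
 assumes P: "!!z. (P has_field_derivative airy_exp x z) (at z)"
 obtains L where "((%R. P (of_real R)) \<longlongrightarrow> L) at_top"
proof -
 have int: "set_integrable lborel {0..} (%t. airy_exp x (\<i> + 1 * of_real t))"
 by (rule set_integrable_complex_bound[where c = 1 and C = "exp (1/3 - x)", OF continuous_on_airy_exp_line])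
 (auto simp: norm_airy_exp exp_add[symmetric])
 from airy_primitive_line[OF P int] obtain L where L: "((%T. P (\<i> + 1 * of_real T)) \<longlongrightarrow> L) at_top" by blast
 have "((%T. P (of_real T) - P (\<i> + 1 * of_real T)) \<longlongrightarrow> 0) at_top"
 proof (rule Lim_null_comparison)
 show "\<forall>\<^sub>F T in at_top. norm (P (of_real T) - P (\<i> + 1 * of_real T)) <= 2 / T\<^sup>2"
 proof -
 have "\<forall>\<^sub>F T in at_top. T >= 1 + sqrt (6 * \<bar>x\<bar>)" by (rule eventually_ge_at_top)
 then show ?thesis
 proof eventually_elim
 case (elim T)
 have T: "T >= 1" using elim by (smt (verit) real_sqrt_ge_zero abs_ge_zero)
 have "sqrt (6 * \<bar>x\<bar>) <= T" using elim by simp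
 then have "6 * \<bar>x\<bar> <= T\<^sup>2" using T by (simp add: sqrt_le_D)
 from airy_primitive_vertical[OF P _ this, of 1] T
 show ?case by (simp add: norm_minus_commute Complex_eq add.commute)
 qed
 qed
 show "((%T::real. 2 / T\<^sup>2) \<longlongrightarrow> 0) at_top"
 by (intro real_tendsto_divide_at_top tendsto_const filterlim_pow_at_top filterlim_ident) auto
 qed
 from tendsto_add[OF L this] have "((%T. P (of_real T)) \<longlongrightarrow> L) at_top" by simp
 then show ?thesis using that by blast
qed

text \<open>On the imaginary axis the integrand is real and the direction is \<open>\<i>\<close>, so
  the real part of the primitive does not move. A contour may therefore start anywhere on this
  axis.\<close>

lemma airy_primitive_imaginary_axis:
 assumes P: "!!z. (P has_field_derivative airy_exp x z) (at z)"
 shows "Re (P (\<i> * of_real y)) = Re (P 0)"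
proof -
 have d: "((%t. P (\<i> * of_real t)) has_vector_derivative \<i> * airy_exp x (\<i> * of_real t)) (at t)" for t
 proof -
 have "((%t. \<i> * of_real t) has_vector_derivative \<i>) (at t)" by (auto intro!: derivative_eq_intros)
 from field_vector_diff_chain_at[OF this P]
 show ?thesis by (simp add: o_def)
 qed
 have re: "Re (\<i> * airy_exp x (\<i> * of_real t)) = 0" for t
 proof -
 have "airy_exp x (\<i> * of_real t) = exp (of_real (t ^ 3 / 3 - x * t))"
 unfolding airy_exp_def by (rule arg_cong[where f = exp]) (simp add: complex_eq_iff power3_eq_cube)
 also have "... = of_real (exp (t ^ 3 / 3 - x * t))" by (rule exp_of_real)
 finally show ?thesis by simp
 qed
 have "((%t. Re (P (\<i> * of_real t))) has_field_derivative 0) (at t)" for t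
 using bounded_linear.has_vector_derivative[OF bounded_linear_Re d[of t]] re by (simp add: has_real_derivative_iff_has_vector_derivative)
 then have "\<forall>t. ((%t. Re (P (\<i> * of_real t))) has_field_derivative 0) (at t)" by blast
 from DERIV_isconst_all[OF this, of y 0] show ?thesis by simp
qed

text \<open>Along the real axis Re \<open>P\<close> is a primitive of the cosine, and a
  Henstock-Kurzweil integral over an unbounded set is a limit over large boxes, so conditional
  convergence of the values of \<open>P\<close> is enough.\<close>

lemma Airy_Ai_eq_limit:
 assumes P: "!!z. (P has_field_derivative airy_exp x z) (at z)"
 and L: "((%R. P (of_real R)) \<longlongrightarrow> L) at_top"
 shows "Airy_Ai x = 1 / pi * Re (L - P 0)"
proof -
 let ?f = "%t. cos (t ^ 3 / 3 + x * t)"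
 have "airy_exp x (of_real t) = exp (\<i> * of_real (t ^ 3 / 3 + x * t))" for t
 unfolding airy_exp_def by simp
 then have re: "Re (airy_exp x (of_real t)) = ?f t" for t by (simp only: Re_exp) simp
 have d: "((%t. Re (P (of_real t))) has_vector_derivative ?f t) (at t within S)" for t S
 proof -
 have "(complex_of_real has_vector_derivative 1) (at t)" by (auto intro!: derivative_eq_intros)
 from field_vector_diff_chain_at[OF this P]
 have "((%t. P (of_real t)) has_vector_derivative airy_exp x (of_real t)) (at t)" by (simp add: o_def)
 from bounded_linear.has_vector_derivative[OF bounded_linear_Re this]
 show ?thesis using re by (simp add: has_vector_derivative_at_within)
 qed
 have fin: "(?f has_integral (Re (P (of_real b)) - Re (P 0))) {0..b}" if "0 <= b" for b using fundamental_theorem_of_calculus[OF that d] by simp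
 have box: "((%t. if t \<in> {0..} then ?f t else 0) has_integral (if b >= 0 then Re (P (of_real b)) - Re (P 0) else 0)) (cbox a b)"
 if "a <= 0" for a b
 proof -
 have "(?f has_integral (if b >= 0 then Re (P (of_real b)) - Re (P 0) else 0)) ({0..b})" using fin[of b] by auto
 moreover have "{0..} \<inter> cbox a b = {0..b}" using that by auto
 ultimately show ?thesis by (simp only: has_integral_restrict_Int)
 qed
 have LR: "((%R. Re (P (of_real R)) - Re (P 0)) \<longlongrightarrow> Re (L - P 0)) at_top"
 using tendsto_diff[OF tendsto_Re[OF L] tendsto_const[of "Re (P 0)"]] by simp
 have "(?f has_integral Re (L - P 0)) {0..}"
 unfolding has_integral_alt'
 proof (intro conjI allI impI)
 fix a b :: real
 have "(%t. if t \<in> {0..} then ?f t else 0) integrable_on cbox (min a 0) b" using box[of "min a 0" b] by (auto simp: integrable_on_def)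
 then show "(%t. if t \<in> {0..} then ?f t else 0) integrable_on cbox a b" by (rule integrable_on_subcbox) auto
 next
 fix e :: real assume "e > 0"
 with LR have "\<forall>\<^sub>F R in at_top. dist (Re (P (of_real R)) - Re (P 0)) (Re (L - P 0)) < e" by (rule tendstoD)
 then obtain N where N: "!!R. R >= N ==> dist (Re (P (of_real R)) - Re (P 0)) (Re (L - P 0)) < e"
 unfolding eventually_at_top_linorder by blast
 show "\<exists>B>0. \<forall>a b. ball 0 B \<subseteq> cbox a b -->
 norm (integral (cbox a b) (%t. if t \<in> {0..} then ?f t else 0) - Re (L - P 0)) < e"
 proof (intro exI[of _ "\<bar>N\<bar> + 1"] conjI allI impI)
 fix a b :: real assume sub: "ball 0 (\<bar>N\<bar> + 1) \<subseteq> cbox a b"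
 have "0 \<in> ball 0 (\<bar>N\<bar> + 1)" "\<bar>N\<bar> \<in> ball 0 (\<bar>N\<bar> + 1)" by (auto simp: dist_norm)
 with sub have "0 \<in> cbox a b" "\<bar>N\<bar> \<in> cbox a b" by blast+
 then have ab: "a <= 0" "b >= 0" "b >= N" by auto
 then have "integral (cbox a b) (%t. if t \<in> {0..} then ?f t else 0) = Re (P (of_real b)) - Re (P 0)"
 using box[OF ab(1), of b] by (simp add: integral_unique)
 then show "norm (integral (cbox a b) (%t. if t \<in> {0..} then ?f t else 0) - Re (L - P 0)) < e" using N[OF ab(3)] by (simp add: dist_norm)
 qed simp
 qed
 then show ?thesis unfolding Airy_Ai_def by (simp add: integral_unique)
qed

text \<open>The start of the line lies on the imaginary axis, where Re \<open>P\<close> is constant,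
  and its far end lies in the sector where the vertical estimate applies. The line Im = 1 serves for
  the differential equation, lines through the saddle points for the asymptotics.\<close>

lemma Airy_Ai_line:
 assumes start: "Re (z0 + d * of_real T0) = 0"
 and int: "set_integrable lborel {T0..} (%t. airy_exp x (z0 + d * of_real t))"
 and sector: "\<forall>\<^sub>F t in at_top. 0 <= Im (z0 + d * of_real t) & Im (z0 + d * of_real t) <= Re (z0 + d * of_real t)"
 and d: "Re d > 0"
 shows "Airy_Ai x = 1 / pi * Re (d * (LINT t:{T0..}|lborel. airy_exp x (z0 + d * of_real t)))"
proof -
 let ?\<gamma> = "%t::real. z0 + d * of_real t"
 let ?J = "d * (LINT t:{T0..}|lborel. airy_exp x (?\<gamma> t))"
 obtain P where P: "!!z. (P has_field_derivative airy_exp x z) (at z)" using airy_exp_primitive by blast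
 obtain L where L: "((%R. P (of_real R)) \<longlongrightarrow> L) at_top" using airy_primitive_limit[OF P] by blast
 have Re_top: "filterlim (%t. Re (?\<gamma> t)) at_top at_top"
 using d by (simp, intro filterlim_tendsto_add_at_top[OF tendsto_const] filterlim_tendsto_pos_mult_at_top[OF tendsto_const])
 (auto simp: filterlim_ident)
 have "((%t. P (?\<gamma> t) - P (of_real (Re (?\<gamma> t)))) \<longlongrightarrow> 0) at_top"
 proof (rule Lim_null_comparison)
 have "\<forall>\<^sub>F t in at_top. Re (?\<gamma> t) >= 1 + sqrt (6 * \<bar>x\<bar>)" using Re_top by (simp add: filterlim_at_top)
 then show "\<forall>\<^sub>F t in at_top. norm (P (?\<gamma> t) - P (of_real (Re (?\<gamma> t)))) <= 2 / (Re (?\<gamma> t))\<^sup>2" using sector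
 proof eventually_elim
 case (elim t)
 let ?T = "Re (?\<gamma> t)"
 have T: "?T >= 1" using elim by (smt (verit) real_sqrt_ge_zero abs_ge_zero)
 have "sqrt (6 * \<bar>x\<bar>) <= ?T" using elim by simp
 then have "6 * \<bar>x\<bar> <= ?T\<^sup>2" using T by (simp add: sqrt_le_D)
 from airy_primitive_vertical[OF P _ this, of "Im (?\<gamma> t)"] T elim
 show ?case by (metis complex_surj less_le_trans zero_less_one)
 qed
 have "((%T. 2 / T\<^sup>2) \<longlongrightarrow> (0::real)) at_top"
 by (intro real_tendsto_divide_at_top tendsto_const filterlim_pow_at_top filterlim_ident) auto
 from filterlim_compose[OF this Re_top]
 show "((%t. 2 / (Re (?\<gamma> t))\<^sup>2) \<longlongrightarrow> 0) at_top" .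
 qed
 from tendsto_add[OF this filterlim_compose[OF L Re_top]]
 have "((%t. P (?\<gamma> t)) \<longlongrightarrow> L) at_top" by simp
 moreover have "((%t. P (?\<gamma> t)) \<longlongrightarrow> P (?\<gamma> T0) + ?J) at_top" by (rule airy_primitive_line[OF P int])
 ultimately have "L = P (?\<gamma> T0) + ?J" by (rule tendsto_unique[rotated]) auto
 moreover have "Re (P (?\<gamma> T0)) = Re (P 0)"
 proof -
 have "?\<gamma> T0 = \<i> * of_real (Im (?\<gamma> T0))" using start by (simp add: complex_eq_iff)
 then show ?thesis using airy_primitive_imaginary_axis[OF P] by metis
 qed
 ultimately have "Re (L - P 0) = Re ?J" by simp
 then show ?thesis using Airy_Ai_eq_limit[OF P L] by simp
qed

section \<open>Airy's differential equation\<close>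

text \<open>A quadratic remainder survives integration against a Gaussian, which makes
  differentiation under the integral sign elementary.\<close>

lemma has_vector_derivative_quadratic:
 fixes f :: "real => 'a::real_normed_vector"
 assumes "!!h. \<bar>h\<bar> <= 1 ==> norm (f (x + h) - f x - h *\<^sub>R D) <= C * h\<^sup>2"
 shows "(f has_vector_derivative D) (at x)"
 unfolding has_vector_derivative_def has_derivative_at
proof (intro conjI bounded_linear_scaleR_left)
 show "(%h. norm (f (x + h) - f x - h *\<^sub>R D) / norm h) \<midarrow>0\<rightarrow> 0"
 proof (rule Lim_null_comparison)
 have "\<forall>\<^sub>F h in at (0::real). \<bar>h\<bar> <= 1" by (auto simp: eventually_at intro!: exI[of _ 1])
 then show "\<forall>\<^sub>F h in at 0. norm (norm (f (x + h) - f x - h *\<^sub>R D) / norm h) <= C * \<bar>h\<bar>"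
 using eventually_neq_at_within[of 0 0 UNIV]
 proof eventually_elim
 case (elim h)
 have "C * h\<^sup>2 / \<bar>h\<bar> = C * \<bar>h\<bar>" using elim by (simp add: field_simps power2_eq_square flip: abs_mult)
 then show ?case using divide_right_mono[OF assms[OF elim(1)], of "\<bar>h\<bar>"] by simp
 qed
 show "((%h. C * \<bar>h\<bar>) \<longlongrightarrow> 0) (at 0)" by (rule tendsto_eq_intros tendsto_rabs_zero refl)+ auto
 qed
qed

text \<open>The derivative of order \<open>k\<close> in \<open>x\<close> of the integral along Im =
  1: each differentiation of the exponential brings down a factor \<open>\<i> * z\<close>.\<close>

definition airy_moment :: "nat => real => complex" where
 "airy_moment k x = (LINT t:{0..}|lborel. (\<i> * (\<i> + of_real t)) ^ k * airy_exp x (\<i> + of_real t))"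

lemma norm_airy_exp_shift: "norm (airy_exp x (\<i> + of_real t)) = exp (1/3 - x) * exp (- t\<^sup>2)" by (simp add: norm_airy_exp exp_add[symmetric])

lemma norm_shift_le:
 assumes "0 <= t" shows "norm (\<i> + of_real t) <= exp t"
proof -
 have "norm (\<i> + of_real t) <= 1 + t" using norm_triangle_ineq[of \<i> "of_real t"] assms by simp
 also have "... <= exp t" by (rule exp_ge_add_one_self)
 finally show ?thesis .
qed

text \<open>Completing the square: half of the Gaussian absorbs the exponential growth by which the
  powers of \<open>z\<close> are majorized.\<close>

lemma exp_linear_gaussian: "exp (a * t) * exp (- t\<^sup>2) <= exp (a\<^sup>2 / 2) * exp (- (1/2) * t\<^sup>2)" for a t :: real
proof -
 have "0 <= (t - a)\<^sup>2" by simp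
 then have "a * t - t\<^sup>2 <= a\<^sup>2 / 2 - (1/2) * t\<^sup>2" by (simp add: power2_diff algebra_simps)
 then show ?thesis by (simp add: exp_add[symmetric])
qed

lemma airy_moment_integrand_bound:
 assumes "0 <= t"
 shows "norm ((\<i> * (\<i> + of_real t)) ^ k * airy_exp x (\<i> + of_real t))
 <= exp (1/3 - x) * exp ((real k)\<^sup>2 / 2) * exp (- (1/2) * t\<^sup>2)"
proof -
 have "norm ((\<i> * (\<i> + of_real t)) ^ k * airy_exp x (\<i> + of_real t))
 = norm (\<i> + of_real t) ^ k * (exp (1/3 - x) * exp (- t\<^sup>2))" by (simp add: norm_mult norm_power norm_airy_exp_shift del: norm_exp_eq_Re)
 also have "... <= exp t ^ k * (exp (1/3 - x) * exp (- t\<^sup>2))" using norm_shift_le[OF assms] by (intro mult_right_mono power_mono) auto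
 also have "... = exp (1/3 - x) * (exp (real k * t) * exp (- t\<^sup>2))" by (simp add: exp_of_nat_mult)
 also have "... <= exp (1/3 - x) * (exp ((real k)\<^sup>2 / 2) * exp (- (1/2) * t\<^sup>2))" by (intro mult_left_mono exp_linear_gaussian) auto
 finally show ?thesis by (simp add: mult.assoc)
qed

lemma airy_moment_integrable:
 "set_integrable lborel {0..} (%t. (\<i> * (\<i> + of_real t)) ^ k * airy_exp x (\<i> + of_real t))"
 by (rule set_integrable_complex_bound[where c = "1/2" and C = "exp (1/3 - x) * exp ((real k)\<^sup>2 / 2)"])
 (use airy_moment_integrand_bound in \<open>auto simp: airy_exp_def intro!: continuous_intros\<close>)

lemma airy_exp_increment:
 assumes "0 <= t" "\<bar>h\<bar> <= 1"
 shows "norm ((\<i> * (\<i> + of_real t)) ^ k * (airy_exp (x + h) (\<i> + of_real t) - airy_exp x (\<i> + of_real t)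
 - h *\<^sub>R (\<i> * (\<i> + of_real t) * airy_exp x (\<i> + of_real t))))
 <= h\<^sup>2 * (exp 1 * exp (1/3 - x) * exp ((real (k + 3))\<^sup>2 / 2) * exp (- (1/2) * t\<^sup>2))"
proof -
 let ?z = "\<i> + of_real t"
 let ?w = "\<i> * of_real h * ?z"
 have e: "airy_exp (x + h) ?z = airy_exp x ?z * exp ?w"
 unfolding airy_exp_def exp_add[symmetric] by (simp add: algebra_simps)
 have "norm (exp ?w - (1 + ?w)) <= exp (norm ?w) * (norm ?w)\<^sup>2" using Taylor_exp_field[of ?w 1] by (simp add: power2_eq_square)
 also have "... <= exp (1 + t) * (h\<^sup>2 * (exp t)\<^sup>2)"
 proof (intro mult_mono)
 have "norm ?z <= 1 + t" using norm_triangle_ineq[of \<i> "of_real t"] assms by simp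
 then have "norm ?w <= 1 * (1 + t)"
 unfolding norm_mult using assms by (intro mult_mono) auto
 then show "exp (norm ?w) <= exp (1 + t)" by simp
 show "(norm ?w)\<^sup>2 <= h\<^sup>2 * (exp t)\<^sup>2" using norm_shift_le[OF assms(1)]
 by (auto simp: norm_mult power_mult_distrib intro!: mult_left_mono power_mono)
 qed auto
 finally have b: "norm (exp ?w - (1 + ?w)) <= exp (1 + t) * (h\<^sup>2 * (exp t)\<^sup>2)" .
 have "(\<i> * ?z) ^ k * (airy_exp (x + h) ?z - airy_exp x ?z - h *\<^sub>R (\<i> * ?z * airy_exp x ?z))
 = (\<i> * ?z) ^ k * airy_exp x ?z * (exp ?w - (1 + ?w))"
 unfolding e by (simp add: algebra_simps scaleR_conv_of_real)
 then have "norm ((\<i> * ?z) ^ k * (airy_exp (x + h) ?z - airy_exp x ?z - h *\<^sub>R (\<i> * ?z * airy_exp x ?z)))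
 = norm ((\<i> * ?z) ^ k * airy_exp x ?z * (exp ?w - (1 + ?w)))" by (rule arg_cong)
 also have "... = norm ?z ^ k * (exp (1/3 - x) * exp (- t\<^sup>2)) * norm (exp ?w - (1 + ?w))"
 by (simp only: norm_mult norm_power norm_airy_exp_shift norm_ii mult_1)
 also have "... <= exp t ^ k * (exp (1/3 - x) * exp (- t\<^sup>2)) * (exp (1 + t) * (h\<^sup>2 * (exp t)\<^sup>2))"
 using norm_shift_le[OF assms(1)] b by (intro mult_mono power_mono) auto
 \<comment> \<open>The exponent \<open>k + 3\<close> collects \<open>k\<close> from the moment, one
   from the exponential of the increment and two from the square of the increment.\<close>
 also have "... = h\<^sup>2 * (exp 1 * exp (1/3 - x) * (exp (real (k + 3) * t) * exp (- t\<^sup>2)))"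
 proof -
 have "exp (real (k + 3) * t) = exp t ^ (k + 3)" by (rule exp_of_nat_mult)
 then show ?thesis by (simp add: exp_add power_add power2_eq_square power3_eq_cube)
 qed
 also have "... <= h\<^sup>2 * (exp 1 * exp (1/3 - x) * (exp ((real (k + 3))\<^sup>2 / 2) * exp (- (1/2) * t\<^sup>2)))"
 by (intro mult_left_mono exp_linear_gaussian) auto
 finally show ?thesis by (simp add: mult.assoc)
qed

lemma airy_moment_deriv: "(airy_moment k has_vector_derivative airy_moment (Suc k) x) (at x)"
proof (rule has_vector_derivative_quadratic)
 define G where "G = (%t::real. exp 1 * exp (1/3 - x) * exp ((real (k + 3))\<^sup>2 / 2) * exp (- (1/2) * t\<^sup>2))"
 fix h :: real assume h: "\<bar>h\<bar> <= 1"
 let ?m = "%k x t. (\<i> * (\<i> + of_real t)) ^ k * airy_exp x (\<i> + of_real t)"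
 let ?D = "%t. ?m k (x + h) t - ?m k x t - h *\<^sub>R ?m (Suc k) x t"
 have Gint: "integrable lborel G" unfolding G_def using gaussian_integrable[of "1/2"] by simp
 have Dint: "set_integrable lborel {0..} ?D" by (intro set_integral_diff set_integrable_scaleR_right airy_moment_integrable)
 have "airy_moment k (x + h) - airy_moment k x - h *\<^sub>R airy_moment (Suc k) x = (LINT t:{0..}|lborel. ?D t)"
 unfolding airy_moment_def by (subst set_integral_diff, (intro set_integral_diff set_integrable_scaleR_right airy_moment_integrable)+)
 (subst set_integral_diff, (intro set_integral_diff set_integrable_scaleR_right airy_moment_integrable)+,
 subst set_integral_scaleR_right, simp)
 also have "norm ... <= (LINT t|lborel. h\<^sup>2 * G t)"
 unfolding set_lebesgue_integral_def
 proof (rule Bochner_Integration.integral_norm_bound_integral)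
 show "integrable lborel (%t. indicat_real {0..} t *\<^sub>R ?D t)" using Dint unfolding set_integrable_def .
 show "integrable lborel (%t. h\<^sup>2 * G t)" using Gint by simp
 fix t :: real
 have "?D t = (\<i> * (\<i> + of_real t)) ^ k * (airy_exp (x + h) (\<i> + of_real t) - airy_exp x (\<i> + of_real t)
 - h *\<^sub>R (\<i> * (\<i> + of_real t) * airy_exp x (\<i> + of_real t)))" by (simp add: algebra_simps)
 then show "norm (indicat_real {0..} t *\<^sub>R ?D t) <= h\<^sup>2 * G t" using airy_exp_increment[of t h k x] h by (auto simp: indicator_def G_def)
 qed
 also have "... = h\<^sup>2 * (LINT t|lborel. G t)" by (rule integral_mult_right_zero)
 also have "... = (LINT t|lborel. G t) * h\<^sup>2" by (rule mult.commute)
 finally show "norm (airy_moment k (x + h) - airy_moment k x - h *\<^sub>R airy_moment (Suc k) x)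
 <= (LINT t|lborel. G t) * h\<^sup>2" .
qed

text \<open>The left side integrates (x + z^2) times the exponential, which is an exact derivative
  along the line, so only the end point \<open>\<i>\<close> contributes. Its contribution is purely
  imaginary; the real part is Airy's equation.\<close>

lemma airy_moment_recurrence: "of_real x * airy_moment 0 x - airy_moment 2 x = \<i> * airy_exp x \<i>"
proof -
 let ?g = "%t. (of_real x + (\<i> + of_real t)\<^sup>2) * airy_exp x (\<i> + of_real t)"
 have d: "((%t. - \<i> * airy_exp x (\<i> + of_real t)) has_vector_derivative ?g t) (at t within S)" for t S
 proof -
 have 1: "((%t. \<i> + of_real t) has_vector_derivative 1) (at t)" by (auto intro!: derivative_eq_intros)
 have 2: "(airy_exp x has_field_derivative (\<i> * ((\<i> + of_real t)\<^sup>2 + of_real x)) * airy_exp x (\<i> + of_real t)) (at (\<i> + of_real t))"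
 unfolding airy_exp_def by (auto intro!: derivative_eq_intros simp: field_simps)
 have "((%t. - \<i> * airy_exp x (\<i> + of_real t)) has_vector_derivative
 - \<i> * (1 * ((\<i> * ((\<i> + of_real t)\<^sup>2 + of_real x)) * airy_exp x (\<i> + of_real t)))) (at t)"
 using has_vector_derivative_mult_right[OF field_vector_diff_chain_at[OF 1 2], of "- \<i>"] by (simp add: o_def)
 then show ?thesis by (simp add: has_vector_derivative_at_within algebra_simps)
 qed
 have g: "?g t = of_real x * ((\<i> * (\<i> + of_real t)) ^ 0 * airy_exp x (\<i> + of_real t))
 - (\<i> * (\<i> + of_real t)) ^ 2 * airy_exp x (\<i> + of_real t)" for t
 proof -
 have "(of_real x + z\<^sup>2) * w = of_real x * ((\<i> * z) ^ 0 * w) - (\<i> * z) ^ 2 * w" for z w by (simp add: power_mult_distrib algebra_simps)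
 then show ?thesis .
 qed
 have int: "set_integrable lborel {0..} ?g"
 unfolding g by (intro set_integral_diff set_integrable_mult_right airy_moment_integrable)
 have 1: "of_real x * airy_moment 0 x - airy_moment 2 x = (LINT t:{0..}|lborel. ?g t)"
 unfolding g airy_moment_def by (subst set_integral_diff, (intro set_integrable_mult_right airy_moment_integrable)+)
 (simp add: set_integral_mult_right)
 have 2: "((%T. LINT t:{0..T}|lborel. ?g t) \<longlongrightarrow> (LINT t:{0..}|lborel. ?g t)) at_top"
 by (intro tendsto_set_lebesgue_integral_at_top int) auto
 have 3: "((%T. LINT t:{0..T}|lborel. ?g t) \<longlongrightarrow> \<i> * airy_exp x \<i>) at_top"
 proof (rule Lim_transform_eventually)
 show "\<forall>\<^sub>F T in at_top. - \<i> * airy_exp x (\<i> + of_real T) + \<i> * airy_exp x \<i> = (LINT t:{0..T}|lborel. ?g t)"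
 unfolding eventually_at_top_linorder
 proof (intro exI[of _ 0] allI impI)
 fix T :: real assume "0 <= T"
 have "(LINT t:{0..T}|lborel. ?g t) = - \<i> * airy_exp x (\<i> + of_real T) - (- \<i> * airy_exp x (\<i> + of_real 0))"
 unfolding set_lebesgue_integral_def
 by (rule integral_FTC_atLeastAtMost[OF \<open>0 <= T\<close> d]) (auto simp: airy_exp_def intro!: continuous_intros)
 then show "- \<i> * airy_exp x (\<i> + of_real T) + \<i> * airy_exp x \<i> = (LINT t:{0..T}|lborel. ?g t)" by simp
 qed
 have "((%T. airy_exp x (\<i> + of_real T)) \<longlongrightarrow> 0) at_top"
 proof (rule Lim_null_comparison)
 show "\<forall>\<^sub>F T in at_top. norm (airy_exp x (\<i> + of_real T)) <= exp (1/3 - x) * exp (- T)" using eventually_ge_at_top[of 1]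
 proof eventually_elim
 case (elim T)
 then have "T <= T\<^sup>2" by (simp add: power2_eq_square)
 then show ?case unfolding norm_airy_exp_shift by simp
 qed
 have "((%T::real. exp (- T)) \<longlongrightarrow> 0) at_top" by (rule filterlim_compose[OF exp_at_bot filterlim_uminus_at_bot_at_top])
 then show "((%T. exp (1/3 - x) * exp (- T)) \<longlongrightarrow> 0) at_top" by (rule tendsto_mult_right_zero)
 qed
 then have "((%T. - \<i> * airy_exp x (\<i> + of_real T) + \<i> * airy_exp x \<i>) \<longlongrightarrow> - \<i> * 0 + \<i> * airy_exp x \<i>) at_top"
 by (intro tendsto_intros)
 then show "((%T. - \<i> * airy_exp x (\<i> + of_real T) + \<i> * airy_exp x \<i>) \<longlongrightarrow> \<i> * airy_exp x \<i>) at_top" by simp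
 qed
 show ?thesis unfolding 1 by (rule tendsto_unique[OF trivial_limit_at_top_linorder 2 3])
qed

lemma Airy_Ai_moment: "Airy_Ai x = 1 / pi * Re (airy_moment 0 x)"
proof -
 have "Airy_Ai x = 1 / pi * Re (1 * (LINT t:{0..}|lborel. airy_exp x (\<i> + 1 * of_real t)))"
 proof (rule Airy_Ai_line)
 show "set_integrable lborel {0..} (%t. airy_exp x (\<i> + 1 * of_real t))" using airy_moment_integrable[of 0 x] by simp
 show "\<forall>\<^sub>F t in at_top. 0 <= Im (\<i> + 1 * of_real t) & Im (\<i> + 1 * of_real t) <= Re (\<i> + 1 * of_real t)"
 using eventually_ge_at_top[of 1] by eventually_elim simp
 qed auto
 then show ?thesis by (simp add: airy_moment_def)
qed

definition Airy_Ai' :: "real => real" where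
 "Airy_Ai' x = 1 / pi * Re (airy_moment 1 x)"

lemma Airy_Ai_deriv: "(Airy_Ai has_real_derivative Airy_Ai' x) (at x)"
proof -
 have "((%x. Re (airy_moment 0 x)) has_real_derivative Re (airy_moment (Suc 0) x)) (at x)"
 unfolding has_real_derivative_iff_has_vector_derivative by (rule bounded_linear.has_vector_derivative[OF bounded_linear_Re airy_moment_deriv])
 from DERIV_cmult[OF this, of "1 / pi"] show ?thesis
 unfolding Airy_Ai'_def by (simp add: Airy_Ai_moment[abs_def])
qed

lemma Airy_Ai'_deriv: "(Airy_Ai' has_real_derivative x * Airy_Ai x) (at x)"
proof -
 have "((%x. Re (airy_moment 1 x)) has_real_derivative Re (airy_moment (Suc 1) x)) (at x)"
 unfolding has_real_derivative_iff_has_vector_derivative by (rule bounded_linear.has_vector_derivative[OF bounded_linear_Re airy_moment_deriv])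
 moreover have "Re (airy_moment (Suc 1) x) = x * Re (airy_moment 0 x)"
 proof -
 have "airy_exp x \<i> = exp (of_real (1 / 3 - x))"
 unfolding airy_exp_def by (rule arg_cong[where f = exp]) (simp add: complex_eq_iff power3_eq_cube)
 also have "... = of_real (exp (1 / 3 - x))" by (rule exp_of_real)
 finally have "Re (\<i> * airy_exp x \<i>) = 0" by simp
 then have "Re (of_real x * airy_moment 0 x - airy_moment 2 x) = 0" by (simp only: airy_moment_recurrence)
 then show ?thesis by (simp add: numeral_2_eq_2)
 qed
 ultimately show ?thesis using DERIV_cmult[of "%x. Re (airy_moment 1 x)" _ x UNIV "1 / pi"] unfolding Airy_Ai'_def by (simp add: Airy_Ai_moment)
qed

section \<open>Asymptotics of Ai in both directions\<close>

lemma complex_gaussian_half: "(LINT t|lborel. indicat_real {0..} t *\<^sub>R complex_of_real (exp (- t\<^sup>2))) = of_real (sqrt pi / 2)"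
proof -
 have "(LINT t|lborel. indicat_real {0..} t *\<^sub>R exp (- t\<^sup>2)) = sqrt pi / 2"
 using gaussian_moment_0 by (simp add: has_bochner_integral_iff)
 moreover have "(LINT t|lborel. indicat_real {0..} t *\<^sub>R complex_of_real (exp (- t\<^sup>2)))
 = (LINT t|lborel. complex_of_real (indicat_real {0..} t *\<^sub>R exp (- t\<^sup>2)))" by (simp add: scaleR_conv_of_real)
 ultimately show ?thesis by (simp only: integral_complex_of_real)
qed

lemma complex_gaussian: "(LINT t|lborel. complex_of_real (exp (- t\<^sup>2))) = of_real (sqrt pi)"
proof -
 have "(LINT t|lborel. exp (- t\<^sup>2 :: real)) = sqrt pi"
 using has_bochner_integral_even_function[OF gaussian_moment_0] by (auto simp: has_bochner_integral_iff)
 then show ?thesis by (simp only: integral_complex_of_real)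
qed

text \<open>The line runs through the saddle point \<open>\<i> s\<^sup>2\<close> of the phase.\<close>

lemma Airy_Ai_asymp_right:
 "((%s. Airy_Ai (s ^ 4) * s * exp (2/3 * s ^ 6)) \<longlongrightarrow> 1 / (2 * sqrt pi)) at_top"
proof -
 \<comment> \<open>With x = s^4 and step 1/s along the line, the phase is exactly -2/3 s^6 - t^2
   plus an imaginary cubic term that vanishes as \<open>s\<close> grows. All powers of
   \<open>x\<close> become integer powers of \<open>s\<close>.\<close>
 let ?g = "%s t. indicat_real {0..} t *\<^sub>R exp (- of_real (t\<^sup>2) + \<i> * of_real (t ^ 3 / (3 * s ^ 3)))"
 have bnd: "norm (?g s t) <= exp (- t\<^sup>2)" for s t by (auto simp: indicator_def)
 have meas: "(%t. ?g s t) \<in> borel_measurable lborel" for s by (intro borel_measurable_scaleR borel_measurable_indicator)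
 (auto intro!: borel_measurable_continuous_onI continuous_intros)
 have G: "integrable lborel (%t::real. exp (- t\<^sup>2))" using gaussian_integrable[of 1] by simp
 have lim: "((%s. LINT t|lborel. ?g s t) \<longlongrightarrow> (LINT t|lborel. indicat_real {0..} t *\<^sub>R complex_of_real (exp (- t\<^sup>2)))) at_top"
 proof (rule integral_dominated_convergence_at_top[where w = "%t. exp (- t\<^sup>2)"])
 show "AE t in lborel. ((%s. ?g s t) \<longlongrightarrow> indicat_real {0..} t *\<^sub>R complex_of_real (exp (- t\<^sup>2))) at_top"
 proof (rule AE_I2)
 fix t :: real
 have "((%s. t ^ 3 / (3 * s ^ 3)) \<longlongrightarrow> 0) at_top" by real_asymp
 then have "((%s. ?g s t) \<longlongrightarrow> indicat_real {0..} t *\<^sub>R exp (- of_real (t\<^sup>2) + \<i> * of_real 0)) at_top"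
 by (intro tendsto_intros)
 then show "((%s. ?g s t) \<longlongrightarrow> indicat_real {0..} t *\<^sub>R complex_of_real (exp (- t\<^sup>2))) at_top"
 by (simp flip: exp_of_real)
 qed
 qed (use bnd meas G in \<open>auto intro!: always_eventually\<close>)
 have eq: "Airy_Ai (s ^ 4) * s * exp (2/3 * s ^ 6) = 1 / pi * Re (LINT t|lborel. ?g s t)" if s: "s > 0" for s
 proof -
 let ?z = "%t. \<i> * of_real (s\<^sup>2) + of_real (1 / s) * of_real t"
 have z: "airy_exp (s ^ 4) (?z t) = exp (- 2/3 * s ^ 6) *\<^sub>R exp (- of_real (t\<^sup>2) + \<i> * of_real (t ^ 3 / (3 * s ^ 3)))" for t
 proof -
 have "\<i> * (?z t ^ 3 / 3 + of_real (s ^ 4) * ?z t) = of_real (- 2/3 * s ^ 6) + (- of_real (t\<^sup>2) + \<i> * of_real (t ^ 3 / (3 * s ^ 3)))"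
 using s by (simp add: complex_eq_iff power3_eq_cube power2_eq_square field_simps) (simp add: algebra_simps power_numeral_reduce)?
 then show ?thesis unfolding airy_exp_def by (simp only: exp_add exp_of_real scaleR_conv_of_real)
 qed
 have int: "set_integrable lborel {0..} (%t. airy_exp (s ^ 4) (?z t))"
 unfolding z set_integrable_def by (rule Bochner_Integration.integrable_bound[of _ "%t. exp (- 2/3 * s ^ 6) * exp (- t\<^sup>2)"])
 (use G s in \<open>auto intro!: borel_measurable_scaleR borel_measurable_indicator borel_measurable_continuous_onI continuous_intros simp: indicator_def\<close>)
 have "Airy_Ai (s ^ 4) = 1 / pi * Re (of_real (1 / s) * (LINT t:{0..}|lborel. airy_exp (s ^ 4) (?z t)))"
 proof (rule Airy_Ai_line[OF _ int])
 show "\<forall>\<^sub>F t in at_top. 0 <= Im (?z t) & Im (?z t) <= Re (?z t)"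
 using eventually_ge_at_top[of "s * s\<^sup>2"] by eventually_elim (use s in \<open>auto simp: field_simps\<close>)
 qed (use s in auto)
 also have "(LINT t:{0..}|lborel. airy_exp (s ^ 4) (?z t)) = exp (- 2/3 * s ^ 6) *\<^sub>R (LINT t|lborel. ?g s t)"
 unfolding z set_lebesgue_integral_def by (simp flip: integral_scaleR_right) (simp add: algebra_simps)
 finally have "Airy_Ai (s ^ 4) = 1 / pi * (1 / s * (exp (- 2/3 * s ^ 6) * Re (LINT t|lborel. ?g s t)))" by simp
 then show ?thesis using s by (simp add: exp_minus field_simps)
 qed
 from tendsto_mult[OF tendsto_const[of "1 / pi"] tendsto_Re[OF lim]]
 have "((%s. 1 / pi * Re (LINT t|lborel. ?g s t)) \<longlongrightarrow> 1 / pi * (sqrt pi / 2)) at_top"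
 unfolding complex_gaussian_half by simp
 moreover have "1 / pi * (sqrt pi / 2) = 1 / (2 * sqrt pi)" by (simp add: field_simps)
 ultimately have "((%s. 1 / pi * Re (LINT t|lborel. ?g s t)) \<longlongrightarrow> 1 / (2 * sqrt pi)) at_top" by (simp only:)
 moreover have "\<forall>\<^sub>F s in at_top. 1 / pi * Re (LINT t|lborel. ?g s t) = Airy_Ai (s ^ 4) * s * exp (2/3 * s ^ 6)"
 using eventually_gt_at_top[of 0] by eventually_elim (rule eq[symmetric])
 ultimately show ?thesis by (rule Lim_transform_eventually)
qed

lemma Re_of_real_mult: "Re (of_real a * w) = a * Re w" by simp

text \<open>The line runs through the saddle point \<open>s\<^sup>2\<close> in the direction of steepest descent and starts on
 the imaginary axis.\<close>

lemma Airy_Ai_asymp_left: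
 "((%s. Airy_Ai (- (s ^ 4)) * s - (cos (2/3 * s ^ 6) + sin (2/3 * s ^ 6)) / sqrt (2 * pi)) \<longlongrightarrow> 0) at_top"
proof -
 let ?c = "%s t::real. t ^ 3 / (3 * sqrt 2 * s ^ 3)"
 let ?E = "%s t. exp (of_real (- (t\<^sup>2) - ?c s t) - \<i> * of_real (?c s t))"
 let ?g = "%s t. indicat_real {- sqrt 2 * s ^ 3..} t *\<^sub>R ?E s t"
 \<comment> \<open>For negative \<open>t\<close> the cubic term works against the Gaussian. The line
   meets the imaginary axis at t = - sqrt 2 s^3, and from there on the cubic term is at most t^2/3,
   which leaves the uniform majorant exp (- 2/3 t^2).\<close>
 have bnd: "norm (?g s t) <= exp (- (2/3) * t\<^sup>2)" if s: "s > 0" for s t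
 proof (cases "t >= - sqrt 2 * s ^ 3")
 case True
 have "- t * t\<^sup>2 <= sqrt 2 * s ^ 3 * t\<^sup>2" using True by (intro mult_right_mono) auto
 then have "- (t ^ 3) <= sqrt 2 * s ^ 3 * t\<^sup>2" by (simp add: power3_eq_cube power2_eq_square)
 then have "- (t ^ 3) / (3 * sqrt 2 * s ^ 3) <= sqrt 2 * s ^ 3 * t\<^sup>2 / (3 * sqrt 2 * s ^ 3)" using s by (intro divide_right_mono) auto
 also have "... = t\<^sup>2 / 3" using s by simp
 finally have "- (t\<^sup>2) - ?c s t <= - (2/3) * t\<^sup>2" by simp
 then show ?thesis using True by simp
 qed simp
 have meas: "(%t. ?g s t) \<in> borel_measurable lborel" for s
 proof -
 have "continuous_on UNIV (?E s)"
 unfolding divide_inverse by (intro continuous_intros)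
 then have "?E s \<in> borel_measurable lborel" by (simp add: borel_measurable_continuous_onI)
 then show ?thesis by (intro borel_measurable_scaleR borel_measurable_indicator) auto
 qed
 have G: "integrable lborel (%t::real. exp (- (2/3) * t\<^sup>2))" by (rule gaussian_integrable) simp
 have lim: "((%s. LINT t|lborel. ?g s t) \<longlongrightarrow> (LINT t|lborel. complex_of_real (exp (- t\<^sup>2)))) at_top"
 proof (rule integral_dominated_convergence_at_top[where w = "%t. exp (- (2/3) * t\<^sup>2)"])
 show "AE t in lborel. ((%s. ?g s t) \<longlongrightarrow> complex_of_real (exp (- t\<^sup>2))) at_top"
 proof (rule AE_I2)
 fix t :: real
 have "((%s::real. t ^ 3 * inverse (3 * sqrt 2) / s ^ 3) \<longlongrightarrow> 0) at_top"
 by (intro real_tendsto_divide_at_top tendsto_const filterlim_pow_at_top filterlim_ident) auto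
 then have c: "((%s. ?c s t) \<longlongrightarrow> 0) at_top" by (simp add: field_simps)
 have "((%s. ?E s t) \<longlongrightarrow> exp (of_real (- (t\<^sup>2) - 0) - \<i> * of_real 0)) at_top" by (intro tendsto_intros c)
 moreover have "\<forall>\<^sub>F s in at_top. ?E s t = ?g s t"
 proof -
 have "filterlim (%s::real. sqrt 2 * s ^ 3) at_top at_top"
 by (intro filterlim_tendsto_pos_mult_at_top[OF tendsto_const] filterlim_pow_at_top filterlim_ident) auto
 then have "\<forall>\<^sub>F s in at_top. sqrt 2 * s ^ 3 >= - t" by (simp only: filterlim_at_top)
 then show ?thesis by eventually_elim simp
 qed
 ultimately have "((%s. ?g s t) \<longlongrightarrow> exp (of_real (- (t\<^sup>2) - 0) - \<i> * of_real 0)) at_top"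
 by (rule Lim_transform_eventually)
 then show "((%s. ?g s t) \<longlongrightarrow> complex_of_real (exp (- t\<^sup>2))) at_top" by (simp flip: exp_of_real)
 qed
 show "\<forall>\<^sub>F s in at_top. AE t in lborel. norm (?g s t) <= exp (- (2/3) * t\<^sup>2)"
 using eventually_gt_at_top[of 0] by eventually_elim (intro AE_I2 bnd)
 qed (use meas G in auto)
 let ?J = "%s. LINT t|lborel. ?g s t"
 \<comment> \<open>The direction of the line times the value at the saddle point; its real part is
   (cos + sin) / sqrt 2 of 2/3 s^6.\<close>
 let ?u = "%s. (1 + \<i>) / of_real (sqrt 2) * exp (- \<i> * of_real (2/3 * s ^ 6))"
 have eq: "Airy_Ai (- (s ^ 4)) * s = 1 / pi * Re (?u s * ?J s)" if s: "s > 0" for s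
 proof -
 let ?d = "(1 + \<i>) * of_real (1 / (sqrt 2 * s))"
 have gen1: "?d * (a * b) = of_real (1 / s) * ((1 + \<i>) / of_real (sqrt 2) * a * b)" for a b by (simp add: divide_inverse)
 have gen2: "a = 1 / pi * (1 / s * b) ==> a * s = 1 / pi * b" for a b using s by simp
 let ?z = "%t. of_real (s\<^sup>2) + ?d * of_real t"
 have z: "airy_exp (- (s ^ 4)) (?z t) = exp (- \<i> * of_real (2/3 * s ^ 6)) * ?E s t" for t
 proof -
 define r where "r = t / (sqrt 2 * s)"
 have zr: "?z t = Complex (s\<^sup>2 + r) r" unfolding r_def by (simp add: complex_eq_iff)
 have r2: "r\<^sup>2 = t\<^sup>2 / (2 * s\<^sup>2)" unfolding r_def by (simp add: power_divide power_mult_distrib)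
 have r3: "r ^ 3 = t ^ 3 / (2 * sqrt 2 * s ^ 3)"
 unfolding r_def by (simp add: power_divide power_mult_distrib power3_eq_cube)
 have re: "Re (?z t ^ 3) = s ^ 6 + 3 * s ^ 4 * r - 2 * r ^ 3"
 unfolding zr by (simp add: power3_eq_cube) algebra
 have im: "Im (?z t ^ 3) = 3 * s ^ 4 * r + 6 * s\<^sup>2 * r\<^sup>2 + 2 * r ^ 3"
 unfolding zr by (simp add: power3_eq_cube) algebra
 have sr: "s\<^sup>2 * r\<^sup>2 = t\<^sup>2 / 2" unfolding r2 using s by simp
 have c: "?c s t = 2/3 * r ^ 3" unfolding r3 by simp
 have zr1: "Re (?z t) = s\<^sup>2 + r" "Im (?z t) = r" unfolding zr by simp_all
 have "\<i> * (?z t ^ 3 / 3 + of_real (- (s ^ 4)) * ?z t) = - \<i> * of_real (2/3 * s ^ 6) + (of_real (- (t\<^sup>2) - ?c s t) - \<i> * of_real (?c s t))"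
 proof (rule complex_eqI)
 have "Re (\<i> * (?z t ^ 3 / 3 + of_real (- (s ^ 4)) * ?z t)) = - (Im (?z t ^ 3) / 3 - s ^ 4 * Im (?z t))" by simp
 also have "... = - (t\<^sup>2) - ?c s t" unfolding im zr1 c using sr by algebra
 finally show "Re (\<i> * (?z t ^ 3 / 3 + of_real (- (s ^ 4)) * ?z t)) = Re (- \<i> * of_real (2/3 * s ^ 6) + (of_real (- (t\<^sup>2) - ?c s t) - \<i> * of_real (?c s t)))"
 by simp
 have "Im (\<i> * (?z t ^ 3 / 3 + of_real (- (s ^ 4)) * ?z t)) = Re (?z t ^ 3) / 3 - s ^ 4 * Re (?z t)" by simp
 also have "... = - (2/3 * s ^ 6) - ?c s t" unfolding re zr1 c
 using power_add[of s 4 2] by (simp add: algebra_simps add_divide_distrib diff_divide_distrib)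
 finally show "Im (\<i> * (?z t ^ 3 / 3 + of_real (- (s ^ 4)) * ?z t)) = Im (- \<i> * of_real (2/3 * s ^ 6) + (of_real (- (t\<^sup>2) - ?c s t) - \<i> * of_real (?c s t)))"
 by simp
 qed
 then show ?thesis unfolding airy_exp_def by (simp only: exp_add)
 qed
 have int: "set_integrable lborel {- sqrt 2 * s ^ 3..} (%t. airy_exp (- (s ^ 4)) (?z t))"
 proof (rule set_integrable_complex_bound[where c = "2/3" and C = 1])
 fix t assume "t >= - sqrt 2 * s ^ 3"
 then show "norm (airy_exp (- (s ^ 4)) (?z t)) <= 1 * exp (- (2/3) * t\<^sup>2)" using bnd[OF s, of t] unfolding z by (simp add: norm_mult)
 qed (rule continuous_on_airy_exp_line, simp)
 have "Airy_Ai (- (s ^ 4)) = 1 / pi * Re (?d * (LINT t:{- sqrt 2 * s ^ 3..}|lborel. airy_exp (- (s ^ 4)) (?z t)))"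
 proof (rule Airy_Ai_line[OF _ int])
 show "Re (of_real (s\<^sup>2) + ?d * of_real (- sqrt 2 * s ^ 3)) = 0" using s by (simp add: power2_eq_square power3_eq_cube)
 show "\<forall>\<^sub>F t in at_top. 0 <= Im (?z t) & Im (?z t) <= Re (?z t)" using eventually_ge_at_top[of 0] by eventually_elim (use s in auto)
 qed (use s in auto)
 also have "(LINT t:{- sqrt 2 * s ^ 3..}|lborel. airy_exp (- (s ^ 4)) (?z t)) = exp (- \<i> * of_real (2/3 * s ^ 6)) * ?J s"
 unfolding z set_lebesgue_integral_def by (subst integral_mult_right_zero[symmetric]) (simp add: scaleR_conv_of_real mult.left_commute)
 also have "?d * (exp (- \<i> * of_real (2/3 * s ^ 6)) * ?J s) = of_real (1 / s) * (?u s * ?J s)" by (rule gen1)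
 finally have "Airy_Ai (- (s ^ 4)) = 1 / pi * (1 / s * Re (?u s * ?J s))" by (simp only: Re_of_real_mult)
 then show ?thesis by (rule gen2)
 qed
 have cis: "exp (- \<i> * of_real \<theta>) = cis (- \<theta>)" for \<theta> by (simp add: cis_conv_exp)
 have u: "norm (?u s) = 1" for s
 unfolding cis norm_mult norm_divide norm_cis by (simp add: cmod_def)
 have Reu: "1 / pi * Re (?u s * of_real (sqrt pi)) = (cos (2/3 * s ^ 6) + sin (2/3 * s ^ 6)) / sqrt (2 * pi)" for s
 proof -
 have "1 / pi * (sqrt pi / sqrt 2) = 1 / sqrt (2 * pi)" by (simp add: real_sqrt_mult real_div_sqrt field_simps)
 then have m: "1 / pi * (sqrt pi / sqrt 2 * S) = S / sqrt (2 * pi)" for S by (simp only: mult.assoc[symmetric]) simp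
 have e: "(1 + \<i>) / of_real a * c * of_real b = of_real (b / a) * ((1 + \<i>) * c)" for a b c by (simp add: divide_inverse)
 have "Re ((1 + \<i>) * cis (- \<theta>)) = cos \<theta> + sin \<theta>" for \<theta> by simp
 then show ?thesis unfolding cis e Re_of_real_mult m by (simp only:)
 qed
 have r: "\<bar>1 / pi * Re (w * z)\<bar> <= 1 / pi * norm z" if "norm w = 1" for w z
 using abs_Re_le_cmod[of "w * z"] that by (simp add: norm_mult abs_mult divide_right_mono)
 show ?thesis
 proof (rule Lim_null_comparison)
 show "\<forall>\<^sub>F s in at_top. norm (Airy_Ai (- (s ^ 4)) * s - (cos (2/3 * s ^ 6) + sin (2/3 * s ^ 6)) / sqrt (2 * pi))
 <= 1 / pi * norm (?J s - of_real (sqrt pi))" using eventually_gt_at_top[of 0]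
 proof eventually_elim
 case (elim s)
 have "Airy_Ai (- (s ^ 4)) * s - (cos (2/3 * s ^ 6) + sin (2/3 * s ^ 6)) / sqrt (2 * pi)
 = 1 / pi * Re (?u s * (?J s - of_real (sqrt pi)))"
 unfolding eq[OF elim] Reu[symmetric] by (simp only: right_diff_distrib minus_complex.simps)
 then show ?case by (simp only: real_norm_def r[OF u])
 qed
 have "((%s. norm (?J s - of_real (sqrt pi))) \<longlongrightarrow> 0) at_top"
 using lim unfolding complex_gaussian by (intro tendsto_norm_zero LIM_zero)
 then show "((%s. 1 / pi * norm (?J s - of_real (sqrt pi))) \<longlongrightarrow> 0) at_top" by (rule tendsto_mult_right_zero)
 qed
qed

section \<open>Recessive solutions, positivity and logarithmic slope of Ai\<close>

lemma DERIV_nonneg_mono: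
 fixes f f' :: "real => real"
 assumes "!!x. x \<in> {a..b} ==> (f has_real_derivative f' x) (at x)"
 and "!!x. x \<in> {a..b} ==> 0 <= f' x" and "a <= b"
 shows "f a <= f b" using assms by (intro DERIV_nonneg_imp_nondecreasing[of a b f]) (auto intro!: exI[of _ "f' _"])

lemma DERIV_nonpos_mono:
 fixes f f' :: "real => real"
 assumes "!!x. x \<in> {a..b} ==> (f has_real_derivative f' x) (at x)"
 and "!!x. x \<in> {a..b} ==> f' x <= 0" and "a <= b"
 shows "f b <= f a" using assms by (intro DERIV_nonpos_imp_nonincreasing[of a b f]) (auto intro!: exI[of _ "f' _"])

text \<open>The derivative of u u' is u'^2 + Q u^2 >= 0. Were u u' positive somewhere, u^2 would
  grow at least linearly from there on, contrary to \<open>small\<close>. That hypothesis asks for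
  small values only arbitrarily far out, which suits Ai as well as square integrable
  solutions.\<close>

lemma recessive_nonincreasing:
 fixes u u1 Q :: "real => real"
 assumes u: "!!x. a <= x ==> (u has_real_derivative u1 x) (at x)"
 and u1: "!!x. a <= x ==> (u1 has_real_derivative Q x * u x) (at x)"
 and Q: "!!x. a <= x ==> 0 <= Q x"
 and small: "!!b. \<exists>x\<ge>b. (u x)\<^sup>2 < 1"
 and b: "a <= b"
 shows "u b * u1 b <= 0"
proof (rule ccontr)
 assume "\<not> u b * u1 b <= 0"
 then have g: "0 < u b * u1 b" by simp
 have g_mono: "u b * u1 b <= u x * u1 x" if "b <= x" for x
 by (rule DERIV_nonneg_mono[where f = "%x. u x * u1 x" and f' = "%x. u1 x * u1 x + Q x * u x * u x"])
 (use b that Q in \<open>auto intro!: derivative_eq_intros u u1 add_nonneg_nonneg simp: mult.assoc\<close>)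
 have grow: "(u b)\<^sup>2 + 2 * (u b * u1 b) * (x - b) <= (u x)\<^sup>2" if "b <= x" for x
 proof -
 have "(u b)\<^sup>2 - 2 * (u b * u1 b) * (b - b) <= (u x)\<^sup>2 - 2 * (u b * u1 b) * (x - b)"
 proof (rule DERIV_nonneg_mono[where f = "%x. (u x)\<^sup>2 - 2 * (u b * u1 b) * (x - b)" and f' = "%x. 2 * (u x * u1 x) - 2 * (u b * u1 b)"])
 fix y assume "y \<in> {b..x}"
 then show "((%x. (u x)\<^sup>2 - 2 * (u b * u1 b) * (x - b)) has_real_derivative 2 * (u y * u1 y) - 2 * (u b * u1 b)) (at y)"
 using b by (auto intro!: derivative_eq_intros u)
 show "0 <= 2 * (u y * u1 y) - 2 * (u b * u1 b)" using g_mono[of y] \<open>y \<in> {b..x}\<close> by simp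
 qed (use that in auto)
 then show ?thesis by simp
 qed
 obtain x where x: "x >= b + 1 / (2 * (u b * u1 b))" "(u x)\<^sup>2 < 1" using small by blast
 have pos: "0 < 1 / (2 * (u b * u1 b))" using g by simp
 then have xb: "b <= x" using x(1) by linarith
 have "1 = 2 * (u b * u1 b) * (1 / (2 * (u b * u1 b)))" using g by (metis less_irrefl mult_eq_0_iff nonzero_mult_divide_mult_cancel_left times_divide_eq_right mult_1_right zero_neq_numeral divide_self)
 also have "... <= 2 * (u b * u1 b) * (x - b)" using x(1) g by (intro mult_left_mono) auto
 also have "... <= (u b)\<^sup>2 + 2 * (u b * u1 b) * (x - b)" by simp
 also have "... <= (u x)\<^sup>2" by (rule grow[OF xb])
 finally show False using x(2) by simp
qed

text \<open>Since u^2 does not increase, a zero persists to the right. For Ai this contradicts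
  positivity far out, for an eigenfunction it contradicts unique continuation.\<close>

lemma recessive_zero:
 fixes u u1 Q :: "real => real"
 assumes u: "!!x. a <= x ==> (u has_real_derivative u1 x) (at x)"
 and u1: "!!x. a <= x ==> (u1 has_real_derivative Q x * u x) (at x)"
 and Q: "!!x. a <= x ==> 0 <= Q x"
 and small: "!!b. \<exists>x\<ge>b. (u x)\<^sup>2 < 1"
 and b: "a <= b" "u b = 0" "b <= x"
 shows "u x = 0"
proof -
 have "(u x)\<^sup>2 <= (u b)\<^sup>2"
 proof (rule DERIV_nonpos_mono[where f = "%x. (u x)\<^sup>2" and f' = "%x. 2 * (u x * u1 x)"])
 fix y assume "y \<in> {b..x}"
 then have y: "a <= y" using b by auto
 show "((%x. (u x)\<^sup>2) has_real_derivative 2 * (u y * u1 y)) (at y)" by (auto intro!: derivative_eq_intros u[OF y])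
 show "2 * (u y * u1 y) <= 0" using recessive_nonincreasing[OF u u1 Q small y] by simp
 qed (use b in auto)
 then show ?thesis using b by simp
qed

lemma recessive_sign:
 fixes u u1 Q :: "real => real"
 assumes u: "!!x. a <= x ==> (u has_real_derivative u1 x) (at x)"
 and u1: "!!x. a <= x ==> (u1 has_real_derivative Q x * u x) (at x)"
 and Q: "!!x. a <= x ==> 0 <= Q x"
 and small: "!!b. \<exists>x\<ge>b. (u x)\<^sup>2 < 1"
 and nz: "!!x. a <= x ==> u x ~= 0" and pos: "a <= c" "0 < u c"
 and b: "a <= b"
 shows "0 < u b" "u1 b <= 0"
proof -
 show *: "0 < u b"
 proof (rule ccontr)
 assume "\<not> 0 < u b"
 then have ub: "u b <= 0" by simp
 have cont: "continuous_on {min b c..max b c} u"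
 using u b pos by (intro DERIV_continuous_on[where D = u1]) (auto intro: has_field_derivative_at_within simp: min_def split: if_splits)
 have "\<exists>x. a <= x & u x = 0"
 proof (cases "b <= c")
 case True
 then obtain x where "b <= x" "u x = 0" using IVT'[of u b 0 c] ub pos cont by auto
 then show ?thesis using b by (intro exI[of _ x]) auto
 next
 case False
 then obtain x where "c <= x" "u x = 0" using IVT2'[of u b 0 c] ub pos cont by auto
 then show ?thesis using pos by (intro exI[of _ x]) auto
 qed
 then show False using nz by blast
 qed
 show "u1 b <= 0" using recessive_nonincreasing[OF u u1 Q small b] * by (simp add: mult_le_0_iff)
qed

lemma Airy_Ai_asymp:
 "((%x. Airy_Ai x * x powr (1/4) * exp (2/3 * x powr (3/2))) \<longlongrightarrow> 1 / (2 * sqrt pi)) at_top"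
proof -
 have "filterlim (%x::real. x powr (1/4)) at_top at_top" by real_asymp
 from filterlim_compose[OF Airy_Ai_asymp_right this]
 have "((%x. Airy_Ai ((x powr (1/4)) ^ 4) * x powr (1/4) * exp (2/3 * (x powr (1/4)) ^ 6)) \<longlongrightarrow> 1 / (2 * sqrt pi)) at_top" .
 moreover have "\<forall>\<^sub>F x in at_top. Airy_Ai ((x powr (1/4)) ^ 4) * x powr (1/4) * exp (2/3 * (x powr (1/4)) ^ 6)
 = Airy_Ai x * x powr (1/4) * exp (2/3 * x powr (3/2))" using eventually_gt_at_top[of 0]
 proof eventually_elim
 case (elim x)
 have "(x powr (1/4)) ^ n = x powr (real n / 4)" for n using elim by (simp add: powr_powr flip: powr_realpow)
 from this[of 4] this[of 6] elim show ?case by simp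
 qed
 ultimately show ?thesis by (rule Lim_transform_eventually)
qed

lemma Airy_Ai_decay: "((%x. x * Airy_Ai x) \<longlongrightarrow> 0) at_top" "\<forall>\<^sub>F x in at_top. 0 < Airy_Ai x"
proof -
 let ?f = "%x. Airy_Ai x * x powr (1/4) * exp (2/3 * x powr (3/2))"
 have "((%x::real. x * (x powr (-1/4) * exp (- 2/3 * x powr (3/2)))) \<longlongrightarrow> 0) at_top" by real_asymp
 from tendsto_mult[OF Airy_Ai_asymp this]
 have "((%x. ?f x * (x * (x powr (-1/4) * exp (- 2/3 * x powr (3/2))))) \<longlongrightarrow> 0) at_top" by simp
 moreover have "\<forall>\<^sub>F x in at_top. ?f x * (x * (x powr (-1/4) * exp (- 2/3 * x powr (3/2)))) = x * Airy_Ai x"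
 using eventually_gt_at_top[of 0] by eventually_elim (simp add: powr_minus exp_minus field_simps)
 ultimately show "((%x. x * Airy_Ai x) \<longlongrightarrow> 0) at_top" by (rule Lim_transform_eventually)
 have "\<forall>\<^sub>F x in at_top. 0 < ?f x" by (rule order_tendstoD(1)[OF Airy_Ai_asymp]) simp
 then show "\<forall>\<^sub>F x in at_top. 0 < Airy_Ai x" using eventually_gt_at_top[of 0] by eventually_elim (simp add: zero_less_mult_iff)
qed

lemma Airy_Ai_small: "\<exists>x\<ge>b. (Airy_Ai x)\<^sup>2 < 1"
proof -
 have "\<forall>\<^sub>F x in at_top. \<bar>x * Airy_Ai x\<bar> < 1" using tendstoD[OF Airy_Ai_decay(1), of 1] by (simp add: dist_real_def)
 then have "\<forall>\<^sub>F x in at_top. \<bar>x * Airy_Ai x\<bar> < 1 & x >= max b 1" using eventually_ge_at_top by (rule eventually_conj)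
 then obtain x where x: "\<bar>x * Airy_Ai x\<bar> < 1" "x >= max b 1" using eventually_happens'[OF trivial_limit_at_top_linorder] by blast
 have "\<bar>Airy_Ai x\<bar> <= \<bar>x\<bar> * \<bar>Airy_Ai x\<bar>" using x by (simp add: mult_le_cancel_right1)
 then have "\<bar>Airy_Ai x\<bar> < 1" using x by (simp add: abs_mult)
 then show ?thesis using x by (auto simp: abs_square_less_1)
qed

lemma Airy_Ai_pos: "0 <= x ==> 0 < Airy_Ai x" and Airy_Ai'_nonpos: "0 <= x ==> Airy_Ai' x <= 0"
proof -
 have nz: "Airy_Ai b ~= 0" if "0 <= b" for b
 proof
 assume "Airy_Ai b = 0"
 have "\<forall>\<^sub>F x in at_top. 0 < Airy_Ai x & x >= b" using Airy_Ai_decay(2) eventually_ge_at_top by (rule eventually_conj)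
 then obtain x where "0 < Airy_Ai x" "b <= x" using eventually_happens'[OF trivial_limit_at_top_linorder] by blast
 with recessive_zero[OF Airy_Ai_deriv Airy_Ai'_deriv _ Airy_Ai_small that \<open>Airy_Ai b = 0\<close>]
 show False by force
 qed
 have "\<forall>\<^sub>F x in at_top. 0 < Airy_Ai x & x >= 0" using Airy_Ai_decay(2) eventually_ge_at_top by (rule eventually_conj)
 then obtain c where c: "0 <= c" "0 < Airy_Ai c" using eventually_happens'[OF trivial_limit_at_top_linorder] by blast
 assume "0 <= x"
 from recessive_sign[OF Airy_Ai_deriv Airy_Ai'_deriv _ Airy_Ai_small nz c this]
 show "0 < Airy_Ai x" "Airy_Ai' x <= 0" by auto
qed

lemma Airy_Ai_antimono: "0 <= x ==> x <= y ==> Airy_Ai y <= Airy_Ai x"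
 by (rule DERIV_nonpos_mono[where f' = Airy_Ai']) (auto intro: Airy_Ai_deriv Airy_Ai'_nonpos)

text \<open>The function \<open>?k\<close> has derivative - Ai^2, so a negative value would persist;
  but it is at least - x Ai^2, which tends to zero.\<close>

lemma Airy_Ai_log_deriv_sqrt:
 assumes "0 <= x" shows "sqrt x * Airy_Ai x <= - Airy_Ai' x"
proof -
 let ?k = "%x. (Airy_Ai' x)\<^sup>2 - x * (Airy_Ai x)\<^sup>2"
 have "0 <= ?k x"
 proof (rule ccontr)
 assume neg: "\<not> 0 <= ?k x"
 have "?k y <= ?k x" if "x <= y" for y by (rule DERIV_nonpos_mono[where f = ?k and f' = "%x. - (Airy_Ai x)\<^sup>2"])
 (use that in \<open>auto intro!: derivative_eq_intros Airy_Ai_deriv Airy_Ai'_deriv simp: power2_eq_square algebra_simps\<close>)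
 then have ge: "- ?k x <= y * (Airy_Ai y)\<^sup>2" if "x <= y" for y using that zero_le_power2[of "Airy_Ai' y"] by (smt (verit))
 have "((%y::real. 1 / y) \<longlongrightarrow> 0) at_top" by real_asymp
 from tendsto_mult[OF this tendsto_mult[OF Airy_Ai_decay(1) Airy_Ai_decay(1)]]
 have "((%y. 1 / y * (y * Airy_Ai y * (y * Airy_Ai y))) \<longlongrightarrow> 0) at_top" by simp
 then have "\<forall>\<^sub>F y in at_top. 1 / y * (y * Airy_Ai y * (y * Airy_Ai y)) < - ?k x" using neg by (intro order_tendstoD(2)) auto
 then have "\<forall>\<^sub>F y in at_top. 1 / y * (y * Airy_Ai y * (y * Airy_Ai y)) < - ?k x & y >= max 1 x"
 using eventually_ge_at_top by (rule eventually_conj)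
 then obtain y where y: "1 / y * (y * Airy_Ai y * (y * Airy_Ai y)) < - ?k x" "y >= max 1 x"
 using eventually_happens'[OF trivial_limit_at_top_linorder] by blast
 have "1 / y * (y * Airy_Ai y * (y * Airy_Ai y)) = y * (Airy_Ai y)\<^sup>2" using y(2) by (simp add: power2_eq_square)
 with ge[of y] y show False by simp
 qed
 then have "(sqrt x * Airy_Ai x)\<^sup>2 <= (- Airy_Ai' x)\<^sup>2" using assms by (simp add: power_mult_distrib)
 then show ?thesis by (rule power2_le_imp_le) (use Airy_Ai'_nonpos[OF assms] in simp)
qed

text \<open>The slope of Ai is the damping that pays for all errors right of the turning point, so
  it must not degenerate at x = 0 as \<open>sqrt x\<close> does. On [0,1] the bound comes from -Ai'
  >= -Ai'(1) >= Ai(1), beyond 1 from sqrt (1 + x) <= 2 sqrt x; the constant is the worse of the two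
  cases.\<close>

lemma Airy_Ai_log_deriv: "\<exists>c>0. \<forall>x\<ge>0. c * sqrt (1 + x) * Airy_Ai x <= - Airy_Ai' x"
proof (intro exI[of _ "Airy_Ai 1 / (2 * Airy_Ai 0)"] conjI allI impI)
 have p: "0 < Airy_Ai 0" "0 < Airy_Ai 1" by (auto intro: Airy_Ai_pos)
 have le: "Airy_Ai 1 <= Airy_Ai 0" by (rule Airy_Ai_antimono) auto
 let ?c = "Airy_Ai 1 / (2 * Airy_Ai 0)"
 show "0 < ?c" using p by simp
 fix x :: real assume x: "0 <= x"
 have px: "0 < Airy_Ai x" using x by (rule Airy_Ai_pos)
 show "?c * sqrt (1 + x) * Airy_Ai x <= - Airy_Ai' x"
 proof (cases "1 <= x")
 case True
 have "sqrt (1 + x) <= sqrt (4 * x)" using True by simp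
 then have s: "sqrt (1 + x) <= 2 * sqrt x" by (simp add: real_sqrt_mult)
 have "?c * sqrt (1 + x) <= 1 / 2 * (2 * sqrt x)" using p le s x by (intro mult_mono) (auto simp: field_simps)
 then have "?c * sqrt (1 + x) * Airy_Ai x <= sqrt x * Airy_Ai x" using px by (intro mult_right_mono) auto
 then show ?thesis using Airy_Ai_log_deriv_sqrt[OF x] by simp
 next
 case False
 have "Airy_Ai' x <= Airy_Ai' 1" by (rule DERIV_nonneg_mono[where f = Airy_Ai' and f' = "%x. x * Airy_Ai x"])
 (use False x in \<open>auto intro!: Airy_Ai'_deriv mult_nonneg_nonneg less_imp_le[OF Airy_Ai_pos]\<close>)
 moreover have "Airy_Ai 1 <= - Airy_Ai' 1" using Airy_Ai_log_deriv_sqrt[of 1] by simp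
 moreover have "?c * sqrt (1 + x) * Airy_Ai x <= ?c * 2 * Airy_Ai 0"
 proof (intro mult_mono)
 show "sqrt (1 + x) <= 2" using False by (intro real_le_lsqrt) auto
 show "Airy_Ai x <= Airy_Ai 0" using x by (intro Airy_Ai_antimono) auto
 qed (use p px x in auto)
 moreover have "?c * 2 * Airy_Ai 0 = Airy_Ai 1" using p by simp
 ultimately show ?thesis by linarith
 qed
qed

lemma Airy_Ai_bound_right: "\<exists>C>0. \<forall>x\<ge>0. Airy_Ai x * (1 + x) powr (1/4) <= C"
proof -
 have "\<forall>\<^sub>F x in at_top. \<bar>x * Airy_Ai x\<bar> < 1" using tendstoD[OF Airy_Ai_decay(1), of 1] by (simp add: dist_real_def)
 then obtain N where N: "!!x. N <= x ==> \<bar>x * Airy_Ai x\<bar> < 1"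
 unfolding eventually_at_top_linorder by blast
 let ?N = "max N 1"
 have p: "0 < Airy_Ai 0" by (auto intro: Airy_Ai_pos)
 show ?thesis
 proof (intro exI[of _ "2 + Airy_Ai 0 * (1 + ?N)"] conjI allI impI)
 show "0 < 2 + Airy_Ai 0 * (1 + ?N)" using p by (intro add_pos_nonneg mult_nonneg_nonneg) auto
 fix x :: real assume x: "0 <= x"
 have px: "0 < Airy_Ai x" using x by (rule Airy_Ai_pos)
 have "(1 + x) powr (1/4) <= (1 + x) powr 1" using x by (intro powr_mono) auto
 then have pw: "(1 + x) powr (1/4) <= 1 + x" using x by simp
 show "Airy_Ai x * (1 + x) powr (1/4) <= 2 + Airy_Ai 0 * (1 + ?N)"
 proof (cases "?N <= x")
 case True
 have "Airy_Ai x * (1 + x) powr (1/4) <= Airy_Ai x * (1 + x)" using px pw by (intro mult_left_mono) auto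
 also have "... <= Airy_Ai x * (2 * x)" using px True by (intro mult_left_mono) auto
 also have "... <= 2" using N[of x] True by (simp add: mult.commute)
 also have "2 <= 2 + Airy_Ai 0 * (1 + ?N)" using p by simp
 finally show ?thesis .
 next
 case False
 have "Airy_Ai x * (1 + x) powr (1/4) <= Airy_Ai 0 * (1 + ?N)" using p px pw x False by (intro mult_mono Airy_Ai_antimono) auto
 then show ?thesis by simp
 qed
 qed
qed

section \<open>An energy for the Airy equation in the oscillatory region\<close>

text \<open>A smooth substitute for the square root of |s|, the local frequency of the Airy
  equation, without its zero at the turning point.\<close>

definition airy_weight :: "real => real" where
 "airy_weight s = (1 + s\<^sup>2) powr (1/4)"

lemma airy_weight_power4: "airy_weight s ^ 4 = 1 + s\<^sup>2"
proof -
 have "0 < 1 + s\<^sup>2" by (simp add: add_pos_nonneg)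
 then show ?thesis unfolding airy_weight_def by (simp add: powr_powr flip: powr_realpow)
qed

lemma airy_weight_ge_1: "1 <= airy_weight s"
 unfolding airy_weight_def by (rule ge_one_powr_ge_zero) auto

lemma airy_weight_pos: "0 < airy_weight s" using airy_weight_ge_1[of s] by linarith

lemma abs_le_airy_weight: "\<bar>s\<bar> <= airy_weight s ^ 2"
proof (rule power2_le_imp_le)
 have "(airy_weight s ^ 2)\<^sup>2 = airy_weight s ^ 4" by (simp flip: power_mult)
 then show "\<bar>s\<bar>\<^sup>2 <= (airy_weight s ^ 2)\<^sup>2" by (simp add: airy_weight_power4)
qed simp

lemma airy_weight_deriv: "(airy_weight has_real_derivative s / (2 * airy_weight s ^ 3)) (at s)"
proof -
 have p: "0 < 1 + s\<^sup>2" by (simp add: add_pos_nonneg)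
 have "(airy_weight has_real_derivative (1 + s\<^sup>2) powr (-3/4) * s / 2) (at s)"
 unfolding airy_weight_def using p by (auto intro!: derivative_eq_intros simp: field_simps)
 moreover have "(1 + s\<^sup>2) powr (-3/4) = 1 / airy_weight s ^ 3"
 proof -
 have "airy_weight s ^ 3 = (1 + s\<^sup>2) powr (3/4)"
 unfolding airy_weight_def using p by (simp add: powr_powr flip: powr_realpow)
 then show ?thesis by (simp add: powr_minus field_simps flip: minus_divide_left)
 qed
 ultimately show ?thesis by (simp add: mult.commute)
qed

text \<open>Scaled so that both terms stay of order one on oscillating solutions, whose amplitude is
  the weight to the power -1/2.\<close>

definition airy_energy0 :: "real => real => real => real" where
 "airy_energy0 s w w1 = w1\<^sup>2 / airy_weight s + airy_weight s * w\<^sup>2"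

text \<open>The last term cancels the leading part of the derivative of the first two along \<open>w'' = s w\<close>,
 so that the derivative becomes integrable at \<open>-\<infinity>\<close>.\<close>

definition airy_energy :: "real => real => real => real" where
 "airy_energy s w w1 = airy_energy0 s w w1 + s / (2 * airy_weight s ^ 5) * (w * w1)"

lemma airy_energy0_nonneg: "0 <= airy_energy0 s w w1"
 unfolding airy_energy0_def using airy_weight_pos[of s] by simp

lemma airy_energy0_mult: "2 * \<bar>w * w1\<bar> <= airy_energy0 s w w1"
proof -
 let ?e = "airy_weight s"
 have e: "0 < ?e" by (rule airy_weight_pos)
 have "0 <= (\<bar>w1\<bar> - ?e * \<bar>w\<bar>)\<^sup>2 / ?e" using e by simp
 also have "... = airy_energy0 s w w1 - 2 * \<bar>w * w1\<bar>"
 unfolding airy_energy0_def using e by (simp add: power2_eq_square abs_mult field_simps)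
 finally show ?thesis by simp
qed

lemma airy_energy0_w: "w\<^sup>2 <= airy_energy0 s w w1 / airy_weight s"
 unfolding airy_energy0_def using airy_weight_pos[of s] by (simp add: field_simps)

lemma airy_energy0_w1: "w1\<^sup>2 <= airy_energy0 s w w1 * airy_weight s"
 unfolding airy_energy0_def using airy_weight_pos[of s] by (simp add: field_simps)

lemma airy_energy_cross: "\<bar>airy_energy s w w1 - airy_energy0 s w w1\<bar> <= airy_energy0 s w w1 / (4 * airy_weight s ^ 3)"
proof -
 let ?e = "airy_weight s"
 have e: "0 < ?e" by (rule airy_weight_pos)
 have "\<bar>airy_energy s w w1 - airy_energy0 s w w1\<bar> = \<bar>s\<bar> / (2 * ?e ^ 5) * \<bar>w * w1\<bar>"
 unfolding airy_energy_def using e by (simp add: abs_mult)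
 also have "... <= ?e ^ 2 / (2 * ?e ^ 5) * (airy_energy0 s w w1 / 2)" using e abs_le_airy_weight[of s] airy_energy0_mult[of w w1 s]
 by (intro mult_mono divide_right_mono) auto
 also have "... = airy_energy0 s w w1 / (4 * ?e ^ 3)" using e by (simp add: field_simps eval_nat_numeral)
 finally show ?thesis .
qed

lemma airy_energy_equiv:
 "3 / 4 * airy_energy0 s w w1 <= airy_energy s w w1" "airy_energy s w w1 <= 5 / 4 * airy_energy0 s w w1"
proof -
 have "airy_energy0 s w w1 / (4 * airy_weight s ^ 3) <= airy_energy0 s w w1 / (4 * 1)" using airy_weight_ge_1[of s] airy_energy0_nonneg[of s w w1]
 by (intro divide_left_mono mult_left_mono one_le_power mult_pos_pos) auto
 then show "3 / 4 * airy_energy0 s w w1 <= airy_energy s w w1" "airy_energy s w w1 <= 5 / 4 * airy_energy0 s w w1"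
 using airy_energy_cross[of s w w1] by auto
qed

text \<open>The derivative of \<open>airy_energy\<close> in \<open>s\<close> along w'' = s w + F. No
  term in \<open>w1\<close> squared is left. The coefficients that remain are small for negative
  \<open>s\<close>, either through \<open>s + airy_weight s ^ 2\<close> or through high negative
  powers of the weight.\<close>

definition airy_energy_rate :: "real => real => real => real => real" where
 "airy_energy_rate s F w w1 =
 (2 * (s + airy_weight s ^ 2) / airy_weight s + (1 / airy_weight s ^ 5 - 5 / 2 * s\<^sup>2 / airy_weight s ^ 9) / 2) * (w * w1)
 + s * (airy_weight s ^ 2 + s) / (2 * airy_weight s ^ 5) * w\<^sup>2
 + F * (2 * w1 / airy_weight s + s / (2 * airy_weight s ^ 5) * w)"

lemma airy_energy_deriv:
 assumes \<sigma>: "(\<sigma> has_real_derivative d) (at x)"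
 and w: "(w has_real_derivative d * w1 x) (at x)"
 and w1: "(w1 has_real_derivative d * (\<sigma> x * w x + F)) (at x)"
 shows "((%x. airy_energy (\<sigma> x) (w x) (w1 x)) has_real_derivative
 d * airy_energy_rate (\<sigma> x) F (w x) (w1 x)) (at x)"
proof -
 define e where "e = (%x. airy_weight (\<sigma> x))"
 have e: "0 < e x" unfolding e_def by (rule airy_weight_pos)
 have de: "(e has_real_derivative d * (\<sigma> x / (2 * e x ^ 3))) (at x)"
 unfolding e_def using DERIV_chain[OF airy_weight_deriv \<sigma>] by (simp add: o_def mult.commute)
 let ?E1 = "%x. (w1 x)\<^sup>2 / e x"
 let ?E2 = "%x. e x * (w x)\<^sup>2"
 let ?E3 = "%x. \<sigma> x / (2 * e x ^ 5)"
 let ?E4 = "%x. w x * w1 x"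
 have d1: "(?E1 has_real_derivative d * (2 * w1 x * (\<sigma> x * w x + F) / e x - (w1 x)\<^sup>2 * \<sigma> x / (2 * e x ^ 5))) (at x)"
 using e by (auto intro!: derivative_eq_intros w1 de simp: field_simps eval_nat_numeral)
 have d2: "(?E2 has_real_derivative d * (\<sigma> x / (2 * e x ^ 3) * (w x)\<^sup>2 + 2 * e x * w x * w1 x)) (at x)"
 using e by (auto intro!: derivative_eq_intros w de simp: field_simps eval_nat_numeral)
 have d3: "(?E3 has_real_derivative d * ((1 / e x ^ 5 - 5 / 2 * (\<sigma> x)\<^sup>2 / e x ^ 9) / 2)) (at x)"
 using e by (auto intro!: derivative_eq_intros \<sigma> de simp: field_simps eval_nat_numeral)
 have d4: "(?E4 has_real_derivative d * ((w1 x)\<^sup>2 + \<sigma> x * (w x)\<^sup>2 + w x * F)) (at x)"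
 by (auto intro!: derivative_eq_intros w w1 simp: field_simps eval_nat_numeral)
 have E: "(%x. airy_energy (\<sigma> x) (w x) (w1 x)) = (%x. (?E1 x + ?E2 x) + ?E3 x * ?E4 x)"
 unfolding airy_energy_def airy_energy0_def e_def by simp
 have "((%x. (?E1 x + ?E2 x) + ?E3 x * ?E4 x) has_real_derivative
 (d * (2 * w1 x * (\<sigma> x * w x + F) / e x - (w1 x)\<^sup>2 * \<sigma> x / (2 * e x ^ 5))
 + d * (\<sigma> x / (2 * e x ^ 3) * (w x)\<^sup>2 + 2 * e x * w x * w1 x))
 + (d * ((1 / e x ^ 5 - 5 / 2 * (\<sigma> x)\<^sup>2 / e x ^ 9) / 2) * ?E4 x
 + d * ((w1 x)\<^sup>2 + \<sigma> x * (w x)\<^sup>2 + w x * F) * ?E3 x)) (at x)" by (rule DERIV_add[OF DERIV_add[OF d1 d2] DERIV_mult[OF d3 d4]])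
 also have "(d * (2 * w1 x * (\<sigma> x * w x + F) / e x - (w1 x)\<^sup>2 * \<sigma> x / (2 * e x ^ 5))
 + d * (\<sigma> x / (2 * e x ^ 3) * (w x)\<^sup>2 + 2 * e x * w x * w1 x))
 + (d * ((1 / e x ^ 5 - 5 / 2 * (\<sigma> x)\<^sup>2 / e x ^ 9) / 2) * ?E4 x
 + d * ((w1 x)\<^sup>2 + \<sigma> x * (w x)\<^sup>2 + w x * F) * ?E3 x)
 = d * airy_energy_rate (\<sigma> x) F (w x) (w1 x)"
 proof -
 define p where "p = (1 / e x ^ 5 - 5 / 2 * (\<sigma> x)\<^sup>2 / e x ^ 9) / 2"
 have "2 * w1 x * (\<sigma> x * w x + F) / e x - (w1 x)\<^sup>2 * \<sigma> x / (2 * e x ^ 5)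
 + (\<sigma> x / (2 * e x ^ 3) * (w x)\<^sup>2 + 2 * e x * w x * w1 x)
 + (p * (w x * w1 x) + ((w1 x)\<^sup>2 + \<sigma> x * (w x)\<^sup>2 + w x * F) * (\<sigma> x / (2 * e x ^ 5)))
 = (2 * (\<sigma> x + e x ^ 2) / e x + p) * (w x * w1 x)
 + \<sigma> x * (e x ^ 2 + \<sigma> x) / (2 * e x ^ 5) * (w x)\<^sup>2
 + F * (2 * w1 x / e x + \<sigma> x / (2 * e x ^ 5) * w x)" using e by (simp add: field_simps eval_nat_numeral)
 then show ?thesis unfolding airy_energy_rate_def p_def[symmetric] e_def[symmetric]
 unfolding e_def p_def by (simp only: distrib_left[symmetric] mult.assoc)
 qed
 finally show ?thesis unfolding E .
qed

lemma abs_sum3_le: "\<bar>a\<bar> <= A ==> \<bar>b\<bar> <= B ==> \<bar>c\<bar> <= C ==> A + B <= D ==> \<bar>a + b + c\<bar> <= D + C"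
 for a b c A B C D :: real by linarith

text \<open>The homogeneous part is of order weight^(-3), that is |s|^(-3/2), and so integrable at
  minus infinity. A source \<open>F\<close> costs only the square root of the energy over the
  weight.\<close>

lemma airy_energy_rate_bound:
 assumes s: "s <= 0"
 shows "\<bar>airy_energy_rate s F w w1\<bar> <=
 9/4 / airy_weight s ^ 3 * airy_energy0 s w w1
 + \<bar>F\<bar> * (5/2 * sqrt (airy_energy0 s w w1 / airy_weight s))"
proof -
 define e where "e = airy_weight s"
 have e: "1 <= e" unfolding e_def by (rule airy_weight_ge_1)
 then have e0: "0 < e" by simp
 have e4: "e ^ 4 = 1 + s\<^sup>2" unfolding e_def by (rule airy_weight_power4)
 have se: "\<bar>s\<bar> <= e ^ 2" unfolding e_def by (rule abs_le_airy_weight)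
 define E where "E = airy_energy0 s w w1"
 have E0: "0 <= E" unfolding E_def by (rule airy_energy0_nonneg)
 have ww: "\<bar>w * w1\<bar> <= E / 2" using airy_energy0_mult[of w w1 s] unfolding E_def by simp
 have w2: "w\<^sup>2 <= E / e" and w12: "w1\<^sup>2 <= E * e" using airy_energy0_w airy_energy0_w1 unfolding E_def e_def by auto
 \<comment> \<open>For s <= 0 the frequency and its smooth substitute nearly cancel: (e^2 + s)(e^2 -
   s) = e^4 - s^2 = 1, and the second factor is at least e^2.\<close>
 have gap: "0 <= s + e ^ 2" "s + e ^ 2 <= 1 / e ^ 2"
 proof -
 show "0 <= s + e ^ 2" using se by linarith
 have "(s + e ^ 2) * e ^ 2 <= (s + e ^ 2) * (e ^ 2 - s)" using se s by (intro mult_left_mono) auto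
 also have "... = e ^ 4 - s\<^sup>2" by (simp add: algebra_simps eval_nat_numeral)
 also have "... = 1" using e4 by simp
 finally show "s + e ^ 2 <= 1 / e ^ 2" using e0 by (simp add: field_simps)
 qed
 have c1: "\<bar>2 * (s + e ^ 2) / e + (1 / e ^ 5 - 5 / 2 * s\<^sup>2 / e ^ 9) / 2\<bar> <= 13/4 / e ^ 3"
 proof -
 have "2 * (s + e ^ 2) / e <= 2 * (1 / e ^ 2) / e" using gap e0 by (intro divide_right_mono mult_left_mono) auto
 also have "... = 2 / e ^ 3" using e0 by (simp add: field_simps eval_nat_numeral)
 finally have a: "2 * (s + e ^ 2) / e <= 2 / e ^ 3" .
 have "s\<^sup>2 / e ^ 9 <= e ^ 4 / e ^ 9" using e4 e0 by (intro divide_right_mono) auto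
 also have "... = 1 / e ^ 5" using e0 by (simp add: field_simps eval_nat_numeral)
 finally have b: "s\<^sup>2 / e ^ 9 <= 1 / e ^ 5" .
 have c: "1 / e ^ 5 <= 1 / e ^ 3" using e by (intro divide_left_mono power_increasing) auto
 have n: "0 <= 2 * (s + e ^ 2) / e" "0 <= s\<^sup>2 / e ^ 9" "0 <= 1 / e ^ 5" using gap e0 by auto
 have eq: "5 / 2 * s\<^sup>2 / e ^ 9 = 5 / 2 * (s\<^sup>2 / e ^ 9)" "13/4 / e ^ 3 = 13/4 * (1 / e ^ 3)" "2 / e ^ 3 = 2 * (1 / e ^ 3)" by auto
 have "\<bar>A + (D - 5/2 * B) / 2\<bar> <= 13/4 * Z"
 if "0 <= A" "A <= 2 * Z" "0 <= B" "B <= D" "D <= Z" "0 <= D" for A B D Z :: real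
 proof (rule abs_leI)
 show "A + (D - 5/2 * B) / 2 <= 13/4 * Z" using that by (simp add: field_simps)
 show "- (A + (D - 5/2 * B) / 2) <= 13/4 * Z" using that by (simp add: field_simps)
 qed
 from this[OF n(1) a[unfolded eq] n(2) b c n(3)] show ?thesis unfolding eq .
 qed
 have c2: "\<bar>s * (e ^ 2 + s) / (2 * e ^ 5)\<bar> <= 1 / 2 / e ^ 2 * (1 / e ^ 3) * 1"
 proof -
 have "\<bar>s * (e ^ 2 + s) / (2 * e ^ 5)\<bar> = \<bar>s\<bar> * (s + e ^ 2) / (2 * e ^ 5)" using gap e0 by (simp add: abs_mult add.commute)
 also have "... <= e ^ 2 * (1 / e ^ 2) / (2 * e ^ 5)" using gap se e0 by (intro divide_right_mono mult_mono) auto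
 also have "... = 1 / 2 / e ^ 2 * (1 / e ^ 3) * 1" using e0 by (simp add: field_simps eval_nat_numeral)
 finally show ?thesis .
 qed
 have t1: "\<bar>(2 * (s + e ^ 2) / e + (1 / e ^ 5 - 5 / 2 * s\<^sup>2 / e ^ 9) / 2) * (w * w1)\<bar> <= 13/4 / e ^ 3 * (E / 2)"
 unfolding abs_mult[of _ "w * w1"] using c1 ww e0 by (intro mult_mono) auto
 have t2: "\<bar>s * (e ^ 2 + s) / (2 * e ^ 5) * w\<^sup>2\<bar> <= 1/2 / e ^ 3 * E"
 proof -
 have "\<bar>s * (e ^ 2 + s) / (2 * e ^ 5) * w\<^sup>2\<bar> <= (1 / 2 / e ^ 2 * (1 / e ^ 3) * 1) * (E / e)"
 unfolding abs_mult[of _ "w\<^sup>2"] using c2 w2 e0 by (intro mult_mono) auto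
 also have "... = 1/2 / e ^ 3 * E * (1 / e ^ 3)" using e0 by (simp add: field_simps eval_nat_numeral)
 also have "... <= 1/2 / e ^ 3 * E * 1" using e e0 E0 by (intro mult_left_mono) (auto simp: field_simps intro!: one_le_power)
 finally show ?thesis by simp
 qed
 have aw: "\<bar>w\<bar> <= sqrt (E / e)" using w2 by (intro real_le_rsqrt) auto
 have aw1: "\<bar>w1\<bar> <= e * sqrt (E / e)"
 proof (rule power2_le_imp_le)
 have "(e * sqrt (E / e))\<^sup>2 = e\<^sup>2 * (sqrt (E / e))\<^sup>2" by (rule power_mult_distrib)
 also have "... = e\<^sup>2 * (E / e)" using e0 E0 by simp
 also have "... = E * e" using e0 by (simp add: power2_eq_square)
 finally have "(e * sqrt (E / e))\<^sup>2 = E * e" .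
 then show "\<bar>w1\<bar>\<^sup>2 <= (e * sqrt (E / e))\<^sup>2" using w12 by simp
 qed (use e0 E0 in auto)
 have t3: "\<bar>2 * w1 / e + s / (2 * e ^ 5) * w\<bar> <= 5/2 * sqrt (E / e)"
 proof -
 have "\<bar>2 * w1 / e\<bar> <= 2 * sqrt (E / e)" using aw1 e0 by (simp add: field_simps)
 moreover have "\<bar>s / (2 * e ^ 5) * w\<bar> <= 1/2 * sqrt (E / e)"
 proof -
 have "\<bar>s\<bar> <= e ^ 5" using se power_increasing[of 2 5 e] e by linarith
 then have "\<bar>s / (2 * e ^ 5)\<bar> <= 1/2" using e0 by (simp add: field_simps)
 then show ?thesis unfolding abs_mult using aw by (intro mult_mono) auto
 qed
 ultimately show ?thesis by linarith
 qed
 have t3': "\<bar>F * (2 * w1 / e + s / (2 * e ^ 5) * w)\<bar> <= \<bar>F\<bar> * (5/2 * sqrt (E / e))"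
 unfolding abs_mult using t3 by (intro mult_left_mono) auto
 \<comment> \<open>13/8 + 1/2 = 17/8, rounded up to 9/4.\<close>
 have sum: "13/4 / e ^ 3 * (E / 2) + 1/2 / e ^ 3 * E <= 9/4 / e ^ 3 * E" using e0 E0 by (simp add: field_simps)
 show ?thesis
 unfolding airy_energy_rate_def e_def[symmetric] E_def[symmetric] by (rule abs_sum3_le[OF t1 t2 t3' sum])
qed

lemma airy_weight_decay:
 assumes "s <= 0" shows "1 / airy_weight s ^ 3 <= 2 * (1 - s) powr (-3/2)"
 and "1 / airy_weight s <= 2 * (1 - s) powr (-1/2)"
proof -
 have p: "0 < 1 + s\<^sup>2" by (simp add: add_pos_nonneg)
 have "0 <= (1 + s)\<^sup>2" by simp
 then have "(1 - s) powr 2 <= 2 * (1 + s\<^sup>2)" using assms by (simp add: power2_eq_square algebra_simps)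
 then have "((1 - s) powr 2) powr (1/4) <= (2 * (1 + s\<^sup>2)) powr (1/4)" using assms by (intro powr_mono2) auto
 moreover have "((1 - s) powr 2) powr (1/4) = (1 - s) powr (1/2)"
 unfolding powr_powr by simp
 moreover have "(2 * (1 + s\<^sup>2)) powr (1/4) = 2 powr (1/4) * airy_weight s"
 unfolding airy_weight_def by (rule powr_mult)
 ultimately have "(1 - s) powr (1/2) <= 2 powr (1/4) * airy_weight s" by linarith
 moreover have "(2::real) powr (1/4) * airy_weight s <= 2 powr (1/3) * airy_weight s"
 using airy_weight_pos[of s] by (intro mult_right_mono powr_mono) auto
 ultimately have le: "(1 - s) powr (1/2) <= 2 powr (1/3) * airy_weight s" by linarith
 then have "((1 - s) powr (1/2)) ^ 3 <= (2 powr (1/3) * airy_weight s) ^ 3" by (intro power_mono) auto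
 moreover have "((1 - s) powr (1/2)) ^ 3 = (1 - s) powr (3/2)" using assms by (simp add: powr_powr flip: powr_realpow)
 moreover have "(2 powr (1/3) * airy_weight s) ^ 3 = 2 * airy_weight s ^ 3" by (simp add: power_mult_distrib powr_powr flip: powr_realpow)
 ultimately have "(1 - s) powr (3/2) <= 2 * airy_weight s ^ 3" by simp
 then show "1 / airy_weight s ^ 3 <= 2 * (1 - s) powr (-3/2)" using airy_weight_pos[of s] assms by (simp add: powr_minus field_simps)
 have "(2::real) powr (1/3) <= 2 powr 1" by (intro powr_mono) auto
 then have "2 powr (1/3) * airy_weight s <= 2 * airy_weight s" using airy_weight_pos[of s] by (intro mult_right_mono) auto
 with le have "(1 - s) powr (1/2) <= 2 * airy_weight s" by linarith
 then show "1 / airy_weight s <= 2 * (1 - s) powr (-1/2)" using airy_weight_pos[of s] assms by (simp add: powr_minus field_simps)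
qed

section \<open>The limit of the energy of Ai at minus infinity\<close>

abbreviation (input) Ai_energy :: "real => real" where
 "Ai_energy s \<equiv> airy_energy s (Airy_Ai s) (Airy_Ai' s)"

lemma Ai_energy_deriv:
 "(Ai_energy has_real_derivative airy_energy_rate s 0 (Airy_Ai s) (Airy_Ai' s)) (at s)"
 using airy_energy_deriv[of "%s. s" 1 s Airy_Ai Airy_Ai' 0] Airy_Ai_deriv Airy_Ai'_deriv by simp

lemma airy_energy_nonneg: "0 <= airy_energy s w w1" using airy_energy_equiv(1)[of s w w1] airy_energy0_nonneg[of s w w1] by linarith

lemma Ai_energy_rate:
 assumes "s <= 0"
 shows "\<bar>airy_energy_rate s 0 (Airy_Ai s) (Airy_Ai' s)\<bar> <= 6 * (1 - s) powr (-3/2) * Ai_energy s"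
proof -
 let ?E = "airy_energy0 s (Airy_Ai s) (Airy_Ai' s)"
 have "\<bar>airy_energy_rate s 0 (Airy_Ai s) (Airy_Ai' s)\<bar> <= 9/4 * (1 / airy_weight s ^ 3) * ?E"
 using airy_energy_rate_bound[OF assms, of 0] by simp
 also have "... <= 9/4 * (2 * (1 - s) powr (-3/2)) * (4/3 * Ai_energy s)"
 using airy_weight_decay(1)[OF assms] airy_energy0_nonneg[of s "Airy_Ai s"] airy_weight_pos[of s]
 airy_energy_equiv(1)[of s "Airy_Ai s" "Airy_Ai' s"] by (intro mult_mono) (auto simp: less_imp_le)
 finally show ?thesis by (simp add: mult_ac)
qed

text \<open>The primitive of the rate 6 (1 - s)^(-3/2) that vanishes at minus infinity. It is at
  most 12 on the half line, so it serves as Gronwall exponent and as bound for the tail.\<close>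

definition airy_mu :: "real => real" where "airy_mu s = 12 * (1 - s) powr (-1/2)"

lemma airy_mu_deriv: "s <= 0 ==> (airy_mu has_real_derivative 6 * (1 - s) powr (-3/2)) (at s)"
 unfolding airy_mu_def by (auto intro!: derivative_eq_intros)

lemma airy_mu_bound: "s <= 0 ==> 0 <= airy_mu s & airy_mu s <= 12"
 unfolding airy_mu_def using powr_mono[of "-1/2" 0 "1 - s"] by simp

text \<open>Gronwall from 0 to the left: the energy times exp of \<open>airy_mu\<close> is
  nondecreasing, and the exponential lies between 1 and exp 12.\<close>

lemma Ai_energy_bounded: "\<exists>M>0. \<forall>s\<le>0. Ai_energy s <= M"
proof (intro exI[of _ "exp 12 * Ai_energy 0 + 1"] conjI allI impI)
 show "0 < exp 12 * Ai_energy 0 + 1" using airy_energy_nonneg[of 0 "Airy_Ai 0" "Airy_Ai' 0"] by (intro add_nonneg_pos) auto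
 fix s :: real assume s: "s <= 0"
 let ?f = "%s. Ai_energy s * exp (airy_mu s)"
 let ?f' = "%s. airy_energy_rate s 0 (Airy_Ai s) (Airy_Ai' s) * exp (airy_mu s)
 + Ai_energy s * (exp (airy_mu s) * (6 * (1 - s) powr (-3/2)))"
 have "?f s <= ?f 0"
 proof (rule DERIV_nonneg_mono[where f = ?f and f' = ?f'])
 fix t assume "t \<in> {s..0}"
 then have t: "t <= 0" by auto
 show "(?f has_real_derivative ?f' t) (at t)" by (auto intro!: derivative_eq_intros Ai_energy_deriv airy_mu_deriv[OF t])
 have "0 <= airy_energy_rate t 0 (Airy_Ai t) (Airy_Ai' t) + Ai_energy t * (6 * (1 - t) powr (-3/2))"
 using Ai_energy_rate[OF t] by (simp add: abs_le_iff mult.commute) linarith?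
 then have "0 <= (airy_energy_rate t 0 (Airy_Ai t) (Airy_Ai' t) + Ai_energy t * (6 * (1 - t) powr (-3/2))) * exp (airy_mu t)"
 by (intro mult_nonneg_nonneg) auto
 then show "0 <= ?f' t" by (simp add: algebra_simps)
 qed (use s in auto)
 moreover have "Ai_energy s * 1 <= ?f s" using airy_mu_bound[OF s] airy_energy_nonneg by (intro mult_left_mono) auto
 moreover have "?f 0 <= Ai_energy 0 * exp 12" using airy_mu_bound[of 0] airy_energy_nonneg by (intro mult_left_mono) auto
 ultimately show "Ai_energy s <= exp 12 * Ai_energy 0 + 1" by (simp add: mult.commute)
qed

text \<open>Adding or subtracting \<open>M * airy_mu\<close> makes the energy monotone, so it is
  Cauchy at minus infinity with an explicit rate. It then suffices to identify the limit along
  sequences.\<close>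

lemma Ai_energy_cauchy:
 assumes M: "!!s. s <= 0 ==> Ai_energy s <= M" "0 < M" and st: "t <= s" "s <= 0"
 shows "\<bar>Ai_energy s - Ai_energy t\<bar> <= M * airy_mu s"
proof -
 have r: "\<bar>airy_energy_rate x 0 (Airy_Ai x) (Airy_Ai' x)\<bar> <= M * (6 * (1 - x) powr (-3/2))" if "x <= 0" for x
 proof -
 have "6 * (1 - x) powr (-3/2) * Ai_energy x <= 6 * (1 - x) powr (-3/2) * M" using M(1)[OF that] by (intro mult_left_mono) auto
 then show ?thesis using Ai_energy_rate[OF that] by (simp add: mult.commute)
 qed
 have 1: "Ai_energy t + M * airy_mu t <= Ai_energy s + M * airy_mu s"
 proof (rule DERIV_nonneg_mono[where f = "%x. Ai_energy x + M * airy_mu x" and f' = "%x. airy_energy_rate x 0 (Airy_Ai x) (Airy_Ai' x) + M * (6 * (1 - x) powr (-3/2))"])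
 fix x assume "x \<in> {t..s}"
 then have x: "x <= 0" using st by auto
 show "((%x. Ai_energy x + M * airy_mu x) has_real_derivative airy_energy_rate x 0 (Airy_Ai x) (Airy_Ai' x) + M * (6 * (1 - x) powr (-3/2))) (at x)"
 by (intro DERIV_add Ai_energy_deriv DERIV_cmult airy_mu_deriv x)
 show "0 <= airy_energy_rate x 0 (Airy_Ai x) (Airy_Ai' x) + M * (6 * (1 - x) powr (-3/2))" using r[OF x] by linarith
 qed (use st in auto)
 have 2: "Ai_energy s - M * airy_mu s <= Ai_energy t - M * airy_mu t"
 proof (rule DERIV_nonpos_mono[where f = "%x. Ai_energy x - M * airy_mu x" and f' = "%x. airy_energy_rate x 0 (Airy_Ai x) (Airy_Ai' x) - M * (6 * (1 - x) powr (-3/2))"])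
 fix x assume "x \<in> {t..s}"
 then have x: "x <= 0" using st by auto
 show "((%x. Ai_energy x - M * airy_mu x) has_real_derivative airy_energy_rate x 0 (Airy_Ai x) (Airy_Ai' x) - M * (6 * (1 - x) powr (-3/2))) (at x)"
 by (intro DERIV_diff Ai_energy_deriv DERIV_cmult airy_mu_deriv x)
 show "airy_energy_rate x 0 (Airy_Ai x) (Airy_Ai' x) - M * (6 * (1 - x) powr (-3/2)) <= 0" using r[OF x] by linarith
 qed (use st in auto)
 have "0 <= M * airy_mu t" using airy_mu_bound[of t] st M(2) by simp
 then show ?thesis using 1 2 by linarith
qed

lemma airy_weight_asymp: "((%S. airy_weight (- (S ^ 4)) / S\<^sup>2) \<longlongrightarrow> 1) at_top"
 unfolding airy_weight_def by real_asymp

lemma airy_weight_cube_at_top: "((%S. 1 / (4 * airy_weight (- (S ^ 4)) ^ 3)) \<longlongrightarrow> 0) at_top"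
 unfolding airy_weight_def by real_asymp

definition Ai_amplitude_error :: "real => real" where
 "Ai_amplitude_error S = \<bar>Airy_Ai (- (S ^ 4)) * S - (cos (2/3 * S ^ 6) + sin (2/3 * S ^ 6)) / sqrt (2 * pi)\<bar>"

lemma Ai_amplitude_error: "(Ai_amplitude_error \<longlongrightarrow> 0) at_top"
 unfolding Ai_amplitude_error_def[abs_def] by (intro tendsto_rabs_zero Airy_Ai_asymp_left)

lemma cos_plus_sin: "cos x + sin x = sqrt 2 * cos (x - pi/4)" for x :: real
 unfolding cos_diff cos_45 sin_45 by (simp add: field_simps)

lemma airy_phase_eq:
 "(cos (2/3 * S ^ 6) + sin (2/3 * S ^ 6)) / sqrt (2 * pi) = cos (2/3 * S ^ 6 - pi/4) / sqrt pi"
 unfolding cos_plus_sin by (simp add: real_sqrt_mult)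

text \<open>\<open>phase_point n\<close> is where the phase \<open>2/3 S\<^sup>6 - \<pi>/4\<close> equals \<open>n \<pi>\<close>.\<close>

definition phase_point :: "nat => real" where
 "phase_point n = (3/2 * (pi/4 + real n * pi)) powr (1/6)"

lemma phase_point: "0 < phase_point n" "2/3 * phase_point n ^ 6 - pi/4 = real n * pi"
proof -
 have p: "0 < 3/2 * (pi/4 + real n * pi)" by (intro mult_pos_pos add_pos_nonneg) auto
 then show "0 < phase_point n" unfolding phase_point_def by simp
 have "phase_point n ^ 6 = 3/2 * (pi/4 + real n * pi)"
 unfolding phase_point_def using p by (simp add: powr_powr flip: powr_realpow)
 then show "2/3 * phase_point n ^ 6 - pi/4 = real n * pi" by simp
qed

lemma phase_point_at_top: "filterlim phase_point at_top sequentially"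
 unfolding phase_point_def by real_asymp

text \<open>The asymptotics are known for Ai but not for Ai', so an upper bound is taken where Ai'
  vanishes: there the energy is the weight times Ai^2, and |cos| <= 1 bounds it by 1/pi in the
  limit. Such points exist arbitrarily far left by Rolle's theorem, since Ai changes sign between
  consecutive phase points.\<close>

lemma Ai_energy_critical_upper:
 assumes "\<delta> > 0" shows "\<exists>t\<le>b. Ai_energy t <= 1 / pi + \<delta>"
proof -
 let ?U = "%S. airy_weight (- (S ^ 4)) / S\<^sup>2 * (1 / sqrt pi + Ai_amplitude_error S)\<^sup>2"
 have "(?U \<longlongrightarrow> 1 * (1 / sqrt pi + 0)\<^sup>2) at_top" by (intro tendsto_intros airy_weight_asymp Ai_amplitude_error)
 then have "\<forall>\<^sub>F S in at_top. ?U S < 1 / pi + \<delta>" using assms by (intro order_tendstoD(2)) (auto simp: power_divide)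
 moreover have "\<forall>\<^sub>F S in at_top. Ai_amplitude_error S < 1 / sqrt pi" by (rule order_tendstoD(2)[OF Ai_amplitude_error]) simp
 moreover have "\<forall>\<^sub>F S in at_top. S >= 1 + \<bar>b\<bar>" by (rule eventually_ge_at_top)
 ultimately have "\<forall>\<^sub>F S in at_top. ?U S < 1 / pi + \<delta> & Ai_amplitude_error S < 1 / sqrt pi & S >= 1 + \<bar>b\<bar>"
 by eventually_elim auto
 then obtain N where N: "!!S. N <= S ==> ?U S < 1 / pi + \<delta> & Ai_amplitude_error S < 1 / sqrt pi & S >= 1 + \<bar>b\<bar>"
 unfolding eventually_at_top_linorder by blast
 have "\<forall>\<^sub>F n in sequentially. phase_point n >= N" using phase_point_at_top by (simp add: filterlim_at_top)
 then obtain n0 where n0: "!!n. n0 <= n ==> N <= phase_point n"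
 unfolding eventually_sequentially by blast
 \<comment> \<open>The even offset \<open>2 * n0\<close> makes the sign of Ai at \<open>x n\<close>
   equal to that of (-1)^n.\<close>
 define x where "x = (%n. - (phase_point (2 * n0 + n) ^ 4))"
 have NS: "N <= phase_point (2 * n0 + n)" for n by (rule n0) simp
 have sgn: "0 < (-1) ^ n * Airy_Ai (x n)" for n
 proof -
 let ?S = "phase_point (2 * n0 + n)"
 have S: "0 < ?S" by (rule phase_point)
 have c: "cos (2/3 * ?S ^ 6 - pi/4) = (-1) ^ n"
 unfolding phase_point(2) cos_npi by (simp add: power_add power_mult)
 have "\<bar>Airy_Ai (x n) * ?S - (-1) ^ n / sqrt pi\<bar> < 1 / sqrt pi"
 using N[OF NS[of n]] unfolding Ai_amplitude_error_def airy_phase_eq c x_def by blast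
 then have "\<bar>(-1) ^ n * (Airy_Ai (x n) * ?S - (-1) ^ n / sqrt pi)\<bar> < 1 / sqrt pi" by (simp add: abs_mult power_abs)
 moreover have "(-1) ^ n * (Airy_Ai (x n) * ?S - (-1) ^ n / sqrt pi) = ((-1) ^ n * Airy_Ai (x n)) * ?S - 1 / sqrt pi"
 by (simp add: algebra_simps flip: power_mult_distrib)
 ultimately have "0 < ((-1) ^ n * Airy_Ai (x n)) * ?S" by linarith
 then show ?thesis using S by (simp add: zero_less_mult_iff)
 qed
 have dec: "x (Suc n) < x n" for n
 unfolding x_def phase_point_def by (auto intro!: power_strict_mono powr_less_mono2)
 have cont: "continuous_on S Airy_Ai" for S using Airy_Ai_deriv by (intro DERIV_continuous_on) (auto intro: has_field_derivative_at_within)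
 have zero: "\<exists>z. x (Suc n) <= z & z <= x n & Airy_Ai z = 0" for n
 proof (cases "even n")
 case True
 then show ?thesis using IVT'[of Airy_Ai "x (Suc n)" 0 "x n"] sgn[of n] sgn[of "Suc n"] dec[of n] cont by auto
 next
 case False
 then show ?thesis using IVT2'[of Airy_Ai "x n" 0 "x (Suc n)"] sgn[of n] sgn[of "Suc n"] dec[of n] cont by auto
 qed
 \<comment> \<open>The intervals [x 1, x 0] and [x 3, x 2] are disjoint, so the two zeros are
   distinct, as Rolle's theorem requires.\<close>
 obtain z0 where z0: "x 1 <= z0" "z0 <= x 0" "Airy_Ai z0 = 0" using zero[of 0] by auto
 obtain z1 where z1: "x 3 <= z1" "z1 <= x 2" "Airy_Ai z1 = 0" using zero[of 2] by (auto simp: eval_nat_numeral)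
 have "x 2 < x 1" using dec[of 1] by (simp add: eval_nat_numeral)
 then have "z1 < z0" using z0 z1 by linarith
 from Rolle_deriv[OF this _ cont, of "%x. (*) (Airy_Ai' x)"] z0 z1 Airy_Ai_deriv
 obtain t where t: "z1 < t" "t < z0" "(*) (Airy_Ai' t) = (%v. 0)" by (auto simp: has_field_derivative_def)
 then have t0: "Airy_Ai' t = 0" by (metis mult.right_neutral)
 have "x 0 < 0" unfolding x_def using phase_point(1)[of "2 * n0"] by simp
 then have tneg: "t < 0" using t z0 by linarith
 define S where "S = (- t) powr (1/4)"
 have S: "0 < S" "t = - (S ^ 4)"
 unfolding S_def using tneg by (auto simp: powr_powr simp flip: powr_realpow)
 have "phase_point (2 * n0) ^ 4 <= S ^ 4" using t z0 S unfolding x_def by simp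
 then have "phase_point (2 * n0) <= S" using S phase_point(1)[of "2 * n0"] by (meson less_imp_le not_le power_strict_mono zero_less_numeral)
 then have NS: "N <= S" using n0[of "2 * n0"] by simp
 have "t <= b"
 proof -
 have "1 + \<bar>b\<bar> <= S" using N[OF NS] by simp
 also have "S <= S ^ 4" using \<open>1 + \<bar>b\<bar> <= S\<close> by (intro self_le_power) auto
 finally show ?thesis using S by linarith
 qed
 moreover have "Ai_energy t <= 1 / pi + \<delta>"
 proof -
 have "\<bar>cos (2/3 * S ^ 6 - pi/4) / sqrt pi\<bar> <= 1 / sqrt pi" by (simp add: divide_right_mono)
 then have le: "\<bar>Airy_Ai t * S\<bar> <= 1 / sqrt pi + Ai_amplitude_error S"
 unfolding Ai_amplitude_error_def airy_phase_eq S(2) by linarith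
 have "Ai_energy t = airy_weight t * (Airy_Ai t)\<^sup>2"
 unfolding airy_energy_def airy_energy0_def t0 by simp
 also have "... = airy_weight t / S\<^sup>2 * \<bar>Airy_Ai t * S\<bar>\<^sup>2" using S by (simp add: power_mult_distrib)
 also have "... <= airy_weight t / S\<^sup>2 * (1 / sqrt pi + Ai_amplitude_error S)\<^sup>2"
 using le airy_weight_pos[of t] by (intro mult_left_mono power_mono) auto
 also have "... <= 1 / pi + \<delta>" using N[OF NS] unfolding S(2) by simp
 finally show ?thesis .
 qed
 ultimately show ?thesis by blast
qed

text \<open>At the phase points |cos| is 1, and the term in Ai^2 alone already reaches 1/pi in the
  limit; the term in Ai' squared only helps.\<close>

lemma Ai_energy_lower:
 assumes "\<delta> > 0" shows "\<exists>t\<le>b. 1 / pi - \<delta> <= Ai_energy t"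
proof -
 let ?V = "%S. (1 - 1 / (4 * airy_weight (- (S ^ 4)) ^ 3)) * (airy_weight (- (S ^ 4)) / S\<^sup>2) * (1 / sqrt pi - Ai_amplitude_error S)\<^sup>2"
 have "(?V \<longlongrightarrow> (1 - 0) * 1 * (1 / sqrt pi - 0)\<^sup>2) at_top"
 by (intro tendsto_intros airy_weight_asymp Ai_amplitude_error airy_weight_cube_at_top)
 then have "\<forall>\<^sub>F S in at_top. 1 / pi - \<delta> < ?V S" using assms by (intro order_tendstoD(1)) (auto simp: power_divide)
 moreover have "\<forall>\<^sub>F S in at_top. Ai_amplitude_error S < 1 / sqrt pi" by (rule order_tendstoD(2)[OF Ai_amplitude_error]) simp
 moreover have "\<forall>\<^sub>F S in at_top. S >= 1 + \<bar>b\<bar>" by (rule eventually_ge_at_top)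
 ultimately have "\<forall>\<^sub>F S in at_top. 1 / pi - \<delta> < ?V S & Ai_amplitude_error S < 1 / sqrt pi & S >= 1 + \<bar>b\<bar>"
 by eventually_elim auto
 then obtain N where N: "!!S. N <= S ==> 1 / pi - \<delta> < ?V S & Ai_amplitude_error S < 1 / sqrt pi & S >= 1 + \<bar>b\<bar>"
 unfolding eventually_at_top_linorder by blast
 have "\<forall>\<^sub>F n in sequentially. phase_point n >= N" using phase_point_at_top by (simp add: filterlim_at_top)
 then obtain n0 where n0: "!!n. n0 <= n ==> N <= phase_point n"
 unfolding eventually_sequentially by blast
 define S where "S = phase_point (2 * n0)"
 have NS: "N <= S" unfolding S_def by (rule n0) simp
 have S: "0 < S" unfolding S_def by (rule phase_point)
 have c: "cos (2/3 * S ^ 6 - pi/4) = 1"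
 unfolding S_def phase_point(2) cos_npi by (simp add: power_mult)
 let ?t = "- (S ^ 4)"
 have "?t <= b"
 proof -
 have "1 + \<bar>b\<bar> <= S" using N[OF NS] by simp
 also have "S <= S ^ 4" using \<open>1 + \<bar>b\<bar> <= S\<close> by (intro self_le_power) auto
 finally show ?thesis by linarith
 qed
 moreover have "1 / pi - \<delta> <= Ai_energy ?t"
 proof -
 have err: "1 / sqrt pi - Ai_amplitude_error S <= \<bar>Airy_Ai ?t * S\<bar>"
 unfolding Ai_amplitude_error_def airy_phase_eq c by linarith
 have k: "0 <= 1 - 1 / (4 * airy_weight ?t ^ 3)" using one_le_power[OF airy_weight_ge_1, of ?t 3] airy_weight_pos[of ?t] by (simp add: field_simps)
 have "1 / pi - \<delta> <= (1 - 1 / (4 * airy_weight ?t ^ 3)) * (airy_weight ?t / S\<^sup>2) * (1 / sqrt pi - Ai_amplitude_error S)\<^sup>2"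
 using N[OF NS] by simp
 also have "... <= (1 - 1 / (4 * airy_weight ?t ^ 3)) * (airy_weight ?t / S\<^sup>2) * \<bar>Airy_Ai ?t * S\<bar>\<^sup>2"
 using err N[OF NS] k airy_weight_pos[of ?t] by (intro mult_left_mono power_mono) auto
 also have "... = (1 - 1 / (4 * airy_weight ?t ^ 3)) * (airy_weight ?t * (Airy_Ai ?t)\<^sup>2)" using S by (simp add: power_mult_distrib)
 also have "... <= (1 - 1 / (4 * airy_weight ?t ^ 3)) * airy_energy0 ?t (Airy_Ai ?t) (Airy_Ai' ?t)"
 using k airy_weight_pos[of ?t] by (intro mult_left_mono) (auto simp: airy_energy0_def)
 also have "... <= Ai_energy ?t" using airy_energy_cross[of ?t "Airy_Ai ?t" "Airy_Ai' ?t"] by (simp add: algebra_simps abs_le_iff)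
 finally show ?thesis .
 qed
 ultimately show ?thesis by blast
qed

text \<open>The upper bound and the lower bound hold along different sequences. The Cauchy property
  joins them and turns \<open>airy_mu\<close> into the rate of convergence.\<close>

lemma Ai_energy_limit: "\<exists>M>0. \<forall>s\<le>0. Ai_energy s <= M & \<bar>Ai_energy s - 1 / pi\<bar> <= M * (1 - s) powr (-1/2)"
proof -
 obtain M where M: "0 < M" "!!s. s <= 0 ==> Ai_energy s <= M" using Ai_energy_bounded by blast
 show ?thesis
 proof (intro exI[of _ "12 * M"] conjI allI impI)
 fix s :: real assume s: "s <= 0"
 show "Ai_energy s <= 12 * M" using M(1) M(2)[OF s] by linarith
 have "Ai_energy s - 1 / pi <= M * airy_mu s"
 proof (rule field_le_epsilon)
 fix \<delta> :: real assume "0 < \<delta>"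
 from Ai_energy_critical_upper[OF this, of s] obtain t where "t <= s" "Ai_energy t <= 1 / pi + \<delta>" by blast
 then show "Ai_energy s - 1 / pi <= M * airy_mu s + \<delta>" using Ai_energy_cauchy[OF M(2) M(1) _ s, of t] by linarith
 qed
 moreover have "1 / pi - Ai_energy s <= M * airy_mu s"
 proof (rule field_le_epsilon)
 fix \<delta> :: real assume "0 < \<delta>"
 from Ai_energy_lower[OF this, of s] obtain t where "t <= s" "1 / pi - \<delta> <= Ai_energy t" by blast
 then show "1 / pi - Ai_energy s <= M * airy_mu s + \<delta>" using Ai_energy_cauchy[OF M(2) M(1) _ s, of t] by linarith
 qed
 ultimately show "\<bar>Ai_energy s - 1 / pi\<bar> <= 12 * M * (1 - s) powr (-1/2)"
 unfolding airy_mu_def by (simp add: abs_le_iff)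
 qed (use M in auto)
qed

section \<open>Comparison of positive decaying solutions\<close>

lemma strictly_decaying_not_pos:
 fixes r r' :: "real => real"
 assumes r: "!!x. a <= x ==> (r has_real_derivative r' x) (at x)"
 and r': "!!x. a <= x ==> r' x <= - \<epsilon>" and e: "0 < \<epsilon>"
 and pos: "!!x. a <= x ==> 0 < r x"
 shows False
proof -
 define b where "b = a + r a / \<epsilon>"
 have ab: "a <= b" unfolding b_def using pos[of a] e by simp
 have "r b + \<epsilon> * b <= r a + \<epsilon> * a"
 proof (rule DERIV_nonpos_mono[where f = "%x. r x + \<epsilon> * x" and f' = "%x. r' x + \<epsilon>"])
 fix x assume "x \<in> {a..b}"
 then show "((%x. r x + \<epsilon> * x) has_real_derivative r' x + \<epsilon>) (at x)" "r' x + \<epsilon> <= 0"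
 using r[of x] r'[of x] by (auto intro!: derivative_eq_intros)
 qed (rule ab)
 moreover have "\<epsilon> * b = \<epsilon> * a + r a" unfolding b_def using e by (simp add: field_simps)
 ultimately show False using pos[OF ab] by linarith
qed

text \<open>If the Wronskian exceeded the bound at some point, it would stay away from zero, so one of the
 ratios of the two positive bounded functions would decrease linearly.\<close>

lemma wronskian_comparison:
 fixes y y1 \<psi> \<psi>1 Q p \<beta> \<beta>' :: "real => real"
 assumes y: "!!x. a <= x ==> (y has_real_derivative y1 x) (at x)"
 and y1: "!!x. a <= x ==> (y1 has_real_derivative (Q x + p x) * y x) (at x)"
 and \<psi>: "!!x. a <= x ==> (\<psi> has_real_derivative \<psi>1 x) (at x)"
 and \<psi>1: "!!x. a <= x ==> (\<psi>1 has_real_derivative Q x * \<psi> x) (at x)"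
 and ypos: "!!x. a <= x ==> 0 < y x" and ybd: "!!x. a <= x ==> y x <= My"
 and \<psi>pos: "!!x. a <= x ==> 0 < \<psi> x" and \<psi>bd: "!!x. a <= x ==> \<psi> x <= M\<psi>"
 and \<psi>dec: "!!x. a <= x ==> \<psi>1 x <= 0"
 and \<beta>: "!!x. a <= x ==> (\<beta> has_real_derivative \<beta>' x) (at x)" and \<beta>pos: "!!x. a <= x ==> 0 <= \<beta> x"
 and key: "!!x. a <= x ==> \<beta>' x * y x + \<bar>p x\<bar> * y x <= - y1 x * \<beta> x"
 and x: "a <= x"
 shows "\<bar>\<psi>1 x * y x - \<psi> x * y1 x\<bar> <= \<beta> x * (\<psi> x * y x)"
proof -
 let ?W = "%x. \<psi>1 x * y x - \<psi> x * y1 x"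
 let ?b = "%x. \<beta> x * (\<psi> x * y x)"
 have W: "(?W has_real_derivative - p x * (\<psi> x * y x)) (at x)" if "a <= x" for x
 using that by (auto intro!: derivative_eq_intros y y1 \<psi> \<psi>1 simp: algebra_simps)
 have b: "(?b has_real_derivative \<beta>' x * (\<psi> x * y x) + \<beta> x * (\<psi>1 x * y x + \<psi> x * y1 x)) (at x)" if "a <= x" for x
 using that by (auto intro!: derivative_eq_intros y \<psi> \<beta> simp: algebra_simps)
 have bpos: "0 <= ?b x" if "a <= x" for x using \<beta>pos[OF that] \<psi>pos[OF that] ypos[OF that] by simp
 \<comment> \<open>By \<open>key\<close> and the sign of \<open>\<psi>1\<close> the majorant falls
   at least as fast as the Wronskian can change, so an excess over the majorant never
   shrinks.\<close>
 have rate: "\<beta>' x * (\<psi> x * y x) + \<beta> x * (\<psi>1 x * y x + \<psi> x * y1 x) <= - \<bar>p x\<bar> * (\<psi> x * y x)" if "a <= x" for x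
 proof -
 have "(\<beta>' x * y x + \<bar>p x\<bar> * y x) * \<psi> x <= (- y1 x * \<beta> x) * \<psi> x"
 using key[OF that] \<psi>pos[OF that] by (intro mult_right_mono) auto
 moreover have "\<beta> x * (\<psi>1 x * y x) <= 0"
 using \<beta>pos[OF that] \<psi>dec[OF that] ypos[OF that] by (simp add: mult_nonneg_nonpos mult_nonpos_nonneg)
 ultimately show ?thesis by (simp add: algebra_simps)
 qed
 have pp: "p x * (\<psi> x * y x) <= \<bar>p x\<bar> * (\<psi> x * y x)" "- p x * (\<psi> x * y x) <= \<bar>p x\<bar> * (\<psi> x * y x)" if "a <= x" for x
 proof -
 have nn: "0 <= \<psi> x * y x" using \<psi>pos[OF that] ypos[OF that] by simp
 show "p x * (\<psi> x * y x) <= \<bar>p x\<bar> * (\<psi> x * y x)" by (rule mult_right_mono[OF abs_ge_self nn])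
 show "- p x * (\<psi> x * y x) <= \<bar>p x\<bar> * (\<psi> x * y x)" by (rule mult_right_mono[OF abs_ge_minus_self nn])
 qed
 have 1: "?W x <= ?b x"
 proof (rule ccontr)
 assume "\<not> ?W x <= ?b x"
 define d where "d = ?W x - ?b x"
 have d: "0 < d" unfolding d_def using \<open>\<not> ?W x <= ?b x\<close> by simp
 have mono: "d <= ?W z - ?b z" if "x <= z" for z unfolding d_def
 proof (rule DERIV_nonneg_mono[where f = "%z. ?W z - ?b z" and f' = "%x. - p x * (\<psi> x * y x) - (\<beta>' x * (\<psi> x * y x) + \<beta> x * (\<psi>1 x * y x + \<psi> x * y1 x))"])
 fix t assume "t \<in> {x..z}"
 then have t: "a <= t" using x by auto
 show "((%z. ?W z - ?b z) has_real_derivative - p t * (\<psi> t * y t) - (\<beta>' t * (\<psi> t * y t) + \<beta> t * (\<psi>1 t * y t + \<psi> t * y1 t))) (at t)"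
 by (intro DERIV_diff W b t)
 show "0 <= - p t * (\<psi> t * y t) - (\<beta>' t * (\<psi> t * y t) + \<beta> t * (\<psi>1 t * y t + \<psi> t * y1 t))"
 using rate[OF t] pp[OF t] by linarith
 qed (rule that)
 show False
 proof (rule strictly_decaying_not_pos[where a = x and r = "%x. y x / \<psi> x" and r' = "%x. - ?W x / (\<psi> x)\<^sup>2" and \<epsilon> = "d / M\<psi>\<^sup>2"])
 fix z assume z: "x <= z"
 then have az: "a <= z" using x by simp
 show "((%x. y x / \<psi> x) has_real_derivative - ?W z / (\<psi> z)\<^sup>2) (at z)"
 using \<psi>pos[OF az] by (auto intro!: derivative_eq_intros y[OF az] \<psi>[OF az] simp: power2_eq_square field_simps)
 have "d / M\<psi>\<^sup>2 <= d / (\<psi> z)\<^sup>2"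
 using \<psi>pos[OF az] \<psi>bd[OF az] d by (intro divide_left_mono power_mono mult_pos_pos) auto
 also have "... <= ?W z / (\<psi> z)\<^sup>2" using mono[OF z] bpos[OF az] by (intro divide_right_mono) auto
 finally show "- ?W z / (\<psi> z)\<^sup>2 <= - (d / M\<psi>\<^sup>2)"
 unfolding minus_divide_left[symmetric] by (rule le_imp_neg_le)
 show "0 < y z / \<psi> z" using \<psi>pos[OF az] ypos[OF az] by simp
 next
 show "0 < d / M\<psi>\<^sup>2" using d \<psi>pos[OF x] \<psi>bd[OF x] by simp
 qed
 qed
 have 2: "- ?W x <= ?b x"
 proof (rule ccontr)
 assume "\<not> - ?W x <= ?b x"
 define d where "d = - ?W x - ?b x"
 have d: "0 < d" unfolding d_def using \<open>\<not> - ?W x <= ?b x\<close> by simp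
 have mono: "d <= - ?W z - ?b z" if "x <= z" for z unfolding d_def
 proof (rule DERIV_nonneg_mono[where f = "%z. - ?W z - ?b z" and f' = "%x. - (- p x * (\<psi> x * y x)) - (\<beta>' x * (\<psi> x * y x) + \<beta> x * (\<psi>1 x * y x + \<psi> x * y1 x))"])
 fix t assume "t \<in> {x..z}"
 then have t: "a <= t" using x by auto
 show "((%z. - ?W z - ?b z) has_real_derivative - (- p t * (\<psi> t * y t)) - (\<beta>' t * (\<psi> t * y t) + \<beta> t * (\<psi>1 t * y t + \<psi> t * y1 t))) (at t)"
 by (intro DERIV_diff DERIV_minus W b t)
 show "0 <= - (- p t * (\<psi> t * y t)) - (\<beta>' t * (\<psi> t * y t) + \<beta> t * (\<psi>1 t * y t + \<psi> t * y1 t))"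
 using rate[OF t] pp[OF t] by linarith
 qed (rule that)
 show False
 proof (rule strictly_decaying_not_pos[where a = x and r = "%x. \<psi> x / y x" and r' = "%x. ?W x / (y x)\<^sup>2" and \<epsilon> = "d / My\<^sup>2"])
 fix z assume z: "x <= z"
 then have az: "a <= z" using x by simp
 show "((%x. \<psi> x / y x) has_real_derivative ?W z / (y z)\<^sup>2) (at z)"
 using ypos[OF az] by (auto intro!: derivative_eq_intros y[OF az] \<psi>[OF az] simp: power2_eq_square field_simps)
 have "d / My\<^sup>2 <= d / (y z)\<^sup>2" using ypos[OF az] ybd[OF az] d by (intro divide_left_mono power_mono mult_pos_pos) auto
 also have "... <= - ?W z / (y z)\<^sup>2" using mono[OF z] bpos[OF az] by (intro divide_right_mono) auto
 finally show "?W z / (y z)\<^sup>2 <= - (d / My\<^sup>2)"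
 unfolding minus_divide_left[symmetric] by linarith
 show "0 < \<psi> z / y z" using \<psi>pos[OF az] ypos[OF az] by simp
 next
 show "0 < d / My\<^sup>2" using d ypos[OF x] ybd[OF x] by simp
 qed
 qed
 show ?thesis using 1 2 by linarith
qed

lemma recessive_wronskian_zero:
 fixes y y1 \<psi> \<psi>1 Q :: "real => real"
 assumes "!!x. a <= x ==> (y has_real_derivative y1 x) (at x)"
 and "!!x. a <= x ==> (y1 has_real_derivative Q x * y x) (at x)"
 and "!!x. a <= x ==> (\<psi> has_real_derivative \<psi>1 x) (at x)"
 and "!!x. a <= x ==> (\<psi>1 has_real_derivative Q x * \<psi> x) (at x)"
 and "!!x. a <= x ==> 0 < y x" and "!!x. a <= x ==> y x <= My"
 and "!!x. a <= x ==> 0 < \<psi> x" and "!!x. a <= x ==> \<psi> x <= M\<psi>"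
 and "!!x. a <= x ==> \<psi>1 x <= 0" and "a <= x"
 shows "\<psi>1 x * y x = \<psi> x * y1 x"
proof -
 have "\<bar>\<psi>1 x * y x - \<psi> x * y1 x\<bar> <= 0 * (\<psi> x * y x)"
 by (rule wronskian_comparison[where \<beta> = "%_. 0" and \<beta>' = "%_. 0" and p = "%_. 0" and Q = Q and a = a
 and My = My and M\<psi> = M\<psi>]) (simp_all add: assms)
 then show ?thesis by simp
qed

text \<open>L + G decreases and L - G increases while G tends to zero, so the infimum of L + G is
  the limit of L and G bounds the distance to it.\<close>

lemma convergence_by_majorant:
 fixes L L' G G' :: "real => real"
 assumes L: "!!x. a <= x ==> (L has_real_derivative L' x) (at x)"
 and G: "!!x. a <= x ==> (G has_real_derivative - G' x) (at x)"
 and le: "!!x. a <= x ==> \<bar>L' x\<bar> <= G' x" and G0: "(G \<longlongrightarrow> 0) at_top"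
 obtains l where "(L \<longlongrightarrow> l) at_top" "!!x. a <= x ==> \<bar>L x - l\<bar> <= G x"
proof -
 have G_mono: "G y <= G x" if "a <= x" "x <= y" for x y
 proof (rule DERIV_nonpos_mono[where f = G and f' = "%x. - G' x"])
 fix t assume "t \<in> {x..y}"
 then have t: "a <= t" using that by auto
 show "(G has_real_derivative - G' t) (at t)" "- G' t <= 0" using G[OF t] le[OF t] by auto
 qed (rule that)
 have Gpos: "0 <= G x" if "a <= x" for x using G0 by (rule tendsto_upperbound)
 (use G_mono that in \<open>auto simp: eventually_at_top_linorder\<close>)
 have plus: "L y + G y <= L x + G x" if "a <= x" "x <= y" for x y
 proof (rule DERIV_nonpos_mono[where f = "%x. L x + G x" and f' = "%x. L' x + - G' x"])
 fix t assume "t \<in> {x..y}"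
 then have t: "a <= t" using that by auto
 show "((%x. L x + G x) has_real_derivative L' t + - G' t) (at t)" by (intro DERIV_add L G t)
 show "L' t + - G' t <= 0" using le[OF t] by linarith
 qed (rule that)
 have minus: "L x - G x <= L y - G y" if "a <= x" "x <= y" for x y
 proof (rule DERIV_nonneg_mono[where f = "%x. L x - G x" and f' = "%x. L' x - - G' x"])
 fix t assume "t \<in> {x..y}"
 then have t: "a <= t" using that by auto
 show "((%x. L x - G x) has_real_derivative L' t - - G' t) (at t)" by (intro DERIV_diff L G t)
 show "0 <= L' t - - G' t" using le[OF t] by linarith
 qed (rule that)
 have cross: "L x - G x <= L y + G y" if "a <= x" "a <= y" for x y
 proof (cases "x <= y")
 case True
 then show ?thesis using minus[OF that(1) True] Gpos[OF that(2)] by linarith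
 next
 case False
 then show ?thesis using plus[OF that(2), of x] Gpos[OF that(1)] by linarith
 qed
 define l where "l = (INF x\<in>{a..}. L x + G x)"
 have bdd: "bdd_below ((%x. L x + G x) ` {a..})" by (rule bdd_belowI[of _ "L a - G a"]) (use cross in auto)
 have lb: "\<bar>L x - l\<bar> <= G x" if "a <= x" for x
 proof -
 have "l <= L x + G x" unfolding l_def using that by (intro cINF_lower bdd) auto
 moreover have "L x - G x <= l" unfolding l_def using cross that by (intro cINF_greatest) auto
 ultimately show ?thesis by linarith
 qed
 have "((%x. L x - l) \<longlongrightarrow> 0) at_top"
 by (rule Lim_null_comparison[OF _ G0]) (use lb in \<open>auto simp: eventually_at_top_linorder\<close>)
 then have "(L \<longlongrightarrow> l) at_top" by (simp add: LIM_zero_iff)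
 then show ?thesis using that lb by blast
qed

section \<open>Langer's transformation and the decaying side\<close>

text \<open>A fixed choice of the constant, so that other constants can be defined in terms of
  it.\<close>

definition airy_slope :: real where
 "airy_slope = (SOME c. c > 0 & (\<forall>x\<ge>0. c * sqrt (1 + x) * Airy_Ai x <= - Airy_Ai' x))"

lemma airy_slope: "0 < airy_slope" "0 <= x ==> airy_slope * sqrt (1 + x) * Airy_Ai x <= - Airy_Ai' x"
proof -
 have "\<exists>c. c > 0 & (\<forall>x\<ge>0. c * sqrt (1 + x) * Airy_Ai x <= - Airy_Ai' x)" using Airy_Ai_log_deriv by blast
 from someI_ex[OF this, folded airy_slope_def]
 show "0 < airy_slope" "0 <= x ==> airy_slope * sqrt (1 + x) * Airy_Ai x <= - Airy_Ai' x" by auto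
qed

text \<open>Langer's change of variable \<open>\<xi>\<close> with derivative \<open>\<xi>'\<close> at a turning point \<open>x0\<close>, where \<open>l\<close> is the
 logarithmic derivative of \<open>\<xi>'\<close> and \<open>K\<close> bounds everything uniformly. We write \<open>h = k\<^sup>3\<close>.\<close>

locale langer =
 fixes K rho x1 x0 :: real and Q xi xi1 l l1 :: "real => real"
 assumes K: "1 <= K" and rho: "0 < rho"
 and x1_x0: "1 / K <= x0 - x1" "x0 - x1 <= K"
 and xi: "x1 <= x ==> (xi has_real_derivative xi1 x) (at x)"
 and xi1: "x1 <= x ==> (xi1 has_real_derivative xi1 x * l x) (at x)"
 and l: "x1 <= x ==> (l has_real_derivative l1 x) (at x)"
 and xi1_pos: "x1 <= x ==> 0 < xi1 x"
 and Q_eq: "x1 <= x ==> Q x = xi x * (xi1 x)\<^sup>2"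
 and xi_x0: "xi x0 = 0"
 and l_right: "x0 <= x ==> \<bar>l x\<bar> <= K * xi1 x * sqrt (1 + xi x)"
 and p_right: "x0 <= x ==> \<bar>(l x)\<^sup>2 / 4 - l1 x / 2\<bar> <= K * (xi1 x)\<^sup>2 * (1 + xi x) powr (- rho - 1/2)"
 and left: "x1 <= x ==> x <= x0 ==> \<bar>l x\<bar> <= K & \<bar>l1 x\<bar> <= K"
 and xi1_near: "x1 <= x ==> x <= x0 + 1 / K ==> 1 / K <= xi1 x & xi1 x <= K"
 and xi_at_top: "filterlim xi at_top at_top"
 and Q_lower: "x0 <= x ==> min (x - x0) 1 / K <= Q x"
begin

lemma K_pos: "0 < K" using K by simp

lemma x1_less_x0: "x1 < x0" using x1_x0(1) K_pos by (smt (verit) divide_pos_pos)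

lemma xi_mono: "x1 <= x ==> x <= y ==> xi x <= xi y" by (rule DERIV_nonneg_mono[where f = xi and f' = xi1]) (auto intro: xi less_imp_le[OF xi1_pos])

lemma xi_nonneg: "x0 <= x ==> 0 <= xi x" using xi_mono[of x0 x] xi_x0 x1_less_x0 by simp

lemma xi_nonpos: "x1 <= x ==> x <= x0 ==> xi x <= 0" using xi_mono[of x x0] xi_x0 by simp

text \<open>Minus one half of the Schwarzian derivative of \<open>xi\<close>: the potential by which
  the ansatz \<open>Y\<close> misses the equation.\<close>

definition p :: "real => real" where "p x = (l x)\<^sup>2 / 4 - l1 x / 2"

definition sig :: "real => real => real" where "sig k x = xi x / k\<^sup>2"

definition Y :: "real => real => real" where
 "Y k x = Airy_Ai (sig k x) / sqrt (xi1 x)"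

definition Y1 :: "real => real => real" where
 "Y1 k x = (Airy_Ai' (sig k x) * (xi1 x / k\<^sup>2) - l x / 2 * Airy_Ai (sig k x)) / sqrt (xi1 x)"

lemma sig_deriv: "x1 <= x ==> (sig k has_real_derivative xi1 x / k\<^sup>2) (at x)"
 unfolding sig_def by (rule DERIV_cdivide[OF xi])

lemma sqrt_xi1_deriv:
 assumes "x1 <= x" shows "((%x. sqrt (xi1 x)) has_real_derivative sqrt (xi1 x) * l x / 2) (at x)"
proof -
 have "inverse (sqrt X) / 2 * (X * L) = sqrt X * L / 2" if "0 < X" for X L :: real
 proof -
 have "inverse r / 2 * (r * r * L) = r * L / 2" if "0 < r" for r :: real using that by (simp add: field_simps)
 from this[of "sqrt X"] that show ?thesis by simp
 qed
 from DERIV_cong[OF DERIV_chain2[OF DERIV_real_sqrt[OF xi1_pos[OF assms]] xi1[OF assms]] this[OF xi1_pos[OF assms]]]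
 show ?thesis .
qed

lemma Ai_sig_deriv: "x1 <= x ==> ((%x. Airy_Ai (sig k x)) has_real_derivative Airy_Ai' (sig k x) * (xi1 x / k\<^sup>2)) (at x)"
 by (rule DERIV_chain2[OF Airy_Ai_deriv sig_deriv])

lemma Ai'_sig_deriv: "x1 <= x ==> ((%x. Airy_Ai' (sig k x)) has_real_derivative sig k x * Airy_Ai (sig k x) * (xi1 x / k\<^sup>2)) (at x)"
 by (rule DERIV_chain2[OF Airy_Ai'_deriv sig_deriv])

lemma Y_deriv:
 assumes "x1 <= x" shows "(Y k has_real_derivative Y1 k x) (at x)"
proof -
 let ?r = "sqrt (xi1 x)"
 have r: "0 < ?r" using xi1_pos[OF assms] by simp
 have "(Y k has_real_derivative (Airy_Ai' (sig k x) * (xi1 x / k\<^sup>2) * ?r - Airy_Ai (sig k x) * (?r * l x / 2)) / (?r * ?r)) (at x)"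
 unfolding Y_def[abs_def] using r by (intro DERIV_divide Ai_sig_deriv sqrt_xi1_deriv assms) auto
 moreover have "(Airy_Ai' (sig k x) * (xi1 x / k\<^sup>2) * ?r - Airy_Ai (sig k x) * (?r * l x / 2)) / (?r * ?r) = Y1 k x"
 proof -
 have "(A * r - B * (r * L / 2)) / (r * r) = (A - L / 2 * B) / r" if "0 < r" for A B L r :: real using that by (simp add: field_simps)
 from this[OF r] show ?thesis unfolding Y1_def .
 qed
 ultimately show ?thesis by simp
qed

lemma Y1_deriv:
 assumes "x1 <= x" "k > 0" shows "(Y1 k has_real_derivative (Q x / k ^ 6 + p x) * Y k x) (at x)"
proof -
 let ?r = "sqrt (xi1 x)"
 let ?a = "Airy_Ai (sig k x)" and ?a1 = "Airy_Ai' (sig k x)"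
 let ?d = "xi1 x / k\<^sup>2"
 have r: "0 < ?r" using xi1_pos[OF assms(1)] by simp
 let ?N' = "(sig k x * ?a * ?d) * ?d + xi1 x * l x / k\<^sup>2 * ?a1 - (l1 x / 2 * ?a + ?a1 * ?d * (l x / 2))"
 have N: "((%x. Airy_Ai' (sig k x) * (xi1 x / k\<^sup>2) - l x / 2 * Airy_Ai (sig k x)) has_real_derivative ?N') (at x)"
 by (intro DERIV_diff DERIV_mult Ai'_sig_deriv Ai_sig_deriv DERIV_cdivide xi1 l assms(1))
 have "(Y1 k has_real_derivative (?N' * ?r - (?a1 * ?d - l x / 2 * ?a) * (?r * l x / 2)) / (?r * ?r)) (at x)"
 unfolding Y1_def[abs_def] using r by (intro DERIV_divide N sqrt_xi1_deriv assms) auto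
 moreover have "(?N' * ?r - (?a1 * ?d - l x / 2 * ?a) * (?r * l x / 2)) / (?r * ?r) = (Q x / k ^ 6 + p x) * Y k x"
 proof -
 have s: "sig k x * ?d * ?d = Q x / k ^ 6"
 unfolding Q_eq[OF assms(1)] sig_def using assms(2) by (simp add: field_simps eval_nat_numeral)
 have "(((S * a * d) * d + d * L * a1 - (L1 / 2 * a + a1 * d * (L / 2))) * r - (a1 * d - L / 2 * a) * (r * L / 2)) / (r * r)
 = (S * d * d + (L\<^sup>2 / 4 - L1 / 2)) * (a / r)" if "0 < r" for S a d L a1 L1 r :: real using that by (simp add: field_simps power2_eq_square)
 from this[OF r, of "sig k x" ?a ?d "l x" ?a1 "l1 x"] show ?thesis
 unfolding s p_def Y_def by (simp add: mult.commute)
 qed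
 ultimately show ?thesis by simp
qed

lemma Y_pos: "x0 <= x ==> 0 < k ==> 0 < Y k x"
 unfolding Y_def sig_def using xi_nonneg[of x] xi1_pos[of x] x1_less_x0 by (intro divide_pos_pos Airy_Ai_pos) auto

text \<open>The square root of \<open>xi\<close>, regularized at the turning point on the Airy scale
  k^2.\<close>

definition zeta :: "real => real => real" where "zeta k x = sqrt (k\<^sup>2 + xi x)"

text \<open>Large enough that \<open>p\<close> uses at most half of the damping supplied by
  \<open>airy_slope\<close>. The power of 4 pays for replacing 1 + xi by (1 + zeta)^2.\<close>

definition B :: real where "B = 2 * K * 4 powr (rho + 1/2) / airy_slope"

text \<open>Two demands dictate the form: it dominates |p| divided by the decay rate of the ansatz,
  and it is an exact derivative, namely that of - \<open>Gam\<close>, so that integrating it yields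
  the decay rate \<open>rho\<close> in \<open>xi\<close>.\<close>

definition beta :: "real => real => real" where
 "beta k x = B * k ^ 3 * (xi1 x / zeta k x * (1 + zeta k x) powr (- 2 * rho - 1))"

definition Gam :: "real => real => real" where
 "Gam k x = B * k ^ 3 / rho * (1 + zeta k x) powr (- 2 * rho)"

lemma B_pos: "0 < B" unfolding B_def using K_pos airy_slope(1) by simp

lemma zeta_pos: "x0 <= x ==> 0 < k ==> 0 < zeta k x"
 unfolding zeta_def using xi_nonneg[of x] by (simp add: add_pos_nonneg)

lemma zeta_deriv:
 assumes "x0 <= x" "0 < k" shows "(zeta k has_real_derivative xi1 x / (2 * zeta k x)) (at x)"
proof -
 have p: "0 < k\<^sup>2 + xi x" using xi_nonneg[OF assms(1)] assms(2) by (simp add: add_pos_nonneg)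
 have x: "x1 <= x" using assms(1) x1_less_x0 by simp
 have d: "((%x. k\<^sup>2 + xi x) has_real_derivative 0 + xi1 x) (at x)" by (intro DERIV_add DERIV_const xi x)
 have "(zeta k has_real_derivative inverse (sqrt (k\<^sup>2 + xi x)) / 2 * (0 + xi1 x)) (at x)"
 unfolding zeta_def[abs_def] by (rule DERIV_chain2[OF DERIV_real_sqrt[OF p] d])
 moreover have "inverse r / 2 * (0 + X) = X / (2 * r)" for r X :: real by (cases "r = 0") (auto simp: field_simps)
 ultimately show ?thesis by (simp only: zeta_def)
qed

lemma beta_nonneg: "x0 <= x ==> 0 < k ==> 0 <= beta k x"
 unfolding beta_def using B_pos zeta_pos[of x k] xi1_pos[of x] x1_less_x0 by simp

lemma Gam_deriv:
 assumes "x0 <= x" "0 < k" shows "(Gam k has_real_derivative - beta k x) (at x)"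
proof -
 have z: "0 < 1 + zeta k x" using zeta_pos[OF assms] by simp
 have "((%x. 1 + zeta k x) has_real_derivative 0 + xi1 x / (2 * zeta k x)) (at x)" by (intro DERIV_add DERIV_const zeta_deriv assms)
 from DERIV_cmult[OF DERIV_chain2[OF has_real_derivative_powr[OF z, of "- 2 * rho"] this], of "B * k ^ 3 / rho"]
 have "(Gam k has_real_derivative B * k ^ 3 / rho * (- 2 * rho * (1 + zeta k x) powr (- 2 * rho - 1) * (0 + xi1 x / (2 * zeta k x)))) (at x)"
 unfolding Gam_def .
 moreover have "B * k ^ 3 / rho * (- 2 * rho * (1 + zeta k x) powr (- 2 * rho - 1) * (0 + xi1 x / (2 * zeta k x))) = - beta k x"
 unfolding beta_def using rho by simp
 ultimately show ?thesis by simp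
qed

definition beta' :: "real => real => real" where
 "beta' k x = beta k x * (l x - xi1 x / (2 * (zeta k x)\<^sup>2) - (2 * rho + 1) * xi1 x / (2 * zeta k x * (1 + zeta k x)))"

lemma beta_deriv:
 assumes "x0 <= x" "0 < k" shows "(beta k has_real_derivative beta' k x) (at x)"
proof -
 have x: "x1 <= x" using assms(1) x1_less_x0 by simp
 let ?z = "zeta k x"
 have z: "0 < 1 + ?z" "0 < ?z" using zeta_pos[OF assms] by auto
 have d1: "((%x. 1 + zeta k x) has_real_derivative 0 + xi1 x / (2 * zeta k x)) (at x)" by (intro DERIV_add DERIV_const zeta_deriv assms)
 have d2: "((%x. xi1 x / zeta k x) has_real_derivative (xi1 x * l x * ?z - xi1 x * (xi1 x / (2 * ?z))) / (?z * ?z)) (at x)"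
 using z by (intro DERIV_divide xi1 zeta_deriv assms x) auto
 have "(beta k has_real_derivative B * k ^ 3 * ((xi1 x * l x * ?z - xi1 x * (xi1 x / (2 * ?z))) / (?z * ?z) * (1 + ?z) powr (- 2 * rho - 1)
 + ((- 2 * rho - 1) * (1 + ?z) powr (- 2 * rho - 1 - 1) * (0 + xi1 x / (2 * ?z))) * (xi1 x / ?z))) (at x)"
 unfolding beta_def[abs_def] by (intro DERIV_cmult DERIV_mult d2 DERIV_chain2[OF has_real_derivative_powr[OF z(1)] d1])
 moreover have "B * k ^ 3 * ((xi1 x * l x * ?z - xi1 x * (xi1 x / (2 * ?z))) / (?z * ?z) * (1 + ?z) powr (- 2 * rho - 1)
 + ((- 2 * rho - 1) * (1 + ?z) powr (- 2 * rho - 1 - 1) * (0 + xi1 x / (2 * ?z))) * (xi1 x / ?z)) = beta' k x"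
 proof -
 have pw: "(1 + ?z) powr (- 2 * rho - 1 - 1) = (1 + ?z) powr (- 2 * rho - 1) / (1 + ?z)" by (subst powr_diff) (use z in simp)
 have "((X * L * z - X * (X / (2 * z))) / (z * z) * P + ((- 2 * r - 1) * (P / (1 + z)) * (0 + X / (2 * z))) * (X / z))
 = X / z * P * (L - X / (2 * z\<^sup>2) - (2 * r + 1) * X / (2 * z * (1 + z)))" if "0 < z" for X L z P r :: real
 proof -
 have "0 < 1 + z" using that by simp
 then have "1 + z ~= 0" by simp
 with that show ?thesis by (simp add: divide_simps power2_eq_square) algebra
 qed
 from this[OF z(2)] show ?thesis unfolding pw beta'_def beta_def by (simp only: mult.assoc)
 qed
 ultimately show ?thesis by simp
qed

text \<open>A budget for the logarithmic slope c X z / k^3 of the ansatz. One half of it covers |p|.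
  The other half has to cover the growth of \<open>beta\<close>, at rate K X z / k, and the
  \<open>l\<close> term in \<open>Y1\<close>, at half that rate; this is the condition 3 K k^2 <=
  \<open>airy_slope\<close>.\<close>

lemma key_inequality:
 assumes x: "x0 <= x" and k: "0 < k" "k <= 1" "3 * K * k\<^sup>2 <= airy_slope"
 shows "beta' k x * Y k x + \<bar>p x\<bar> * Y k x <= - Y1 k x * beta k x" and "Y1 k x <= 0"
proof -
 have x1x: "x1 <= x" using x x1_less_x0 by simp
 define z where "z = zeta k x"
 define X where "X = xi1 x"
 define c where "c = airy_slope"
 define b where "b = beta k x"
 have z: "0 < z" unfolding z_def using zeta_pos[OF x k(1)] .
 have X: "0 < X" unfolding X_def using xi1_pos[OF x1x] .
 have c: "0 < c" unfolding c_def by (rule airy_slope)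
 have b: "0 <= b" unfolding b_def by (rule beta_nonneg[OF x k(1)])
 have xi: "0 <= xi x" using x by (rule xi_nonneg)
 have z2: "z\<^sup>2 = k\<^sup>2 + xi x" unfolding z_def zeta_def using xi by simp
 have k2: "k\<^sup>2 <= 1" using k by (simp add: power_le_one)
 \<comment> \<open>Since k <= 1, k^2 (1 + xi) <= k^2 + xi = z^2. This makes the bound on
   \<open>l\<close> smaller than the slope by a factor k^2.\<close>
 have sq: "sqrt (1 + xi x) <= z / k"
 proof (rule real_le_lsqrt)
 have "(1 + xi x) * k\<^sup>2 <= z\<^sup>2" unfolding z2 using k2 xi by (simp add: algebra_simps mult_left_le)
 then show "1 + xi x <= (z / k)\<^sup>2" using k(1) by (simp add: power_divide field_simps)
 qed (use xi z k in auto)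
 have lb: "\<bar>l x\<bar> <= K * X * (z / k)" using l_right[OF x] mult_left_mono[OF sq, of "K * X"] K_pos X unfolding X_def by simp
 have b'le: "beta' k x <= b * (K * X * (z / k))"
 unfolding beta'_def b_def[symmetric] z_def[symmetric] X_def[symmetric]
 proof (intro mult_left_mono b)
 have "0 <= X / (2 * z\<^sup>2)" "0 <= (2 * rho + 1) * X / (2 * z * (1 + z))" using X z rho by auto
 then show "l x - X / (2 * z\<^sup>2) - (2 * rho + 1) * X / (2 * z * (1 + z)) <= K * X * (z / k)" using lb by linarith
 qed
 have slope: "(c * X * z / k ^ 3 - K * X * (z / k) / 2) * Y k x <= - Y1 k x"
 proof -
 have sg: "0 <= sig k x" unfolding sig_def using xi by simp
 have a: "0 < Airy_Ai (sig k x)" by (rule Airy_Ai_pos[OF sg])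
 have "1 + sig k x = z\<^sup>2 / k\<^sup>2" unfolding z2 sig_def using k by (simp add: field_simps)
 then have s1: "sqrt (1 + sig k x) = z / k" using z k by (simp add: real_sqrt_divide)
 have "c * (z / k) * Airy_Ai (sig k x) <= - Airy_Ai' (sig k x)" using airy_slope(2)[OF sg] unfolding s1 c_def .
 then have "c * (z / k) * Airy_Ai (sig k x) * (X / k\<^sup>2) <= - Airy_Ai' (sig k x) * (X / k\<^sup>2)" using X by (intro mult_right_mono) auto
 moreover have "- (K * X * (z / k) / 2) * Airy_Ai (sig k x) <= l x / 2 * Airy_Ai (sig k x)" using lb a by (intro mult_right_mono) auto
 ultimately have "(c * (z / k) * (X / k\<^sup>2) - K * X * (z / k) / 2) * Airy_Ai (sig k x)
 <= - (Airy_Ai' (sig k x) * (X / k\<^sup>2) - l x / 2 * Airy_Ai (sig k x))"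
 proof -
 have "P * a * d <= - M * d ==> - R * a <= L ==> (P * d - R) * a <= - (M * d - L)" for P a d M R L :: real by (simp add: algebra_simps)
 then show ?thesis using \<open>_ <= - Airy_Ai' (sig k x) * (X / k\<^sup>2)\<close> \<open>_ <= l x / 2 * Airy_Ai (sig k x)\<close> by blast
 qed
 moreover have "c * (z / k) * (X / k\<^sup>2) = c * X * z / k ^ 3" by (simp add: power2_eq_square power3_eq_cube mult_ac)
 ultimately have "(c * X * z / k ^ 3 - K * X * (z / k) / 2) * Airy_Ai (sig k x) / sqrt X
 <= - (Airy_Ai' (sig k x) * (X / k\<^sup>2) - l x / 2 * Airy_Ai (sig k x)) / sqrt X" using X by (intro divide_right_mono) auto
 then show ?thesis unfolding Y_def Y1_def X_def by (simp only: times_divide_eq_right minus_divide_left)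
 qed
 have pb: "\<bar>p x\<bar> <= c / 2 / k ^ 3 * X * z * b"
 proof -
 have "1 + z <= 2 * sqrt (1 + xi x)"
 proof -
 have "z <= sqrt (1 + xi x)" unfolding z_def zeta_def using k2 by simp
 moreover have "1 <= sqrt (1 + xi x)" using xi by simp
 ultimately show ?thesis by linarith
 qed
 then have "(1 + z)\<^sup>2 <= (2 * sqrt (1 + xi x))\<^sup>2" using z by (intro power_mono) auto
 then have "(1 + z)\<^sup>2 <= 4 * (1 + xi x)" using xi by (simp add: power_mult_distrib)
 then have "((1 + z)\<^sup>2) powr (rho + 1/2) <= (4 * (1 + xi x)) powr (rho + 1/2)" using rho by (intro powr_mono2) auto
 moreover have "((1 + z)\<^sup>2) powr (rho + 1/2) = (1 + z) powr (2 * rho + 1)" using z by (simp add: powr_powr algebra_simps flip: powr_numeral)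
 moreover have "(4 * (1 + xi x)) powr (rho + 1/2) = 4 powr (rho + 1/2) * (1 + xi x) powr (rho + 1/2)" by (rule powr_mult)
 ultimately have "(1 + z) powr (2 * rho + 1) <= 4 powr (rho + 1/2) * (1 + xi x) powr (rho + 1/2)" by simp
 moreover have "0 < (1 + xi x) powr (rho + 1/2)" "0 < (1 + z) powr (2 * rho + 1)" using xi z by auto
 ultimately have "1 / (1 + xi x) powr (rho + 1/2) <= 4 powr (rho + 1/2) / (1 + z) powr (2 * rho + 1)" by (simp add: field_simps)
 then have pw: "(1 + xi x) powr (- rho - 1/2) <= 4 powr (rho + 1/2) * (1 + z) powr (- 2 * rho - 1)"
 proof -
 have "- rho - 1/2 = - (rho + 1/2)" "- 2 * rho - 1 = - (2 * rho + 1)" by auto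
 then show ?thesis using \<open>1 / _ <= _\<close> by (simp only: powr_minus inverse_eq_divide times_divide_eq_right mult_1_right)
 qed
 have "\<bar>p x\<bar> <= K * X\<^sup>2 * (1 + xi x) powr (- rho - 1/2)"
 unfolding p_def X_def using p_right[OF x] .
 also have "... <= K * X\<^sup>2 * (4 powr (rho + 1/2) * (1 + z) powr (- 2 * rho - 1))" using pw K_pos by (intro mult_left_mono) auto
 also have "... = c / 2 / k ^ 3 * X * z * b"
 unfolding b_def beta_def B_def c_def[symmetric] z_def[symmetric] X_def[symmetric] using k c z by (simp add: field_simps power2_eq_square)
 finally show ?thesis .
 qed
 have coef: "b * (K * X * (z / k)) + c / 2 / k ^ 3 * X * z * b <= (c * X * z / k ^ 3 - K * X * (z / k) / 2) * b"
 proof -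
 have "3 * K * k\<^sup>2 * (X * z * b) <= c * (X * z * b)" using k(3) X z b unfolding c_def by (intro mult_right_mono) auto
 then have "3 * K * k\<^sup>2 * (X * z * b) / (2 * k ^ 3) <= c * (X * z * b) / (2 * k ^ 3)" using k by (intro divide_right_mono) auto
 moreover have "3 * K * k\<^sup>2 * (X * z * b) / (2 * k ^ 3) = 3/2 * (K * (X * z * b) / k)" using k by (simp add: power2_eq_square power3_eq_cube)
 moreover have "b * (K * X * (z / k)) = K * (X * z * b) / k" "c / 2 / k ^ 3 * X * z * b = c * (X * z * b) / (2 * k ^ 3)"
 "(c * X * z / k ^ 3 - K * X * (z / k) / 2) * b = 2 * (c * (X * z * b) / (2 * k ^ 3)) - 1/2 * (K * (X * z * b) / k)"
 by (auto simp: left_diff_distrib)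
 moreover have "A <= D ==> A = 3/2 * E ==> L1 = E ==> L2 = D ==> R = 2 * D - 1/2 * E ==> L1 + L2 <= R" for A D E L1 L2 R :: real by linarith
 ultimately show ?thesis by blast
 qed
 have Yp: "0 < Y k x" by (rule Y_pos[OF x k(1)])
 have "beta' k x * Y k x + \<bar>p x\<bar> * Y k x <= (b * (K * X * (z / k)) + c / 2 / k ^ 3 * X * z * b) * Y k x"
 using b'le pb Yp unfolding distrib_right by (intro add_mono mult_right_mono) auto
 also have "... <= ((c * X * z / k ^ 3 - K * X * (z / k) / 2) * b) * Y k x" using coef Yp by (intro mult_right_mono) auto
 also have "... = ((c * X * z / k ^ 3 - K * X * (z / k) / 2) * Y k x) * b" by simp
 also have "... <= - Y1 k x * b" using slope b by (intro mult_right_mono) auto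
 finally show "beta' k x * Y k x + \<bar>p x\<bar> * Y k x <= - Y1 k x * beta k x" unfolding b_def .
 have "K * k\<^sup>2 / 2 <= c"
 proof -
 have "0 <= K * k\<^sup>2" using K_pos by simp
 moreover have "3 * (K * k\<^sup>2) <= c" using k(3) unfolding c_def by simp
 ultimately show ?thesis by linarith
 qed
 then have "0 <= (c - K * k\<^sup>2 / 2) * (X * z / k ^ 3) * Y k x" using X z k Yp by simp
 also have "(c - K * k\<^sup>2 / 2) * (X * z / k ^ 3) = c * X * z / k ^ 3 - K * X * (z / k) / 2"
 using k by (simp add: field_simps power2_eq_square power3_eq_cube)
 finally show "Y1 k x <= 0" using slope by linarith
qed

end

lemma abs_exp_minus_one_le: "\<bar>t\<bar> <= 1 ==> \<bar>exp t - 1\<bar> <= 2 * \<bar>t\<bar>" for t :: real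
proof -
 assume t: "\<bar>t\<bar> <= 1"
 have "1 + t <= exp t" by (rule exp_ge_add_one_self)
 moreover have "exp t <= 1 + 2 * \<bar>t\<bar>"
 proof (cases "0 <= t")
 case True
 have "t\<^sup>2 <= t" using True t by (simp add: power2_eq_square mult_left_le)
 then show ?thesis using exp_bound[of t] True t by linarith
 next
 case False
 then have "exp t <= 1" by simp
 then show ?thesis by linarith
 qed
 ultimately show ?thesis by linarith
qed

context langer
begin

lemma Gam_tendsto_0:
 assumes "0 < k" shows "(Gam k \<longlongrightarrow> 0) at_top"
proof -
 have z: "filterlim (%x. 1 + zeta k x) at_top at_top"
 unfolding zeta_def by (intro filterlim_tendsto_add_at_top[OF tendsto_const] filterlim_compose[OF sqrt_at_top] xi_at_top)
 have "((%x. (1 + zeta k x) powr (- 2 * rho)) \<longlongrightarrow> 0) at_top" using rho by (intro tendsto_neg_powr z) auto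
 then show ?thesis unfolding Gam_def[abs_def] by (rule tendsto_mult_right_zero)
qed

lemma Gam_le:
 assumes "x0 <= x" "0 < k" shows "Gam k x <= B * k ^ 3 / rho * (1 + xi x) powr (- rho)"
proof -
 have xi: "0 <= xi x" using assms by (simp add: xi_nonneg)
 have z: "0 < zeta k x" by (rule zeta_pos[OF assms])
 have "(zeta k x)\<^sup>2 = k\<^sup>2 + xi x" unfolding zeta_def using xi by simp
 then have "1 + xi x <= (1 + zeta k x)\<^sup>2" using z zero_le_power2[of k] by (simp add: power2_sum)
 then have "((1 + zeta k x)\<^sup>2) powr (- rho) <= (1 + xi x) powr (- rho)" using rho xi by (intro powr_mono2') auto
 moreover have "((1 + zeta k x)\<^sup>2) powr (- rho) = (1 + zeta k x) powr (- 2 * rho)" using z by (simp add: powr_powr flip: powr_numeral)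
 ultimately show ?thesis unfolding Gam_def using B_pos rho assms by (intro mult_left_mono) auto
qed

lemma Gam_le_1:
 assumes "x0 <= x" "0 < k" "B * k ^ 3 <= rho" shows "Gam k x <= 1"
proof -
 have "(1 + zeta k x) powr (- 2 * rho) <= 1" using powr_mono[of "- 2 * rho" 0 "1 + zeta k x"] zeta_pos[OF assms(1,2)] rho by simp
 moreover have "0 <= B * k ^ 3 / rho" "B * k ^ 3 / rho <= 1" using assms B_pos rho by (auto simp: field_simps)
 ultimately show ?thesis unfolding Gam_def using mult_mono[of "B * k ^ 3 / rho" 1 "(1 + zeta k x) powr (- 2 * rho)" 1] by simp
qed

text \<open>The logarithm of \<psi> / Y has derivative Wronskian / (\<psi> Y), which
  \<open>beta\<close> bounds; so it converges with error \<open>Gam\<close>. The Wronskian at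
  \<open>x0\<close> is kept because the estimate on the other side starts from it.\<close>

lemma right_asymptotics:
 assumes k: "0 < k" "k <= 1" "3 * K * k\<^sup>2 <= airy_slope" "B * k ^ 3 <= rho"
 and \<psi>: "!!x. x0 <= x ==> (\<psi> has_real_derivative \<psi>1 x) (at x)"
 and \<psi>1: "!!x. x0 <= x ==> (\<psi>1 has_real_derivative Q x / k ^ 6 * \<psi> x) (at x)"
 and pos: "!!x. x0 <= x ==> 0 < \<psi> x" and dec: "!!x. x0 <= x ==> \<psi>1 x <= 0"
 obtains c where "0 < c" "((%x. \<psi> x / Y k x) \<longlongrightarrow> c) at_top"
 "!!x. x0 <= x ==> \<bar>\<psi> x / (c * Y k x) - 1\<bar> <= 2 * Gam k x"
 "\<bar>\<psi>1 x0 * Y k x0 - \<psi> x0 * Y1 k x0\<bar> <= beta k x0 * (\<psi> x0 * Y k x0)"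
proof -
 have x1: "x1 <= x" if "x0 <= x" for x using that x1_less_x0 by simp
 have \<psi>bd: "\<psi> x <= \<psi> x0" if "x0 <= x" for x
 by (rule DERIV_nonpos_mono[where f = \<psi> and f' = \<psi>1]) (use that \<psi> dec in auto)
 have Ybd: "Y k x <= Y k x0" if "x0 <= x" for x by (rule DERIV_nonpos_mono[where f = "Y k" and f' = "Y1 k"])
 (use that Y_deriv x1 key_inequality(2)[OF _ k(1,2,3)] in auto)
 have W: "\<bar>\<psi>1 x * Y k x - \<psi> x * Y1 k x\<bar> <= beta k x * (\<psi> x * Y k x)" if "x0 <= x" for x
 proof (rule wronskian_comparison[where y = "Y k" and ?y1.0 = "Y1 k" and \<psi> = \<psi> and ?\<psi>1.0 = \<psi>1 and \<beta> = "beta k" and a = x0 and \<beta>' = "beta' k" and p = p and Q = "%x. Q x / k ^ 6" and My = "Y k x0" and M\<psi> = "\<psi> x0"])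
 fix x assume x: "x0 <= x"
 show "(Y k has_real_derivative Y1 k x) (at x)" by (rule Y_deriv[OF x1[OF x]])
 show "(Y1 k has_real_derivative (Q x / k ^ 6 + p x) * Y k x) (at x)" by (rule Y1_deriv[OF x1[OF x] k(1)])
 show "beta' k x * Y k x + \<bar>p x\<bar> * Y k x <= - Y1 k x * beta k x" by (rule key_inequality(1)[OF x k(1,2,3)])
 qed (use \<psi> \<psi>1 pos dec \<psi>bd Ybd Y_pos k beta_deriv beta_nonneg that in auto)
 let ?L = "%x. ln (\<psi> x / Y k x)"
 let ?L' = "%x. (\<psi>1 x * Y k x - \<psi> x * Y1 k x) / (\<psi> x * Y k x)"
 have L: "(?L has_real_derivative ?L' x) (at x)" if "x0 <= x" for x
 proof -
 have p: "0 < \<psi> x" "0 < Y k x" using pos Y_pos k that by auto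
 have d: "((%x. \<psi> x / Y k x) has_real_derivative (\<psi>1 x * Y k x - \<psi> x * Y1 k x) / (Y k x * Y k x)) (at x)"
 using p by (intro DERIV_divide \<psi>[OF that] Y_deriv x1[OF that]) auto
 have "(?L has_real_derivative 1 / (\<psi> x / Y k x) * ((\<psi>1 x * Y k x - \<psi> x * Y1 k x) / (Y k x * Y k x))) (at x)"
 using p by (intro DERIV_chain2[OF DERIV_ln_divide d]) auto
 moreover have "1 / (a / b) * (w / (b * b)) = w / (a * b)" if "0 < a" "0 < b" for a b w :: real using that by (simp add: field_simps)
 ultimately show ?thesis using p by simp
 qed
 have L'le: "\<bar>?L' x\<bar> <= beta k x" if "x0 <= x" for x
 proof -
 have "0 < \<psi> x * Y k x" using pos Y_pos k that by simp
 then show ?thesis using W[OF that] by (simp add: pos_divide_le_eq abs_divide)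
 qed
 obtain m where m: "(?L \<longlongrightarrow> m) at_top" "!!x. x0 <= x ==> \<bar>?L x - m\<bar> <= Gam k x"
 using convergence_by_majorant[OF L Gam_deriv[OF _ k(1)] L'le Gam_tendsto_0[OF k(1)]] by blast
 have e: "exp (?L x) = \<psi> x / Y k x" if "x0 <= x" for x using pos Y_pos k that by (intro exp_ln) auto
 show ?thesis
 proof (rule that[of "exp m"])
 show "0 < exp m" by simp
 have "\<forall>\<^sub>F x in at_top. exp (?L x) = \<psi> x / Y k x" using e by (auto simp: eventually_at_top_linorder)
 then show "((%x. \<psi> x / Y k x) \<longlongrightarrow> exp m) at_top" by (rule Lim_transform_eventually[OF tendsto_exp[OF m(1)]])
 show "\<bar>\<psi>1 x0 * Y k x0 - \<psi> x0 * Y1 k x0\<bar> <= beta k x0 * (\<psi> x0 * Y k x0)" by (rule W) simp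
 fix x assume x: "x0 <= x"
 have "\<bar>?L x - m\<bar> <= 1" using m(2)[OF x] Gam_le_1[OF x k(1,4)] by linarith
 then have "\<bar>exp (?L x - m) - 1\<bar> <= 2 * \<bar>?L x - m\<bar>" by (rule abs_exp_minus_one_le)
 also have "exp (?L x - m) = \<psi> x / (exp m * Y k x)"
 unfolding exp_diff e[OF x] by (simp add: mult.commute)
 also have "2 * \<bar>?L x - m\<bar> <= 2 * Gam k x" using m(2)[OF x] by simp
 finally show "\<bar>\<psi> x / (exp m * Y k x) - 1\<bar> <= 2 * Gam k x" .
 qed
qed

end

section \<open>The oscillatory side by an energy estimate\<close>

definition airy_M :: real where
 "airy_M = (SOME M. M > 0 & (\<forall>s\<le>0. Ai_energy s <= M & \<bar>Ai_energy s - 1 / pi\<bar> <= M * (1 - s) powr (-1/2)))"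

lemma airy_M: "0 < airy_M" "s <= 0 ==> Ai_energy s <= airy_M"
 "s <= 0 ==> \<bar>Ai_energy s - 1 / pi\<bar> <= airy_M * (1 - s) powr (-1/2)"
proof -
 have "\<exists>M. M > 0 & (\<forall>s\<le>0. Ai_energy s <= M & \<bar>Ai_energy s - 1 / pi\<bar> <= M * (1 - s) powr (-1/2))"
 using Ai_energy_limit by blast
 from someI_ex[OF this, folded airy_M_def]
 show "0 < airy_M" "s <= 0 ==> Ai_energy s <= airy_M"
 "s <= 0 ==> \<bar>Ai_energy s - 1 / pi\<bar> <= airy_M * (1 - s) powr (-1/2)" by auto
qed

lemma Ai_energy0_le: "s <= 0 ==> airy_energy0 s (Airy_Ai s) (Airy_Ai' s) <= 4/3 * airy_M"
 using airy_energy_equiv(1)[of s "Airy_Ai s" "Airy_Ai' s"] airy_M(2)[of s] by linarith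

text \<open>Young's inequality replaces \<open>sqrt E\<close> by an affine function of \<open>E\<close>, which makes Gronwall's
 argument linear.\<close>

lemma young_sqrt:
 fixes A E k :: real
 assumes "0 <= A" "0 <= E" "0 < k"
 shows "sqrt A * sqrt E <= (A * k ^ 3 + E / k ^ 3) / 2"
proof -
 have "0 <= (sqrt (A * k ^ 3) - sqrt (E / k ^ 3))\<^sup>2" by simp
 also have "... = A * k ^ 3 + E / k ^ 3 - 2 * (sqrt (A * k ^ 3) * sqrt (E / k ^ 3))" using assms by (simp add: power2_diff)
 also have "sqrt (A * k ^ 3) * sqrt (E / k ^ 3) = sqrt A * sqrt E" using assms by (simp flip: real_sqrt_mult)
 finally show ?thesis by simp
qed

text \<open>\<open>w\<close> is the difference from a reference solution \<open>a\<close>, so the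
  perturbation acts on a + w. The target size of the energy is k^6, that is h^2; Young's inequality
  with that scaling turns the source of size k^4 into the rate k / weight acting on the energy plus
  A k^6.\<close>

lemma airy_energy_rate_gronwall:
 assumes s: "s <= 0" and k: "0 < k" "k <= 1" and R: "\<bar>R\<bar> <= N * k ^ 4" and N: "0 <= N"
 and A: "a\<^sup>2 <= A / airy_weight s" "0 <= A"
 shows "\<bar>airy_energy_rate s (R * (a + w)) w w1\<bar> <=
 (6 * (1 - s) powr (-3/2) + 10 * N * k * (1 - s) powr (-1/2)) * (airy_energy s w w1 + A * k ^ 6)"
proof -
 define e where "e = airy_weight s"
 define E where "E = airy_energy0 s w w1"
 have e: "0 < e" unfolding e_def by (rule airy_weight_pos)
 have E: "0 <= E" unfolding E_def by (rule airy_energy0_nonneg)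
 have a: "\<bar>a\<bar> <= sqrt A / sqrt e" using A unfolding e_def[symmetric] by (metis real_sqrt_abs real_sqrt_divide real_sqrt_le_iff)
 have w: "\<bar>w\<bar> <= sqrt E / sqrt e" using airy_energy0_w[of w s w1] unfolding e_def[symmetric] E_def[symmetric]
 by (metis real_sqrt_abs real_sqrt_divide real_sqrt_le_iff)
 have "\<bar>R * (a + w)\<bar> * (5/2 * sqrt (E / e)) <= N * k ^ 4 * (sqrt A / sqrt e + sqrt E / sqrt e) * (5/2 * (sqrt E / sqrt e))"
 unfolding abs_mult real_sqrt_divide using a w R N k e E by (intro mult_right_mono mult_mono) auto
 also have "... = 5/2 * N * (1 / e) * (k ^ 4 * (sqrt A * sqrt E + E))"
 proof -
 have "n * (b / r + c / r) * (5/2 * (c / r)) = 5/2 * n * (1 / (r * r)) * (b * c + c * c)" if "0 < r" for n b c r :: real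
 using that by (simp add: field_simps)
 from this[of "sqrt e" "N * k ^ 4" "sqrt A" "sqrt E"] show ?thesis using e E by simp
 qed
 also have "... <= 5/2 * N * (1 / e) * (3/2 * k * (E + A * k ^ 6))"
 proof (intro mult_left_mono)
 have "k ^ 4 * (sqrt A * sqrt E) <= k ^ 4 * ((A * k ^ 3 + E / k ^ 3) / 2)" using young_sqrt[OF A(2) E k(1)] k by (intro mult_left_mono) auto
 also have "... = k * (A * k ^ 6 + E) / 2" using k by (simp add: field_simps eval_nat_numeral)
 finally have 1: "k ^ 4 * (sqrt A * sqrt E) <= k * (A * k ^ 6 + E) / 2" .
 have "k ^ 4 <= k ^ 1" using k by (intro power_decreasing) auto
 then have "k ^ 4 * E <= k * E" using E by (intro mult_right_mono) auto
 moreover have "0 <= k * (A * k ^ 6)" using A k by simp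
 ultimately show "k ^ 4 * (sqrt A * sqrt E + E) <= 3/2 * k * (E + A * k ^ 6)" using 1 by (simp add: algebra_simps)
 qed (use N e in auto)
 finally have F: "\<bar>R * (a + w)\<bar> * (5/2 * sqrt (E / e)) <= 15/4 * N * k * (1 / e) * (E + A * k ^ 6)" by (simp add: mult_ac)
 have Ak: "0 <= A * k ^ 6" using A k by simp
 have "\<bar>airy_energy_rate s (R * (a + w)) w w1\<bar> <= 9/4 * (1 / e ^ 3) * E + 15/4 * N * k * (1 / e) * (E + A * k ^ 6)"
 using airy_energy_rate_bound[OF s, of "R * (a + w)" w w1] F unfolding e_def[symmetric] E_def[symmetric] by simp
 also have "... <= 9/4 * (2 * (1 - s) powr (-3/2)) * (E + A * k ^ 6) + 15/4 * N * k * (2 * (1 - s) powr (-1/2)) * (E + A * k ^ 6)"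
 using airy_weight_decay[OF s] e E Ak N k unfolding e_def[symmetric] by (intro add_mono mult_mono mult_right_mono mult_left_mono) auto
 also have "... = (9/2 * (1 - s) powr (-3/2) + 15/2 * N * k * (1 - s) powr (-1/2)) * (E + A * k ^ 6)" by (simp add: algebra_simps)
 also have "... <= (9/2 * (1 - s) powr (-3/2) + 15/2 * N * k * (1 - s) powr (-1/2)) * (4/3 * (airy_energy s w w1 + A * k ^ 6))"
 proof (rule mult_left_mono)
 show "E + A * k ^ 6 <= 4/3 * (airy_energy s w w1 + A * k ^ 6)" using airy_energy_equiv(1)[of s w w1] Ak unfolding E_def by (simp add: algebra_simps)
 qed (use N k in auto)
 also have "... = (6 * (1 - s) powr (-3/2) + 10 * N * k * (1 - s) powr (-1/2)) * (airy_energy s w w1 + A * k ^ 6)" by (simp add: algebra_simps)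
 finally show ?thesis .
qed

text \<open>A primitive of that rate. Its second term is not bounded at minus infinity, but it
  carries a factor k while the range of \<open>sig k\<close> has length of order k^(-2), so the
  exponent varies by a bounded amount only.\<close>

definition gronwall_exponent :: "real => real => real => real" where
 "gronwall_exponent N k s = 12 * (1 - s) powr (-1/2) - 20 * N * k * (1 - s) powr (1/2)"

lemma gronwall_exponent_deriv:
 "s <= 0 ==> (gronwall_exponent N k has_real_derivative
 6 * (1 - s) powr (-3/2) + 10 * N * k * (1 - s) powr (-1/2)) (at s)"
 unfolding gronwall_exponent_def[abs_def] by (auto intro!: derivative_eq_intros)

context langer
begin

text \<open>In the variable \<open>sig k\<close> the equation reads W'' = (sig + R) W, where
  \<open>W1\<close> is the derivative with respect to that variable and \<open>R\<close> is of order
  k^4.\<close>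

definition W :: "(real => real) => real => real" where
 "W u x = sqrt (xi1 x) * u x"

definition W1 :: "real => (real => real) => (real => real) => real => real" where
 "W1 k u u1 x = k\<^sup>2 * (u1 x + l x / 2 * u x) / sqrt (xi1 x)"

definition R :: "real => real => real" where "R k x = - p x * k ^ 4 / (xi1 x)\<^sup>2"

lemma W_deriv:
 assumes x: "x1 <= x" and k: "0 < k" and u: "(u has_real_derivative u1 x) (at x)"
 shows "(W u has_real_derivative (xi1 x / k\<^sup>2) * W1 k u u1 x) (at x)"
proof -
 let ?r = "sqrt (xi1 x)"
 have r: "0 < ?r" "?r * ?r = xi1 x" using xi1_pos[OF x] by auto
 have "(W u has_real_derivative ?r * l x / 2 * u x + u1 x * ?r) (at x)"
 unfolding W_def[abs_def] by (intro DERIV_mult sqrt_xi1_deriv x u)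
 moreover have "r * L / 2 * v + v1 * r = (r * r / k\<^sup>2) * (k\<^sup>2 * (v1 + L / 2 * v) / r)" if "0 < r" for r L v v1 :: real
 using that k by (simp add: field_simps)
 from this[OF r(1)] have "?r * l x / 2 * u x + u1 x * ?r = (xi1 x / k\<^sup>2) * W1 k u u1 x"
 unfolding W1_def r(2) .
 ultimately show ?thesis by simp
qed

lemma W1_deriv:
 assumes x: "x1 <= x" and k: "0 < k" and u: "(u has_real_derivative u1 x) (at x)"
 and u1: "(u1 has_real_derivative Q x / k ^ 6 * u x) (at x)"
 shows "(W1 k u u1 has_real_derivative (xi1 x / k\<^sup>2) * (sig k x * W u x + R k x * W u x)) (at x)"
proof -
 let ?r = "sqrt (xi1 x)"
 have r: "0 < ?r" "?r * ?r = xi1 x" using xi1_pos[OF x] by auto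
 let ?N' = "k\<^sup>2 * (Q x / k ^ 6 * u x + (l1 x / 2 * u x + u1 x * (l x / 2)))"
 have "(W1 k u u1 has_real_derivative (?N' * ?r - k\<^sup>2 * (u1 x + l x / 2 * u x) * (?r * l x / 2)) / (?r * ?r)) (at x)"
 unfolding W1_def[abs_def] using r by (intro DERIV_divide DERIV_cmult DERIV_add DERIV_mult DERIV_cdivide sqrt_xi1_deriv x u u1 l) auto
 moreover have "(?N' * ?r - k\<^sup>2 * (u1 x + l x / 2 * u x) * (?r * l x / 2)) / (?r * ?r)
 = (xi1 x / k\<^sup>2) * (sig k x * W u x + R k x * W u x)"
 proof -
 have "(k\<^sup>2 * (S * (r * r)\<^sup>2 / k ^ 6 * v + (L1 / 2 * v + v1 * (L / 2))) * r - k\<^sup>2 * (v1 + L / 2 * v) * (r * L / 2)) / (r * r)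
 = (r * r / k\<^sup>2) * (S / k\<^sup>2 * (r * v) + (- (L\<^sup>2 / 4 - L1 / 2) * k ^ 4 / (r * r)\<^sup>2) * (r * v))"
 if "0 < r" for S r v L1 v1 L :: real using that k by (simp add: field_simps power2_eq_square eval_nat_numeral)
 from this[OF r(1), of "xi x" "u x" "l1 x" "u1 x" "l x"] show ?thesis
 unfolding W_def R_def p_def sig_def Q_eq[OF x] r(2) by simp
 qed
 ultimately show ?thesis by simp
qed

lemma R_bound:
 assumes x: "x1 <= x" "x <= x0" shows "\<bar>R k x\<bar> <= K ^ 4 * k ^ 4"
proof -
 have b: "\<bar>l x\<bar> <= K" "\<bar>l1 x\<bar> <= K" "1 / K <= xi1 x"
 proof -
 have "0 < 1 / K" using K_pos by simp
 then show "\<bar>l x\<bar> <= K" "\<bar>l1 x\<bar> <= K" "1 / K <= xi1 x" using left[OF x] xi1_near[of x] x by linarith+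
 qed
 have "(l x)\<^sup>2 <= K\<^sup>2" using b K_pos by (simp add: abs_le_square_iff[symmetric])
 moreover have "K <= K\<^sup>2" using K by (simp add: power2_eq_square)
 ultimately have p: "\<bar>p x\<bar> <= K\<^sup>2" unfolding p_def using b zero_le_power2[of "l x"] by linarith
 have "1 / (xi1 x)\<^sup>2 <= 1 / (1 / K)\<^sup>2" using b K_pos by (intro divide_left_mono power_mono mult_pos_pos) auto
 then have "1 / (xi1 x)\<^sup>2 <= K\<^sup>2" by (simp add: power_divide)
 then have "\<bar>p x\<bar> * (1 / (xi1 x)\<^sup>2) * k ^ 4 <= K\<^sup>2 * K\<^sup>2 * k ^ 4" using p by (intro mult_mono mult_right_mono) auto
 then show ?thesis unfolding R_def by (simp add: abs_mult power_even_abs flip: power_add)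
qed

lemma xi_left_bounds:
 assumes x: "x1 <= x" "x <= x0" shows "(x0 - x) / K <= - xi x" "- xi x <= K\<^sup>2"
proof -
 have b: "1 / K <= xi1 t & xi1 t <= K" if "x <= t" "t <= x0" for t using xi1_near[of t] that x K_pos by (smt (verit) divide_pos_pos)
 have "xi x - x / K <= xi x0 - x0 / K" by (rule DERIV_nonneg_mono[where f = "%x. xi x - x / K" and f' = "%x. xi1 x - 1 / K"])
 (use x b in \<open>auto intro!: DERIV_diff xi DERIV_cdivide DERIV_ident\<close>)
 then show "(x0 - x) / K <= - xi x" using xi_x0 by (simp add: diff_divide_distrib)
 have "xi x0 - K * x0 <= xi x - K * x" by (rule DERIV_nonpos_mono[where f = "%x. xi x - K * x" and f' = "%x. xi1 x - K * 1"])
 (use x b in \<open>auto intro!: DERIV_diff xi DERIV_cmult DERIV_ident\<close>)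
 then have "- xi x <= K * (x0 - x)" using xi_x0 by (simp add: algebra_simps)
 also have "... <= K * K" using x x1_x0 K_pos by (intro mult_left_mono) auto
 finally show "- xi x <= K\<^sup>2" by (simp add: power2_eq_square)
qed

lemma sig_nonpos: "x1 <= x ==> x <= x0 ==> sig k x <= 0"
 unfolding sig_def using xi_nonpos[of x] by (simp add: divide_nonpos_nonneg)

text \<open>\<open>G\<close> measures how well \<open>u\<close> agrees with the comparison function \<open>Y\<close> at the turning point.\<close>

definition init_const :: "real => real" where
 "init_const G = 5/4 * (G\<^sup>2 * ((2 * Airy_Ai 0 + \<bar>Airy_Ai' 0\<bar>)\<^sup>2 + (Airy_Ai 0)\<^sup>2)) + 4/3 * airy_M"

text \<open>40 K^5 is the variation of the second term of the Gronwall exponent for N = K^4, using k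
  sqrt (1 - sig) <= 2 K; 12 is that of the first. The factor 4/3 returns from
  \<open>airy_energy\<close> to \<open>airy_energy0\<close>.\<close>

definition D :: "real => real" where
 "D G = 4/3 * (init_const G * exp (12 + 40 * K ^ 5))"

lemma D_pos: "0 < D G"
proof -
 have "0 <= 5/4 * (G\<^sup>2 * ((2 * Airy_Ai 0 + \<bar>Airy_Ai' 0\<bar>)\<^sup>2 + (Airy_Ai 0)\<^sup>2))" by simp
 then have "0 < init_const G" unfolding init_const_def using airy_M(1) by linarith
 then show ?thesis unfolding D_def by simp
qed

lemma init_energy:
 assumes k: "0 < k" "k <= 1" and G: "0 <= G" "G * k ^ 3 <= 1"
 and u0: "\<bar>u x0 / Y k x0 - 1\<bar> <= G * k ^ 3"
 and u1: "\<bar>u1 x0 * Y k x0 - u x0 * Y1 k x0\<bar> <= G * k\<^sup>2 * xi1 x0 * (u x0 * Y k x0)"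
 shows "airy_energy0 0 (W u x0 - Airy_Ai 0) (W1 k u u1 x0 - Airy_Ai' 0)
 <= G\<^sup>2 * ((2 * Airy_Ai 0 + \<bar>Airy_Ai' 0\<bar>)\<^sup>2 + (Airy_Ai 0)\<^sup>2) * k ^ 6"
proof -
 define a a1 w w1 where "a = Airy_Ai 0" and "a1 = Airy_Ai' 0" and "w = W u x0" and "w1 = W1 k u u1 x0"
 let ?r = "sqrt (xi1 x0)"
 have a: "0 < a" unfolding a_def by (rule Airy_Ai_pos) simp
 have r: "0 < ?r" "?r * ?r = xi1 x0" using xi1_pos[of x0] x1_less_x0 by auto
 have s0: "sig k x0 = 0" unfolding sig_def xi_x0 by simp
 have Y: "Y k x0 = a / ?r" unfolding Y_def s0 a_def ..
 have Y1: "Y1 k x0 = (a1 * (?r * ?r / k\<^sup>2) - l x0 / 2 * a) / ?r" unfolding Y1_def s0 a_def a1_def r(2) ..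
 have w: "w = ?r * u x0" unfolding w_def W_def ..
 have w1: "w1 = k\<^sup>2 * (u1 x0 + l x0 / 2 * u x0) / ?r" unfolding w1_def W1_def ..
 have "u x0 / Y k x0 = w / a" unfolding Y w using r a by (simp add: field_simps)
 then have "\<bar>w / a - 1\<bar> * a <= G * k ^ 3 * a" using u0 a by (intro mult_right_mono) auto
 then have wa: "\<bar>w - a\<bar> <= G * k ^ 3 * a" using a by (simp add: abs_if field_simps split: if_splits)
 have "G * k ^ 3 * a <= 1 * a" using G a by (intro mult_right_mono) auto
 then have w2: "0 <= w" "w <= 2 * a" using wa a by linarith+
 \<comment> \<open>The Wronskian is invariant under the change of variables up to the factor k^2.
   Together with the bound on the values it determines the derivative, because Ai(0) is
   positive.\<close>
 have "w1 * a - w * a1 = k\<^sup>2 * (u1 x0 * Y k x0 - u x0 * Y1 k x0)"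
 proof -
 have "k\<^sup>2 * (v1 + L / 2 * v) / r * a - r * v * a1 = k\<^sup>2 * (v1 * (a / r) - v * ((a1 * (r * r / k\<^sup>2) - L / 2 * a) / r))"
 if "0 < r" for r v v1 L :: real using that k by (simp add: field_simps)
 from this[OF r(1)] show ?thesis unfolding Y Y1 w w1 .
 qed
 then have "\<bar>w1 * a - w * a1\<bar> = k\<^sup>2 * \<bar>u1 x0 * Y k x0 - u x0 * Y1 k x0\<bar>" by (simp add: abs_mult)
 also have "... <= k\<^sup>2 * (G * k\<^sup>2 * xi1 x0 * (u x0 * Y k x0))" using u1 by (intro mult_left_mono) auto
 also have "... = G * k ^ 4 * (w * a)"
 proof -
 have "k\<^sup>2 * (G * k\<^sup>2 * (r * r) * (v * (a / r))) = G * k ^ 4 * (r * v * a)" if "0 < r" for r v :: real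
 using that by (simp add: field_simps eval_nat_numeral)
 from this[OF r(1)] show ?thesis unfolding Y w r(2) .
 qed
 also have "... <= G * k ^ 3 * (2 * a * a)" using G k w2 a by (intro mult_mono mult_left_mono mult_right_mono power_decreasing) auto
 finally have Wr: "\<bar>w1 * a - w * a1\<bar> <= G * k ^ 3 * (2 * a * a)" .
 have "\<bar>(w1 - a1) * a\<bar> = \<bar>(w1 * a - w * a1) + (w - a) * a1\<bar>" by (simp add: algebra_simps)
 also have "... <= G * k ^ 3 * (2 * a * a) + (G * k ^ 3 * a) * \<bar>a1\<bar>"
 using Wr wa by (intro order_trans[OF abs_triangle_ineq] add_mono) (auto simp: abs_mult intro: mult_right_mono)
 also have "... = (G * k ^ 3 * (2 * a + \<bar>a1\<bar>)) * a" by (simp add: algebra_simps)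
 finally have d1: "\<bar>w1 - a1\<bar> <= G * k ^ 3 * (2 * a + \<bar>a1\<bar>)" using a by (simp add: abs_mult)
 have e0: "airy_weight 0 = 1" unfolding airy_weight_def by simp
 have "(w1 - a1)\<^sup>2 <= (G * k ^ 3 * (2 * a + \<bar>a1\<bar>))\<^sup>2" using power_mono[OF d1, of 2] by simp
 moreover have "(w - a)\<^sup>2 <= (G * k ^ 3 * a)\<^sup>2" using power_mono[OF wa, of 2] by simp
 ultimately have "(w1 - a1)\<^sup>2 + (w - a)\<^sup>2 <= (G * k ^ 3 * (2 * a + \<bar>a1\<bar>))\<^sup>2 + (G * k ^ 3 * a)\<^sup>2" by (rule add_mono)
 also have "... = G\<^sup>2 * ((2 * a + \<bar>a1\<bar>)\<^sup>2 + a\<^sup>2) * k ^ 6"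
 proof -
 have "(c * b)\<^sup>2 + (c * d)\<^sup>2 = c\<^sup>2 * (b\<^sup>2 + d\<^sup>2)" for b c d :: real by (simp add: power_mult_distrib distrib_left)
 moreover have "(G * k ^ 3)\<^sup>2 * S = G\<^sup>2 * S * k ^ 6" for S by (simp add: power_mult_distrib flip: power_mult)
 ultimately show ?thesis by (simp only:)
 qed
 finally show ?thesis unfolding airy_energy0_def e0 a_def a1_def w_def w1_def by simp
qed

text \<open>The solution is compared with Ai, not with zero: the difference obeys the Airy equation
  with source R (Ai + difference), and its energy at the turning point is of order k^6.\<close>

lemma left_energy:
 assumes k: "0 < k" "k <= 1" and G: "0 <= G" "G * k ^ 3 <= 1"
 and u: "!!x. x1 <= x ==> x <= x0 ==> (u has_real_derivative u1 x) (at x)"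
 and u1: "!!x. x1 <= x ==> x <= x0 ==> (u1 has_real_derivative Q x / k ^ 6 * u x) (at x)"
 and i0: "\<bar>u x0 / Y k x0 - 1\<bar> <= G * k ^ 3"
 and i1: "\<bar>u1 x0 * Y k x0 - u x0 * Y1 k x0\<bar> <= G * k\<^sup>2 * xi1 x0 * (u x0 * Y k x0)"
 and x: "x1 <= x" "x <= x0"
 shows "airy_energy0 (sig k x) (W u x - Airy_Ai (sig k x)) (W1 k u u1 x - Airy_Ai' (sig k x)) <= D G * k ^ 6"
proof -
 let ?d = "%x. W u x - Airy_Ai (sig k x)"
 let ?d1 = "%x. W1 k u u1 x - Airy_Ai' (sig k x)"
 let ?F = "%x. R k x * (Airy_Ai (sig k x) + ?d x)"
 define A where "A = 4/3 * airy_M"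
 have A: "0 < A" unfolding A_def using airy_M(1) by simp
 have Ak: "0 <= A * k ^ 6" using A k by simp
 define E where "E = (%x. airy_energy (sig k x) (?d x) (?d1 x))"
 define r where "r = (%x. airy_energy_rate (sig k x) (?F x) (?d x) (?d1 x))"
 define g where "g = gronwall_exponent (K ^ 4) k"
 define g' where "g' = (%s. 6 * (1 - s) powr (-3/2) + 10 * K ^ 4 * k * (1 - s) powr (-1/2))"
 have E0: "0 <= E x" for x unfolding E_def by (rule airy_energy_nonneg)
 have dE: "(E has_real_derivative (xi1 t / k\<^sup>2) * r t) (at t)" if t: "x1 <= t" "t <= x0" for t
 unfolding E_def r_def
 proof (rule airy_energy_deriv[OF sig_deriv[OF t(1)]])
 have "(?d has_real_derivative (xi1 t / k\<^sup>2) * W1 k u u1 t - Airy_Ai' (sig k t) * (xi1 t / k\<^sup>2)) (at t)"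
 by (intro DERIV_diff W_deriv Ai_sig_deriv t u k)
 then show "(?d has_real_derivative (xi1 t / k\<^sup>2) * ?d1 t) (at t)" by (simp add: algebra_simps)
 have "(?d1 has_real_derivative (xi1 t / k\<^sup>2) * (sig k t * W u t + R k t * W u t) - sig k t * Airy_Ai (sig k t) * (xi1 t / k\<^sup>2)) (at t)"
 by (intro DERIV_diff W1_deriv Ai'_sig_deriv t u u1 k)
 then show "(?d1 has_real_derivative (xi1 t / k\<^sup>2) * (sig k t * ?d t + ?F t)) (at t)" by (simp add: algebra_simps)
 qed
 have rb: "\<bar>r t\<bar> <= g' (sig k t) * (E t + A * k ^ 6)" if t: "x1 <= t" "t <= x0" for t
 unfolding r_def E_def g'_def
 proof (rule airy_energy_rate_gronwall[OF sig_nonpos[OF t] k R_bound[OF t]])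
 show "(Airy_Ai (sig k t))\<^sup>2 <= A / airy_weight (sig k t)"
 proof (rule order_trans[OF airy_energy0_w[of _ _ "Airy_Ai' (sig k t)"]])
 show "airy_energy0 (sig k t) (Airy_Ai (sig k t)) (Airy_Ai' (sig k t)) / airy_weight (sig k t) <= A / airy_weight (sig k t)"
 using Ai_energy0_le[OF sig_nonpos[OF t]] airy_weight_pos unfolding A_def by (intro divide_right_mono) (auto intro: less_imp_le)
 qed
 qed (use A K_pos in auto)
 let ?f = "%t. (E t + A * k ^ 6) * exp (g (sig k t))"
 \<comment> \<open>Gronwall's inequality from the turning point leftwards. Shifting the energy by A
   k^6 absorbs the inhomogeneous part of the rate.\<close>
 have "?f x <= ?f x0"
 proof (rule DERIV_nonneg_mono[where f = ?f and f' = "%t. (xi1 t / k\<^sup>2) * (r t + g' (sig k t) * (E t + A * k ^ 6)) * exp (g (sig k t))"])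
 fix t assume "t \<in> {x..x0}"
 then have t: "x1 <= t" "t <= x0" using x by auto
 have "((%t. exp (g (sig k t))) has_real_derivative exp (g (sig k t)) * (g' (sig k t) * (xi1 t / k\<^sup>2))) (at t)"
 unfolding g_def g'_def by (intro DERIV_chain2[OF DERIV_exp] DERIV_chain2[OF gronwall_exponent_deriv] sig_deriv sig_nonpos t)
 then have "(?f has_real_derivative ((xi1 t / k\<^sup>2) * r t + 0) * exp (g (sig k t))
 + (exp (g (sig k t)) * (g' (sig k t) * (xi1 t / k\<^sup>2))) * (E t + A * k ^ 6)) (at t)" by (intro DERIV_mult DERIV_add DERIV_const dE t)
 moreover have "(d * r + 0) * e + (e * (b * d)) * S = d * (r + b * S) * e" for d r e b S :: real by (simp add: algebra_simps)
 ultimately show "(?f has_real_derivative (xi1 t / k\<^sup>2) * (r t + g' (sig k t) * (E t + A * k ^ 6)) * exp (g (sig k t))) (at t)" by (simp only:)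
 show "0 <= (xi1 t / k\<^sup>2) * (r t + g' (sig k t) * (E t + A * k ^ 6)) * exp (g (sig k t))"
 using rb[OF t] xi1_pos[OF t(1)] by (intro mult_nonneg_nonneg) auto
 qed (use x in auto)
 then have "(E x + A * k ^ 6) <= (E x0 + A * k ^ 6) * exp (g (sig k x0) - g (sig k x))" by (simp add: exp_diff field_simps)
 also have "... <= (init_const G * k ^ 6) * exp (12 + 40 * K ^ 5)"
 proof (intro mult_mono)
 have "E x0 <= 5/4 * (G\<^sup>2 * ((2 * Airy_Ai 0 + \<bar>Airy_Ai' 0\<bar>)\<^sup>2 + (Airy_Ai 0)\<^sup>2) * k ^ 6)"
 using init_energy[where u = u and ?u1.0 = u1, OF k G i0 i1] airy_energy_equiv(2)[of 0 "W u x0 - Airy_Ai 0" "W1 k u u1 x0 - Airy_Ai' 0"]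
 unfolding E_def by (simp add: sig_def xi_x0)
 then show "E x0 + A * k ^ 6 <= init_const G * k ^ 6"
 unfolding init_const_def A_def by (simp add: algebra_simps)
 have s0: "sig k x0 = 0" unfolding sig_def xi_x0 by simp
 have sx: "sig k x <= 0" by (rule sig_nonpos[OF x])
 have "g (sig k x0) - g (sig k x) <= 12 + 20 * K ^ 4 * (k * (1 - sig k x) powr (1/2))"
 unfolding g_def gronwall_exponent_def s0 using k K_pos by (simp add: algebra_simps)
 also have "k * (1 - sig k x) powr (1/2) = sqrt (k\<^sup>2 - xi x)"
 proof -
 have "k * sqrt (1 - sig k x) = sqrt (k\<^sup>2 * (1 - sig k x))" using k by (simp add: real_sqrt_mult)
 also have "k\<^sup>2 * (1 - sig k x) = k\<^sup>2 - xi x" unfolding sig_def using k by (simp add: algebra_simps)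
 finally show ?thesis using sx by (simp add: powr_half_sqrt)
 qed
 also have "sqrt (k\<^sup>2 - xi x) <= 2 * K"
 proof (rule real_le_lsqrt)
 have "k\<^sup>2 <= 1\<^sup>2" using k by (intro power_mono) auto
 moreover have "1\<^sup>2 <= K\<^sup>2" using K by (intro power_mono) auto
 ultimately show "k\<^sup>2 - xi x <= (2 * K)\<^sup>2" using xi_left_bounds(2)[OF x] by (simp add: power_mult_distrib)
 qed (use K_pos in auto)
 finally show "exp (g (sig k x0) - g (sig k x)) <= exp (12 + 40 * K ^ 5)" using K_pos by (simp add: eval_nat_numeral mult_ac)
 show "0 <= init_const G * k ^ 6" using D_pos[of G] k unfolding D_def by (simp add: zero_less_mult_iff)
 qed auto
 finally have "E x <= (init_const G * k ^ 6) * exp (12 + 40 * K ^ 5)" using Ak by linarith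
 then show ?thesis using airy_energy_equiv(1)[of "sig k x" "?d x" "?d1 x"] unfolding E_def D_def by (simp add: mult_ac)
qed

end

definition airy_R :: real where
 "airy_R = (SOME C. C > 0 & (\<forall>x\<ge>0. Airy_Ai x * (1 + x) powr (1/4) <= C))"

lemma airy_R: "0 < airy_R" "0 <= x ==> Airy_Ai x * (1 + x) powr (1/4) <= airy_R"
proof -
 have "\<exists>C. C > 0 & (\<forall>x\<ge>0. Airy_Ai x * (1 + x) powr (1/4) <= C)" using Airy_Ai_bound_right by blast
 from someI_ex[OF this, folded airy_R_def]
 show "0 < airy_R" "0 <= x ==> Airy_Ai x * (1 + x) powr (1/4) <= airy_R" by auto
qed

lemma airy_weight_le: "s <= 0 ==> airy_weight s <= sqrt (1 - s)"
proof (rule real_le_rsqrt)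
 assume s: "s <= 0"
 show "(airy_weight s)\<^sup>2 <= 1 - s"
 proof (rule power2_le_imp_le)
 have "((airy_weight s)\<^sup>2)\<^sup>2 = airy_weight s ^ 4" by (simp flip: power_mult)
 also have "... <= (1 - s)\<^sup>2" using s by (simp add: airy_weight_power4 power2_diff)
 finally show "((airy_weight s)\<^sup>2)\<^sup>2 <= (1 - s)\<^sup>2" .
 qed (use s in auto)
qed

lemma airy_weight_gap: "s <= 0 ==> 0 <= airy_weight s ^ 2 + s & airy_weight s ^ 2 + s <= 1"
proof -
 assume s: "s <= 0"
 have "(airy_weight s ^ 2 + s) * 1 <= (airy_weight s ^ 2 + s) * (airy_weight s ^ 2 - s)"
 using abs_le_airy_weight[of s] s one_le_power[OF airy_weight_ge_1, of s 2] by (intro mult_left_mono) auto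
 also have "... = airy_weight s ^ 4 - s\<^sup>2" by (simp add: algebra_simps eval_nat_numeral)
 also have "... = 1" by (simp add: airy_weight_power4)
 finally show ?thesis using abs_le_airy_weight[of s] s by auto
qed

lemma airy_energy0_add: "airy_energy0 s (a + d) (a1 + d1) <= 2 * airy_energy0 s a a1 + 2 * airy_energy0 s d d1"
proof -
 have sq: "(x + y)\<^sup>2 <= 2 * x\<^sup>2 + 2 * y\<^sup>2" for x y :: real using zero_le_power2[of "x - y"] by (simp add: power2_sum power2_diff)
 have "(a1 + d1)\<^sup>2 / airy_weight s <= (2 * a1\<^sup>2 + 2 * d1\<^sup>2) / airy_weight s"
 "airy_weight s * (a + d)\<^sup>2 <= airy_weight s * (2 * a\<^sup>2 + 2 * d\<^sup>2)"
 using sq airy_weight_pos[of s] by (auto intro!: divide_right_mono mult_left_mono)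
 then show ?thesis unfolding airy_energy0_def by (simp add: algebra_simps add_divide_distrib)
qed

text \<open>Along w'' = s w its derivative is exactly - w^2, which makes it the tool for computing
  mass.\<close>

definition airy_action :: "real => real => real => real" where
 "airy_action s w w1 = w1\<^sup>2 - s * w\<^sup>2"

text \<open>Three bounded errors: action against weight times energy; energy against 1/pi, where the
  rate (1 - s)^(-1/2) exactly compensates the growth of the weight; weight against sqrt (-
  s).\<close>

lemma Ai_action:
 assumes s: "s <= 0"
 shows "\<bar>airy_action s (Airy_Ai s) (Airy_Ai' s) - sqrt (- s) / pi\<bar> <= 4 * airy_M + 1"
proof -
 define e a a1 E where "e = airy_weight s" and "a = Airy_Ai s" and "a1 = Airy_Ai' s" and "E = airy_energy s a a1"
 have e: "1 <= e" "0 < e" unfolding e_def using airy_weight_ge_1 airy_weight_pos by auto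
 have E0: "airy_energy0 s a a1 <= 4/3 * airy_M" unfolding a_def a1_def by (rule Ai_energy0_le[OF s])
 have "a\<^sup>2 <= (4/3 * airy_M) / e" using airy_energy0_w[of a s a1] divide_right_mono[OF E0, of e] e unfolding e_def by linarith
 also have "... <= 4/3 * airy_M" using e airy_M(1) by (simp add: field_simps)
 finally have a2: "a\<^sup>2 <= 4/3 * airy_M" .
 have aa: "\<bar>a * a1\<bar> <= 2/3 * airy_M" using airy_energy0_mult[of a a1 s] E0 by linarith
 have eq: "airy_action s a a1 - e * E = - (e\<^sup>2 + s) * a\<^sup>2 - s / (2 * e ^ 4) * (a * a1)"
 unfolding airy_action_def E_def airy_energy_def airy_energy0_def e_def[symmetric] using e by (simp add: field_simps eval_nat_numeral)
 have "\<bar>(e\<^sup>2 + s) * a\<^sup>2\<bar> <= 1 * (4/3 * airy_M)"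
 using airy_weight_gap[OF s] a2 unfolding e_def[symmetric] abs_mult by (intro mult_mono) auto
 moreover have "\<bar>s / (2 * e ^ 4) * (a * a1)\<bar> <= 1/2 * (2/3 * airy_M)"
 proof -
 have "\<bar>s\<bar> <= e ^ 4" using abs_le_airy_weight[of s] power_increasing[of 2 4 e] e unfolding e_def by linarith
 then have "\<bar>s / (2 * e ^ 4)\<bar> <= 1/2" using e by (simp add: field_simps)
 then show ?thesis unfolding abs_mult[of "s / (2 * e ^ 4)"] using aa by (intro mult_mono) auto
 qed
 ultimately have 1: "\<bar>airy_action s a a1 - e * E\<bar> <= 2 * airy_M" unfolding eq using airy_M(1) by linarith
 have ele: "e <= sqrt (1 - s)" unfolding e_def by (rule airy_weight_le[OF s])
 have "e * E - e / pi = e * (E - 1 / pi)" by (simp add: right_diff_distrib)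
 then have "\<bar>e * E - e / pi\<bar> = e * \<bar>E - 1 / pi\<bar>" using e by (simp add: abs_mult)
 also have "... <= sqrt (1 - s) * (airy_M * (1 - s) powr (-1/2))"
 using ele airy_M(3)[OF s] e airy_M(1) s unfolding E_def a_def a1_def by (intro mult_mono) auto
 also have "... = airy_M" using s by (simp add: powr_minus powr_half_sqrt)
 finally have 2: "\<bar>e * E - e / pi\<bar> <= airy_M" .
 have "sqrt (1 - s) <= 1 + sqrt (- s)" using s by (intro real_le_lsqrt) (auto simp: power2_sum)
 moreover have "sqrt (- s) <= e" using abs_le_airy_weight[of s] e s unfolding e_def by (intro real_le_lsqrt) auto
 ultimately have "\<bar>e - sqrt (- s)\<bar> <= 1" using ele by linarith
 then have "\<bar>e - sqrt (- s)\<bar> / pi <= 1 / 1" using pi_ge_two by (intro frac_le) auto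
 then have 3: "\<bar>e / pi - sqrt (- s) / pi\<bar> <= 1" by (simp add: abs_divide flip: diff_divide_distrib)
 show ?thesis using 1 2 3 airy_M(1) unfolding a_def a1_def by linarith
qed

lemma airy_action_diff:
 assumes s: "s <= 0"
 shows "\<bar>airy_action s (a + d) (a1 + d1) - airy_action s a a1\<bar> <=
 airy_weight s * (2 * airy_energy0 s d d1 + 4 * sqrt (airy_energy0 s d d1 * airy_energy0 s a a1))"
proof -
 define e where "e = airy_weight s"
 define Ed where "Ed = airy_energy0 s d d1"
 define Ea where "Ea = airy_energy0 s a a1"
 have e: "0 < e" unfolding e_def by (rule airy_weight_pos)
 have nn: "0 <= Ed" "0 <= Ea" unfolding Ed_def Ea_def by (auto intro: airy_energy0_nonneg)
 have d1: "d1\<^sup>2 <= Ed * e" and a1: "a1\<^sup>2 <= Ea * e" and d: "d\<^sup>2 <= Ed / e" and a: "a\<^sup>2 <= Ea / e"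
 unfolding Ed_def Ea_def e_def by (auto intro: airy_energy0_w airy_energy0_w1)
 have "(\<bar>d1\<bar> * \<bar>a1\<bar>)\<^sup>2 <= (Ed * e) * (Ea * e)"
 unfolding power_mult_distrib using d1 a1 nn e by (intro mult_mono) auto
 also have "... = (e * sqrt (Ed * Ea))\<^sup>2" using nn e by (simp add: power_mult_distrib) (simp add: power2_eq_square)
 finally have da1: "\<bar>d1\<bar> * \<bar>a1\<bar> <= e * sqrt (Ed * Ea)" by (rule power2_le_imp_le) (use e nn in auto)
 have "(\<bar>d\<bar> * \<bar>a\<bar>)\<^sup>2 <= (Ed / e) * (Ea / e)"
 unfolding power_mult_distrib using d a nn e by (intro mult_mono) auto
 also have "... = (sqrt (Ed * Ea) / e)\<^sup>2" using nn e by (simp add: power_divide) (simp add: power2_eq_square)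
 finally have da: "\<bar>d\<bar> * \<bar>a\<bar> <= sqrt (Ed * Ea) / e" by (rule power2_le_imp_le) (use e nn in auto)
 have se: "\<bar>s\<bar> <= e\<^sup>2" unfolding e_def by (rule abs_le_airy_weight)
 have "airy_action s (a + d) (a1 + d1) - airy_action s a a1 = (d1\<^sup>2 + 2 * (d1 * a1)) + (- s) * (d\<^sup>2 + 2 * (d * a))"
 unfolding airy_action_def by (simp add: power2_sum algebra_simps)
 also have "\<bar>...\<bar> <= (d1\<^sup>2 + 2 * (\<bar>d1\<bar> * \<bar>a1\<bar>)) + \<bar>s\<bar> * (d\<^sup>2 + 2 * (\<bar>d\<bar> * \<bar>a\<bar>))"
 proof (rule order_trans[OF abs_triangle_ineq add_mono])
 show "\<bar>d1\<^sup>2 + 2 * (d1 * a1)\<bar> <= d1\<^sup>2 + 2 * (\<bar>d1\<bar> * \<bar>a1\<bar>)"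
 by (rule order_trans[OF abs_triangle_ineq]) (simp add: abs_mult)
 have "\<bar>d\<^sup>2 + 2 * (d * a)\<bar> <= d\<^sup>2 + 2 * (\<bar>d\<bar> * \<bar>a\<bar>)"
 by (rule order_trans[OF abs_triangle_ineq]) (simp add: abs_mult)
 then show "\<bar>- s * (d\<^sup>2 + 2 * (d * a))\<bar> <= \<bar>s\<bar> * (d\<^sup>2 + 2 * (\<bar>d\<bar> * \<bar>a\<bar>))"
 unfolding abs_mult[of "- s"] by (simp add: mult_left_mono)
 qed
 also have "... <= (Ed * e + 2 * (e * sqrt (Ed * Ea))) + e\<^sup>2 * (Ed / e + 2 * (sqrt (Ed * Ea) / e))"
 using nn e by (intro add_mono[OF add_mono[OF d1 mult_left_mono[OF da1]] mult_mono[OF se add_mono[OF d mult_left_mono[OF da]]]]) auto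
 also have "... = e * (2 * Ed + 4 * sqrt (Ed * Ea))" using e by (simp add: power2_eq_square algebra_simps)
 finally show ?thesis unfolding e_def Ed_def Ea_def .
qed

section \<open>Pointwise bounds and action of a normalized solution\<close>

text \<open>The hypotheses are what \<open>right_asymptotics\<close> gives after division by its
  limit: closeness to \<open>Y\<close> on the decaying side, and the Wronskian at \<open>x0\<close>
  as initial datum for the other side.\<close>

locale langer_solution = langer +
 fixes k G :: real and u u1 :: "real => real"
 assumes k: "0 < k" "k <= 1" and G: "0 <= G" "G * k ^ 3 <= 1"
 and u: "!!x. x1 <= x ==> (u has_real_derivative u1 x) (at x)"
 and u1: "!!x. x1 <= x ==> (u1 has_real_derivative Q x / k ^ 6 * u x) (at x)"
 and u_Y: "!!x. x0 <= x ==> \<bar>u x / Y k x - 1\<bar> <= G * k ^ 3"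
 and u1_x0: "\<bar>u1 x0 * Y k x0 - u x0 * Y1 k x0\<bar> <= G * k\<^sup>2 * xi1 x0 * (u x0 * Y k x0)"
 and u_dec: "!!x. x0 <= x ==> u1 x <= 0"
begin

definition N :: real where "N = 8/3 * airy_M + 2 * D G"

lemma N_pos: "0 < N" unfolding N_def using airy_M(1) D_pos[of G] by linarith

abbreviation "dW x \<equiv> W u x - Airy_Ai (sig k x)"
abbreviation "dW1 x \<equiv> W1 k u u1 x - Airy_Ai' (sig k x)"

lemma energy_diff:
 assumes x: "x1 <= x" "x <= x0" shows "airy_energy0 (sig k x) (dW x) (dW1 x) <= D G * k ^ 6"
 by (rule left_energy[where u = u and ?u1.0 = u1, OF k G u u1 u_Y u1_x0 x]) auto

lemma k_power_le: "k ^ n <= 1" using k by (simp add: power_le_one)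

lemma energy_W:
 assumes x: "x1 <= x" "x <= x0" shows "airy_energy0 (sig k x) (W u x) (W1 k u u1 x) <= N"
proof -
 have "airy_energy0 (sig k x) (W u x) (W1 k u u1 x) <=
 2 * airy_energy0 (sig k x) (Airy_Ai (sig k x)) (Airy_Ai' (sig k x)) + 2 * airy_energy0 (sig k x) (dW x) (dW1 x)"
 using airy_energy0_add[of "sig k x" "Airy_Ai (sig k x)" "dW x" "Airy_Ai' (sig k x)" "dW1 x"] by simp
 also have "... <= 2 * (4/3 * airy_M) + 2 * (D G * 1)"
 using Ai_energy0_le[OF sig_nonpos[OF x]] order_trans[OF energy_diff[OF x] mult_left_mono[OF k_power_le]] D_pos[of G]
 by (intro add_mono mult_left_mono) auto
 finally show ?thesis unfolding N_def by simp
qed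

lemma WW1_bound: "x1 <= x ==> x <= x0 ==> \<bar>W u x * W1 k u u1 x\<bar> <= N"
 using airy_energy0_mult[of "W u x" "W1 k u u1 x" "sig k x"] energy_W[of x] abs_ge_zero[of "W u x * W1 k u u1 x"] by linarith

lemma W_bound: "x1 <= x ==> x <= x0 ==> (W u x)\<^sup>2 <= N / airy_weight (sig k x)"
 using airy_energy0_w[of "W u x" "sig k x" "W1 k u u1 x"] divide_right_mono[OF energy_W[of x], of "airy_weight (sig k x)"]
 airy_weight_pos[of "sig k x"] by linarith

lemma W_bound': "x1 <= x ==> x <= x0 ==> (W u x)\<^sup>2 <= N"
proof -
 assume x: "x1 <= x" "x <= x0"
 have "N / airy_weight (sig k x) <= N / 1" using N_pos airy_weight_ge_1[of "sig k x"] airy_weight_pos[of "sig k x"] by (intro divide_left_mono) auto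
 then show ?thesis using W_bound[OF x] by simp
qed

lemma xi1_left: "x1 <= x ==> x <= x0 ==> 1 / K <= xi1 x & xi1 x <= K"
proof -
 assume x: "x1 <= x" "x <= x0"
 have "0 < 1 / K" using K_pos by simp
 then show ?thesis using xi1_near[of x] x by linarith
qed

lemma sqrt_xi1_inverse: "x1 <= x ==> x <= x0 + 1 / K ==> 1 / sqrt (xi1 x) <= K"
proof -
 assume x: "x1 <= x" "x <= x0 + 1 / K"
 have p: "0 < xi1 x" using xi1_pos x by simp
 have "1 / xi1 x <= K" using xi1_near[OF x] K_pos p by (simp add: field_simps)
 then have "sqrt (1 / xi1 x) <= sqrt (K\<^sup>2)" using K by (intro real_sqrt_le_mono) (auto simp: power2_eq_square intro: order_trans)
 then show ?thesis using K_pos by (simp add: real_sqrt_divide)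
qed

text \<open>Returns from the Airy scale to the physical one: - xi >= (x0 - x) / K bounds 1 - sig
  from below by (k^2 + |x - x0|) / k^2 up to a factor K.\<close>

lemma weight_inverse:
 assumes x: "x1 <= x" "x <= x0"
 shows "sqrt (1 / airy_weight (sig k x)) <= 2 * K * sqrt k * (k\<^sup>2 + \<bar>x - x0\<bar>) powr (-1/4)"
proof -
 let ?r = "k\<^sup>2 + \<bar>x - x0\<bar>"
 have r: "0 < ?r" using k by (intro add_pos_nonneg) auto
 have "k\<^sup>2 / K <= k\<^sup>2" using mult_right_mono[OF K, of "k\<^sup>2"] K_pos by (simp add: field_simps)
 then have "?r / K <= k\<^sup>2 - xi x" using xi_left_bounds(1)[OF x] x by (simp add: add_divide_distrib)
 then have "?r / K / k\<^sup>2 <= (k\<^sup>2 - xi x) / k\<^sup>2" by (intro divide_right_mono) auto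
 also have "... = 1 - sig k x" unfolding sig_def using k by (simp add: diff_divide_distrib)
 finally have "(1 - sig k x) powr (-1/2) <= (?r / K / k\<^sup>2) powr (-1/2)" using r K_pos k by (intro powr_mono2') auto
 also have "... = K powr (1/2) * k * ?r powr (-1/2)"
 proof -
 have "(k\<^sup>2) powr (-1/2) = 1 / k" using k by (simp add: powr_minus powr_half_sqrt inverse_eq_divide)
 moreover have "(K * k\<^sup>2) powr (1/2) = k * K powr (1/2)" using k K_pos by (simp add: powr_mult powr_half_sqrt)
 ultimately show ?thesis using r K_pos k by (simp add: powr_divide powr_minus field_simps)
 qed
 finally have "1 / airy_weight (sig k x) <= 2 * (K powr (1/2) * k * ?r powr (-1/2))" using airy_weight_decay(2)[OF sig_nonpos[OF x], of k] by linarith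
 also have "... <= 4 * K\<^sup>2 * (k * ?r powr (-1/2))"
 proof -
 have "K powr (1/2) <= K powr 2" using K by (intro powr_mono) auto
 then have "K powr (1/2) <= K\<^sup>2" using K_pos by simp
 then have "2 * K powr (1/2) <= 4 * K\<^sup>2" using zero_le_power2[of K] by linarith
 then have "2 * K powr (1/2) * (k * ?r powr (-1/2)) <= 4 * K\<^sup>2 * (k * ?r powr (-1/2))" using k by (intro mult_right_mono) auto
 then show ?thesis by (simp add: mult.assoc)
 qed
 also have "... = (2 * K * sqrt k * ?r powr (-1/4))\<^sup>2"
 proof -
 have "(?r powr (-1/4))\<^sup>2 = ?r powr (-1/2)" using r by (simp add: powr_powr flip: powr_numeral)
 then show ?thesis using k by (simp add: power_mult_distrib)
 qed
 finally have "sqrt (1 / airy_weight (sig k x)) <= \<bar>2 * K * sqrt k * ?r powr (-1/4)\<bar>" by (metis real_sqrt_abs real_sqrt_le_iff)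
 then show ?thesis using K_pos k by (simp add: abs_mult)
qed

text \<open>k^3 is the square root of the energy bound and sqrt k comes from the weight; together
  they are h to the power 7/6.\<close>

lemma left_error:
 assumes x: "x1 <= x" "x <= x0"
 shows "\<bar>u x - Y k x\<bar> <= 2 * K\<^sup>2 * sqrt (D G) * (k ^ 3 * sqrt k) * (k\<^sup>2 + \<bar>x - x0\<bar>) powr (-1/4)"
proof -
 have r: "0 < sqrt (xi1 x)" using xi1_pos x by simp
 have "(dW x)\<^sup>2 <= D G * k ^ 6 / airy_weight (sig k x)"
 using airy_energy0_w[of "dW x" "sig k x" "dW1 x"] divide_right_mono[OF energy_diff[OF x], of "airy_weight (sig k x)"]
 airy_weight_pos[of "sig k x"] by linarith
 also have "... = D G * (k ^ 3)\<^sup>2 * (1 / airy_weight (sig k x))" by (simp flip: power_mult)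
 finally have "\<bar>dW x\<bar> <= sqrt (D G * (k ^ 3)\<^sup>2 * (1 / airy_weight (sig k x)))" by (intro real_le_rsqrt) simp
 also have "... = sqrt (D G) * k ^ 3 * sqrt (1 / airy_weight (sig k x))" using k by (simp only: real_sqrt_mult real_sqrt_abs) simp
 also have "... <= sqrt (D G) * k ^ 3 * (2 * K * sqrt k * (k\<^sup>2 + \<bar>x - x0\<bar>) powr (-1/4))"
 using D_pos[of G] k by (intro mult_left_mono weight_inverse x) auto
 finally have d: "\<bar>dW x\<bar> <= sqrt (D G) * k ^ 3 * (2 * K * sqrt k * (k\<^sup>2 + \<bar>x - x0\<bar>) powr (-1/4))" .
 have "u x - Y k x = 1 / sqrt (xi1 x) * dW x" unfolding Y_def W_def using r by (simp add: field_simps)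
 then have "\<bar>u x - Y k x\<bar> = 1 / sqrt (xi1 x) * \<bar>dW x\<bar>" using r by (simp add: abs_mult)
 also have "... <= K * (sqrt (D G) * k ^ 3 * (2 * K * sqrt k * (k\<^sup>2 + \<bar>x - x0\<bar>) powr (-1/4)))"
 using d K_pos x by (intro mult_mono sqrt_xi1_inverse) (auto intro: order_trans[of _ x0])
 finally show ?thesis by (simp add: power2_eq_square mult_ac)
qed

text \<open>To the left the energy bounds \<open>W u\<close>; to the right u <= 2 Y together with
  the algebraic bound on Ai suffices, as long as \<open>xi1\<close> is bounded below, which limits
  the range to x0 + 1 / K.\<close>

lemma turning_bound:
 assumes x: "x1 <= x" "x <= x0 + 1 / K"
 shows "\<bar>u x\<bar> <= 2 * K\<^sup>2 * (sqrt N + airy_R) * sqrt k * (k\<^sup>2 + \<bar>x - x0\<bar>) powr (-1/4)"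
proof (cases "x <= x0")
 case True
 have r: "0 < sqrt (xi1 x)" using xi1_pos x by simp
 have "\<bar>W u x\<bar> <= sqrt (N * (1 / airy_weight (sig k x)))" using W_bound[OF x(1) True] by (intro real_le_rsqrt) simp
 also have "... = sqrt N * sqrt (1 / airy_weight (sig k x))" by (rule real_sqrt_mult)
 also have "... <= sqrt N * (2 * K * sqrt k * (k\<^sup>2 + \<bar>x - x0\<bar>) powr (-1/4))"
 using N_pos by (intro mult_left_mono weight_inverse x True) auto
 finally have d: "\<bar>W u x\<bar> <= sqrt N * (2 * K * sqrt k * (k\<^sup>2 + \<bar>x - x0\<bar>) powr (-1/4))" .
 have "\<bar>u x\<bar> = 1 / sqrt (xi1 x) * \<bar>W u x\<bar>" unfolding W_def using r by (simp add: abs_mult)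
 also have "... <= K * (sqrt N * (2 * K * sqrt k * (k\<^sup>2 + \<bar>x - x0\<bar>) powr (-1/4)))"
 using d K_pos x by (intro mult_mono sqrt_xi1_inverse) auto
 also have "... = 2 * K\<^sup>2 * sqrt N * sqrt k * (k\<^sup>2 + \<bar>x - x0\<bar>) powr (-1/4)" by (simp add: power2_eq_square mult_ac)
 also have "... <= 2 * K\<^sup>2 * (sqrt N + airy_R) * sqrt k * (k\<^sup>2 + \<bar>x - x0\<bar>) powr (-1/4)"
 using airy_R(1) k by (intro mult_right_mono mult_left_mono) auto
 finally show ?thesis .
next
 case False
 then have x': "x0 <= x" by simp
 let ?r = "k\<^sup>2 + \<bar>x - x0\<bar>"
 have r: "0 < ?r" using k by (intro add_pos_nonneg) auto
 have Yp: "0 < Y k x" by (rule Y_pos[OF x' k(1)])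
 have "\<bar>u x / Y k x - 1\<bar> <= 1" using u_Y[OF x'] G by linarith
 then have "\<bar>u x / Y k x\<bar> <= 2" by linarith
 then have "\<bar>u x\<bar> <= 2 * Y k x" using Yp by (simp add: abs_divide pos_divide_le_eq)
 also have "... = 2 * (1 / sqrt (xi1 x) * Airy_Ai (sig k x))" unfolding Y_def by simp
 also have "... <= 2 * (K * (airy_R * (K * sqrt k * ?r powr (-1/4))))"
 proof (intro mult_left_mono mult_mono sqrt_xi1_inverse x)
 have s: "0 <= sig k x" unfolding sig_def using xi_nonneg[OF x'] by simp
 have "1 / K <= xi1 t" if "x0 <= t" "t <= x" for t using xi1_near[of t] that x x1_less_x0 by simp
 then have "xi x0 - x0 / K <= xi x - x / K"
 using x1_less_x0 x' by (intro DERIV_nonneg_mono[where f = "%x. xi x - x / K" and f' = "%x. xi1 x - 1 / K"])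
 (auto intro!: DERIV_diff xi DERIV_cdivide DERIV_ident)
 then have xl: "(x - x0) / K <= xi x" using xi_x0 by (simp add: diff_divide_distrib)
 have "k\<^sup>2 / K <= k\<^sup>2" using mult_right_mono[OF K, of "k\<^sup>2"] K_pos by (simp add: field_simps)
 then have "?r / K <= k\<^sup>2 + xi x" using xl x' by (simp add: add_divide_distrib)
 then have "?r / K / k\<^sup>2 <= (k\<^sup>2 + xi x) / k\<^sup>2" by (intro divide_right_mono) auto
 also have "... = 1 + sig k x" unfolding sig_def using k by (simp add: add_divide_distrib)
 finally have "(1 + sig k x) powr (-1/4) <= (?r / K / k\<^sup>2) powr (-1/4)" using r K_pos k by (intro powr_mono2') auto
 also have "... = K powr (1/4) * sqrt k * ?r powr (-1/4)"
 proof -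
 have "(k\<^sup>2) powr (1/4) = sqrt k" using k by (simp add: powr_powr powr_half_sqrt flip: powr_numeral)
 then have "(K * k\<^sup>2) powr (1/4) = sqrt k * K powr (1/4)" by (simp add: powr_mult)
 then show ?thesis using r K_pos k by (simp add: powr_divide powr_minus field_simps)
 qed
 also have "... <= K * sqrt k * ?r powr (-1/4)"
 proof -
 have "K powr (1/4) <= K powr 1" using K by (intro powr_mono) auto
 then show ?thesis using K_pos k by (intro mult_right_mono) auto
 qed
 finally have pw: "(1 + sig k x) powr (-1/4) <= K * sqrt k * ?r powr (-1/4)" .
 have "Airy_Ai (sig k x) * ((1 + sig k x) powr (1/4) * (1 + sig k x) powr (-1/4)) <= airy_R * (1 + sig k x) powr (-1/4)"
 using airy_R(2)[OF s] unfolding mult.assoc[symmetric] by (intro mult_right_mono) auto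
 moreover have "(1 + sig k x) powr (1/4) * (1 + sig k x) powr (-1/4) = 1" using s by (simp flip: powr_add)
 ultimately have "Airy_Ai (sig k x) <= airy_R * (1 + sig k x) powr (-1/4)" by simp
 then show "Airy_Ai (sig k x) <= airy_R * (K * sqrt k * ?r powr (-1/4))" using mult_left_mono[OF pw, of airy_R] airy_R(1) by linarith
 show "0 <= Airy_Ai (sig k x)" using Airy_Ai_pos[OF s] by simp
 qed (use K_pos x x' x1_less_x0 in auto)
 also have "... = 2 * K\<^sup>2 * airy_R * sqrt k * ?r powr (-1/4)" by (simp add: power2_eq_square mult_ac)
 also have "... <= 2 * K\<^sup>2 * (sqrt N + airy_R) * sqrt k * ?r powr (-1/4)" using N_pos k by (intro mult_right_mono mult_left_mono) auto
 finally show ?thesis .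
qed

definition CP :: real where "CP = 4 * airy_M + 1 + 2 * K * (2 * D G + 4 * sqrt (D G * (4/3 * airy_M)))"

lemma CP_nonneg: "0 <= CP"
 unfolding CP_def using airy_M(1) D_pos[of G] K_pos by (intro add_nonneg_nonneg mult_nonneg_nonneg) auto

lemma weight_k:
 assumes x: "x1 <= x" "x <= x0" shows "k * airy_weight (sig k x) <= 2 * K"
proof -
 have "k * airy_weight (sig k x) <= k * sqrt (1 - sig k x)" using airy_weight_le[OF sig_nonpos[OF x]] k by (intro mult_left_mono) auto
 also have "... = sqrt (k\<^sup>2 * (1 - sig k x))" using k by (simp add: real_sqrt_mult)
 also have "k\<^sup>2 * (1 - sig k x) = k\<^sup>2 - xi x" unfolding sig_def using k by (simp add: algebra_simps)
 also have "sqrt (k\<^sup>2 - xi x) <= 2 * K"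
 proof (rule real_le_lsqrt)
 have "k\<^sup>2 <= 1\<^sup>2" using k by (intro power_mono) auto
 moreover have "1\<^sup>2 <= K\<^sup>2" using K by (intro power_mono) auto
 ultimately show "k\<^sup>2 - xi x <= (2 * K)\<^sup>2" using xi_left_bounds(2)[OF x] by (simp add: power_mult_distrib)
 qed (use K_pos in auto)
 finally show ?thesis .
qed

lemma action_bound:
 assumes x: "x1 <= x" "x <= x0"
 shows "\<bar>airy_action (sig k x) (W u x) (W1 k u u1 x) - sqrt (- sig k x) / pi\<bar> <= CP"
proof -
 let ?s = "sig k x"
 have s: "?s <= 0" by (rule sig_nonpos[OF x])
 let ?Ed = "airy_energy0 ?s (dW x) (dW1 x)" and ?Ea = "airy_energy0 ?s (Airy_Ai ?s) (Airy_Ai' ?s)"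
 \<comment> \<open>Only k^2 of the available k^6 is kept. The weight is of order 1 / k, and the
   square root of this bound supplies the compensating factor k.\<close>
 have Ed: "?Ed <= D G * (k\<^sup>2 * 1)"
 using energy_diff[OF x] D_pos[of G] power_decreasing[of 2 6 k] k by (smt (verit) mult.right_neutral mult_left_mono numeral_le_iff semiring_norm(68,69,72,75,76,78))
 have Ed': "?Ed <= D G * k"
 proof -
 have "D G * (k\<^sup>2 * 1) <= D G * k" using D_pos[of G] k by (intro mult_left_mono) (auto simp: power2_eq_square mult_left_le)
 then show ?thesis using Ed by linarith
 qed
 have "?Ed * ?Ea <= D G * (k\<^sup>2 * 1) * (4/3 * airy_M)"
 using Ed Ai_energy0_le[OF s] D_pos[of G] by (intro mult_mono) (auto intro: airy_energy0_nonneg)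
 then have "sqrt (?Ed * ?Ea) <= sqrt (D G * (k\<^sup>2 * 1) * (4/3 * airy_M))" by (rule real_sqrt_le_mono)
 also have "D G * (k\<^sup>2 * 1) * (4/3 * airy_M) = D G * (4/3 * airy_M) * k\<^sup>2" by simp
 also have "sqrt ... = sqrt (D G * (4/3 * airy_M)) * k" using k by (subst real_sqrt_mult) simp
 finally have "2 * ?Ed + 4 * sqrt (?Ed * ?Ea) <= (2 * D G + 4 * sqrt (D G * (4/3 * airy_M))) * k" using Ed' by (simp add: algebra_simps)
 then have "airy_weight ?s * (2 * ?Ed + 4 * sqrt (?Ed * ?Ea)) <= airy_weight ?s * ((2 * D G + 4 * sqrt (D G * (4/3 * airy_M))) * k)"
 using airy_weight_pos[of ?s] by (intro mult_left_mono) auto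
 also have "... = (k * airy_weight ?s) * (2 * D G + 4 * sqrt (D G * (4/3 * airy_M)))" by simp
 also have "... <= 2 * K * (2 * D G + 4 * sqrt (D G * (4/3 * airy_M)))" using D_pos[of G] airy_M(1) by (intro mult_right_mono weight_k x) auto
 finally have "airy_weight ?s * (2 * ?Ed + 4 * sqrt (?Ed * ?Ea)) <= 2 * K * (2 * D G + 4 * sqrt (D G * (4/3 * airy_M)))" .
 with airy_action_diff[OF s, of "Airy_Ai ?s" "dW x" "Airy_Ai' ?s" "dW1 x"] Ai_action[OF s]
 show ?thesis unfolding CP_def by simp linarith?
qed

end

section \<open>Energy at the matching point and mass of the solution\<close>

lemma integral_deriv_within:
 fixes f :: "real => real"
 assumes "continuous_on {a..b} f" "x \<in> {a..b}"
 shows "((%x. integral {a..x} f) has_real_derivative f x) (at x within {a..b})"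
 using integral_has_vector_derivative[OF assms] by (simp add: has_real_derivative_iff_has_vector_derivative)

lemma abs_increment_le:
 fixes f f' :: "real => real"
 assumes "!!x. x \<in> {a..b} ==> (f has_real_derivative f' x) (at x within {a..b})"
 and "!!x. x \<in> {a..b} ==> \<bar>f' x\<bar> <= C" and "a <= b"
 shows "\<bar>f b - f a\<bar> <= C * (b - a)" using field_differentiable_bound[OF convex_real_interval(5) assms(1), of C b a] assms(2,3) by auto

context langer_solution
begin

abbreviation "P x \<equiv> airy_action (sig k x) (W u x) (W1 k u u1 x)"

lemma P_deriv:
 assumes x: "x1 <= x"
 shows "((%x. P x) has_real_derivative (xi1 x / k\<^sup>2) * (2 * R k x * (W u x * W1 k u u1 x) - (W u x)\<^sup>2)) (at x)"
proof -
 note dW = W_deriv[where u = u and ?u1.0 = u1, OF x k(1) u[OF x]]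
 and dW1 = W1_deriv[where u = u and ?u1.0 = u1, OF x k(1) u[OF x] u1[OF x]]
 have "((%x. P x) has_real_derivative
 2 * W1 k u u1 x * ((xi1 x / k\<^sup>2) * (sig k x * W u x + R k x * W u x))
 - ((xi1 x / k\<^sup>2) * (W u x)\<^sup>2 + (2 * W u x * ((xi1 x / k\<^sup>2) * W1 k u u1 x)) * sig k x)) (at x)"
 unfolding airy_action_def by (rule derivative_eq_intros sig_deriv[OF x] dW dW1 refl)+
 (simp add: power2_eq_square algebra_simps)
 then show ?thesis by (rule DERIV_cong) (simp add: algebra_simps)
qed

text \<open>The factor that makes k^2 om P' equal to - u^2, up to the term with \<open>R\<close>.
  The mass is thus accessible by partial integration.\<close>

definition om :: "real => real" where "om x = 1 / (xi1 x)\<^sup>2"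

lemma om_deriv: assumes x: "x1 <= x" shows "(om has_real_derivative - 2 * l x * om x) (at x)"
 unfolding om_def[abs_def] using xi1_pos[OF x] by (auto intro!: derivative_eq_intros xi1[OF x] simp: field_simps power2_eq_square eval_nat_numeral)

lemma om_bound: assumes x: "x1 <= x" "x <= x0" shows "0 <= om x" "om x <= K\<^sup>2"
proof -
 have "1 / (xi1 x)\<^sup>2 <= 1 / (1 / K)\<^sup>2"
 using xi1_left[OF x] K_pos xi1_pos[OF x(1)] by (intro divide_left_mono power_mono mult_pos_pos) auto
 then show "om x <= K\<^sup>2" unfolding om_def by (simp add: power_divide)
qed (simp add: om_def)

definition fs :: "real => real" where "fs x = sqrt (- xi x)"

lemma fs_bound: assumes x: "x1 <= x" "x <= x0" shows "0 <= fs x" "fs x <= K"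
 unfolding fs_def using xi_left_bounds(2)[OF x] xi_nonpos[OF x] K_pos by (auto intro!: real_le_lsqrt)

lemma sqrt_sig: "sqrt (- sig k x) = fs x / k"
proof -
 have "- sig k x = - xi x / k\<^sup>2" unfolding sig_def by simp
 then show ?thesis unfolding fs_def using k by (simp only: real_sqrt_divide) simp
qed

lemma P_bound: "x1 <= x ==> x <= x0 ==> \<bar>k\<^sup>2 * P x - k / pi * fs x\<bar> <= CP * k\<^sup>2"
proof -
 assume x: "x1 <= x" "x <= x0"
 have "k\<^sup>2 * P x - k / pi * fs x = k\<^sup>2 * (P x - sqrt (- sig k x) / pi)"
 unfolding sqrt_sig using k by (simp add: algebra_simps power2_eq_square)
 then have "\<bar>k\<^sup>2 * P x - k / pi * fs x\<bar> = k\<^sup>2 * \<bar>P x - sqrt (- sig k x) / pi\<bar>" by (simp add: abs_mult)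
 also have "... <= k\<^sup>2 * CP" by (intro mult_left_mono action_bound x) auto
 finally show ?thesis by (simp add: mult.commute)
qed

lemma fs_x1: "1 / K <= fs x1"
proof -
 have x: "x1 <= x1" "x1 <= x0" using x1_less_x0 by auto
 have "(1 / K)\<^sup>2 = 1 / K / K" by (simp add: power2_eq_square)
 also have "... <= (x0 - x1) / K" using x1_x0 K_pos by (intro divide_right_mono) auto
 also have "... <= - xi x1" by (rule xi_left_bounds(1)[OF x])
 finally show ?thesis unfolding fs_def by (rule real_le_rsqrt)
qed

definition CE :: real where "CE = K * CP + 2 * K ^ 5 * N"

text \<open>The left side is k^2 P / fs up to cross terms with \<open>l\<close> of order k^4, and
  k^2 P is k fs / pi up to order k^2. Only squares of \<open>u\<close> and of its derivative occur,
  with coefficients depending on \<open>Q x1\<close> alone, so solutions from both sides can be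
  compared in this form.\<close>

lemma energy_at_x1:
 "\<bar>k ^ 6 * (u1 x1)\<^sup>2 / sqrt (- Q x1) + sqrt (- Q x1) * (u x1)\<^sup>2 - k / pi\<bar> <= CE * k\<^sup>2"
proof -
 have x: "x1 <= x1" "x1 <= x0" using x1_less_x0 by auto
 define s r w w1 L where "s = fs x1" and "r = sqrt (xi1 x1)" and "w = W u x1" and "w1 = W1 k u u1 x1" and "L = l x1"
 have s: "0 < s" "1 / s <= K"
 proof -
 have "0 < 1 / K" using K_pos by simp
 then show s0: "0 < s" using fs_x1 unfolding s_def by linarith
 show "1 / s <= K" using fs_x1 s0 K_pos unfolding s_def by (simp add: field_simps)
 qed
 have r: "0 < r" "r\<^sup>2 = xi1 x1" unfolding r_def using xi1_pos[OF x(1)] by auto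
 have r2: "1 / r\<^sup>2 <= K" using xi1_left[OF x] K_pos xi1_pos[OF x(1)] unfolding r(2) by (simp add: field_simps)
 have sQ: "sqrt (- Q x1) = s * r\<^sup>2"
 proof -
 have "- Q x1 = (- xi x1) * (xi1 x1)\<^sup>2" using Q_eq[OF x(1)] by simp
 then have "sqrt (- Q x1) = sqrt (- xi x1) * sqrt ((xi1 x1)\<^sup>2)" by (simp only: real_sqrt_mult)
 then show ?thesis unfolding s_def fs_def r(2) using xi1_pos[OF x(1)] by simp
 qed
 have ux: "u x1 = w / r" unfolding w_def W_def r_def using r(1) unfolding r_def by simp
 have u1x: "u1 x1 = r * w1 / k\<^sup>2 - L * w / (2 * r)"
 proof -
 have "w1 = k\<^sup>2 * (u1 x1 + L / 2 * u x1) / r" unfolding w1_def W1_def L_def r_def ..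
 then show ?thesis unfolding ux using r(1) k by (simp add: field_simps)
 qed
 \<comment> \<open>The terms produced by the summand with \<open>l\<close> when \<open>u1\<close> is
   expressed through \<open>W\<close> and \<open>W1\<close>.\<close>
 define e where "e = (k ^ 6 * (L\<^sup>2 * w\<^sup>2) * (1 / r\<^sup>2)\<^sup>2 / 4 - k ^ 4 * L * (w * w1) * (1 / r\<^sup>2)) * (1 / s)"
 have P: "k\<^sup>2 * P x1 = k\<^sup>2 * w1\<^sup>2 + s\<^sup>2 * w\<^sup>2"
 proof -
 have "s\<^sup>2 = - xi x1" unfolding s_def fs_def using xi_nonpos[OF x] by simp
 then show ?thesis unfolding airy_action_def sig_def w_def w1_def using k by (simp add: field_simps)
 qed
 have "k ^ 6 * (u1 x1)\<^sup>2 / sqrt (- Q x1) + sqrt (- Q x1) * (u x1)\<^sup>2 = k\<^sup>2 * P x1 / s + e"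
 unfolding sQ ux u1x e_def P using r(1) s k by (simp add: field_simps power2_eq_square eval_nat_numeral)
 moreover have "\<bar>k\<^sup>2 * P x1 / s - k / pi\<bar> <= K * CP * k\<^sup>2"
 proof -
 have "\<bar>k\<^sup>2 * P x1 - k / pi * s\<bar> * (1 / s) <= (CP * k\<^sup>2) * K"
 using P_bound[OF x] s CP_nonneg unfolding s_def[symmetric] by (intro mult_mono) auto
 moreover have "\<bar>a - b * s\<bar> * (1 / s) = \<bar>a / s - b\<bar>" for a b :: real
 proof -
 have "a / s - b = (a - b * s) * (1 / s)" using s by (simp add: field_simps)
 then show ?thesis using s by (simp only: abs_mult) simp
 qed
 ultimately have "\<bar>k\<^sup>2 * P x1 / s - k / pi\<bar> <= (CP * k\<^sup>2) * K" by (simp only:)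
 moreover have "(CP * k\<^sup>2) * K = K * CP * k\<^sup>2" by simp
 ultimately show ?thesis by (simp only:)
 qed
 moreover have "\<bar>e\<bar> <= 2 * K ^ 5 * N * k\<^sup>2"
 proof -
 have Lb: "\<bar>L\<bar> <= K" using left[OF x] unfolding L_def by simp
 have L2: "L\<^sup>2 <= K\<^sup>2" using Lb K_pos by (simp add: abs_le_square_iff[symmetric])
 have w2: "w\<^sup>2 <= N" and ww: "\<bar>w * w1\<bar> <= N" unfolding w_def w1_def using W_bound'[OF x] WW1_bound[OF x] by auto
 have k62: "k ^ 6 <= k\<^sup>2" and k42: "k ^ 4 <= k\<^sup>2" using k by (auto intro!: power_decreasing)
 have r2n: "0 <= 1 / r\<^sup>2" by simp
 have "\<bar>k ^ 6 * (L\<^sup>2 * w\<^sup>2) * (1 / r\<^sup>2)\<^sup>2 / 4\<bar> <= k\<^sup>2 * (K\<^sup>2 * N) * K\<^sup>2 / 4"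
 using k62 L2 w2 r2 r2n power_mono[OF r2 r2n, of 2] k N_pos by (auto simp: abs_mult intro!: mult_mono)
 also have "... <= K ^ 4 * N * k\<^sup>2" using N_pos K_pos k by (simp add: eval_nat_numeral)
 finally have a: "\<bar>k ^ 6 * (L\<^sup>2 * w\<^sup>2) * (1 / r\<^sup>2)\<^sup>2 / 4\<bar> <= K ^ 4 * N * k\<^sup>2" .
 have "\<bar>k ^ 4 * L * (w * w1) * (1 / r\<^sup>2)\<bar> = k ^ 4 * \<bar>L\<bar> * \<bar>w * w1\<bar> * (1 / r\<^sup>2)" by (simp add: abs_mult)
 also have "... <= k\<^sup>2 * K * N * K" using k42 Lb ww r2 r2n k N_pos K_pos by (intro mult_mono mult_nonneg_nonneg) auto
 also have "... = K\<^sup>2 * N * k\<^sup>2" by (simp add: power2_eq_square)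
 also have "... <= K ^ 4 * N * k\<^sup>2" using N_pos K by (intro mult_right_mono power_increasing) auto
 finally have b: "\<bar>k ^ 4 * L * (w * w1) * (1 / r\<^sup>2)\<bar> <= K ^ 4 * N * k\<^sup>2" .
 have "\<bar>e\<bar> <= (K ^ 4 * N * k\<^sup>2 + K ^ 4 * N * k\<^sup>2) * K"
 unfolding e_def abs_mult[of _ "1 / s"] using s N_pos K_pos k by (intro mult_mono[OF order_trans[OF abs_triangle_ineq4 add_mono[OF a b]]]) auto
 then show ?thesis by (simp add: eval_nat_numeral mult_ac)
 qed
 ultimately have "\<bar>k ^ 6 * (u1 x1)\<^sup>2 / sqrt (- Q x1) + sqrt (- Q x1) * (u x1)\<^sup>2 - k / pi\<bar> <= K * CP * k\<^sup>2 + 2 * K ^ 5 * N * k\<^sup>2"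
 by linarith
 then show ?thesis unfolding CE_def by (simp add: algebra_simps)
qed

text \<open>\<open>Vint x0\<close> is the integral of \<open>(- Q)\<^sup>-\<^sup>1\<^sup>/\<^sup>2\<close> over \<open>[x1, x0]\<close>, integrated by parts so that the
 singularity at \<open>x0\<close> disappears.\<close>

definition Vint :: "real => real" where
 "Vint x = 2 * om x1 * fs x1 - 2 * om x * fs x + integral {x1..x} (%t. - 4 * l t * om t * fs t)"

lemma cont_basic: "continuous_on {x1..x0} xi" "continuous_on {x1..x0} l" "continuous_on {x1..x0} om" "continuous_on {x1..x0} fs"
proof -
 show xic: "continuous_on {x1..x0} xi" "continuous_on {x1..x0} l" "continuous_on {x1..x0} om"
 by (auto intro!: continuous_at_imp_continuous_on DERIV_isCont[OF xi] DERIV_isCont[OF l] DERIV_isCont[OF om_deriv])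
 show "continuous_on {x1..x0} fs" unfolding fs_def[abs_def] by (intro continuous_intros xic)
qed

lemma cont_integrand: "continuous_on {x1..x0} (%t. - 4 * l t * om t * fs t)" by (intro continuous_intros cont_basic)

lemma Vint_cont: "continuous_on {x1..x0} Vint"
 unfolding Vint_def[abs_def] by (intro continuous_intros cont_basic indefinite_integral_continuous_1 integrable_continuous_real cont_integrand)

lemma Vint_deriv:
 assumes x: "x1 < x" "x < x0"
 shows "(Vint has_real_derivative 1 / (fs x * xi1 x)) (at x)"
proof -
 have x1x: "x1 <= x" "x <= x0" using x by auto
 have "0 < - xi x"
 proof -
 have "0 < (x0 - x) / K" using x K_pos by simp
 then show ?thesis using xi_left_bounds(1)[OF x1x] by linarith
 qed
 then have s: "0 < fs x" unfolding fs_def by simp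
 have dfs: "(fs has_real_derivative - xi1 x / (2 * fs x)) (at x)"
 proof -
 have "((%x. - xi x) has_real_derivative - xi1 x) (at x)" by (intro DERIV_minus xi x1x)
 from DERIV_chain2[OF DERIV_real_sqrt[OF \<open>0 < - xi x\<close>] this]
 moreover have "inverse r / 2 * (- X) = - X / (2 * r)" for r X :: real by (cases "r = 0") (auto simp: field_simps)
 ultimately show ?thesis unfolding fs_def[abs_def] by (simp only:)
 qed
 have "((%x. integral {x1..x} (%t. - 4 * l t * om t * fs t)) has_real_derivative - 4 * l x * om x * fs x) (at x within {x1..x0})"
 using x by (intro integral_deriv_within cont_integrand) auto
 then have I: "((%x. integral {x1..x} (%t. - 4 * l t * om t * fs t)) has_real_derivative - 4 * l x * om x * fs x) (at x)"
 using x by (simp add: at_within_Icc_at)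
 have "((%x. 2 * om x * fs x) has_real_derivative (2 * (- 2 * l x * om x)) * fs x + (- xi1 x / (2 * fs x)) * (2 * om x)) (at x)"
 by (intro DERIV_mult DERIV_cmult om_deriv dfs x1x)
 then have "(Vint has_real_derivative 0 - ((2 * (- 2 * l x * om x)) * fs x + (- xi1 x / (2 * fs x)) * (2 * om x)) + - 4 * l x * om x * fs x) (at x)"
 unfolding Vint_def[abs_def] by (intro DERIV_add DERIV_diff DERIV_const I)
 moreover have "0 - ((2 * (- 2 * l x * om x)) * fs x + (- xi1 x / (2 * fs x)) * (2 * om x)) + - 4 * l x * om x * fs x = 1 / (fs x * xi1 x)"
 unfolding om_def using s xi1_pos[OF x1x(1)] by (simp add: field_simps power2_eq_square)
 ultimately show ?thesis by simp
qed

lemma Q_powr: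
 assumes x: "x1 <= x" "x <= x0" shows "(- Q x) powr (-1/2) = 1 / (fs x * xi1 x)"
proof -
 have "- Q x = (fs x * xi1 x)\<^sup>2" unfolding Q_eq[OF x(1)] fs_def using xi_nonpos[OF x] by (simp add: power_mult_distrib)
 moreover have "0 <= fs x * xi1 x" using fs_bound[OF x] xi1_pos[OF x(1)] by simp
 ultimately show ?thesis by (simp add: powr_minus powr_half_sqrt inverse_eq_divide)
qed

text \<open>The integrand is singular only at \<open>x0\<close>, while its primitive
  \<open>Vint\<close> is continuous there. As the integrand is nonnegative, integrability comes
  together with the value.\<close>

lemma Vint_integral:
 "set_integrable lborel (einterval (ereal x1) (ereal x0)) (%x. (- Q x) powr (-1/2))"
 "(LBINT x=ereal x1..ereal x0. (- Q x) powr (-1/2)) = Vint x0"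
proof -
 let ?f = "%x. (- Q x) powr (-1/2)"
 have Q_cont: "isCont ?f x" if x: "x1 < x" "x < x0" for x
 proof -
 have "isCont (%x. - (xi x * (xi1 x)\<^sup>2)) x" using x by (intro continuous_intros DERIV_isCont[OF xi] DERIV_isCont[OF xi1]) auto
 moreover have "\<forall>\<^sub>F y in nhds x. - (xi y * (xi1 y)\<^sup>2) = - Q y"
 using eventually_nhds_in_open[of "{x1<..}" x] x by (auto elim!: eventually_mono simp: Q_eq)
 ultimately have "isCont (%x. - Q x) x" by (simp only: isCont_cong)
 moreover have "- Q x > 0"
 proof -
 have "0 < (x0 - x) / K" using x K_pos by simp
 then have "xi x < 0" using xi_left_bounds(1)[of x] x by linarith
 then show ?thesis using Q_eq[of x] xi1_pos[of x] x by (simp add: mult_neg_pos)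
 qed
 ultimately show ?thesis unfolding isCont_def by (intro tendsto_powr tendsto_const) auto
 qed
 have lim: "((Vint \<circ> real_of_ereal) \<longlongrightarrow> Vint x1) (at_right (ereal x1))" "((Vint \<circ> real_of_ereal) \<longlongrightarrow> Vint x0) (at_left (ereal x0))"
 using Vint_cont x1_less_x0 unfolding ereal_tendsto_simps by (auto simp: continuous_on_Icc_at_rightD continuous_on_Icc_at_leftD)
 have V1: "Vint x1 = 0" unfolding Vint_def by simp
 have dv: "(Vint has_real_derivative ?f x) (at x)" if "ereal x1 < ereal x" "ereal x < ereal x0" for x using Vint_deriv[of x] Q_powr[of x] that by simp
 note * = interval_integral_FTC_nonneg[OF _ dv Q_cont AE_I2 lim]
 show "set_integrable lborel (einterval (ereal x1) (ereal x0)) ?f" by (rule *) (use x1_less_x0 in auto)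
 have "(LBINT x=ereal x1..ereal x0. ?f x) = Vint x0 - Vint x1" by (rule *) (use x1_less_x0 in auto)
 then show "(LBINT x=ereal x1..ereal x0. ?f x) = Vint x0" unfolding V1 by simp
qed

lemma om'_bound:
 assumes x: "x1 <= x" "x <= x0" shows "\<bar>2 * l x * om x\<bar> <= 2 * K ^ 3"
proof -
 have "\<bar>2 * l x * om x\<bar> = 2 * \<bar>l x\<bar> * om x" using om_bound[OF x] by (simp add: abs_mult)
 also have "... <= 2 * K * K\<^sup>2" using left[OF x] om_bound[OF x] K_pos by (intro mult_mono) auto
 finally show ?thesis by (simp add: power2_eq_square power3_eq_cube mult_ac)
qed

lemma Vint_bounds: "1 / K ^ 3 <= Vint x0" "Vint x0 <= 6 * K ^ 5"
proof -
 have le: "x1 <= x0" using x1_less_x0 by simp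
 have "Vint x1 - x1 / K\<^sup>2 <= Vint x0 - x0 / K\<^sup>2"
 proof (rule DERIV_nonneg_imp_increasing_open[OF le])
 show "continuous_on {x1..x0} (%x. Vint x - x / K\<^sup>2)" using K_pos by (intro continuous_intros Vint_cont) auto
 fix x assume x: "x1 < x" "x < x0"
 then have x': "x1 <= x" "x <= x0" by auto
 have "0 < - xi x"
 proof -
 have "0 < (x0 - x) / K" using x K_pos by simp
 then show ?thesis using xi_left_bounds(1)[OF x'] by linarith
 qed
 then have s: "0 < fs x" unfolding fs_def by simp
 have "fs x * xi1 x <= K * K" using fs_bound[OF x'] xi1_left[OF x'] K_pos xi1_pos[OF x'(1)] by (intro mult_mono) auto
 then have "1 / K\<^sup>2 <= 1 / (fs x * xi1 x)" using s xi1_pos[OF x'(1)] by (simp add: power2_eq_square frac_le)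
 then show "\<exists>y. ((%x. Vint x - x / K\<^sup>2) has_real_derivative y) (at x) & 0 <= y"
 using DERIV_diff[OF Vint_deriv[OF x] DERIV_cdivide[OF DERIV_ident, of "K\<^sup>2"]] by (intro exI conjI) auto
 qed
 moreover have "Vint x1 = 0" unfolding Vint_def by simp
 moreover have "1 / K ^ 3 <= (x0 - x1) / K\<^sup>2"
 using divide_right_mono[OF x1_x0(1), of "K\<^sup>2"] by (simp add: power2_eq_square power3_eq_cube)
 ultimately show "1 / K ^ 3 <= Vint x0" by (simp add: diff_divide_distrib)
 have "\<bar>integral {x1..x0} (%t. - 4 * l t * om t * fs t)\<bar> <= (4 * K ^ 4) * (x0 - x1)"
 proof (rule integral_bound[OF le cont_integrand, simplified real_norm_def])
 fix t assume "t \<in> {x1..x0}"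
 then have t: "x1 <= t" "t <= x0" by auto
 have "\<bar>- 4 * l t * om t * fs t\<bar> = 2 * \<bar>2 * l t * om t\<bar> * fs t" using fs_bound[OF t] by (simp add: abs_mult)
 also have "... <= 2 * (2 * K ^ 3) * K" using om'_bound[OF t] fs_bound[OF t] K_pos by (intro mult_mono) auto
 finally show "\<bar>- 4 * l t * om t * fs t\<bar> <= 4 * K ^ 4" by (simp add: eval_nat_numeral)
 qed
 also have "... <= (4 * K ^ 4) * K" using x1_x0 K_pos by (intro mult_left_mono) auto
 finally have i: "\<bar>integral {x1..x0} (%t. - 4 * l t * om t * fs t)\<bar> <= 4 * K ^ 5" by (simp add: eval_nat_numeral)
 have "om x1 * fs x1 <= K\<^sup>2 * K" using om_bound[of x1] fs_bound[of x1] le K_pos by (intro mult_mono) auto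
 also have "... = K ^ 3" by (simp add: power2_eq_square power3_eq_cube)
 also have "... <= K ^ 5" using K by (intro power_increasing) auto
 finally show "Vint x0 <= 6 * K ^ 5" using i unfolding Vint_def by (simp add: fs_def xi_x0)
qed

definition CS :: real where "CS = (2 * K ^ 3 * CP + 2 * K ^ 5 * N) * K + 2 * K\<^sup>2 * CP"

lemma u_cont: "x1 <= a ==> continuous_on {a..b} u" by (auto intro!: continuous_at_imp_continuous_on DERIV_isCont[OF u])

text \<open>Partial integration without oscillatory integrals: u^2 is replaced by - k^2 om P', and
  then k^2 P by its leading term k fs / pi. Boundary terms and the remaining integral assemble to k
  / (2 pi) times \<open>Vint x0\<close>.\<close>

lemma left_mass: "\<bar>integral {x1..x0} (%t. (u t)\<^sup>2) - k / (2 * pi) * Vint x0\<bar> <= CS * k\<^sup>2"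
proof -
 have le: "x1 <= x0" using x1_less_x0 by simp
 \<comment> \<open>Arranged so that in the derivative u^2 cancels and \<open>P\<close> appears only
   in the combination k^2 P - k fs / pi, which is of order k^2.\<close>
 define S where "S = (%x. integral {x1..x} (%t. (u t)\<^sup>2) + k\<^sup>2 * (om x * P x) - k / (2 * pi) * integral {x1..x} (%t. - 4 * l t * om t * fs t))"
 define S' where "S' = (%x. - 2 * l x * om x * (k\<^sup>2 * P x - k / pi * fs x) + 2 * (om x * xi1 x * R k x) * (W u x * W1 k u u1 x))"
 have dS: "(S has_real_derivative S' x) (at x within {x1..x0})" if x: "x \<in> {x1..x0}" for x
 proof -
 have x': "x1 <= x" "x <= x0" using x by auto
 have "(S has_real_derivative (u x)\<^sup>2 + k\<^sup>2 * ((- 2 * l x * om x) * P x + ((xi1 x / k\<^sup>2) * (2 * R k x * (W u x * W1 k u u1 x) - (W u x)\<^sup>2)) * om x)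
 - k / (2 * pi) * (- 4 * l x * om x * fs x)) (at x within {x1..x0})"
 unfolding S_def by (intro DERIV_diff DERIV_add DERIV_cmult DERIV_mult integral_deriv_within x cont_integrand continuous_intros u_cont
 has_field_derivative_at_within[OF om_deriv] has_field_derivative_at_within[OF P_deriv] x') auto
 moreover have "(u x)\<^sup>2 + k\<^sup>2 * ((- 2 * l x * om x) * P x + ((xi1 x / k\<^sup>2) * (2 * R k x * (W u x * W1 k u u1 x) - (W u x)\<^sup>2)) * om x)
 - k / (2 * pi) * (- 4 * l x * om x * fs x) = S' x"
 proof -
 have "(u x)\<^sup>2 = om x * xi1 x * (W u x)\<^sup>2"
 unfolding om_def W_def using xi1_pos[OF x'(1)] by (simp add: power_mult_distrib) (simp add: power2_eq_square)
 then show ?thesis unfolding S'_def using k by (simp add: field_simps power2_eq_square)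
 qed
 ultimately show ?thesis by simp
 qed
 have S'b: "\<bar>S' x\<bar> <= (2 * K ^ 3 * CP + 2 * K ^ 5 * N) * k\<^sup>2" if x: "x \<in> {x1..x0}" for x
 proof -
 have x': "x1 <= x" "x <= x0" using x by auto
 have 1: "\<bar>- 2 * l x * om x * (k\<^sup>2 * P x - k / pi * fs x)\<bar> <= 2 * K ^ 3 * (CP * k\<^sup>2)"
 unfolding abs_mult[of _ "k\<^sup>2 * P x - k / pi * fs x"] using om'_bound[OF x'] P_bound[OF x'] K_pos by (intro mult_mono) auto
 have "om x * xi1 x = 1 / xi1 x" unfolding om_def by (simp add: power2_eq_square)
 also have "... <= K" using xi1_left[OF x'] xi1_pos[OF x'(1)] K_pos by (simp add: field_simps)
 finally have ox: "om x * xi1 x <= K" .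
 have ox0: "0 <= om x * xi1 x" using om_bound[OF x'] xi1_pos[OF x'(1)] by simp
 have "\<bar>2 * (om x * xi1 x * R k x) * (W u x * W1 k u u1 x)\<bar> = 2 * (om x * xi1 x) * \<bar>R k x\<bar> * \<bar>W u x * W1 k u u1 x\<bar>"
 proof -
 have "\<bar>2 * (A * b) * c\<bar> = 2 * A * \<bar>b\<bar> * \<bar>c\<bar>" if "0 <= A" for A b c :: real using that by (simp add: abs_mult)
 then show ?thesis using ox0 by blast
 qed
 also have "... <= 2 * K * (K ^ 4 * k\<^sup>2) * N"
 proof (intro mult_mono)
 have "K ^ 4 * k ^ 4 <= K ^ 4 * k\<^sup>2" using k by (intro mult_left_mono power_decreasing) auto
 then show "\<bar>R k x\<bar> <= K ^ 4 * k\<^sup>2" using R_bound[OF x', of k] by linarith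
 qed (use ox ox0 WW1_bound[OF x'] K_pos in auto)
 also have "... = 2 * K ^ 5 * N * k\<^sup>2" by (simp add: eval_nat_numeral)
 finally have 2: "\<bar>2 * (om x * xi1 x * R k x) * (W u x * W1 k u u1 x)\<bar> <= 2 * K ^ 5 * N * k\<^sup>2" .
 have "\<bar>S' x\<bar> <= 2 * K ^ 3 * (CP * k\<^sup>2) + 2 * K ^ 5 * N * k\<^sup>2"
 unfolding S'_def by (rule order_trans[OF abs_triangle_ineq add_mono[OF 1 2]])
 then show ?thesis by (simp add: algebra_simps)
 qed
 have "\<bar>S x0 - S x1\<bar> <= (2 * K ^ 3 * CP + 2 * K ^ 5 * N) * k\<^sup>2 * (x0 - x1)" by (rule abs_increment_le[OF dS S'b le])
 also have "... <= (2 * K ^ 3 * CP + 2 * K ^ 5 * N) * k\<^sup>2 * K" using x1_x0 CP_nonneg N_pos K_pos by (intro mult_left_mono) auto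
 finally have inc: "\<bar>S x0 - S x1\<bar> <= (2 * K ^ 3 * CP + 2 * K ^ 5 * N) * k\<^sup>2 * K" .
 have end_bound: "\<bar>om x * (k\<^sup>2 * P x - k / pi * fs x)\<bar> <= K\<^sup>2 * (CP * k\<^sup>2)" if x: "x1 <= x" "x <= x0" for x
 unfolding abs_mult using om_bound[OF x] P_bound[OF x] by (intro mult_mono) auto
 have "S x1 = om x1 * (k\<^sup>2 * P x1 - k / pi * fs x1) + k / pi * (om x1 * fs x1)"
 unfolding S_def by (simp add: algebra_simps)
 moreover have "S x0 = integral {x1..x0} (%t. (u t)\<^sup>2) - k / (2 * pi) * Vint x0 + k / pi * (om x1 * fs x1) + om x0 * (k\<^sup>2 * P x0 - k / pi * fs x0)"
 unfolding S_def Vint_def by (simp add: algebra_simps fs_def xi_x0)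
 ultimately have "\<bar>integral {x1..x0} (%t. (u t)\<^sup>2) - k / (2 * pi) * Vint x0\<bar> <=
 (2 * K ^ 3 * CP + 2 * K ^ 5 * N) * k\<^sup>2 * K + K\<^sup>2 * (CP * k\<^sup>2) + K\<^sup>2 * (CP * k\<^sup>2)"
 proof -
 have "\<bar>I\<bar> <= B + E + E" if "S1 = e1 + t" "S0 = I + t + e0" "\<bar>S0 - S1\<bar> <= B" "\<bar>e1\<bar> <= E" "\<bar>e0\<bar> <= E" for I B E S1 S0 e1 e0 t :: real
 using that by linarith
 from this[OF _ _ inc end_bound[of x1] end_bound[of x0]] le \<open>S x1 = _\<close> \<open>S x0 = _\<close> show ?thesis by blast
 qed
 then show ?thesis unfolding CS_def by (simp add: algebra_simps)
qed

lemma u_right_nonneg: "x0 <= x ==> 0 <= u x"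
proof -
 assume x: "x0 <= x"
 have "\<bar>u x / Y k x - 1\<bar> <= 1" using u_Y[OF x] G by linarith
 then have "0 <= u x / Y k x" by linarith
 then show ?thesis using Y_pos[OF x k(1)] by (simp add: zero_le_divide_iff)
qed

text \<open>On the Airy scale [x0, x0 + k^2] the solution is bounded. Beyond it Q >= k^2 / K, so u^2
  <= K k^4 (u u')', which integrates to at most - K k^4 u u' at the turning point; there u u' is of
  order k^(-2).\<close>

lemma right_mass:
 assumes X: "x0 <= X" shows "integral {x0..X} (%t. (u t)\<^sup>2) <= 3 * K ^ 3 * N * k\<^sup>2"
proof -
 have x1: "x1 <= x" if "x0 <= x" for x using that x1_less_x0 by simp
 have udec: "u x <= u x0" if "x0 <= x" for x by (rule DERIV_nonpos_mono[where f = u and f' = u1]) (use that u u_dec x1 in auto)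
 have xx: "x1 <= x0" "x0 <= x0" using x1_less_x0 by auto
 have r: "0 < sqrt (xi1 x0)" using xi1_pos[OF xx(1)] by simp
 have u0: "(u x0)\<^sup>2 <= K * N"
 proof -
 have "(u x0)\<^sup>2 = 1 / xi1 x0 * (W u x0)\<^sup>2" unfolding W_def using xi1_pos[OF xx(1)] by (simp add: power_mult_distrib)
 also have "... <= K * N" using xi1_left[OF xx] xi1_pos[OF xx(1)] K_pos W_bound'[OF xx] by (intro mult_mono) (auto simp: field_simps)
 finally show ?thesis .
 qed
 have uu1: "- (u x0 * u1 x0) <= N / k\<^sup>2 + K / 2 * (K * N)"
 proof -
 have "u x0 * u1 x0 = W u x0 * W1 k u u1 x0 / k\<^sup>2 - l x0 / 2 * (u x0)\<^sup>2"
 unfolding W_def W1_def using r k by (simp add: field_simps power2_eq_square)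
 moreover have "- (W u x0 * W1 k u u1 x0) / k\<^sup>2 <= N / k\<^sup>2" using WW1_bound[OF xx] by (intro divide_right_mono) auto
 moreover have "l x0 / 2 * (u x0)\<^sup>2 <= K / 2 * (K * N)" using left[OF xx] u0 K_pos by (intro mult_mono) auto
 ultimately show ?thesis by simp
 qed
 have int_le: "integral {x0..b} (%t. (u t)\<^sup>2) <= K * N * (b - x0)" if "x0 <= b" for b
 proof -
 have "integral {x0..b} (%t. (u t)\<^sup>2) <= integral {x0..b} (%t. K * N)"
 proof (rule integral_le)
 fix t assume "t \<in> {x0..b}"
 then have "(u t)\<^sup>2 <= (u x0)\<^sup>2" using udec u_right_nonneg by (intro power_mono) auto
 then show "(u t)\<^sup>2 <= K * N" using u0 by linarith
 qed (use x1 in \<open>auto intro!: integrable_continuous_real continuous_intros u_cont\<close>)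
 then show ?thesis using that by (simp add: mult_ac)
 qed
 have Kk: "K * N * k\<^sup>2 <= K ^ 3 * N * k\<^sup>2" using N_pos power_increasing[of 1 3 K] K by (intro mult_right_mono) auto
 show ?thesis
 proof (cases "X <= x0 + k\<^sup>2")
 case True
 have "K * N * (X - x0) <= K * N * k\<^sup>2" using True K_pos N_pos by (intro mult_left_mono) auto
 moreover have "0 <= K ^ 3 * N * k\<^sup>2" using K_pos N_pos by simp
 ultimately show ?thesis using int_le[OF X] Kk by linarith
 next
 case False
 define b where "b = x0 + k\<^sup>2"
 have b: "x0 <= b" "b <= X" unfolding b_def using False by auto
 let ?U = "%x. integral {x0..x} (%t. (u t)\<^sup>2)"
 let ?Z = "%x. ?U x - K * k ^ 4 * (u x * u1 x)"
 have "?Z X <= ?Z b"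
 proof (rule DERIV_nonpos_imp_decreasing_open[OF b(2)])
 show "continuous_on {b..X} ?Z"
 proof (intro continuous_intros)
 have "continuous_on {x0..X} ?U" using x1 by (intro indefinite_integral_continuous_1 integrable_continuous_real continuous_intros u_cont) auto
 then show "continuous_on {b..X} ?U" by (rule continuous_on_subset) (use b in auto)
 show "continuous_on {b..X} u" using b x1 by (intro u_cont) auto
 show "continuous_on {b..X} u1" using b x1 by (auto intro!: continuous_at_imp_continuous_on DERIV_isCont[OF u1])
 qed
 fix x assume x: "b < x" "x < X"
 then have x0x: "x0 < x" using b by simp
 have xx: "x1 <= x" using x0x x1 by simp
 have "(?U has_real_derivative (u x)\<^sup>2) (at x within {x0..X})" using x x0x x1 by (intro integral_deriv_within continuous_intros u_cont) auto
 then have dU: "(?U has_real_derivative (u x)\<^sup>2) (at x)" using x x0x by (simp add: at_within_Icc_at)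
 have dZ: "(?Z has_real_derivative (u x)\<^sup>2 - K * k ^ 4 * (u1 x * u1 x + Q x / k ^ 6 * u x * u x)) (at x)"
 by (intro DERIV_diff DERIV_cmult DERIV_mult dU u u1 xx)
 have "k\<^sup>2 <= min (x - x0) 1" using x k_power_le[of 2] unfolding b_def by simp
 then have "k\<^sup>2 / K <= Q x" using Q_lower[of x] x0x divide_right_mono[of "k\<^sup>2" "min (x - x0) 1" K] K_pos by simp
 then have "1 <= K * Q x / k\<^sup>2" using K_pos k by (simp add: field_simps)
 then have "1 * (u x)\<^sup>2 <= K * Q x / k\<^sup>2 * (u x)\<^sup>2" by (intro mult_right_mono) auto
 also have "... = K * k ^ 4 * (Q x / k ^ 6 * u x * u x)" using k by (simp add: field_simps eval_nat_numeral)
 finally have "(u x)\<^sup>2 <= K * k ^ 4 * (Q x / k ^ 6 * u x * u x)" by simp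
 moreover have "0 <= K * k ^ 4 * (u1 x * u1 x)" using K_pos k by simp
 ultimately have "(u x)\<^sup>2 - K * k ^ 4 * (u1 x * u1 x + Q x / k ^ 6 * u x * u x) <= 0" by (simp add: distrib_left)
 then show "\<exists>y. (?Z has_real_derivative y) (at x) & y <= 0" using dZ by blast
 qed
 moreover have "u X * u1 X <= 0" using u_right_nonneg[OF X] u_dec[OF X] by (rule mult_nonneg_nonpos)
 moreover have "u x0 * u1 x0 <= u b * u1 b"
 proof (rule DERIV_nonneg_mono[where f = "%x. u x * u1 x" and f' = "%x. u1 x * u1 x + Q x / k ^ 6 * u x * u x"])
 fix x assume "x \<in> {x0..b}"
 then have x: "x0 <= x" by simp
 show "((%x. u x * u1 x) has_real_derivative u1 x * u1 x + Q x / k ^ 6 * u x * u x) (at x)" by (intro DERIV_mult u u1 x1 x)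
 have "0 <= Q x" using Q_lower[OF x] x K_pos by (smt (verit) divide_nonneg_pos min_def)
 then show "0 <= u1 x * u1 x + Q x / k ^ 6 * u x * u x" using k by (simp add: mult.assoc)
 qed (rule b)
 ultimately have "?U X <= ?U b + K * k ^ 4 * (- (u x0 * u1 x0))"
 proof -
 assume 1: "?Z X <= ?Z b" and 2: "u X * u1 X <= 0" and 3: "u x0 * u1 x0 <= u b * u1 b"
 have "K * k ^ 4 * (u X * u1 X) <= K * k ^ 4 * 0" using 2 K_pos k by (intro mult_left_mono) auto
 moreover have "K * k ^ 4 * (u x0 * u1 x0) <= K * k ^ 4 * (u b * u1 b)" using 3 K_pos k by (intro mult_left_mono) auto
 ultimately show ?thesis using 1 by simp
 qed
 also have "... <= K * N * k\<^sup>2 + K * k ^ 4 * (N / k\<^sup>2 + K / 2 * (K * N))"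
 using int_le[OF b(1)] uu1 K_pos k unfolding b_def by (intro add_mono mult_left_mono) auto
 also have "K * k ^ 4 * (N / k\<^sup>2 + K / 2 * (K * N)) = K * N * k\<^sup>2 + K ^ 3 * N * (k ^ 4 / 2)"
 using k by (simp add: field_simps eval_nat_numeral)
 also have "K ^ 3 * N * (k ^ 4 / 2) <= K ^ 3 * N * k\<^sup>2"
 proof (rule mult_left_mono)
 have "k ^ 4 <= k\<^sup>2" using k by (intro power_decreasing) auto
 then show "k ^ 4 / 2 <= k\<^sup>2" using zero_le_power2[of k] by linarith
 qed (use K_pos N_pos in auto)
 finally show ?thesis using Kk by linarith
 qed
qed

definition CI :: real where "CI = CS + 3 * K ^ 3 * N"

lemma total_mass:
 assumes int: "set_integrable lborel {x1..} (%x. (u x)\<^sup>2)"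
 shows "\<bar>(LINT x:{x1..}|lborel. (u x)\<^sup>2) - k / (2 * pi) * Vint x0\<bar> <= CI * k\<^sup>2"
proof -
 let ?c = "k / (2 * pi) * Vint x0"
 have bound: "?c - CI * k\<^sup>2 <= (LINT x:{x1..X}|lborel. (u x)\<^sup>2) & (LINT x:{x1..X}|lborel. (u x)\<^sup>2) <= ?c + CI * k\<^sup>2" if X: "x0 <= X" for X
 proof -
 have le: "x1 <= x0" using x1_less_x0 by simp
 have si: "set_integrable lborel {x1..X} (%x. (u x)\<^sup>2)" by (rule borel_integrable_atLeastAtMost') (intro continuous_intros u_cont order_refl)
 have "(LINT x:{x1..X}|lborel. (u x)\<^sup>2) = integral {x1..X} (%x. (u x)\<^sup>2)" by (rule set_borel_integral_eq_integral(2)[OF si])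
 also have "... = integral {x1..x0} (%x. (u x)\<^sup>2) + integral {x0..X} (%x. (u x)\<^sup>2)"
 by (rule Henstock_Kurzweil_Integration.integral_combine[OF le X, symmetric]) (intro integrable_continuous_real continuous_intros u_cont order_refl)
 finally have eq: "(LINT x:{x1..X}|lborel. (u x)\<^sup>2) = integral {x1..x0} (%x. (u x)\<^sup>2) + integral {x0..X} (%x. (u x)\<^sup>2)" .
 have "0 <= integral {x0..X} (%x. (u x)\<^sup>2)" using le by (intro integral_nonneg integrable_continuous_real continuous_intros u_cont) auto
 moreover have "0 <= 3 * K ^ 3 * N * k\<^sup>2" using K_pos N_pos by simp
 ultimately show ?thesis using left_mass right_mass[OF X] unfolding eq CI_def by (simp add: algebra_simps abs_le_iff)
 qed
 have lim: "((%X. LINT x:{x1..X}|lborel. (u x)\<^sup>2) \<longlongrightarrow> (LINT x:{x1..}|lborel. (u x)\<^sup>2)) at_top"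
 by (intro tendsto_set_lebesgue_integral_at_top int) auto
 have "?c - CI * k\<^sup>2 <= (LINT x:{x1..}|lborel. (u x)\<^sup>2)"
 by (rule tendsto_lowerbound[OF lim]) (use bound in \<open>auto simp: eventually_at_top_linorder\<close>)
 moreover have "(LINT x:{x1..}|lborel. (u x)\<^sup>2) <= ?c + CI * k\<^sup>2"
 by (rule tendsto_upperbound[OF lim]) (use bound in \<open>auto simp: eventually_at_top_linorder\<close>)
 ultimately show ?thesis by linarith
qed

end

section \<open>Weighted averages along segments\<close>

text \<open>\<open>moment_avg n x0 G x\<close> averages \<open>G\<close> over the segment from \<open>x0\<close> to \<open>x\<close>. It divides the zero at
 \<open>x0\<close> out of the primitives that occur below without losing smoothness.\<close>

definition moment_avg :: "nat => real => (real => real) => real => real" where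
 "moment_avg n x0 G x = integral {0..1} (%r. r ^ n * G (x0 + r\<^sup>2 * (x - x0)))"

lemma segment_point:
 fixes x x0 d r :: real
 assumes "\<bar>x - x0\<bar> < d" "0 <= r" "r <= 1" shows "\<bar>(x0 + r\<^sup>2 * (x - x0)) - x0\<bar> < d"
proof -
 have "r\<^sup>2 * \<bar>x - x0\<bar> <= 1 * \<bar>x - x0\<bar>" using assms by (intro mult_right_mono) (auto simp: power_le_one)
 then show ?thesis using assms by (simp add: abs_mult)
qed

lemma moment_avg_continuous_integrand:
 fixes G :: "real => real"
 assumes G: "continuous_on {x0 - d<..<x0 + d} G" and x: "\<bar>x - x0\<bar> < d"
 shows "continuous_on {0..1} (%r. r ^ n * G (x0 + r\<^sup>2 * (x - x0)))"
proof -
 have "continuous_on {0..1} (%r. G (x0 + r\<^sup>2 * (x - x0)))"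
 proof (rule continuous_on_compose2[OF G])
 show "(%r. x0 + r\<^sup>2 * (x - x0)) ` {0..1} \<subseteq> {x0 - d<..<x0 + d}"
 proof
 fix y assume "y \<in> (%r. x0 + r\<^sup>2 * (x - x0)) ` {0..1}"
 then obtain r where "r \<in> {0..1}" "y = x0 + r\<^sup>2 * (x - x0)" by blast
 with segment_point[OF x, of r] show "y \<in> {x0 - d<..<x0 + d}" by (auto simp: abs_less_iff)
 qed
 qed (intro continuous_intros)
 then show ?thesis by (intro continuous_intros)
qed

lemma continuous_on_segment:
 fixes G :: "real => real"
 assumes G: "continuous_on {x0 - d<..<x0 + d} G"
 shows "continuous_on ({x0 - d<..<x0 + d} \<times> {0..1}) (%p. G (x0 + (snd p)\<^sup>2 * (fst p - x0)))"
proof (rule continuous_on_compose2[OF G])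
 show "continuous_on ({x0 - d<..<x0 + d} \<times> {0..1}) (%p::real \<times> real. x0 + (snd p)\<^sup>2 * (fst p - x0))" by (intro continuous_intros)
 show "(%p. x0 + (snd p)\<^sup>2 * (fst p - x0)) ` ({x0 - d<..<x0 + d} \<times> {0..1}) \<subseteq> {x0 - d<..<x0 + d}"
 proof
 fix y assume "y \<in> (%p. x0 + (snd p)\<^sup>2 * (fst p - x0)) ` ({x0 - d<..<x0 + d} \<times> {0..1})"
 then obtain x r where p: "x \<in> {x0 - d<..<x0 + d}" "r \<in> {0..1}" "y = x0 + r\<^sup>2 * (x - x0)" by auto
 have "\<bar>x - x0\<bar> < d" using p(1) by (auto simp: abs_less_iff)
 from segment_point[OF this, of r] p show "y \<in> {x0 - d<..<x0 + d}" by (auto simp: abs_less_iff)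
 qed
qed

lemma moment_avg_continuous:
 fixes G :: "real => real"
 assumes G: "continuous_on {x0 - d<..<x0 + d} G"
 shows "continuous_on {x0 - d<..<x0 + d} (moment_avg n x0 G)"
proof -
 have "continuous_on ({x0 - d<..<x0 + d} \<times> cbox 0 1) (%(x, r). r ^ n * G (x0 + r\<^sup>2 * (x - x0)))"
 unfolding case_prod_beta using continuous_on_segment[OF G] by (intro continuous_intros) auto
 from integral_continuous_on_param[OF this] show ?thesis
 unfolding moment_avg_def[abs_def] by simp
qed

text \<open>Differentiating in \<open>x\<close> brings down r^2 and raises the index by two, with
  the derivative of \<open>G\<close> as new argument; no regularity of \<open>G\<close> is lost at
  \<open>x0\<close>.\<close>

lemma moment_avg_deriv:
 assumes G: "!!y. \<bar>y - x0\<bar> < d ==> (G has_real_derivative G' y) (at y)"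
 and G': "continuous_on {x0 - d<..<x0 + d} G'" and x: "\<bar>x - x0\<bar> < d"
 shows "(moment_avg n x0 G has_real_derivative moment_avg (n + 2) x0 G' x) (at x)"
proof -
 let ?U = "{x0 - d<..<x0 + d}"
 have xU: "x \<in> ?U" using x by (auto simp: abs_less_iff)
 have contG: "continuous_on ?U G" by (auto intro!: continuous_at_imp_continuous_on DERIV_isCont[OF G])
 have "((%x. integral (cbox 0 1) (%r. r ^ n * G (x0 + r\<^sup>2 * (x - x0)))) has_field_derivative
 integral (cbox 0 1) (%r. r ^ (n + 2) * G' (x0 + r\<^sup>2 * (x - x0)))) (at x within ?U)"
 proof (rule leibniz_rule_field_derivative[OF _ _ _ xU])
 fix y r :: real assume y: "y \<in> ?U" and r: "r \<in> cbox 0 1"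
 then have "\<bar>(x0 + r\<^sup>2 * (y - x0)) - x0\<bar> < d" by (intro segment_point) auto
 note dG = G[OF this]
 have "((%y. x0 + r\<^sup>2 * (y - x0)) has_real_derivative r\<^sup>2) (at y)" by (auto intro!: derivative_eq_intros)
 from DERIV_cmult[OF DERIV_chain2[OF dG this], of "r ^ n"]
 have "((%y. r ^ n * G (x0 + r\<^sup>2 * (y - x0))) has_field_derivative r ^ (n + 2) * G' (x0 + r\<^sup>2 * (y - x0))) (at y)"
 by (rule DERIV_cong) (simp only: power_add mult_ac)
 then show "((%y. r ^ n * G (x0 + r\<^sup>2 * (y - x0))) has_field_derivative r ^ (n + 2) * G' (x0 + r\<^sup>2 * (y - x0))) (at y within ?U)"
 by (rule has_field_derivative_at_within)
 next
 fix y assume "y \<in> ?U"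
 then have "\<bar>y - x0\<bar> < d" by (auto simp: abs_less_iff)
 from moment_avg_continuous_integrand[OF contG this]
 show "(%r. r ^ n * G (x0 + r\<^sup>2 * (y - x0))) integrable_on cbox 0 1" by (auto intro!: integrable_continuous_real)
 next
 show "continuous_on (?U \<times> cbox 0 1) (%(y, r). r ^ (n + 2) * G' (x0 + r\<^sup>2 * (y - x0)))"
 unfolding case_prod_beta using continuous_on_segment[OF G'] by (intro continuous_intros) auto
 qed simp
 then show ?thesis unfolding moment_avg_def[abs_def] using xU by (simp add: at_within_open[of x ?U])
qed

text \<open>The derivative of r^(n+1) G(x0 + r^2 (x - x0)) in \<open>r\<close>, integrated from 0 to
  1.\<close>

lemma moment_avg_identity:
 assumes G: "!!y. \<bar>y - x0\<bar> < d ==> (G has_real_derivative G' y) (at y)"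
 and G': "continuous_on {x0 - d<..<x0 + d} G'" and x: "\<bar>x - x0\<bar> < d"
 shows "real (n + 1) * moment_avg n x0 G x + 2 * (x - x0) * moment_avg (n + 2) x0 G' x = G x"
proof -
 have contG: "continuous_on {x0 - d<..<x0 + d} G" by (auto intro!: continuous_at_imp_continuous_on DERIV_isCont[OF G])
 let ?g = "%r. r ^ n * G (x0 + r\<^sup>2 * (x - x0))"
 let ?g' = "%r. r ^ (n + 2) * G' (x0 + r\<^sup>2 * (x - x0))"
 have "((%r. real (n + 1) * ?g r + 2 * (x - x0) * ?g' r) has_integral
 (1 ^ (n + 1) * G (x0 + 1\<^sup>2 * (x - x0)) - 0 ^ (n + 1) * G (x0 + 0\<^sup>2 * (x - x0)))) {0..1}"
 proof (rule fundamental_theorem_of_calculus[where f = "%r. r ^ (n + 1) * G (x0 + r\<^sup>2 * (x - x0))"])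
 fix r :: real assume r: "r \<in> {0..1}"
 then have "\<bar>(x0 + r\<^sup>2 * (x - x0)) - x0\<bar> < d" using segment_point[OF x] by auto
 note dG = G[OF this]
 have "((%r. x0 + r\<^sup>2 * (x - x0)) has_real_derivative 2 * r * (x - x0)) (at r)" by (auto intro!: derivative_eq_intros)
 from DERIV_mult[OF DERIV_pow[of "n + 1" r UNIV] DERIV_chain2[OF dG this]]
 have "((%r. r ^ (n + 1) * G (x0 + r\<^sup>2 * (x - x0))) has_real_derivative real (n + 1) * ?g r + 2 * (x - x0) * ?g' r) (at r)"
 by (rule DERIV_cong) (simp add: power_add power2_eq_square algebra_simps)
 then show "((%r. r ^ (n + 1) * G (x0 + r\<^sup>2 * (x - x0))) has_vector_derivative real (n + 1) * ?g r + 2 * (x - x0) * ?g' r) (at r within {0..1})"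
 by (simp add: has_real_derivative_iff_has_vector_derivative has_vector_derivative_at_within)
 qed simp
 then have "integral {0..1} (%r. real (n + 1) * ?g r + 2 * (x - x0) * ?g' r) = G x" by (simp add: integral_unique)
 moreover have "integral {0..1} (%r. real (n + 1) * ?g r + 2 * (x - x0) * ?g' r)
 = real (n + 1) * integral {0..1} ?g + 2 * (x - x0) * integral {0..1} ?g'"
 by (intro integral_unique has_integral_add has_integral_mult_right integrable_integral integrable_continuous_real
 moment_avg_continuous_integrand[OF contG x] moment_avg_continuous_integrand[OF G' x])
 ultimately show ?thesis unfolding moment_avg_def by simp
qed

lemma integral_power_01: "integral {0..1} (%r::real. r ^ n * c) = c / real (n + 1)"
proof -
 let ?F = "%r. r ^ (n + 1) * (c / real (n + 1))"
 have "((%r. r ^ n * c) has_integral (?F 1 - ?F 0)) {0..1}"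
 proof (rule fundamental_theorem_of_calculus)
 fix r :: real
 have "(?F has_real_derivative r ^ n * c) (at r)" by (rule DERIV_cong[OF DERIV_cmult_right[OF DERIV_pow]]) simp
 then show "(?F has_vector_derivative r ^ n * c) (at r within {0..1})"
 by (simp add: has_real_derivative_iff_has_vector_derivative has_vector_derivative_at_within)
 qed simp
 from integral_unique[OF this] show ?thesis by simp
qed

lemma moment_avg_bounds:
 assumes G: "continuous_on {x0 - d<..<x0 + d} G" and x: "\<bar>x - x0\<bar> < d"
 and b: "!!y. \<bar>y - x0\<bar> < d ==> a <= G y & G y <= b"
 shows "a <= real (n + 1) * moment_avg n x0 G x" "real (n + 1) * moment_avg n x0 G x <= b"
proof -
 have i: "(%r. r ^ n * c) integrable_on {0..1::real}" for c :: real by (intro integrable_continuous_real continuous_intros)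
 have j: "(%r. r ^ n * G (x0 + r\<^sup>2 * (x - x0))) integrable_on {0..1}"
 by (intro integrable_continuous_real moment_avg_continuous_integrand[OF G x])
 have "integral {0..1} (%r. r ^ n * a) <= moment_avg n x0 G x" unfolding moment_avg_def
 using segment_point[OF x] b by (intro integral_le i j mult_left_mono) auto
 then show "a <= real (n + 1) * moment_avg n x0 G x" unfolding integral_power_01 by (simp add: field_simps)
 have "moment_avg n x0 G x <= integral {0..1} (%r. r ^ n * b)" unfolding moment_avg_def
 using segment_point[OF x] b by (intro integral_le i j mult_left_mono) auto
 then show "real (n + 1) * moment_avg n x0 G x <= b" unfolding integral_power_01 by (simp add: field_simps)
qed

lemma moment_avg_abs:
 assumes "continuous_on {x0 - d<..<x0 + d} G" "\<bar>x - x0\<bar> < d" "!!y. \<bar>y - x0\<bar> < d ==> \<bar>G y\<bar> <= b"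
 shows "\<bar>real (n + 1) * moment_avg n x0 G x\<bar> <= b"
proof -
 have "- b <= G y & G y <= b" if "\<bar>y - x0\<bar> < d" for y using assms(3)[OF that] by linarith
 from moment_avg_bounds[OF assms(1,2) this, of n] show ?thesis by linarith
qed

lemma nat_sums: "1 + 2 = (3::nat)" "2 + 2 = (4::nat)" "3 + 2 = (5::nat)" "4 + 2 = (6::nat)" by simp_all

section \<open>Langer's variable at a turning point\<close>

text \<open>Quantitative data at the right turning point with a single constant \<open>M\<close>, so
  that whatever follows from \<open>M\<close> is uniform in \<open>lam\<close>. Third derivatives
  are assumed up to distance 2 d from \<open>x0\<close>, and bounds on two derivatives from distance
  d on; the two descriptions overlap.\<close>

locale turning =
 fixes M d kap xl x1 x0 :: real and q q1 q2 q3 :: "real => real"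
 assumes M: "1 <= M" and d: "1 / M <= d" "d <= 1" and kap: "1 < kap" "kap <= 2"
 and pts: "xl < x1" "x1 <= x0 - d" "x0 - x1 <= M"
 and q: "!!x. (q has_real_derivative q1 x) (at x)" and q1: "!!x. (q1 has_real_derivative q2 x) (at x)"
 and q2: "!!x. \<bar>x - x0\<bar> < 2 * d ==> (q2 has_real_derivative q3 x) (at x)"
 and q3: "continuous_on {x0 - 2 * d<..<x0 + 2 * d} q3"
 and near: "!!x. \<bar>x - x0\<bar> < 2 * d ==> 1 / M <= q1 x & q1 x <= M & \<bar>q2 x\<bar> <= M & \<bar>q3 x\<bar> <= M"
 and q_x0: "q x0 = 0"
 and right: "!!x. x0 + d <= x ==> 1 / M <= q x"
 and left: "!!x. x1 <= x ==> x <= x0 - d ==> - M <= q x & q x <= - 1 / M & \<bar>q1 x\<bar> <= M & \<bar>q2 x\<bar> <= M"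
 and neg: "!!x. xl < x ==> x < x0 ==> q x < 0"
 and decay: "!!x. x0 + d <= x ==>
 (q1 x)\<^sup>2 <= M * (q x) ^ 3 * (1 + integral {x0..x} (%y. sqrt (q y))) powr (- kap) &
 \<bar>q2 x\<bar> <= M * (q x)\<^sup>2 * (1 + integral {x0..x} (%y. sqrt (q y))) powr (- kap)"
begin

lemma M_pos: "0 < M" and d_pos: "0 < d"
proof -
 show "0 < M" using M by simp
 then have "0 < 1 / M" by simp
 then show "0 < d" using d by linarith
qed

lemma cont_q: "continuous_on S q" "continuous_on S q1" by (auto intro!: continuous_at_imp_continuous_on DERIV_isCont[OF q] DERIV_isCont[OF q1])

abbreviation "nbhd \<equiv> {x0 - 2 * d<..<x0 + 2 * d}"

lemma cont_q2: "continuous_on nbhd q2" by (auto intro!: continuous_at_imp_continuous_on DERIV_isCont[OF q2] simp: abs_less_iff)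

text \<open>The quotient q / (x - x0), as the mean of \<open>q1\<close> over the segment; the
  substitution t = r^2 explains index and factor.\<close>

definition g :: "real => real" where "g x = 2 * moment_avg 1 x0 q1 x"
definition g1 :: "real => real" where "g1 x = 2 * moment_avg 3 x0 q2 x"
definition g2 :: "real => real" where "g2 x = 2 * moment_avg 5 x0 q3 x"

lemma g_deriv: assumes x: "\<bar>x - x0\<bar> < 2 * d" shows "(g has_real_derivative g1 x) (at x)"
 unfolding g_def[abs_def] g1_def using DERIV_cmult[OF moment_avg_deriv[where n = 1, OF q1 cont_q2 x], of 2] by (simp only: nat_sums)

lemma g1_deriv: assumes x: "\<bar>x - x0\<bar> < 2 * d" shows "(g1 has_real_derivative g2 x) (at x)"
 unfolding g1_def[abs_def] g2_def using DERIV_cmult[OF moment_avg_deriv[where n = 3, OF q2 q3 x], of 2] by (simp only: nat_sums)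

lemma g2_cont: "continuous_on nbhd g2"
 unfolding g2_def[abs_def] by (intro continuous_intros moment_avg_continuous q3)

lemma g_bounds:
 assumes x: "\<bar>x - x0\<bar> < 2 * d" shows "1 / M <= g x" "g x <= M" "\<bar>g1 x\<bar> <= M" "\<bar>g2 x\<bar> <= M"
proof -
 show "1 / M <= g x" "g x <= M"
 unfolding g_def using moment_avg_bounds[OF cont_q(2) x, of "1 / M" M 1] near by auto
 have "\<bar>real (3 + 1) * moment_avg 3 x0 q2 x\<bar> <= M" by (rule moment_avg_abs[OF cont_q2 x]) (use near in blast)
 then show "\<bar>g1 x\<bar> <= M" unfolding g1_def by (simp add: abs_mult)
 have "\<bar>real (5 + 1) * moment_avg 5 x0 q3 x\<bar> <= M" by (rule moment_avg_abs[OF q3 x]) (use near in blast)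
 then show "\<bar>g2 x\<bar> <= M" unfolding g2_def using M_pos by (simp add: abs_mult)
qed

lemma q_eq_g:
 assumes x: "\<bar>x - x0\<bar> < 2 * d" shows "q x = (x - x0) * g x"
proof -
 have "((%r. 2 * (x - x0) * (r ^ 1 * q1 (x0 + r\<^sup>2 * (x - x0)))) has_integral (q (x0 + 1\<^sup>2 * (x - x0)) - q (x0 + 0\<^sup>2 * (x - x0)))) {0..1}"
 proof (rule fundamental_theorem_of_calculus)
 fix r :: real
 have "((%r. x0 + r\<^sup>2 * (x - x0)) has_real_derivative 2 * r * (x - x0)) (at r)" by (auto intro!: derivative_eq_intros)
 from DERIV_chain2[OF q this]
 have "((%r. q (x0 + r\<^sup>2 * (x - x0))) has_real_derivative 2 * (x - x0) * (r ^ 1 * q1 (x0 + r\<^sup>2 * (x - x0)))) (at r)"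
 by (rule DERIV_cong) (simp add: algebra_simps)
 then show "((%r. q (x0 + r\<^sup>2 * (x - x0))) has_vector_derivative 2 * (x - x0) * (r ^ 1 * q1 (x0 + r\<^sup>2 * (x - x0)))) (at r within {0..1})"
 by (simp add: has_real_derivative_iff_has_vector_derivative has_vector_derivative_at_within)
 qed simp
 from integral_unique[OF this] have "integral {0..1} (%r. 2 * (x - x0) * (r ^ 1 * q1 (x0 + r\<^sup>2 * (x - x0)))) = q x" using q_x0 by simp
 moreover have "integral {0..1} (%r. 2 * (x - x0) * (r ^ 1 * q1 (x0 + r\<^sup>2 * (x - x0)))) = 2 * (x - x0) * moment_avg 1 x0 q1 x"
 unfolding moment_avg_def by (rule integral_mult_right)
 ultimately show ?thesis unfolding g_def by (simp only: mult_ac)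
qed

lemma g_pos: "\<bar>x - x0\<bar> < 2 * d ==> 0 < g x" using g_bounds(1)[of x] M_pos by (smt (verit) divide_pos_pos)

definition r :: "real => real" where "r x = sqrt (g x)"
definition r1 :: "real => real" where "r1 x = g1 x / (2 * r x)"
definition r2 :: "real => real" where "r2 x = g2 x / (2 * r x) - (r1 x)\<^sup>2 / r x"

lemma r_bounds:
 assumes x: "\<bar>x - x0\<bar> < 2 * d" shows "1 / M <= r x" "r x <= M" "\<bar>r1 x\<bar> <= M\<^sup>2" "\<bar>r2 x\<bar> <= 2 * M ^ 5"
proof -
 have "(1 / M)\<^sup>2 <= 1 / M" using M by (simp add: power2_eq_square field_simps)
 then show r0: "1 / M <= r x" unfolding r_def using g_bounds[OF x] by (intro real_le_rsqrt) linarith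
 have "M <= M\<^sup>2" using M by (simp add: power2_eq_square)
 then show "r x <= M" unfolding r_def using g_bounds[OF x] M by (intro real_le_lsqrt) auto
 have rp: "0 < r x" unfolding r_def using g_pos[OF x] by simp
 have ri: "1 / r x <= M" using r0 rp M_pos by (simp add: field_simps)
 have "\<bar>r1 x\<bar> = \<bar>g1 x\<bar> * (1 / r x) / 2" unfolding r1_def using rp by (simp add: abs_divide)
 also have "... <= M * M / 2" using g_bounds[OF x] ri rp M_pos by (intro divide_right_mono mult_mono) auto
 also have "... <= M\<^sup>2" by (simp add: power2_eq_square)
 finally show r1b: "\<bar>r1 x\<bar> <= M\<^sup>2" .
 have "\<bar>g2 x / (2 * r x)\<bar> = \<bar>g2 x\<bar> * (1 / r x) / 2" using rp by (simp add: abs_divide)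
 also have "... <= M * M / 2" using g_bounds[OF x] ri rp M_pos by (intro divide_right_mono mult_mono) auto
 also have "... <= M ^ 2" by (simp add: power2_eq_square)
 also have "... <= M ^ 5" using M by (intro power_increasing) auto
 finally have a: "\<bar>g2 x / (2 * r x)\<bar> <= M ^ 5" .
 have "(r1 x)\<^sup>2 * (1 / r x) <= (M\<^sup>2)\<^sup>2 * M" using power_mono[OF r1b abs_ge_zero, of 2] ri rp by (intro mult_mono) auto
 also have "... = M ^ 5" by (simp add: eval_nat_numeral)
 finally have "\<bar>(r1 x)\<^sup>2 / r x\<bar> <= M ^ 5" using rp by (simp add: abs_divide)
 with a show "\<bar>r2 x\<bar> <= 2 * M ^ 5" unfolding r2_def by linarith
qed

lemma r_pos: "\<bar>x - x0\<bar> < 2 * d ==> 0 < r x"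
 unfolding r_def using g_pos by simp

lemma r_deriv: assumes x: "\<bar>x - x0\<bar> < 2 * d" shows "(r has_real_derivative r1 x) (at x)"
proof -
 have "(r has_real_derivative inverse (sqrt (g x)) / 2 * g1 x) (at x)"
 unfolding r_def[abs_def] by (rule DERIV_chain2[OF DERIV_real_sqrt[OF g_pos[OF x]] g_deriv[OF x]])
 then show ?thesis by (rule DERIV_cong) (use r_pos[OF x] in \<open>simp add: r1_def r_def field_simps\<close>)
qed

lemma r1_deriv: assumes x: "\<bar>x - x0\<bar> < 2 * d" shows "(r1 has_real_derivative r2 x) (at x)"
proof -
 have "(r1 has_real_derivative (g2 x * (2 * r x) - g1 x * (2 * r1 x)) / (2 * r x * (2 * r x))) (at x)"
 unfolding r1_def[abs_def] using r_pos[OF x] by (intro DERIV_divide DERIV_cmult g1_deriv[OF x] r_deriv[OF x, unfolded r1_def]) auto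
 moreover have "(a * (2 * b) - c * (2 * (c / (2 * b)))) / (2 * b * (2 * b)) = a / (2 * b) - (c / (2 * b))\<^sup>2 / b"
 if "0 < b" for a b c :: real using that by (simp add: field_simps power2_eq_square)
 ultimately show ?thesis using r_pos[OF x] unfolding r2_def r1_def by simp
qed

lemma r_cont: "continuous_on nbhd r" "continuous_on nbhd r1" "continuous_on nbhd r2"
proof -
 have n: "\<bar>x - x0\<bar> < 2 * d" if "x \<in> nbhd" for x using that by (auto simp: abs_less_iff)
 show rc: "continuous_on nbhd r" "continuous_on nbhd r1"
 by (auto intro!: continuous_at_imp_continuous_on DERIV_isCont[OF r_deriv] DERIV_isCont[OF r1_deriv] simp: abs_less_iff)
 show "continuous_on nbhd r2" unfolding r2_def[abs_def] using r_pos n by (intro continuous_intros rc g2_cont) (auto simp: less_imp_neq[symmetric])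
qed

text \<open>With q = (x - x0) r^2, substituting y = x0 + t^2 (x - x0) in the action integral gives
  2/3 |x - x0|^(3/2) times this average.\<close>

definition H :: "real => real" where "H x = 3 * moment_avg 2 x0 r x"
definition H1 :: "real => real" where "H1 x = 3 * moment_avg 4 x0 r1 x"
definition H2 :: "real => real" where "H2 x = 3 * moment_avg 6 x0 r2 x"

lemma H_deriv: assumes x: "\<bar>x - x0\<bar> < 2 * d" shows "(H has_real_derivative H1 x) (at x)"
 unfolding H_def[abs_def] H1_def using DERIV_cmult[OF moment_avg_deriv[where n = 2, OF r_deriv r_cont(2) x], of 3] by (simp only: nat_sums)

lemma H1_deriv: assumes x: "\<bar>x - x0\<bar> < 2 * d" shows "(H1 has_real_derivative H2 x) (at x)"
 unfolding H1_def[abs_def] H2_def using DERIV_cmult[OF moment_avg_deriv[where n = 4, OF r1_deriv r_cont(3) x], of 3] by (simp only: nat_sums)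

lemma H_identity: assumes x: "\<bar>x - x0\<bar> < 2 * d" shows "H x + 2/3 * (x - x0) * H1 x = r x"
proof -
 have "real (2 + 1) * moment_avg 2 x0 r x + 2 * (x - x0) * moment_avg 4 x0 r1 x = r x"
 using moment_avg_identity[where n = 2, OF r_deriv r_cont(2) x] by (simp only: nat_sums)
 then show ?thesis unfolding H_def H1_def by simp
qed

lemma H_bounds:
 assumes x: "\<bar>x - x0\<bar> < 2 * d" shows "1 / M <= H x" "H x <= M" "\<bar>H1 x\<bar> <= M\<^sup>2" "\<bar>H2 x\<bar> <= 2 * M ^ 5"
proof -
 show "1 / M <= H x" "H x <= M"
 unfolding H_def using moment_avg_bounds[OF r_cont(1) x, of "1 / M" M 2] r_bounds(1,2) by auto
 have "\<bar>real (4 + 1) * moment_avg 4 x0 r1 x\<bar> <= M\<^sup>2" by (rule moment_avg_abs[OF r_cont(2) x]) (use r_bounds(3) in blast)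
 then show "\<bar>H1 x\<bar> <= M\<^sup>2" unfolding H1_def by (simp add: abs_mult)
 have "\<bar>real (6 + 1) * moment_avg 6 x0 r2 x\<bar> <= 2 * M ^ 5" by (rule moment_avg_abs[OF r_cont(3) x]) (use r_bounds(4) in blast)
 then show "\<bar>H2 x\<bar> <= 2 * M ^ 5" unfolding H2_def using M_pos by (simp add: abs_mult)
qed

lemma H_pos: "\<bar>x - x0\<bar> < 2 * d ==> 0 < H x" using H_bounds(1)[of x] M_pos by (smt (verit) divide_pos_pos)

lemma q_pos: "x0 < x ==> 0 < q x"
proof (cases "x < x0 + 2 * d")
 case True
 assume "x0 < x"
 then have "\<bar>x - x0\<bar> < 2 * d" using True by simp
 then show ?thesis using q_eq_g g_pos \<open>x0 < x\<close> by simp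
next
 case False
 then have "x0 + d <= x" using d_pos by simp
 then show ?thesis using right[of x] M_pos by (smt (verit) divide_pos_pos)
qed

definition S :: "real => real" where
 "S x = (if x0 <= x then integral {x0..x} (%y. sqrt (q y)) else integral {x..x0} (%y. sqrt \<bar>q y\<bar>))"

definition xi :: "real => real" where
 "xi x = (if x0 <= x then (3/2 * S x) powr (2/3) else - ((3/2 * S x) powr (2/3)))"

text \<open>\<open>H_identity\<close> says precisely that 2/3 |x - x0|^(3/2) H has derivative sqrt
  |q|, up to the orientation on the left.\<close>

lemma S_near:
 assumes x: "\<bar>x - x0\<bar> < 2 * d" shows "S x = 2/3 * \<bar>x - x0\<bar> powr (3/2) * H x"
proof -
 have Hc: "continuous_on T H" if "T \<subseteq> nbhd" for T
 proof (rule continuous_on_subset[OF _ that])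
 show "continuous_on nbhd H" by (auto intro!: continuous_at_imp_continuous_on DERIV_isCont[OF H_deriv] simp: abs_less_iff)
 qed
 show ?thesis
 proof (cases "x0 <= x")
 case True
 let ?F = "%x. 2/3 * (x - x0) powr (3/2) * H x"
 have "((%y. sqrt (q y)) has_integral (?F x - ?F x0)) {x0..x}"
 proof (rule fundamental_theorem_of_calculus_interior[OF True])
 show "continuous_on {x0..x} ?F" using x True d_pos by (intro continuous_intros Hc continuous_on_powr') (auto simp: abs_less_iff)
 fix y assume y: "y \<in> {x0<..<x}"
 then have y': "\<bar>y - x0\<bar> < 2 * d" "0 < y - x0" using x by auto
 have "(?F has_real_derivative (2/3 * ((3/2) * (y - x0) powr (3/2 - 1) * 1)) * H y + H1 y * (2/3 * (y - x0) powr (3/2))) (at y)"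
 using y' by (auto intro!: derivative_eq_intros H_deriv[OF y'(1)] simp: field_simps)
 moreover have "(2/3 * ((3/2) * (y - x0) powr (3/2 - 1) * 1)) * H y + H1 y * (2/3 * (y - x0) powr (3/2)) = sqrt (q y)"
 proof -
 have p: "(y - x0) powr (3/2) = (y - x0) powr (1/2) * (y - x0)" using powr_add[of "y - x0" "1/2" 1] y' by simp
 have "(2/3 * ((3/2) * (y - x0) powr (3/2 - 1) * 1)) * H y + H1 y * (2/3 * (y - x0) powr (3/2)) = (y - x0) powr (1/2) * (H y + 2/3 * (y - x0) * H1 y)"
 proof -
 have "(2/3 * ((3/2) * P * 1)) * h + h1 * (2/3 * (P * t)) = P * (h + 2/3 * t * h1)" for P h h1 t :: real by (simp add: algebra_simps)
 then show ?thesis unfolding p by simp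
 qed
 also have "... = sqrt (y - x0) * r y" using H_identity[OF y'(1)] y' by (simp add: powr_half_sqrt)
 also have "... = sqrt (q y)" unfolding r_def q_eq_g[OF y'(1)] by (simp add: real_sqrt_mult)
 finally show ?thesis .
 qed
 ultimately show "(?F has_vector_derivative sqrt (q y)) (at y)" by (simp add: has_real_derivative_iff_has_vector_derivative)
 qed
 then show ?thesis using True unfolding S_def by (simp add: integral_unique)
 next
 case False
 then have le: "x <= x0" by simp
 let ?F = "%x. - (2/3 * (x0 - x) powr (3/2) * H x)"
 have "((%y. sqrt \<bar>q y\<bar>) has_integral (?F x0 - ?F x)) {x..x0}"
 proof (rule fundamental_theorem_of_calculus_interior[OF le])
 show "continuous_on {x..x0} ?F" using x le d_pos by (intro continuous_intros Hc continuous_on_powr') (auto simp: abs_less_iff)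
 fix y assume y: "y \<in> {x<..<x0}"
 then have y': "\<bar>y - x0\<bar> < 2 * d" "0 < x0 - y" using x by auto
 have "(?F has_real_derivative - ((2/3 * ((3/2) * (x0 - y) powr (3/2 - 1) * (- 1))) * H y + H1 y * (2/3 * (x0 - y) powr (3/2)))) (at y)"
 using y' by (auto intro!: derivative_eq_intros H_deriv[OF y'(1)] simp: field_simps)
 moreover have "- ((2/3 * ((3/2) * (x0 - y) powr (3/2 - 1) * (- 1))) * H y + H1 y * (2/3 * (x0 - y) powr (3/2))) = sqrt \<bar>q y\<bar>"
 proof -
 have p: "(x0 - y) powr (3/2) = (x0 - y) powr (1/2) * (x0 - y)" using powr_add[of "x0 - y" "1/2" 1] y' by simp
 have "- ((2/3 * ((3/2) * (x0 - y) powr (3/2 - 1) * (- 1))) * H y + H1 y * (2/3 * (x0 - y) powr (3/2))) = (x0 - y) powr (1/2) * (H y + 2/3 * (y - x0) * H1 y)"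
 proof -
 have "- ((2/3 * ((3/2) * P * (- 1))) * h + h1 * (2/3 * (P * (a - b)))) = P * (h + 2/3 * (b - a) * h1)" for P h h1 a b :: real
 by (simp add: field_simps)
 then show ?thesis unfolding p by simp
 qed
 also have "... = sqrt (x0 - y) * r y" using H_identity[OF y'(1)] y' by (simp add: powr_half_sqrt)
 also have "... = sqrt \<bar>q y\<bar>"
 proof -
 have "\<bar>q y\<bar> = (x0 - y) * g y" unfolding q_eq_g[OF y'(1)] using y' g_pos[OF y'(1)] by (simp add: abs_mult)
 then show ?thesis unfolding r_def by (simp add: real_sqrt_mult)
 qed
 finally show ?thesis .
 qed
 ultimately show "(?F has_vector_derivative sqrt \<bar>q y\<bar>) (at y)" by (simp add: has_real_derivative_iff_has_vector_derivative)
 qed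
 then show ?thesis using False unfolding S_def by (simp add: integral_unique)
 qed
qed

text \<open>The powers 3/2 and 2/3 cancel on the distance to \<open>x0\<close>, and what is left is
  smooth through the turning point because \<open>H\<close> is positive.\<close>

lemma xi_near:
 assumes x: "\<bar>x - x0\<bar> < 2 * d" shows "xi x = (x - x0) * H x powr (2/3)"
proof -
 have "(3/2 * S x) powr (2/3) = (\<bar>x - x0\<bar> powr (3/2) * H x) powr (2/3)" unfolding S_near[OF x] by (simp add: mult.commute)
 also have "... = \<bar>x - x0\<bar> * H x powr (2/3)"
 unfolding powr_mult powr_powr by simp
 finally show ?thesis unfolding xi_def by (auto simp: algebra_simps)
qed

end

section \<open>Derivatives of Langer's variable near and away from the turning point\<close>

text \<open>Transfers formulas valid on an open set to functions defined globally by
  \<open>deriv\<close>. The description near the turning point and the one away from it are glued in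
  this way, without comparing them on the overlap.\<close>

lemma iterated_log_deriv:
 fixes f a b c :: "real => real"
 assumes U: "open U" "x \<in> U"
 and f: "!!y. y \<in> U ==> (f has_real_derivative a y) (at y)"
 and a: "!!y. y \<in> U ==> (a has_real_derivative a y * b y) (at y)"
 and b: "!!y. y \<in> U ==> (b has_real_derivative c y) (at y)"
 and pos: "!!y. y \<in> U ==> 0 < a y"
 defines "l \<equiv> %y. deriv (deriv f) y / deriv f y"
 shows "deriv f x = a x" "l x = b x" "deriv l x = c x"
 "(f has_real_derivative deriv f x) (at x)" "(deriv f has_real_derivative deriv f x * l x) (at x)"
 "(l has_real_derivative deriv l x) (at x)"
proof -
 have 1: "deriv f y = a y" if "y \<in> U" for y using f[OF that] by (rule DERIV_imp_deriv)
 have 2: "(deriv f has_real_derivative a y * b y) (at y)" if "y \<in> U" for y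
 by (rule has_field_derivative_transform_within_open[OF a[OF that] U(1) that]) (simp add: 1)
 have 3: "l y = b y" if "y \<in> U" for y
 unfolding l_def 1[OF that] DERIV_imp_deriv[OF 2[OF that]] using pos[OF that] by simp
 have 4: "(l has_real_derivative c y) (at y)" if "y \<in> U" for y
 by (rule has_field_derivative_transform_within_open[OF b[OF that] U(1) that]) (simp add: 3)
 show "deriv f x = a x" "l x = b x" "deriv l x = c x" using 1 3 DERIV_imp_deriv[OF 4] U(2) by auto
 show "(f has_real_derivative deriv f x) (at x)" "(deriv f has_real_derivative deriv f x * l x) (at x)"
 "(l has_real_derivative deriv l x) (at x)" using f 2 4 1 3 DERIV_imp_deriv[OF 4] U(2) by auto
qed

context turning
begin

definition xn1 :: "real => real" where "xn1 x = r x * H x powr (-1/3)"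
definition ln0 :: "real => real" where "ln0 x = r1 x / r x - H1 x / H x / 3"
definition ln1 :: "real => real" where
 "ln1 x = r2 x / r x - (r1 x / r x)\<^sup>2 - (H2 x / H x - (H1 x / H x)\<^sup>2) / 3"

lemma quotient_deriv:
 fixes f g :: "real => real"
 assumes "(f has_real_derivative f1) (at x)" "(g has_real_derivative gd) (at x)" "g x ~= 0"
 shows "((%x. f x / g x) has_real_derivative f1 / g x - f x / g x * (gd / g x)) (at x)"
 using DERIV_divide[OF assms] by (rule DERIV_cong) (use assms(3) in \<open>simp add: field_simps\<close>)

lemma xi_near_deriv:
 assumes x: "\<bar>x - x0\<bar> < 2 * d" shows "(xi has_real_derivative xn1 x) (at x)"
proof (rule has_field_derivative_transform_within_open[where S = nbhd])
 have h: "0 < H x" by (rule H_pos[OF x])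
 have "((%x. (x - x0) * H x powr (2/3)) has_real_derivative 1 * H x powr (2/3) + (2/3 * H x powr (2/3 - 1) * H1 x) * (x - x0)) (at x)"
 by (intro DERIV_mult DERIV_chain2[OF has_real_derivative_powr[OF h] H_deriv[OF x]]) (auto intro!: derivative_eq_intros)
 moreover have "1 * H x powr (2/3) + (2/3 * H x powr (2/3 - 1) * H1 x) * (x - x0) = xn1 x"
 proof -
 have "H x powr (2/3) = H x powr (-1/3) * H x" using powr_add[of "H x" "-1/3" 1] h by simp
 moreover have "H x powr (2/3 - 1) = H x powr (-1/3)" by simp
 ultimately have "1 * H x powr (2/3) + (2/3 * H x powr (2/3 - 1) * H1 x) * (x - x0) = H x powr (-1/3) * (H x + 2/3 * (x - x0) * H1 x)"
 by (simp add: distrib_left)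
 then show ?thesis unfolding xn1_def H_identity[OF x] by (simp only: mult.commute)
 qed
 ultimately show "((%x. (x - x0) * H x powr (2/3)) has_real_derivative xn1 x) (at x)" by (simp only:)
qed (use x xi_near in \<open>auto simp: abs_less_iff\<close>)

lemma xn1_pos: "\<bar>x - x0\<bar> < 2 * d ==> 0 < xn1 x"
 unfolding xn1_def using r_pos[of x] H_pos[of x] by (intro mult_pos_pos) auto

lemma xn1_deriv:
 assumes x: "\<bar>x - x0\<bar> < 2 * d" shows "(xn1 has_real_derivative xn1 x * ln0 x) (at x)"
proof -
 have h: "0 < H x" by (rule H_pos[OF x])
 have "(xn1 has_real_derivative r1 x * H x powr (-1/3) + (-1/3 * H x powr (-1/3 - 1) * H1 x) * r x) (at x)"
 unfolding xn1_def[abs_def] by (intro DERIV_mult r_deriv[OF x] DERIV_chain2[OF has_real_derivative_powr[OF h] H_deriv[OF x]])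
 moreover have "r1 x * H x powr (-1/3) + (-1/3 * H x powr (-1/3 - 1) * H1 x) * r x = xn1 x * ln0 x"
 proof -
 have p: "H x powr (-1/3 - 1) = H x powr (-1/3) / H x" using powr_diff[of "H x" "-1/3" 1] h by simp
 have "a * P + (-1/3 * (P / h) * c) * b = b * P * (a / b - c / h / 3)" if "0 < b" "0 < h" for a b c P h :: real using that by (simp add: field_simps)
 from this[OF r_pos[OF x] h] show ?thesis unfolding p xn1_def ln0_def .
 qed
 ultimately show ?thesis by (simp only:)
qed

lemma ln0_deriv:
 assumes x: "\<bar>x - x0\<bar> < 2 * d" shows "(ln0 has_real_derivative ln1 x) (at x)"
proof -
 have nz: "H x ~= 0" "r x ~= 0" using H_pos[OF x] r_pos[OF x] by auto
 have "(ln0 has_real_derivative (r2 x / r x - r1 x / r x * (r1 x / r x)) - (H2 x / H x - H1 x / H x * (H1 x / H x)) / 3) (at x)"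
 unfolding ln0_def[abs_def] by (intro DERIV_diff DERIV_cdivide quotient_deriv r1_deriv r_deriv H1_deriv H_deriv x nz)
 then show ?thesis unfolding ln1_def by (simp add: power2_eq_square)
qed

lemma nbhd_facts:
 assumes x: "\<bar>x - x0\<bar> < 2 * d"
 shows "\<bar>ln0 x\<bar> <= 2 * M ^ 3" "\<bar>ln1 x\<bar> <= 6 * M ^ 6" "1 / M\<^sup>2 <= xn1 x" "xn1 x <= M\<^sup>2"
proof -
 have rp: "0 < r x" and hp: "0 < H x" using r_pos[OF x] H_pos[OF x] .
 have ri: "1 / r x <= M" and hi: "1 / H x <= M" using r_bounds(1)[OF x] H_bounds(1)[OF x] rp hp M_pos by (auto simp: field_simps)
 have q: "\<bar>a / b\<bar> <= A * M" if "\<bar>a\<bar> <= A" "0 < b" "1 / b <= M" for a b A :: real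
 proof -
 have "\<bar>a\<bar> * (1 / b) <= A * M" using that by (intro mult_mono) auto
 then show ?thesis using that by (simp add: abs_divide)
 qed
 have 1: "\<bar>r1 x / r x\<bar> <= M\<^sup>2 * M" "\<bar>H1 x / H x\<bar> <= M\<^sup>2 * M" "\<bar>r2 x / r x\<bar> <= 2 * M ^ 5 * M" "\<bar>H2 x / H x\<bar> <= 2 * M ^ 5 * M"
 using q[OF r_bounds(3)[OF x] rp ri] q[OF H_bounds(3)[OF x] hp hi] q[OF r_bounds(4)[OF x] rp ri] q[OF H_bounds(4)[OF x] hp hi] by auto
 have m3: "M\<^sup>2 * M = M ^ 3" "2 * M ^ 5 * M = 2 * M ^ 6" by (auto simp: eval_nat_numeral)
 note 1 = 1[unfolded m3]
 have "\<bar>a - b / 3\<bar> <= 2 * T" if "\<bar>a\<bar> <= T" "\<bar>b\<bar> <= T" for a b T :: real using that by linarith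
 from this[OF 1(1,2)] show "\<bar>ln0 x\<bar> <= 2 * M ^ 3" unfolding ln0_def .
 have sq: "0 <= (r1 x / r x)\<^sup>2" "(r1 x / r x)\<^sup>2 <= M ^ 6" "0 <= (H1 x / H x)\<^sup>2" "(H1 x / H x)\<^sup>2 <= M ^ 6"
 using power_mono[OF 1(1) abs_ge_zero, of 2] power_mono[OF 1(2) abs_ge_zero, of 2] unfolding power2_abs power_mult[symmetric] by auto
 have "\<bar>a - b - (c - e) / 3\<bar> <= 6 * T" if "\<bar>a\<bar> <= 2 * T" "\<bar>c\<bar> <= 2 * T" "0 <= b" "b <= T" "0 <= e" "e <= T" for a b c e T :: real
 using that unfolding abs_le_iff diff_divide_distrib by (intro conjI; linarith)
 from this[OF 1(3,4) sq] show "\<bar>ln1 x\<bar> <= 6 * M ^ 6" unfolding ln1_def .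
 have "H x powr (-1/3) <= (1 / M) powr (-1/3)" using H_bounds(1)[OF x] M_pos by (intro powr_mono2') auto
 also have "... = M powr (1/3)" using M_pos by (simp add: powr_divide powr_minus inverse_eq_divide)
 also have "... <= M powr 1" using M by (intro powr_mono) auto
 finally have h1: "H x powr (-1/3) <= M" using M_pos by simp
 have "M powr (-1/3) <= H x powr (-1/3)" using H_bounds(2)[OF x] hp by (intro powr_mono2') auto
 moreover have "M powr (-1) <= M powr (-1/3)" using M by (intro powr_mono) auto
 ultimately have h2: "1 / M <= H x powr (-1/3)" using M_pos by (simp add: powr_minus inverse_eq_divide)
 have "1 / M * (1 / M) <= xn1 x" unfolding xn1_def using r_bounds(1)[OF x] h2 M_pos rp by (intro mult_mono) auto
 then show "1 / M\<^sup>2 <= xn1 x" by (simp add: power2_eq_square)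
 have "xn1 x <= M * M" unfolding xn1_def using r_bounds(2)[OF x] h1 M_pos rp by (intro mult_mono) auto
 then show "xn1 x <= M\<^sup>2" by (simp add: power2_eq_square)
qed

lemma S_deriv_right:
 assumes x: "x0 < x" shows "(S has_real_derivative sqrt (q x)) (at x)"
proof (rule has_field_derivative_transform_within_open[where S = "{x0<..}"])
 have "((%x. integral {x0..x} (%y. sqrt (q y))) has_vector_derivative sqrt (q x)) (at x within {x0..x + 1})"
 using x by (intro integral_has_vector_derivative continuous_intros cont_q) auto
 then have "((%x. integral {x0..x} (%y. sqrt (q y))) has_vector_derivative sqrt (q x)) (at x)" using x by (simp add: at_within_Icc_at)
 then show "((%x. integral {x0..x} (%y. sqrt (q y))) has_real_derivative sqrt (q x)) (at x)"
 by (simp add: has_real_derivative_iff_has_vector_derivative)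
qed (use x in \<open>auto simp: S_def\<close>)

lemma S_deriv_left:
 assumes x: "x < x0" shows "(S has_real_derivative - sqrt \<bar>q x\<bar>) (at x)"
proof (rule has_field_derivative_transform_within_open[where S = "{x - 1<..<x0}"])
 let ?f = "%y. sqrt \<bar>q y\<bar>"
 have i: "?f integrable_on {a..b}" for a b by (intro integrable_continuous_real continuous_intros cont_q)
 have "((%y. integral {x - 1..y} ?f) has_vector_derivative ?f x) (at x within {x - 1..x0})"
 using x by (intro integral_has_vector_derivative continuous_intros cont_q) auto
 then have "((%y. integral {x - 1..y} ?f) has_vector_derivative ?f x) (at x)" using x by (simp add: at_within_Icc_at)
 then have "((%y. integral {x - 1..y} ?f) has_real_derivative ?f x) (at x)" by (simp add: has_real_derivative_iff_has_vector_derivative)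
 from DERIV_diff[OF DERIV_const[of "integral {x - 1..x0} ?f"] this]
 show "((%y. integral {x - 1..x0} ?f - integral {x - 1..y} ?f) has_real_derivative - sqrt \<bar>q x\<bar>) (at x)" by simp
 fix y assume "y \<in> {x - 1<..<x0}"
 then have "integral {x - 1..y} ?f + integral {y..x0} ?f = integral {x - 1..x0} ?f" "\<not> x0 <= y"
 by (auto intro!: Henstock_Kurzweil_Integration.integral_combine i)
 then show "integral {x - 1..x0} ?f - integral {x - 1..y} ?f = S y" unfolding S_def by simp
qed (use x in auto)

lemma S_nonneg: "0 <= S x"
 unfolding S_def by (auto intro!: integral_nonneg integrable_continuous_real continuous_intros cont_q)
 (metis (no_types) less_eq_real_def q_pos q_x0)

lemma S_mono_right: assumes "x0 < x" "x <= y" shows "S x <= S y" by (rule DERIV_nonneg_mono[where f = S and f' = "%x. sqrt (q x)"])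
 (use assms in \<open>auto intro: S_deriv_right less_imp_le[OF q_pos]\<close>)

lemma S_mono_left: assumes "x <= y" "y < x0" shows "S y <= S x" by (rule DERIV_nonpos_mono[where f = S and f' = "%x. - sqrt \<bar>q x\<bar>"])
 (use assms in \<open>auto intro: S_deriv_left\<close>)

lemma S_pos: assumes "x ~= x0" shows "0 < S x"
proof -
 define y where "y = (if x0 < x then min x (x0 + d) else max x (x0 - d))"
 have y: "\<bar>y - x0\<bar> < 2 * d" "y ~= x0" using assms d_pos unfolding y_def by (auto simp: min_def max_def split: if_splits)
 have "0 < S y" unfolding S_near[OF y(1)] using y H_pos[OF y(1)] by simp
 also have "S y <= S x"
 proof (cases "x0 < x")
 case True
 then show ?thesis using d_pos unfolding y_def by (intro S_mono_right) auto
 next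
 case False
 then show ?thesis using d_pos assms unfolding y_def by (intro S_mono_left) auto
 qed
 finally show ?thesis .
qed

lemma xi_sign: "x0 < x ==> 0 < xi x" "x < x0 ==> xi x < 0"
 unfolding xi_def using S_pos[of x] by auto

text \<open>Away from the turning point xi xi'^2 = q can be solved for xi', and the logarithmic
  derivatives need only two derivatives of q, as many as \<open>v\<close> has there.\<close>

definition xf1 :: "real => real" where "xf1 x = sqrt (q x / xi x)"
definition lf0 :: "real => real" where "lf0 x = (q1 x / q x - xf1 x / xi x) / 2"
definition lf1 :: "real => real" where
 "lf1 x = (q2 x / q x - (q1 x / q x)\<^sup>2 - (lf0 x * (xf1 x / xi x) - (xf1 x / xi x)\<^sup>2)) / 2"

abbreviation "far \<equiv> {xl<..} - {x0}"

lemma q_xi_pos: "x \<in> far ==> 0 < q x / xi x" using q_pos[of x] neg[of x] xi_sign[of x] by (cases "x0 < x") (auto simp: divide_neg_neg)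

lemma xf1_pos: "x \<in> far ==> 0 < xf1 x" unfolding xf1_def using q_xi_pos by simp

lemma xi_far_deriv:
 assumes x: "x \<in> far" shows "(xi has_real_derivative xf1 x) (at x)"
proof (cases "x0 < x")
 case True
 have s: "0 < 3/2 * S x" using S_pos x by simp
 have "((%x. (3/2 * S x) powr (2/3)) has_real_derivative 2/3 * (3/2 * S x) powr (2/3 - 1) * (3/2 * sqrt (q x))) (at x)"
 by (rule DERIV_chain2[OF has_real_derivative_powr[OF s] DERIV_cmult[OF S_deriv_right[OF True]]])
 moreover have "2/3 * (3/2 * S x) powr (2/3 - 1) * (3/2 * sqrt (q x)) = xf1 x"
 proof -
 have "sqrt (xi x) = ((3/2 * S x) powr (2/3)) powr (1/2)" unfolding xi_def using True s by (simp add: powr_half_sqrt)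
 also have "... = (3/2 * S x) powr (1/3)" unfolding powr_powr by simp
 finally have sx: "sqrt (xi x) = (3/2 * S x) powr (1/3)" .
 have "(3/2 * S x) powr (2/3 - 1) = 1 / sqrt (xi x)" unfolding sx using s by (simp add: powr_minus inverse_eq_divide flip: minus_divide_left)
 then show ?thesis unfolding xf1_def by (simp add: real_sqrt_divide)
 qed
 ultimately have "((%x. (3/2 * S x) powr (2/3)) has_real_derivative xf1 x) (at x)" by (simp only:)
 then show ?thesis by (rule has_field_derivative_transform_within_open[where S = "{x0<..}"]) (use True in \<open>auto simp: xi_def\<close>)
next
 case False
 then have lt: "x < x0" using x by auto
 have s: "0 < 3/2 * S x" using S_pos x by simp
 have "((%x. - ((3/2 * S x) powr (2/3))) has_real_derivative - (2/3 * (3/2 * S x) powr (2/3 - 1) * (3/2 * (- sqrt \<bar>q x\<bar>)))) (at x)"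
 by (rule DERIV_minus[OF DERIV_chain2[OF has_real_derivative_powr[OF s] DERIV_cmult[OF S_deriv_left[OF lt]]]])
 moreover have "- (2/3 * (3/2 * S x) powr (2/3 - 1) * (3/2 * (- sqrt \<bar>q x\<bar>))) = xf1 x"
 proof -
 have "sqrt (- xi x) = ((3/2 * S x) powr (2/3)) powr (1/2)" unfolding xi_def using lt s by (simp add: powr_half_sqrt)
 also have "... = (3/2 * S x) powr (1/3)" unfolding powr_powr by simp
 finally have sx: "sqrt (- xi x) = (3/2 * S x) powr (1/3)" .
 have "(3/2 * S x) powr (2/3 - 1) = 1 / sqrt (- xi x)" unfolding sx using s by (simp add: powr_minus inverse_eq_divide flip: minus_divide_left)
 moreover have "q x / xi x = \<bar>q x\<bar> / (- xi x)" using neg[of x] x lt by simp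
 ultimately show ?thesis unfolding xf1_def by (simp add: real_sqrt_divide del: minus_divide_right minus_divide_left divide_minus_right)
 qed
 ultimately have "((%x. - ((3/2 * S x) powr (2/3))) has_real_derivative xf1 x) (at x)" by (simp only:)
 then show ?thesis by (rule has_field_derivative_transform_within_open[where S = "{..<x0}"]) (use lt in \<open>auto simp: xi_def\<close>)
qed

lemma far_nz: "x \<in> far ==> q x ~= 0 & xi x ~= 0" using q_xi_pos[of x] by auto

lemma xf1_deriv:
 assumes x: "x \<in> far" shows "(xf1 has_real_derivative xf1 x * lf0 x) (at x)"
proof -
 have p: "0 < q x / xi x" by (rule q_xi_pos[OF x])
 have d1: "((%x. q x / xi x) has_real_derivative q1 x / xi x - q x / xi x * (xf1 x / xi x)) (at x)"
 using far_nz[OF x] by (intro quotient_deriv q xi_far_deriv x) auto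
 have "(xf1 has_real_derivative inverse (sqrt (q x / xi x)) / 2 * (q1 x / xi x - q x / xi x * (xf1 x / xi x))) (at x)"
 unfolding xf1_def[abs_def] using DERIV_chain2[OF DERIV_real_sqrt[OF p] d1] unfolding xf1_def .
 moreover have "inverse (sqrt (q x / xi x)) / 2 * (q1 x / xi x - q x / xi x * (xf1 x / xi x)) = xf1 x * lf0 x"
 proof -
 have X: "0 < xf1 x" "q x / xi x = xf1 x * xf1 x" using xf1_pos[OF x] p unfolding xf1_def by (simp_all del: abs_divide)
 have e: "q1 x / xi x = (xf1 x * xf1 x) * (q1 x / q x)" unfolding X(2)[symmetric] using far_nz[OF x] by simp
 have "inverse X / 2 * ((X * X) * A - X * X * B) = X * ((A - B) / 2)" if "0 < X" for X A B :: real using that by (simp add: field_simps)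
 from this[OF X(1)] show ?thesis unfolding lf0_def e X(2) real_sqrt_abs2 abs_of_pos[OF X(1)] .
 qed
 ultimately show ?thesis by (simp only:)
qed

lemma lf0_deriv:
 assumes x: "x \<in> far" shows "(lf0 has_real_derivative lf1 x) (at x)"
proof -
 have "(lf0 has_real_derivative ((q2 x / q x - q1 x / q x * (q1 x / q x)) - ((xf1 x * lf0 x) / xi x - xf1 x / xi x * (xf1 x / xi x))) / 2) (at x)"
 unfolding lf0_def[abs_def] using far_nz[OF x]
 by (intro DERIV_diff DERIV_cdivide quotient_deriv q q1 xf1_deriv[OF x, unfolded lf0_def] xi_far_deriv x) (auto simp: lf0_def)
 then show ?thesis unfolding lf1_def by (simp add: power2_eq_square mult_ac)
qed

definition xi1 :: "real => real" where "xi1 = deriv xi"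
definition l :: "real => real" where "l = (%y. deriv xi1 y / xi1 y)"
definition l1 :: "real => real" where "l1 = deriv l"

lemma near_eq:
 assumes x: "\<bar>x - x0\<bar> < 2 * d"
 shows "xi1 x = xn1 x" "l x = ln0 x" "l1 x = ln1 x" "(xi has_real_derivative xi1 x) (at x)"
 "(xi1 has_real_derivative xi1 x * l x) (at x)" "(l has_real_derivative l1 x) (at x)"
 unfolding xi1_def l_def l1_def by (rule iterated_log_deriv[where U = nbhd and a = xn1 and b = ln0 and c = ln1];
 use x xi_near_deriv xn1_deriv ln0_deriv xn1_pos in \<open>auto simp: abs_less_iff\<close>)+

lemma far_eq:
 assumes x: "x \<in> far"
 shows "xi1 x = xf1 x" "l x = lf0 x" "l1 x = lf1 x" "(xi has_real_derivative xi1 x) (at x)"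
 "(xi1 has_real_derivative xi1 x * l x) (at x)" "(l has_real_derivative l1 x) (at x)"
proof -
 have o: "open far" by (intro open_Diff) auto
 show "xi1 x = xf1 x" "l x = lf0 x" "l1 x = lf1 x" "(xi has_real_derivative xi1 x) (at x)"
 "(xi1 has_real_derivative xi1 x * l x) (at x)" "(l has_real_derivative l1 x) (at x)"
 unfolding xi1_def l_def l1_def by (rule iterated_log_deriv[OF o x xi_far_deriv xf1_deriv lf0_deriv xf1_pos]; assumption)+
qed

lemma near_or_far: "x1 <= x ==> \<bar>x - x0\<bar> < 2 * d \<or> x \<in> far" using pts d_pos by auto

end

section \<open>Quantitative bounds on Langer's variable\<close>

context turning
begin

lemma xi_mono_right: assumes "x0 < x" "x <= y" shows "xi x <= xi y"
 unfolding xi_def using assms S_mono_right[OF assms] S_nonneg[of x] by (auto intro!: powr_mono2)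

lemma xi_mono_left: assumes "x <= y" "y < x0" shows "xi x <= xi y"
 unfolding xi_def using assms S_mono_left[OF assms] S_nonneg[of y] by (auto intro!: powr_mono2)

lemma edge:
 assumes x: "\<bar>x - x0\<bar> = d" shows "1 / M\<^sup>2 <= \<bar>xi x\<bar>"
proof -
 have n: "\<bar>x - x0\<bar> < 2 * d" using x d_pos by simp
 have "1 / M <= (1 / M) powr (2/3)" using powr_mono'[of "2/3" 1 "1 / M"] M by (simp add: divide_le_eq)
 also have "... <= H x powr (2/3)" using H_bounds(1)[OF n] M_pos by (intro powr_mono2) auto
 finally have "1 / M * (1 / M) <= d * H x powr (2/3)" using d d_pos M_pos by (intro mult_mono) auto
 then show ?thesis unfolding xi_near[OF n] using x by (simp add: abs_mult power2_eq_square)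
qed

lemma xi_ge: "x0 + d <= x ==> 1 / M\<^sup>2 <= xi x" using edge[of "x0 + d"] xi_mono_right[of "x0 + d" x] xi_sign(1)[of "x0 + d"] d_pos by auto

lemma xi_le: "x <= x0 - d ==> 1 / M\<^sup>2 <= - xi x" using edge[of "x0 - d"] xi_mono_left[of x "x0 - d"] xi_sign(2)[of "x0 - d"] d_pos by auto

lemma q_bounded_left: assumes "x1 <= x" "x <= x0" shows "\<bar>q x\<bar> <= M"
proof (cases "x <= x0 - d")
 case True
 have "0 < 1 / M" using M_pos by simp
 moreover have "- M <= q x" "q x <= - 1 / M" using left[OF assms(1) True] by auto
 ultimately show ?thesis unfolding minus_divide_left[symmetric] by linarith
next
 case False
 then have n: "\<bar>x - x0\<bar> < 2 * d" "\<bar>x - x0\<bar> <= 1" using assms(2) d(2) d_pos by linarith+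
 have "\<bar>g x\<bar> <= M" using g_bounds(2)[OF n(1)] g_pos[OF n(1)] by linarith
 then have "\<bar>x - x0\<bar> * \<bar>g x\<bar> <= 1 * M" by (rule mult_mono[OF n(2)]) auto
 then show ?thesis unfolding q_eq_g[OF n(1)] by (simp add: abs_mult)
qed

lemma xi_left_upper: assumes x: "x1 <= x" "x < x0" shows "- xi x <= 3/2 * M\<^sup>2"
proof -
 have "S x <= integral {x..x0} (%y. M)" unfolding S_def
 proof (simp only: if_not_P[of "x0 <= x"] not_le x, rule integral_le)
 show "(%y. sqrt \<bar>q y\<bar>) integrable_on {x..x0}" by (intro integrable_continuous_real continuous_intros cont_q)
 fix y assume "y \<in> {x..x0}"
 then have "\<bar>q y\<bar> <= M" using q_bounded_left[of y] x by auto
 moreover have "M <= M\<^sup>2" using M by (simp add: power2_eq_square)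
 ultimately show "sqrt \<bar>q y\<bar> <= M" using M by (intro real_le_lsqrt) auto
 qed auto
 also have "... = (x0 - x) * M" using x by simp
 also have "... <= M * M" using pts x M_pos by (intro mult_right_mono) auto
 finally have s: "3/2 * S x <= 3/2 * M\<^sup>2" by (simp add: power2_eq_square)
 have "1 <= M\<^sup>2" using M by simp
 then have b: "1 <= 3/2 * M\<^sup>2" by simp
 have "(3/2 * S x) powr (2/3) <= (3/2 * M\<^sup>2) powr (2/3)" using s S_nonneg[of x] by (intro powr_mono2) auto
 also have "... <= (3/2 * M\<^sup>2) powr 1" using b by (intro powr_mono) auto
 finally show ?thesis unfolding xi_def using x b by simp
qed

lemma Q_factor: assumes x: "x1 <= x" shows "q x = xi x * (xi1 x)\<^sup>2" using near_or_far[OF x]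
proof
 assume n: "\<bar>x - x0\<bar> < 2 * d"
 have h: "0 < H x" by (rule H_pos[OF n])
 have "H x powr (2/3) * (r x * H x powr (-1/3))\<^sup>2 = (r x)\<^sup>2 * (H x powr (2/3) * H x powr (-1/3) * H x powr (-1/3))"
 by (simp add: power2_eq_square)
 also have "H x powr (2/3) * H x powr (-1/3) * H x powr (-1/3) = 1" using h unfolding powr_add[symmetric] by simp
 finally have "H x powr (2/3) * (xn1 x)\<^sup>2 = g x" unfolding xn1_def using g_pos[OF n] by (simp add: r_def)
 then show ?thesis unfolding q_eq_g[OF n] xi_near[OF n] near_eq(1)[OF n] by simp
next
 assume f: "x \<in> far"
 have "(xf1 x)\<^sup>2 = q x / xi x" unfolding xf1_def using q_xi_pos[OF f] by (simp del: abs_divide)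
 then show ?thesis unfolding far_eq(1)[OF f] using far_nz[OF f] by simp
qed

lemma xi1_pos: assumes "x1 <= x" shows "0 < xi1 x" using near_or_far[OF assms]
proof
 assume "\<bar>x - x0\<bar> < 2 * d"
 then show ?thesis using near_eq(1)[of x] xn1_pos[of x] by (simp only:)
next
 assume "x \<in> far"
 then show ?thesis using far_eq(1)[of x] xf1_pos[of x] by (simp only:)
qed

lemma left_far:
 assumes x: "x1 <= x" "x <= x0 - d"
 shows "\<bar>l x\<bar> <= M ^ 4" "\<bar>l1 x\<bar> <= 2 * M ^ 8" "1 / (2 * M\<^sup>2) <= xi1 x" "xi1 x <= M\<^sup>2"
proof -
 have f: "x \<in> far" and lt: "x < x0" using x pts d_pos by auto
 have n: "q x < 0" "xi x < 0" using neg[of x] xi_sign(2)[OF lt] f lt by auto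
 have xu: "- xi x <= 3/2 * M\<^sup>2" by (rule xi_left_upper[OF x(1) lt])
 have xl: "1 / (- xi x) <= M\<^sup>2" using xi_le[OF x(2)] n M_pos by (simp add: field_simps)
 have qb: "- q x <= M" "1 / M <= - q x" "\<bar>q1 x\<bar> <= M" "\<bar>q2 x\<bar> <= M" using left[OF x] by auto
 have qi: "1 / (- q x) <= M" using qb(2) n M_pos by (simp add: field_simps)
 have e: "q x / xi x = (- q x) * (1 / (- xi x))" by simp
 have m3: "M * M\<^sup>2 <= (M\<^sup>2)\<^sup>2" unfolding power_mult[symmetric] using power_increasing[of 3 4 M] M by (simp add: eval_nat_numeral)
 have "q x / xi x <= M * M\<^sup>2" unfolding e using qb xl n M_pos by (intro mult_mono) auto
 then have X: "xf1 x <= M\<^sup>2" unfolding xf1_def using m3 by (intro real_le_lsqrt) auto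
 have "2/3 / M\<^sup>2 <= 1 / (- xi x)" using xu n M_pos by (simp add: field_simps)
 then have "1 / M * (2/3 / M\<^sup>2) <= q x / xi x" unfolding e using qb M_pos n by (intro mult_mono) auto
 moreover have "(1 / (2 * M\<^sup>2))\<^sup>2 <= 1 / M * (2/3 / M\<^sup>2)"
 proof -
 have "(1 / (2 * M\<^sup>2))\<^sup>2 = (1/4) / (M\<^sup>2)\<^sup>2" by (simp add: power2_eq_square)
 also have "... <= (2/3) / (M * M\<^sup>2)" using m3 M_pos by (intro frac_le) auto
 finally show ?thesis by simp
 qed
 ultimately have X2: "1 / (2 * M\<^sup>2) <= xf1 x" unfolding xf1_def by (intro real_le_rsqrt) linarith
 then show "1 / (2 * M\<^sup>2) <= xi1 x" "xi1 x <= M\<^sup>2" using X far_eq(1)[OF f] by auto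
 have Xp: "0 < xf1 x" by (rule xf1_pos[OF f])
 have "xf1 x * (1 / (- xi x)) <= M\<^sup>2 * M\<^sup>2" using X xl n Xp by (intro mult_mono) auto
 moreover have "\<bar>xf1 x / xi x\<bar> = xf1 x * (1 / (- xi x))" using Xp n by (simp add: abs_divide)
 moreover have m4: "M\<^sup>2 * M\<^sup>2 = M ^ 4" by (simp flip: power_add)
 ultimately have D: "\<bar>xf1 x / xi x\<bar> <= M ^ 4" by linarith
 have "\<bar>q1 x\<bar> * (1 / (- q x)) <= M * M" "\<bar>q2 x\<bar> * (1 / (- q x)) <= M * M" using qb qi n by (intro mult_mono; auto)+
 then have A: "\<bar>q1 x / q x\<bar> <= M\<^sup>2" "\<bar>q2 x / q x\<bar> <= M\<^sup>2" using n by (auto simp: abs_divide power2_eq_square)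
 have pw: "M\<^sup>2 <= M ^ 4" "M\<^sup>2 <= M ^ 8" "M ^ 4 <= M ^ 8" using M by (auto intro!: power_increasing)
 have "\<bar>(a - b) / 2\<bar> <= T" if "\<bar>a\<bar> <= R" "\<bar>b\<bar> <= T" "R <= T" for a b R T :: real
 using that unfolding abs_le_iff diff_divide_distrib by (intro conjI; linarith)
 from this[OF A(1) D pw(1)] have L: "\<bar>lf0 x\<bar> <= M ^ 4" unfolding lf0_def .
 then show "\<bar>l x\<bar> <= M ^ 4" using far_eq(2)[OF f] by simp
 have m8: "M ^ 4 * M ^ 4 = M ^ 8" "(M ^ 4)\<^sup>2 = M ^ 8" "(M\<^sup>2)\<^sup>2 = M ^ 4" by (auto simp flip: power_add power_mult)
 have "\<bar>lf0 x\<bar> * \<bar>xf1 x / xi x\<bar> <= M ^ 8" using mult_mono[OF L D] M_pos unfolding m8 by simp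
 then have s1: "\<bar>lf0 x * (xf1 x / xi x)\<bar> <= M ^ 8" by (simp only: abs_mult)
 have s2: "(xf1 x / xi x)\<^sup>2 <= M ^ 8" using power_mono[OF D abs_ge_zero, of 2] unfolding power2_abs m8 .
 have s3: "(q1 x / q x)\<^sup>2 <= M ^ 4" using power_mono[OF A(1) abs_ge_zero, of 2] unfolding power2_abs m8 .
 have "\<bar>(e - a - (b - c)) / 2\<bar> <= 2 * T" if "\<bar>e\<bar> <= T1" "T1 <= T" "0 <= a" "a <= T2" "T2 <= T" "\<bar>b\<bar> <= T" "0 <= c" "c <= T" for a b c e T T1 T2 :: real
 using that unfolding abs_le_iff diff_divide_distrib by (intro conjI; linarith)
 from this[OF A(2) pw(2) zero_le_power2 s3 pw(3) s1 zero_le_power2 s2] have "\<bar>lf1 x\<bar> <= 2 * M ^ 8" unfolding lf1_def .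
 then show "\<bar>l1 x\<bar> <= 2 * M ^ 8" using far_eq(3)[OF f] by simp
qed

lemma S_eq_xi: assumes "x0 <= x" shows "S x = 2/3 * xi x powr (3/2)"
proof -
 have "xi x powr (3/2) = (3/2 * S x) powr (2/3 * (3/2))" unfolding xi_def using assms by (simp only: if_True powr_powr)
 then show ?thesis using S_nonneg[of x] by simp
qed

text \<open>The action is 2/3 xi^(3/2), so decay of order \<open>kap\<close> in the action is decay
  of order 3/2 kap in \<open>xi\<close>. The constant 36 is 6^2 with kap <= 2.\<close>

lemma weight_bound:
 assumes x: "x0 <= x"
 shows "(1 + S x) powr (- kap) <= 36 * (1 + xi x) powr (- (3/2) * kap)"
proof -
 have t: "0 <= xi x" unfolding xi_def using x by simp
 have w8: "(2::real) powr (3/2) <= 4"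
 proof -
 have "(2::real) powr (3/2) <= 2 powr 2" by (intro powr_mono) auto
 then show ?thesis by simp
 qed
 have "(1 + xi x) powr (3/2) / 6 <= 1 + S x"
 proof (cases "xi x <= 1")
 case True
 have "(1 + xi x) powr (3/2) <= 2 powr (3/2)" using True t by (intro powr_mono2) auto
 then show ?thesis using w8 S_nonneg[of x] by simp
 next
 case False
 have "(1 + xi x) powr (3/2) <= (2 * xi x) powr (3/2)" using False t by (intro powr_mono2) auto
 also have "... = 2 powr (3/2) * xi x powr (3/2)" by (simp add: powr_mult)
 also have "... <= 4 * xi x powr (3/2)" using w8 by (intro mult_right_mono) auto
 finally show ?thesis unfolding S_eq_xi[OF x] by simp
 qed
 then have "(1 + S x) powr (- kap) <= ((1 + xi x) powr (3/2) / 6) powr (- kap)" using kap t by (intro powr_mono2') auto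
 also have "... = 6 powr kap * (1 + xi x) powr (- (3/2) * kap)" by (simp add: powr_divide powr_powr powr_minus_divide[of 6])
 also have "... <= 6 powr 2 * (1 + xi x) powr (- (3/2) * kap)" using kap by (intro mult_right_mono powr_mono) auto
 finally show ?thesis by simp
qed

text \<open>In terms of q the perturbation is 5/16 (q'/q)^2 - q''/(4 q) - 5/16 (xi'/xi)^2. The
  assumed decay bounds the first two terms by q times the action weight, and q = xi xi'^2; the last
  term is intrinsic to Langer's variable.\<close>

lemma right_far:
 assumes x: "x0 + d <= x"
 shows "\<bar>l x\<bar> <= M\<^sup>2 * xi1 x * sqrt (1 + xi x)"
 "\<bar>(l x)\<^sup>2 / 4 - l1 x / 2\<bar> <= 76 * M ^ 4 * (xi1 x)\<^sup>2 * (1 + xi x) powr (1 - 3/2 * kap)"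
proof -
 have f: "x \<in> far" and gt: "x0 < x" using x pts d_pos by auto
 define X where "X = xi x"
 define Y where "Y = xi1 x"
 define W where "W = (1 + X) powr (1 - 3/2 * kap)"
 have Xp: "0 < X" unfolding X_def by (rule xi_sign(1)[OF gt])
 have Yp: "0 < Y" unfolding Y_def far_eq(1)[OF f] by (rule xf1_pos[OF f])
 have qp: "0 < q x" by (rule q_pos[OF gt])
 have qX: "q x = X * Y\<^sup>2" unfolding X_def Y_def using x pts d_pos by (intro Q_factor) auto
 have Xi: "1 / X <= M\<^sup>2" using xi_ge[OF x] Xp M_pos unfolding X_def by (simp add: field_simps)
 have Z: "1 + integral {x0..x} (%y. sqrt (q y)) = 1 + S x" unfolding S_def using gt by simp
 have z1: "(1 + S x) powr (- kap) <= 1" using S_nonneg[of x] kap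
 powr_mono[of "- kap" 0 "1 + S x"] by (auto split: if_splits)
 have zW: "X * (1 + S x) powr (- kap) <= 36 * W"
 proof -
 have "X * (1 + S x) powr (- kap) <= (1 + X) * (36 * (1 + X) powr (- (3/2) * kap))"
 using weight_bound[of x] gt Xp unfolding X_def by (intro mult_mono) auto
 also have "... = 36 * W" unfolding W_def using powr_add[of "1 + X" 1 "- (3/2) * kap"] Xp by simp
 finally show ?thesis .
 qed
 have dc: "(q1 x)\<^sup>2 <= M * (q x) ^ 3 * (1 + S x) powr (- kap)" "\<bar>q2 x\<bar> <= M * (q x)\<^sup>2 * (1 + S x) powr (- kap)"
 using decay[OF x] unfolding Z by auto
 have A2: "(q1 x / q x)\<^sup>2 <= M * q x * (1 + S x) powr (- kap)"
 proof -
 have "a / b\<^sup>2 <= m * b * z" if "a <= m * b ^ 3 * z" "0 < b" for a b m z :: real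
 using that by (simp add: divide_le_eq eval_nat_numeral mult_ac)
 from this[OF dc(1) qp] show ?thesis by (simp add: power_divide)
 qed
 have E: "\<bar>q2 x / q x\<bar> <= M * q x * (1 + S x) powr (- kap)"
 proof -
 have "a / b <= m * b * z" if "a <= m * b\<^sup>2 * z" "0 < b" for a b m z :: real using that by (simp add: divide_le_eq power2_eq_square mult_ac)
 from this[OF dc(2) qp] show ?thesis using qp by (simp add: abs_divide)
 qed
 have qW: "M * q x * (1 + S x) powr (- kap) <= 36 * M ^ 4 * Y\<^sup>2 * W"
 proof -
 have "M * q x * (1 + S x) powr (- kap) = M * Y\<^sup>2 * (X * (1 + S x) powr (- kap))" unfolding qX by (simp add: mult_ac)
 also have "... <= M * Y\<^sup>2 * (36 * W)" using zW M_pos by (intro mult_left_mono) auto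
 also have "... <= M ^ 4 * Y\<^sup>2 * (36 * W)" using power_increasing[of 1 4 M] M unfolding W_def by (intro mult_right_mono) auto
 finally show ?thesis by (simp add: mult_ac)
 qed
 \<comment> \<open>(xi'/xi)^2 decays only like xi^(-2), whatever the potential. It fits under the
   power 1 - 3/2 kap exactly when kap <= 2: this is the origin of the cap in
   \<open>\<rho>\<close>.\<close>
 have DW: "(Y / X)\<^sup>2 <= 4 * M ^ 4 * Y\<^sup>2 * W"
 proof -
 have "(1 + X) * (1 / X) <= 2 * M\<^sup>2"
 proof -
 have "(1 + X) * (1 / X) = 1 / X + 1" using Xp by (simp add: field_simps)
 moreover have "1 <= M\<^sup>2" using M by simp
 ultimately show ?thesis using Xi by linarith
 qed
 then have "((1 + X) * (1 / X))\<^sup>2 <= (2 * M\<^sup>2)\<^sup>2" using Xp by (intro power_mono) auto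
 also have "(2 * M\<^sup>2)\<^sup>2 = 4 * M ^ 4" by (simp add: power_mult_distrib flip: power_mult)
 finally have "1 / X\<^sup>2 <= 4 * M ^ 4 * (1 / (1 + X)\<^sup>2)" using Xp by (simp add: power_mult_distrib power_divide field_simps)
 also have "1 / (1 + X)\<^sup>2 = (1 + X) powr (-2)" using Xp by (simp add: powr_minus inverse_eq_divide)
 also have "4 * M ^ 4 * ... <= 4 * M ^ 4 * W" unfolding W_def using kap Xp M_pos by (intro mult_left_mono powr_mono) auto
 finally have "Y\<^sup>2 * (1 / X\<^sup>2) <= Y\<^sup>2 * (4 * M ^ 4 * W)" by (intro mult_left_mono) auto
 then show ?thesis by (simp add: power_divide mult_ac)
 qed
 have lx: "l x = (q1 x / q x - Y / X) / 2" and l1x: "l1 x = (q2 x / q x - (q1 x / q x)\<^sup>2 - (l x * (Y / X) - (Y / X)\<^sup>2)) / 2"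
 unfolding far_eq[OF f] Y_def X_def lf1_def lf0_def by simp_all
 have "((A - D) / 2)\<^sup>2 / 4 - ((E - A\<^sup>2 - ((A - D) / 2 * D - D\<^sup>2)) / 2) / 2 = 5/16 * A\<^sup>2 - E / 4 - 5/16 * D\<^sup>2" for A D E :: real
 by (simp add: power2_eq_square field_simps)
 from this[of "q1 x / q x" "Y / X" "q2 x / q x"]
 have p: "(l x)\<^sup>2 / 4 - l1 x / 2 = 5/16 * (q1 x / q x)\<^sup>2 - q2 x / q x / 4 - 5/16 * (Y / X)\<^sup>2" unfolding l1x unfolding lx .
 have "\<bar>5/16 * A - E / 4 - 5/16 * D\<bar> <= 76 * M ^ 4 * Y\<^sup>2 * W"
 if "0 <= A" "A <= T" "\<bar>E\<bar> <= T" "0 <= D" "T <= 36 * M ^ 4 * Y\<^sup>2 * W" "D <= 4 * M ^ 4 * Y\<^sup>2 * W" for A D E T :: real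
 using that by linarith
 from this[OF zero_le_power2 A2 E zero_le_power2 qW DW]
 show "\<bar>(l x)\<^sup>2 / 4 - l1 x / 2\<bar> <= 76 * M ^ 4 * (xi1 x)\<^sup>2 * (1 + xi x) powr (1 - 3/2 * kap)"
 unfolding p unfolding Y_def X_def W_def .
 have "(q1 x / q x)\<^sup>2 <= M * q x * 1" by (rule order_trans[OF A2]) (use z1 M_pos qp in \<open>intro mult_left_mono, auto\<close>)
 also have "... <= M\<^sup>2 * ((1 + X) * Y\<^sup>2)"
 unfolding qX mult_1_right using M Xp by (intro mult_mono) (auto simp: power2_eq_square[of M] intro!: mult_right_mono)
 also have "... = (M * (Y * sqrt (1 + X)))\<^sup>2" using Xp by (simp add: power_mult_distrib)
 finally have a: "\<bar>q1 x / q x\<bar> <= M * (Y * sqrt (1 + X))"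
 unfolding abs_le_square_iff[symmetric] using Yp Xp M_pos by (simp only: abs_of_nonneg[OF mult_nonneg_nonneg[OF less_imp_le mult_nonneg_nonneg[OF less_imp_le]]] real_sqrt_ge_zero add_nonneg_nonneg zero_le_one less_imp_le)
 have "Y * (1 / X) <= Y * M\<^sup>2" using Xi Yp by (intro mult_left_mono) auto
 also have "Y * M\<^sup>2 = M\<^sup>2 * (Y * 1)" by simp
 also have "... <= M\<^sup>2 * (Y * sqrt (1 + X))" using Xp Yp M_pos by (intro mult_left_mono) auto
 finally have b: "\<bar>Y / X\<bar> <= M\<^sup>2 * (Y * sqrt (1 + X))" using Yp Xp by (simp add: abs_divide)
 have c: "M * (Y * sqrt (1 + X)) <= M\<^sup>2 * (Y * sqrt (1 + X))" using M Yp Xp by (intro mult_right_mono) (auto simp: power2_eq_square)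
 have "\<bar>(a - b) / 2\<bar> <= T" if "\<bar>a\<bar> <= R" "\<bar>b\<bar> <= T" "R <= T" for a b R T :: real
 using that unfolding abs_le_iff diff_divide_distrib by (intro conjI; linarith)
 from this[OF a b c] show "\<bar>l x\<bar> <= M\<^sup>2 * xi1 x * sqrt (1 + xi x)" unfolding lx unfolding Y_def X_def by (simp only: mult.assoc)
qed

lemma near_right:
 assumes x: "x0 <= x" "x < x0 + 2 * d"
 shows "\<bar>l x\<bar> <= 2 * M ^ 5 * xi1 x * sqrt (1 + xi x)"
 "\<bar>(l x)\<^sup>2 / 4 - l1 x / 2\<bar> <= 36 * M ^ 12 * (xi1 x)\<^sup>2 * (1 + xi x) powr (1 - 3/2 * kap)"
proof -
 have n: "\<bar>x - x0\<bar> < 2 * d" using x by simp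
 note nf = nbhd_facts[OF n] and ne = near_eq(1-3)[OF n]
 have t: "0 <= xi x" unfolding xi_def using x by simp
 have y: "1 <= M\<^sup>2 * xi1 x" using nf(3) M_pos unfolding ne by (simp add: field_simps)
 have "\<bar>l x\<bar> <= 2 * M ^ 3 * 1 * 1" using nf(1) unfolding ne by simp
 also have "... <= 2 * M ^ 3 * (M\<^sup>2 * xi1 x) * sqrt (1 + xi x)" using y t M_pos by (intro mult_mono) auto
 also have "... = 2 * (M ^ 3 * M\<^sup>2) * xi1 x * sqrt (1 + xi x)" by (simp only: mult.assoc)
 also have "M ^ 3 * M\<^sup>2 = M ^ 5" by (simp flip: power_add)
 finally show "\<bar>l x\<bar> <= 2 * M ^ 5 * xi1 x * sqrt (1 + xi x)" .
 have "H x powr (2/3) <= M powr (2/3)" using H_bounds[OF n] H_pos[OF n] by (intro powr_mono2) auto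
 also have "... <= M powr 1" using M by (intro powr_mono) auto
 finally have "(x - x0) * H x powr (2/3) <= 2 * M" using x d M_pos by (intro mult_mono) auto
 then have "1 + xi x <= 3 * M" unfolding xi_near[OF n] using M by simp
 then have "(1 + xi x)\<^sup>2 <= (3 * M)\<^sup>2" using t by (intro power_mono) auto
 then have "1 / (9 * M\<^sup>2) <= 1 / (1 + xi x)\<^sup>2" using t M_pos by (intro frac_le) (auto simp: power_mult_distrib)
 also have "... = (1 + xi x) powr (-2)" using t by (simp add: powr_minus inverse_eq_divide)
 also have "... <= (1 + xi x) powr (1 - 3/2 * kap)" using kap t by (intro powr_mono) auto
 finally have w: "1 <= 9 * M\<^sup>2 * (1 + xi x) powr (1 - 3/2 * kap)" using M_pos by (simp add: field_simps)
 have y2: "1 <= (M\<^sup>2 * xi1 x)\<^sup>2" using y by simp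
 have "(l x)\<^sup>2 <= 4 * M ^ 6" using power_mono[OF nf(1) abs_ge_zero, of 2] unfolding power2_abs ne
 by (simp add: power_mult_distrib flip: power_mult)
 moreover have "\<bar>l1 x\<bar> <= 6 * M ^ 6" using nf(2) unfolding ne .
 moreover have "\<bar>a / 4 - b / 2\<bar> <= 4 * T" if "a <= 4 * T" "0 <= a" "\<bar>b\<bar> <= 6 * T" for a b T :: real using that by linarith
 ultimately have "\<bar>(l x)\<^sup>2 / 4 - l1 x / 2\<bar> <= 4 * M ^ 6 * 1 * 1" by simp
 also have "... <= 4 * M ^ 6 * (M\<^sup>2 * xi1 x)\<^sup>2 * (9 * M\<^sup>2 * (1 + xi x) powr (1 - 3/2 * kap))"
 using w y2 M_pos by (intro mult_mono) auto
 also have "... = 36 * M ^ 12 * (xi1 x)\<^sup>2 * (1 + xi x) powr (1 - 3/2 * kap)"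
 proof -
 have "4 * a * (b\<^sup>2 * y) * (9 * c * w) = 36 * (a * b\<^sup>2 * c) * y * w" for a b c y w :: real by simp
 moreover have "M ^ 6 * (M\<^sup>2)\<^sup>2 * M\<^sup>2 = M ^ 12" by (simp flip: power_mult power_add)
 ultimately show ?thesis unfolding power_mult_distrib by (simp only:)
 qed
 finally show "\<bar>(l x)\<^sup>2 / 4 - l1 x / 2\<bar> <= 36 * M ^ 12 * (xi1 x)\<^sup>2 * (1 + xi x) powr (1 - 3/2 * kap)" .
qed

lemma xi_at_top: "filterlim xi at_top at_top"
proof -
 have ev: "eventually (%x. (3/2 * ((x - (x0 + d)) / M)) powr (2/3) <= xi x) at_top" using eventually_ge_at_top[of "x0 + d"]
 proof eventually_elim
 case (elim x)
 have "S (x0 + d) - (x0 + d) / M <= S x - x / M"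
 proof (rule DERIV_nonneg_mono[where f = "%x. S x - x / M" and f' = "%x. sqrt (q x) - 1 / M"])
 fix y assume "y \<in> {x0 + d..x}"
 then have y: "x0 + d <= y" "y <= x" by auto
 show "((%x. S x - x / M) has_real_derivative sqrt (q y) - 1 / M) (at y)"
 using S_deriv_right[of y] y d_pos M_pos by (auto intro!: derivative_eq_intros)
 have "(1 / M)\<^sup>2 <= 1 / M" using M by (simp add: power2_eq_square field_simps)
 then show "0 <= sqrt (q y) - 1 / M" using right[OF y(1)] by (simp add: real_le_rsqrt)
 qed (use elim in auto)
 then have "(x - (x0 + d)) / M <= S x" using S_nonneg[of "x0 + d"] by (simp add: diff_divide_distrib)
 then have "(3/2 * ((x - (x0 + d)) / M)) powr (2/3) <= (3/2 * S x) powr (2/3)"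
 using elim M_pos by (intro powr_mono2 mult_left_mono mult_nonneg_nonneg divide_nonneg_pos) auto
 then show ?case unfolding xi_def using elim d_pos by simp
 qed
 have "filterlim (%x. (3/2 * ((x - (x0 + d)) / M)) powr (2/3)) at_top at_top" using M_pos by real_asymp
 from filterlim_at_top_mono[OF this ev] show ?thesis .
qed

lemma langer_geometry: "langer (100 * M ^ 12) (3/2 * (kap - 1)) x1 x0 q xi xi1 l l1"
proof -
 define K where "K = 100 * M ^ 12"
 have pw: "1 <= M ^ n" for n using M by simp
 have K0: "1 <= K" "0 < K" unfolding K_def using pw[of 12] by auto
 \<comment> \<open>Every constant of the preceding bounds has the form c M^n with c <= 100 and n <=
   12, so one \<open>K\<close> covers all of them.\<close>
 have Kn: "c * M ^ n <= K" if "c <= 100" "0 <= c" "n <= 12" for c n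
 unfolding K_def using that power_increasing[OF that(3) M] M_pos by (intro mult_mono) auto
 have Ki: "1 / K <= 1 / (c * M ^ n)" if "c <= 100" "0 < c" "n <= 12" for c n using Kn[of c n] that M_pos by (intro frac_le) auto
 have KM: "M <= K" "1 / K <= 1 / M" using Kn[of 1 1] Ki[of 1 1] by auto
 have dK: "1 / K < 2 * d" using KM d d_pos by linarith
 have "langer K (3/2 * (kap - 1)) x1 x0 q xi xi1 l l1"
 proof
 show "1 <= K" "0 < 3/2 * (kap - 1)" using K0 kap by auto
 show "1 / K <= x0 - x1" "x0 - x1 <= K" using KM d pts by linarith+
 fix x assume x: "x1 <= x"
 show "(xi has_real_derivative xi1 x) (at x)" "(xi1 has_real_derivative xi1 x * l x) (at x)" "(l has_real_derivative l1 x) (at x)"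
 using near_or_far[OF x] near_eq(4-6)[of x] far_eq(4-6)[of x] by blast+
 show "0 < xi1 x" "q x = xi x * (xi1 x)\<^sup>2" using xi1_pos[OF x] Q_factor[OF x] by auto
 next
 show "xi x0 = 0" unfolding xi_def S_def by simp
 show "filterlim xi at_top at_top" by (rule xi_at_top)
 next
 fix x assume x: "x0 <= x"
 have t: "0 <= xi x" unfolding xi_def using x by simp
 have y: "0 < xi1 x" using xi1_pos[of x] x pts d_pos by auto
 have e: "- (3/2 * (kap - 1)) - 1/2 = 1 - 3/2 * kap" by (simp add: field_simps)
 have "\<exists>c n. \<bar>l x\<bar> <= c * M ^ n * xi1 x * sqrt (1 + xi x) & c <= 100 & 0 <= c & n <= 12"
 using near_right(1)[OF x] right_far(1)[of x] d_pos
 by (cases "x < x0 + 2 * d") (fastforce intro: exI[of _ 2] exI[of _ 5], fastforce intro: exI[of _ 1] exI[of _ 2])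
 then obtain c n where c: "\<bar>l x\<bar> <= c * M ^ n * xi1 x * sqrt (1 + xi x)" "c <= 100" "0 <= c" "n <= 12" by blast
 show "\<bar>l x\<bar> <= K * xi1 x * sqrt (1 + xi x)"
 by (rule order_trans[OF c(1)]) (use Kn[OF c(2-4)] y t in \<open>intro mult_right_mono, auto\<close>)
 have "\<exists>c n. \<bar>(l x)\<^sup>2 / 4 - l1 x / 2\<bar> <= c * M ^ n * (xi1 x)\<^sup>2 * (1 + xi x) powr (1 - 3/2 * kap) & c <= 100 & 0 <= c & n <= 12"
 proof (cases "x < x0 + 2 * d")
 case True
 from near_right(2)[OF x True] show ?thesis by (intro exI[of _ 36] exI[of _ 12]) auto
 next
 case False
 with right_far(2)[of x] d_pos show ?thesis by (intro exI[of _ 76] exI[of _ 4]) auto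
 qed
 then obtain c n where c: "\<bar>(l x)\<^sup>2 / 4 - l1 x / 2\<bar> <= c * M ^ n * (xi1 x)\<^sup>2 * (1 + xi x) powr (1 - 3/2 * kap)" "c <= 100" "0 <= c" "n <= 12" by blast
 show "\<bar>(l x)\<^sup>2 / 4 - l1 x / 2\<bar> <= K * (xi1 x)\<^sup>2 * (1 + xi x) powr (- (3/2 * (kap - 1)) - 1/2)" unfolding e
 by (rule order_trans[OF c(1)]) (use Kn[OF c(2-4)] y t in \<open>intro mult_right_mono, auto\<close>)
 show "min (x - x0) 1 / K <= q x"
 proof (cases "x < x0 + 2 * d")
 case True
 then have n: "\<bar>x - x0\<bar> < 2 * d" using x by simp
 have "min (x - x0) 1 * (1 / K) <= (x - x0) * g x" using g_bounds(1)[OF n] KM x K0 by (intro mult_mono) auto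
 then show ?thesis unfolding q_eq_g[OF n] by simp
 next
 case False
 then have "1 / M <= q x" using right[of x] d_pos by auto
 moreover have "min (x - x0) 1 / K <= 1 / K" using K0 by (intro divide_right_mono) auto
 ultimately show ?thesis using KM by linarith
 qed
 next
 fix x assume x: "x1 <= x" "x <= x0"
 have "\<bar>l x\<bar> <= K & \<bar>l1 x\<bar> <= K"
 proof (cases "x <= x0 - d")
 case True
 show ?thesis using left_far(1,2)[OF x(1) True] Kn[of 1 4] Kn[of 2 8] by auto
 next
 case False
 then have n: "\<bar>x - x0\<bar> < 2 * d" using x d_pos by simp
 show ?thesis using nbhd_facts(1,2)[OF n] near_eq(2,3)[OF n] Kn[of 2 3] Kn[of 6 6] by auto
 qed
 then show "\<bar>l x\<bar> <= K & \<bar>l1 x\<bar> <= K" .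
 next
 fix x assume x: "x1 <= x" "x <= x0 + 1 / K"
 have "1 / K <= xi1 x & xi1 x <= K"
 proof (cases "x <= x0 - d")
 case True
 show ?thesis using left_far(3,4)[OF x(1) True] Kn[of 1 2] Ki[of 2 2] by auto
 next
 case False
 then have n: "\<bar>x - x0\<bar> < 2 * d" using x dK d_pos by simp
 show ?thesis using nbhd_facts(3,4)[OF n] near_eq(1)[OF n] Kn[of 1 2] Ki[of 1 2] by auto
 qed
 then show "1 / K <= xi1 x & xi1 x <= K" .
 qed
 then show ?thesis unfolding K_def .
qed

end

section \<open>Uniform geometric data from Assumptions A and B\<close>

lemma interval_integral_continuous:
 fixes f :: "real => real"
 assumes "a <= b" "continuous_on {a..b} f"
 shows "(LBINT y=a..b. f y) = integral {a..b} f" using assms by (intro interval_integral_eq_integral borel_integrable_atLeastAtMost') auto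

lemma integral_le_const:
 fixes f :: "real => real"
 assumes "a <= b" "continuous_on {a..b} f" "!!x. x \<in> {a..b} ==> f x <= c"
 shows "integral {a..b} f <= (b - a) * c"
proof -
 have "integral {a..b} f <= integral {a..b} (%x. c)" using assms by (intro integral_le integrable_continuous_real) auto
 then show ?thesis using assms(1) by simp
qed

lemma compact_bound:
 fixes f :: "real => real"
 assumes "continuous_on {a..b} f" shows "\<exists>C\<ge>0. \<forall>x\<in>{a..b}. \<bar>f x\<bar> <= C"
proof -
 have "bounded (f ` {a..b})" by (intro compact_imp_bounded compact_continuous_image assms) auto
 then obtain C where "\<forall>y\<in>f ` {a..b}. norm y <= C" unfolding bounded_iff by blast
 then show ?thesis by (intro exI[of _ "max C 0"]) (auto simp: le_max_iff_disj)
qed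

text \<open>Assumption A holds at \<open>lam0\<close> with the action counted from 0; what is
  required holds for nearby \<open>lam\<close> with the action counted from a moving turning point.
  On a compact range everything is bounded. Far out v - lam and v - lam0 are comparable, and the two
  actions differ by bounded factors and terms.\<close>

lemma uniform_decay:
 fixes v v1 v2 :: "real => real"
 assumes cv: "continuous_on UNIV v" and cv1: "continuous_on UNIV v1" and cv2: "continuous_on UNIV v2"
 and eta: "0 < eta" and low: "!!x. b <= x ==> lam0 + eta <= v x"
 and kap: "1 < kap" "kap <= 2" "kap <= r0"
 and A: "!!x. RA <= x ==> ((v1 x)\<^sup>2 / \<bar>v x - lam0\<bar> ^ 3 + \<bar>v2 x\<bar> / (v x - lam0)\<^sup>2)
 * \<bar>LBINT y=0..x. sqrt \<bar>v y - lam0\<bar>\<bar> powr r0 <= BA"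
 shows "\<exists>M\<ge>1. \<forall>lam x0 x. \<bar>lam - lam0\<bar> <= eta / 2 --> a <= x0 --> x0 <= b --> b <= x --> (\<forall>y\<ge>x0. lam <= v y) -->
 (v1 x)\<^sup>2 <= M * (v x - lam) ^ 3 * (1 + integral {x0..x} (%y. sqrt (v y - lam))) powr (- kap) &
 \<bar>v2 x\<bar> <= M * (v x - lam)\<^sup>2 * (1 + integral {x0..x} (%y. sqrt (v y - lam))) powr (- kap)"
proof -
 define R where "R = max (max RA 0) b"
 \<comment> \<open>Beyond \<open>R2\<close> the action counted from \<open>R\<close> is at least 1,
   since v - lam0 >= eta there. Bounded terms can then be absorbed and the power \<open>kap\<close>
   raised to \<open>r0\<close>.\<close>
 define R2 where "R2 = R + 1 / sqrt eta"
 have R: "RA <= R" "0 <= R" "b <= R" "R < R2" using eta unfolding R_def R2_def by auto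
 obtain C0 where C0: "0 <= C0" "!!x. a <= x ==> x <= R2 ==> \<bar>v x - lam0\<bar> <= C0"
 using compact_bound[of a R2 "%x. v x - lam0", OF continuous_on_diff[OF continuous_on_subset[OF cv] continuous_on_const]] by auto
 obtain C1 where C1: "0 <= C1" "!!x. a <= x ==> x <= R2 ==> \<bar>v1 x\<bar> <= C1"
 using compact_bound[of a R2 v1, OF continuous_on_subset[OF cv1]] by auto
 obtain C2 where C2: "0 <= C2" "!!x. a <= x ==> x <= R2 ==> \<bar>v2 x\<bar> <= C2"
 using compact_bound[of a R2 v2, OF continuous_on_subset[OF cv2]] by auto
 define Cs where "Cs = sqrt (C0 + eta)"
 define W where "W = 3 + \<bar>R2 - a\<bar> * Cs"
 have Cs0: "0 <= Cs" using C0 eta unfolding Cs_def by simp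
 have W: "3 <= W" unfolding W_def using Cs0 by simp
 \<comment> \<open>The summands pay for both derivatives on the compact range, where 1 + ?I <= W,
   and for the range beyond; there the factor 8 is the cube of 2 in v - lam0 <= 2 (v - lam).\<close>
 define M where "M = 1 + C1\<^sup>2 * (2 / eta) ^ 3 * W\<^sup>2 + C2 * (2 / eta)\<^sup>2 * W\<^sup>2 + 8 * \<bar>BA\<bar> * W\<^sup>2"
 have nn: "0 <= C1\<^sup>2 * (2 / eta) ^ 3 * W\<^sup>2" "0 <= C2 * (2 / eta)\<^sup>2 * W\<^sup>2" "0 <= 8 * \<bar>BA\<bar> * W\<^sup>2"
 using C1(1) C2(1) eta by auto
 show ?thesis
 proof (intro exI[of _ M] conjI allI impI)
 show "1 <= M" unfolding M_def using nn by (linarith | argo | smt (verit))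
 next
 fix lam x0 x assume lam: "\<bar>lam - lam0\<bar> <= eta / 2" and x0: "a <= x0" "x0 <= b" and x: "b <= x" and pos: "\<forall>y\<ge>x0. lam <= v y"
 let ?f = "%y. sqrt (v y - lam)"
 let ?I = "integral {x0..x} ?f"
 have cf: "continuous_on S ?f" for S by (intro continuous_intros continuous_on_subset[OF cv]) auto
 have I0: "0 <= ?I" using pos by (intro integral_nonneg integrable_continuous_real cf) auto
 have lx: "lam0 + eta <= v x" by (rule low[OF x])
 have lam': "lam - lam0 <= eta / 2" "lam0 - lam <= eta / 2" using lam by linarith+
 have qx: "eta / 2 <= v x - lam" "0 < v x - lam" using lx lam eta by linarith+
 have fb: "?f y <= Cs" if "x0 <= y" "y <= R2" for y
 proof -
 have "v y - lam <= C0 + eta" using C0(2)[OF order_trans[OF x0(1) that(1)] that(2)] lam' eta by (linarith | argo | smt (verit))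
 then show ?thesis unfolding Cs_def by simp
 qed
 have key: "(v1 x)\<^sup>2 * (1 + ?I) powr kap <= M * (v x - lam) ^ 3 & \<bar>v2 x\<bar> * (1 + ?I) powr kap <= M * (v x - lam)\<^sup>2"
 proof (cases "x <= R2")
 case True
 have "?I <= (x - x0) * Cs" using x0 x True by (intro integral_le_const cf fb) auto
 also have "... <= \<bar>R2 - a\<bar> * Cs" using x0 x True Cs0 by (intro mult_right_mono) auto
 finally have "1 + ?I <= W" unfolding W_def by simp
 then have "(1 + ?I) powr kap <= W powr kap" using I0 kap by (intro powr_mono2) auto
 also have "... <= W powr 2" using W kap by (intro powr_mono) auto
 finally have pw: "(1 + ?I) powr kap <= W\<^sup>2" using W by simp
 have c: "\<bar>v1 x\<bar> <= C1" "\<bar>v2 x\<bar> <= C2" using C1 C2 x0 x True by auto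
 have g: "s * p <= Mm * t" if "s <= cc" "0 <= s" "p <= w" "0 <= p" "e <= t" "0 < e" "cc * inverse e * w <= Mm" for s p Mm t cc w e :: real
 proof -
 have "s * p <= cc * w" using that by (intro mult_mono) auto
 also have "... = cc * inverse e * w * e" using that by simp
 also have "... <= Mm * t" using that by (intro mult_mono) (auto intro!: mult_nonneg_nonneg order_trans[OF _ that(7)])
 finally show ?thesis .
 qed
 have i3: "inverse ((eta / 2) ^ 3) = (2 / eta) ^ 3" "inverse ((eta / 2)\<^sup>2) = (2 / eta)\<^sup>2" by (simp_all add: power_inverse[symmetric])
 have "(v1 x)\<^sup>2 <= C1\<^sup>2" using power_mono[OF c(1) abs_ge_zero, of 2] by simp
 then show ?thesis using nn c qx eta pw unfolding M_def by (intro conjI g[OF _ _ pw _ power_mono[OF qx(1)], unfolded i3]) (auto simp: i3)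
 next
 case False
 then have xR: "R <= x" "R2 <= x" using R by auto
 let ?g = "%y. sqrt \<bar>v y - lam0\<bar>"
 have cg: "continuous_on S ?g" for S by (intro continuous_intros continuous_on_subset[OF cv]) auto
 define F where "F = integral {R..x} ?g"
 have "(x - R) * sqrt eta <= F"
 proof -
 have "integral {R..x} (%y. sqrt eta) <= F" unfolding F_def
 using R low eta by (intro integral_le integrable_continuous_real cg) (auto simp: abs_le_iff dest!: low[OF order_trans[OF R(3)]] intro: order_trans[OF _ abs_ge_self])
 then show ?thesis using xR by simp
 qed
 moreover have "1 <= (x - R) * sqrt eta"
 proof -
 have "1 / sqrt eta * sqrt eta <= (x - R) * sqrt eta" using xR eta unfolding R2_def by (intro mult_right_mono) auto
 then show ?thesis using eta by simp
 qed
 ultimately have F: "1 <= F" by (linarith | argo | smt (verit))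
 define L where "L = (LBINT y=0..x. ?g y)"
 have "L = integral {0..x} ?g" unfolding L_def zero_ereal_def using xR R by (intro interval_integral_continuous cg) auto
 also have "... = integral {0..R} ?g + F" unfolding F_def
 using xR R by (intro Henstock_Kurzweil_Integration.integral_combine[symmetric] integrable_continuous_real cg) auto
 finally have L: "F <= L" using integral_nonneg[OF integrable_continuous_real[OF cg], of 0 R] by simp
 have "?I = integral {x0..R} ?f + integral {R..x} ?f"
 using x0 xR R by (intro Henstock_Kurzweil_Integration.integral_combine[symmetric] integrable_continuous_real cf) auto
 moreover have "integral {x0..R} ?f <= \<bar>R2 - a\<bar> * Cs"
 proof -
 have "integral {x0..R} ?f <= (R - x0) * Cs" using x0 R by (intro integral_le_const cf fb) auto
 also have "... <= \<bar>R2 - a\<bar> * Cs" using x0 R Cs0 by (intro mult_right_mono) auto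
 finally show ?thesis .
 qed
 moreover have "integral {R..x} ?f <= 2 * F"
 proof -
 have "integral {R..x} ?f <= integral {R..x} (%y. 2 * ?g y)"
 proof (intro integral_le integrable_continuous_real cf continuous_intros cg)
 fix y assume "y \<in> {R..x}"
 then have "lam0 + eta <= v y" using R by (intro low) auto
 then have t: "eta <= v y - lam0" by (linarith | argo | smt (verit))
 then have "\<bar>v y - lam0\<bar> = v y - lam0" using eta by (linarith | argo | smt (verit))
 moreover have "v y - lam <= 4 * (v y - lam0)" using t eta lam' by (argo | smt (verit) | simp add: field_simps)
 ultimately have "v y - lam <= 4 * \<bar>v y - lam0\<bar>" by (simp only:)
 then have "?f y <= sqrt (4 * \<bar>v y - lam0\<bar>)" by simp
 then show "?f y <= 2 * ?g y" by (simp add: real_sqrt_mult)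
 qed (auto intro: continuous_on_subset[OF cv])
 then show ?thesis unfolding F_def by simp
 qed
 ultimately have "1 + ?I <= (W - 2) * 1 + 2 * F" unfolding W_def by simp
 also have "... <= (W - 2) * L + 2 * L" using W F L by (intro add_mono mult_left_mono) auto
 also have "... = W * L" by (simp add: algebra_simps)
 finally have "(1 + ?I) powr kap <= (W * L) powr kap" using I0 kap by (intro powr_mono2) auto
 also have "... = W powr kap * L powr kap" by (simp add: powr_mult)
 also have "... <= W powr 2 * L powr r0" using W kap F L by (intro mult_mono powr_mono) auto
 finally have pw: "(1 + ?I) powr kap <= W\<^sup>2 * L powr r0" using W by simp
 define t where "t = v x - lam0"
 have t: "0 < t" "t <= 2 * (v x - lam)" using lx lam' eta unfolding t_def by (linarith | argo)+
 define P where "P = L powr r0"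
 have P: "0 <= P" unfolding P_def by simp
 have "((v1 x)\<^sup>2 / t ^ 3 + \<bar>v2 x\<bar> / t\<^sup>2) * P <= BA"
 using A[of x] xR R t F L unfolding L_def[symmetric] t_def[symmetric] P_def by simp
 then have s: "(v1 x)\<^sup>2 / t ^ 3 * P + \<bar>v2 x\<bar> / t\<^sup>2 * P <= \<bar>BA\<bar>" by (simp add: algebra_simps)
 have n: "0 <= (v1 x)\<^sup>2 / t ^ 3 * P" "0 <= \<bar>v2 x\<bar> / t\<^sup>2 * P" using t P by auto
 have g: "a' * Z <= M * y ^ m" if "a' / t ^ m * P <= \<bar>BA\<bar>" "0 <= a'" "Z <= W\<^sup>2 * P" "t <= 2 * y" "m = 2 \<or> m = 3" for a' Z y m
 proof -
 have "a' * P <= \<bar>BA\<bar> * t ^ m" using that(1) t by (simp add: field_simps)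
 moreover have "t ^ m <= 8 * y ^ m"
 proof -
 have "t ^ m <= (2 * y) ^ m" using that t by (intro power_mono) auto
 moreover have "0 <= y" using that t by (linarith | argo | smt (verit))
 ultimately show ?thesis using that(5) by (auto simp: power_mult_distrib) (smt (verit) zero_le_power)
 qed
 ultimately have "a' * P <= \<bar>BA\<bar> * (8 * y ^ m)" by (meson abs_ge_zero mult_left_mono order_trans)
 then have "(a' * P) * W\<^sup>2 <= (\<bar>BA\<bar> * (8 * y ^ m)) * W\<^sup>2" by (intro mult_right_mono) auto
 moreover have "a' * Z <= a' * (W\<^sup>2 * P)" using that by (intro mult_left_mono) auto
 moreover have "8 * \<bar>BA\<bar> * W\<^sup>2 * y ^ m <= M * y ^ m" using nn that t unfolding M_def by (intro mult_right_mono) auto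
 ultimately show ?thesis by (simp add: mult_ac)
 qed
 have "(v1 x)\<^sup>2 / t ^ 3 * P <= \<bar>BA\<bar>" "\<bar>v2 x\<bar> / t\<^sup>2 * P <= \<bar>BA\<bar>" using s n by linarith+
 then show ?thesis using g[OF _ _ pw[folded P_def] t(2)] by auto
 qed
 have fin: "s <= m * (1 + ?I) powr (- kap)" if "s * (1 + ?I) powr kap <= m" for s m using that I0 by (simp add: powr_minus field_simps)
 show "(v1 x)\<^sup>2 <= M * (v x - lam) ^ 3 * (1 + ?I) powr (- kap)" "\<bar>v2 x\<bar> <= M * (v x - lam)\<^sup>2 * (1 + ?I) powr (- kap)"
 using key fin by blast+
 qed
qed

lemma Ck_on_2_D:
 assumes "Ck_on 2 v UNIV"
 shows "(v has_real_derivative deriv v x) (at x)" "(deriv v has_real_derivative deriv (deriv v) x) (at x)"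
 "continuous_on UNIV (deriv (deriv v))"
proof -
 have *: "!!i x. i < 2 ==> (deriv ^^ i) v differentiable at x" and "continuous_on UNIV ((deriv ^^ 2) v)" using assms unfolding Ck_on_def by auto
 then show "continuous_on UNIV (deriv (deriv v))" by (simp add: numeral_2_eq_2)
 show "(v has_real_derivative deriv v x) (at x)" "(deriv v has_real_derivative deriv (deriv v) x) (at x)"
 using *[of 0 x] *[of 1 x] by (simp_all add: DERIV_deriv_iff_real_differentiable)
qed

lemma Ck_on_3_D:
 assumes "Ck_on 3 v S"
 shows "x \<in> S ==> (deriv (deriv v) has_real_derivative deriv (deriv (deriv v)) x) (at x)"
 "continuous_on S (deriv (deriv (deriv v)))"
proof -
 have *: "!!i x. i < 3 ==> x \<in> S ==> (deriv ^^ i) v differentiable at x" and "continuous_on S ((deriv ^^ 3) v)"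
 using assms unfolding Ck_on_def by auto
 then show "continuous_on S (deriv (deriv (deriv v)))" by (simp add: numeral_3_eq_3)
 show "(deriv (deriv v) has_real_derivative deriv (deriv (deriv v)) x) (at x)" if "x \<in> S"
 using *[of 2 x] that by (simp add: DERIV_deriv_iff_real_differentiable numeral_2_eq_2)
qed

lemma deriv_q:
 assumes "!!x. (v has_real_derivative deriv v x) (at x)" shows "deriv (q v lam) = deriv v"
proof
 fix x
 have "(q v lam has_real_derivative deriv v x) (at x)"
 unfolding q_def[abs_def] using DERIV_diff[OF assms DERIV_const] by simp
 then show "deriv (q v lam) x = deriv v x" by (rule DERIV_imp_deriv)
qed

lemma turning_points_pair:
 assumes "{x. v x = lam} = {a, b}" "a < b"
 shows "x_minus v lam = a" "x_plus v lam = b" "card {x. v x = lam} = 2"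
 unfolding x_minus_def x_plus_def assms(1) using assms(2) by (auto simp: min_def max_def)

lemma assumption_B_D:
 assumes "assumption_B v lam"
 shows "x_minus v lam < x_plus v lam" "v (x_minus v lam) = lam" "v (x_plus v lam) = lam"
 "{x. v x = lam} = {x_minus v lam, x_plus v lam}"
proof -
 have "card {x. v x = lam} = 2" using assms unfolding assumption_B_def by auto
 then obtain s t where st: "{x. v x = lam} = {s, t}" "s ~= t" by (auto simp: card_2_iff)
 then obtain a b where ab: "{x. v x = lam} = {a, b}" "a < b" by (metis insert_commute linorder_neqE)
 note p = turning_points_pair[OF ab]
 show "x_minus v lam < x_plus v lam" "{x. v x = lam} = {x_minus v lam, x_plus v lam}" unfolding p using ab by auto
 show "v (x_minus v lam) = lam" "v (x_plus v lam) = lam" unfolding p using ab(1) by auto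
qed

lemma compact_margin:
 fixes f :: "real => real"
 assumes "continuous_on {s..t} f" "!!x. x \<in> {s..t} ==> 0 < f x"
 shows "\<exists>e>0. \<forall>x\<in>{s..t}. e <= f x"
proof (cases "s <= t")
 case True
 then obtain y where "y \<in> {s..t}" "\<forall>x\<in>{s..t}. f y <= f x" using continuous_attains_inf[of "{s..t}" f] assms by auto
 then show ?thesis using assms(2) by (intro exI[of _ "f y"]) auto
qed (auto intro: exI[of _ 1])

text \<open>Strict monotonicity on the whole window gives the signs on both sides of the crossing,
  and so its uniqueness there.\<close>

lemma crossing:
 fixes v v1 :: "real => real"
 assumes v: "!!x. (v has_real_derivative v1 x) (at x)" and pos: "!!x. \<bar>x - b\<bar> <= e ==> 0 < v1 x"
 and e: "0 < e" and lo: "v (b - e) < lam" and hi: "lam < v (b + e)"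
 obtains y where "\<bar>y - b\<bar> < e" "v y = lam" "!!x. \<bar>x - b\<bar> <= e ==> x < y ==> v x < lam"
 "!!x. \<bar>x - b\<bar> <= e ==> y < x ==> lam < v x"
proof -
 have "\<exists>y\<ge>b - e. y <= b + e & v y = lam" using lo hi e by (intro IVT) (auto intro: DERIV_isCont[OF v])
 then obtain y where y: "b - e <= y" "y <= b + e" "v y = lam" by blast
 have "y ~= b - e" "y ~= b + e" using y(3) lo hi by auto
 then have yb: "\<bar>y - b\<bar> < e" using y by (auto simp: abs_less_iff)
 have mono: "v s < v t" if "\<bar>s - b\<bar> <= e" "\<bar>t - b\<bar> <= e" "s < t" for s t
 using that pos v by (intro DERIV_pos_imp_increasing[OF that(3)]) (force intro!: exI[of _ "v1 _"])
 show ?thesis by (rule that[OF yb y(3)]) (use mono yb y(3) in \<open>metis less_imp_le\<close>)+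
qed

lemma at_infinity_abs: "eventually P (at_infinity :: real filter) \<longleftrightarrow> (\<exists>R. \<forall>x. R <= \<bar>x\<bar> --> P x)"
 by (simp add: eventually_at_infinity)

text \<open>Everything is fixed at \<open>lam0\<close> before \<open>lam\<close> enters. On radius r
  around each turning point the slope of v is bounded away from zero and v is C^3; outside a much
  smaller radius s, v keeps a distance \<open>eta\<close> from \<open>lam0\<close>. For |lam - lam0|
  < eta / 2 the turning points move by less than s, and no others appear.\<close>

lemma turning_geometry:
 assumes A: "assumption_A v lam0 r0" and B: "assumption_B v lam0" and x1: "x1 \<in> {x_minus v lam0<..<x_plus v lam0}"
 shows "\<exists>e>0. \<exists>M d. \<forall>lam. \<bar>lam - lam0\<bar> < e --> assumption_B v lam & x1 \<in> {x_minus v lam<..<x_plus v lam} &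
 turning M d (min r0 2) (x_minus v lam) x1 (x_plus v lam) (q v lam) (deriv v) (deriv (deriv v)) (deriv (deriv (deriv v)))"
proof -
 define a where "a = x_minus v lam0"
 define b where "b = x_plus v lam0"
 define v1 where "v1 = deriv v"
 define v2 where "v2 = deriv v1"
 define v3 where "v3 = deriv v2"
 have C2: "Ck_on 2 v UNIV" and r0: "1 < r0" using A unfolding assumption_A_def by auto
 note v = Ck_on_2_D(1)[OF C2, folded v1_def] and v1 = Ck_on_2_D(2)[OF C2, folded v1_def v2_def]
 and cv2 = Ck_on_2_D(3)[OF C2, folded v1_def v2_def]
 have cv: "continuous_on S v" and cv1: "continuous_on S v1" for S
 by (auto intro!: continuous_at_imp_continuous_on DERIV_isCont[OF v] DERIV_isCont[OF v1])
 have cv2': "continuous_on S v2" for S by (rule continuous_on_subset[OF cv2 subset_UNIV])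
 note BD = assumption_B_D[OF B, folded a_def b_def]
 have inB: "!!x. a < x ==> x < b ==> v x < lam0" and outB: "!!x. x < a \<or> b < x ==> lam0 < v x"
 and lim: "Liminf at_infinity (%x. ereal (v x)) > ereal lam0" and sl: "0 < v1 b" "v1 a < 0"
 using B unfolding assumption_B_def a_def b_def v1_def by auto
 obtain Sa where Sa: "open Sa" "a \<in> Sa" "Ck_on 3 v Sa" using B unfolding assumption_B_def a_def by blast
 obtain Sb where Sb: "open Sb" "b \<in> Sb" "Ck_on 3 v Sb" using B unfolding assumption_B_def b_def by blast
 define c where "c = min (v1 b) (- v1 a) / 2"
 have c: "0 < c" "c < v1 b" "c < - v1 a" using sl unfolding c_def by auto
 have "open (Sb \<inter> v1 -` {c<..})" "open (Sa \<inter> v1 -` {..<-c})" using Sa Sb cv1 by (intro open_Int open_vimage; auto)+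
 moreover have "b \<in> Sb \<inter> v1 -` {c<..}" "a \<in> Sa \<inter> v1 -` {..<-c}" using Sa Sb c by auto
 ultimately obtain rb ra where rb: "0 < rb" "cball b rb \<subseteq> Sb \<inter> v1 -` {c<..}" and ra: "0 < ra" "cball a ra \<subseteq> Sa \<inter> v1 -` {..<-c}"
 by (meson open_contains_cball)
 define r where "r = min (min 1 (min ra rb)) (min ((x1 - a) / 2) ((b - x1) / 2))"
 have ax: "a < x1" "x1 < b" using x1 unfolding a_def b_def by auto
 have rh: "r <= (x1 - a) / 2" "r <= (b - x1) / 2" unfolding r_def by (rule min.coboundedI2, rule min.cobounded1, rule min.coboundedI2, rule min.cobounded2)
 have r: "0 < r" "r <= 1" "r <= ra" "r <= rb" unfolding r_def using ra rb ax by (auto simp: min_le_iff_disj)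
 have "a + r < x1" "x1 < b - r" using rh ax by argo+
 note r = r this
 have Rb: "x \<in> Sb" "c < v1 x" if "\<bar>x - b\<bar> <= r" for x using rb(2) that r by (force simp: dist_real_def)+
 have Ra: "x \<in> Sa" "v1 x < - c" if "\<bar>x - a\<bar> <= r" for x using ra(2) that r by (force simp: dist_real_def)+
 \<comment> \<open>With d = 2 s and r = 8 s, the radius 2 d around the moved turning point stays
   inside the radius r, as 4 s + s < 8 s, while distance d from it means distance at least s from
   the original one.\<close>
 define d where "d = r / 4"
 define s where "s = d / 2"
 have ds: "0 < d" "d <= 1" "0 < s" "s < r" "d = 2 * s" "r = 8 * s" using r unfolding d_def s_def by auto
 obtain e1 where e1: "0 < e1" "\<forall>x\<in>{a + s..b - s}. e1 <= lam0 - v x"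
 proof -
 have "\<exists>e>0. \<forall>x\<in>{a + s..b - s}. e <= lam0 - v x"
 by (rule compact_margin[OF continuous_on_diff[OF continuous_on_const cv]]) (use ds(3) in \<open>auto intro!: inB\<close>)
 then show ?thesis using that by blast
 qed
 obtain z where z: "lam0 < z" "ereal z < Liminf at_infinity (%x. ereal (v x))" using ereal_dense2[OF lim] by auto
 from less_LiminfD[OF z(2)] obtain R0 where R0: "!!x. R0 <= \<bar>x\<bar> ==> z < v x" by (auto simp: at_infinity_abs)
 obtain e2 where e2: "0 < e2" "\<forall>x\<in>{b + s..\<bar>R0\<bar>}. e2 <= v x - lam0"
 proof -
 have "\<exists>e>0. \<forall>x\<in>{b + s..\<bar>R0\<bar>}. e <= v x - lam0"
 by (rule compact_margin[OF continuous_on_diff[OF cv continuous_on_const]]) (use ds(3) in \<open>auto intro!: outB\<close>)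
 then show ?thesis using that by blast
 qed
 obtain e3 where e3: "0 < e3" "\<forall>x\<in>{- \<bar>R0\<bar>..a - s}. e3 <= v x - lam0"
 proof -
 have "\<exists>e>0. \<forall>x\<in>{- \<bar>R0\<bar>..a - s}. e <= v x - lam0"
 by (rule compact_margin[OF continuous_on_diff[OF cv continuous_on_const]]) (use ds(3) in \<open>auto intro!: outB\<close>)
 then show ?thesis using that by blast
 qed
 \<comment> \<open>The margin of |v - lam0| outside the small windows: three compact pieces, and a
   neighborhood of infinity where the limit inferior leaves room up to \<open>z\<close>.\<close>
 define eta where "eta = min (min e1 (z - lam0)) (min e2 e3)"
 have eta: "0 < eta" "eta <= e1" "eta <= z - lam0" "eta <= e2" "eta <= e3" using e1 e2 e3 z unfolding eta_def by auto
 have inner: "v x <= lam0 - eta" if "a + s <= x" "x <= b - s" for x using e1(2) that eta by force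
 have outer: "lam0 + eta <= v x" if "b + s <= x \<or> x <= a - s" for x
 proof (cases "\<bar>R0\<bar> <= \<bar>x\<bar>")
 case True then show ?thesis using R0[of x] eta by (linarith | argo)
 next
 case False
 then have "x \<in> {b + s..\<bar>R0\<bar>} \<or> x \<in> {- \<bar>R0\<bar>..a - s}" using that by auto
 then have "e2 <= v x - lam0 \<or> e3 <= v x - lam0" using e2(2) e3(2) by blast
 then show ?thesis using eta by linarith
 qed
 obtain BA RA where BA: "!!x. RA <= \<bar>x\<bar> ==> \<bar>((v1 x)\<^sup>2 / \<bar>q v lam0 x\<bar> ^ 3 + \<bar>v2 x\<bar> / (q v lam0 x)\<^sup>2)
 * \<bar>LBINT y=0..x. sqrt \<bar>q v lam0 y\<bar>\<bar> powr r0\<bar> <= BA"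
 using A unfolding assumption_A_def deriv_q[OF v[unfolded v1_def]] v1_def[symmetric] v2_def[symmetric] by auto
 have Ab: "((v1 x)\<^sup>2 / \<bar>v x - lam0\<bar> ^ 3 + \<bar>v2 x\<bar> / (v x - lam0)\<^sup>2) * \<bar>LBINT y=0..x. sqrt \<bar>v y - lam0\<bar>\<bar> powr r0 <= BA"
 if "RA <= x" for x
 proof -
 have "RA <= \<bar>x\<bar>" using that by simp
 from order_trans[OF abs_ge_self BA[OF this]] show ?thesis unfolding q_def .
 qed
 have "1 < min r0 2" "min r0 2 <= 2" "min r0 2 <= r0" using r0 by auto
 from uniform_decay[where a = "b - s" and b = "b + s", OF cv cv1 cv2 eta(1) outer[OF disjI1] this Ab]
 obtain Md where Md: "1 <= Md" "!!lam x0 x. \<bar>lam - lam0\<bar> <= eta / 2 ==> b - s <= x0 ==> x0 <= b + s ==> b + s <= x ==> (\<forall>y\<ge>x0. lam <= v y) ==>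
 (v1 x)\<^sup>2 <= Md * (v x - lam) ^ 3 * (1 + integral {x0..x} (%y. sqrt (v y - lam))) powr (- min r0 2) &
 \<bar>v2 x\<bar> <= Md * (v x - lam)\<^sup>2 * (1 + integral {x0..x} (%y. sqrt (v y - lam))) powr (- min r0 2)" by blast
 obtain D0 where D0: "0 <= D0" "\<forall>x\<in>{x1..b + r}. \<bar>v x - lam0\<bar> <= D0"
 using compact_bound[of x1 "b + r" "%x. v x - lam0", OF continuous_on_diff[OF cv continuous_on_const]] by auto
 obtain D1 where D1: "0 <= D1" "\<forall>x\<in>{x1..b + r}. \<bar>v1 x\<bar> <= D1" using compact_bound[OF cv1] by blast
 obtain D2 where D2: "0 <= D2" "\<forall>x\<in>{x1..b + r}. \<bar>v2 x\<bar> <= D2" using compact_bound[OF cv2'] by blast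
 note v3b = Ck_on_3_D[OF Sb(3), folded v1_def, folded v2_def, folded v3_def]
 have cv3: "continuous_on {b - r..b + r} v3" by (rule continuous_on_subset[OF v3b(2)]) (use Rb(1) in \<open>auto simp: abs_le_iff\<close>)
 obtain D3 where D3: "0 <= D3" "\<forall>x\<in>{b - r..b + r}. \<bar>v3 x\<bar> <= D3" using compact_bound[OF cv3] by blast
 define M where "M = 1 + 1 / d + \<bar>b + 1 - x1\<bar> + 1 / c + D0 + D1 + D2 + D3 + eta + 2 / eta + Md"
 have nn: "0 <= 1 / d" "0 <= 1 / c" "0 <= 2 / eta" using ds c eta by auto
 note M_defs = nn D0(1) D1(1) D2(1) D3(1) eta(1) Md(1)
 have M: "1 <= M" "1 / d <= M" "b + 1 - x1 <= M" "1 / c <= M" "D0 + eta <= M" "D1 <= M" "D2 <= M" "D3 <= M" "2 / eta <= M" "Md <= M"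
 unfolding M_def using M_defs by (linarith | argo)+
 have inv: "1 / M <= t" if "1 / t <= M" "0 < t" for t using that M(1) by (simp add: field_simps)
 have Mi: "1 / M <= d" "1 / M <= c" "1 / M <= eta / 2" using inv[of d] inv[of c] inv[of "eta / 2"] M(2,4,9) ds(1) c(1) eta(1) by simp_all
 show ?thesis
 proof (rule exI[of _ "eta / 2"], rule conjI, simp add: eta(1), rule exI[of _ M], rule exI[of _ d], intro allI impI conjI)
 fix lam assume lam: "\<bar>lam - lam0\<bar> < eta / 2"
 have lamb: "lam - lam0 < eta / 2" "lam0 - lam < eta / 2" using lam by linarith+
 have lamc: "lam < lam0 + eta" "lam0 - eta < lam" using lamb eta(1) by argo+
 have ab: "a + s <= b - s" using r(5,6) ds by argo
 have lo: "v (b - s) < lam" "v (a + s) < lam" using inner[OF ab order_refl] inner[OF order_refl ab] lamc by argo+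
 have hi: "lam < v (b + s)" "lam < v (a - s)" using outer[of "b + s"] outer[of "a - s"] lamc by argo+
 obtain xp where xp: "\<bar>xp - b\<bar> < s" "v xp = lam" "!!x. \<bar>x - b\<bar> <= s ==> x < xp ==> v x < lam"
 "!!x. \<bar>x - b\<bar> <= s ==> xp < x ==> lam < v x"
 proof (rule crossing[OF v, of b s lam])
 fix x assume "\<bar>x - b\<bar> <= s"
 then have "\<bar>x - b\<bar> <= r" using ds by linarith
 from Rb(2)[OF this] show "0 < v1 x" using c by linarith
 qed (use ds lo hi in auto)
 \<comment> \<open>The left turning point is a right turning point of the reflected
   potential.\<close>
 have vm: "((%x. v (- x)) has_real_derivative - v1 (- x)) (at x)" for x using DERIV_mirror[of v "v1 (- x)" x] v by blast
 obtain y where y: "\<bar>y - - a\<bar> < s" "v (- y) = lam" "!!x. \<bar>x - - a\<bar> <= s ==> x < y ==> v (- x) < lam"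
 "!!x. \<bar>x - - a\<bar> <= s ==> y < x ==> lam < v (- x)"
 proof (rule crossing[OF vm, of "- a" s lam])
 fix x assume "\<bar>x - - a\<bar> <= s"
 then have "\<bar>- x - a\<bar> <= r" using ds by (linarith | argo)
 from Ra(2)[OF this] show "0 < - v1 (- x)" using c by (linarith | argo)
 qed (use ds lo hi in \<open>auto simp: add.commute\<close>)
 define xm where "xm = - y"
 have xm: "\<bar>xm - a\<bar> < s" "v xm = lam" "!!x. \<bar>x - a\<bar> <= s ==> xm < x ==> v x < lam"
 "!!x. \<bar>x - a\<bar> <= s ==> x < xm ==> lam < v x"
 proof -
 show "\<bar>xm - a\<bar> < s" "v xm = lam" using y unfolding xm_def by auto
 fix x assume x: "\<bar>x - a\<bar> <= s"
 then have "\<bar>- x - - a\<bar> <= s" by (linarith | argo)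
 from y(3,4)[OF this] show "xm < x ==> v x < lam" "x < xm ==> lam < v x" unfolding xm_def by auto
 qed
 have ord: "xm < x1" "x1 < xp" "x1 <= xp - d" "xp - x1 <= b + 1 - x1" using xm(1) xp(1) r ds unfolding abs_less_iff by (linarith | argo)+
 have neg: "v x < lam" if "xm < x" "x < xp" for x
 proof -
 have "\<bar>x - a\<bar> <= s \<or> \<bar>x - b\<bar> <= s \<or> a + s <= x & x <= b - s" using that xm(1) xp(1) by (smt (verit))
 moreover have "v x < lam" if "a + s <= x & x <= b - s" using inner[OF conjunct1[OF that] conjunct2[OF that]] lamc by argo
 ultimately show ?thesis using xm(3) xp(3) that by blast
 qed
 have posv: "lam < v x" if "x < xm \<or> xp < x" for x
 proof -
 have "\<bar>x - a\<bar> <= s & x < xm \<or> \<bar>x - b\<bar> <= s & xp < x \<or> b + s <= x \<or> x <= a - s"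
 using that xm(1) xp(1) by (smt (verit))
 moreover have "lam < v x" if "b + s <= x \<or> x <= a - s" using outer[OF that] lamc by argo
 ultimately show ?thesis using xm(4) xp(4) by blast
 qed
 have set: "{x. v x = lam} = {xm, xp}"
 proof (intro equalityI subsetI)
 fix x assume "x \<in> {x. v x = lam}"
 then have "\<not> (xm < x & x < xp)" "\<not> (x < xm \<or> xp < x)" using neg[of x] posv[of x] by auto
 then show "x \<in> {xm, xp}" by auto
 qed (use xm(2) xp(2) in auto)
 have xmp: "xm < xp" using ord by simp
 note tp = turning_points_pair[OF set xmp]
 have xpr: "\<bar>xp - b\<bar> <= r" "\<bar>xm - a\<bar> <= r" using xp(1) xm(1) ds by (linarith | argo)+
 have "ereal lam < ereal (lam0 + eta)" using lamc by simp
 also have "... <= Liminf at_infinity (%x. ereal (v x))"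
 proof (rule Liminf_bounded)
 show "\<forall>\<^sub>F x in at_infinity. ereal (lam0 + eta) <= ereal (v x)" unfolding at_infinity_abs
 by (rule exI[of _ "\<bar>b + s\<bar> + \<bar>a - s\<bar>"]) (auto intro!: outer simp: abs_if split: if_splits)
 qed
 finally have liminf: "ereal lam < Liminf at_infinity (%x. ereal (v x))" .
 show "assumption_B v lam" unfolding assumption_B_def tp(1,2)
 using tp(3) neg posv liminf Sa(1,3) Sb(1,3) Ra[OF xpr(2)] Rb[OF xpr(1)] c(1) unfolding v1_def by (auto simp: not_le)
 show "x1 \<in> {x_minus v lam<..<x_plus v lam}" unfolding tp using ord by simp
 have nb: "\<bar>x - b\<bar> <= r" "x \<in> {x1..b + r}" "x \<in> {b - r..b + r}" if "\<bar>x - xp\<bar> < 2 * d" for x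
 using that xp(1) ds r by (auto simp: abs_le_iff abs_less_iff)
 have "turning M d (min r0 2) xm x1 xp (q v lam) v1 v2 v3"
 proof
 show "1 <= M" "1 / M <= d" "d <= 1" "1 < min r0 2" "min r0 2 <= 2" "xm < x1" "x1 <= xp - d" "xp - x1 <= M" using M Mi ds r0 ord by auto
 show "q v lam xp = 0" unfolding q_def using xp by simp
 show "continuous_on {xp - 2 * d<..<xp + 2 * d} v3"
 proof (rule continuous_on_subset[OF cv3], rule subsetI)
 fix x assume "x \<in> {xp - 2 * d<..<xp + 2 * d}"
 then have "\<bar>x - xp\<bar> < 2 * d" by (auto simp: abs_less_iff)
 then show "x \<in> {b - r..b + r}" by (rule nb(3))
 qed
 fix x
 show "(q v lam has_real_derivative v1 x) (at x)" unfolding q_def[abs_def] using DERIV_diff[OF v DERIV_const] by simp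
 show "(v1 has_real_derivative v2 x) (at x)" by (rule v1)
 show "q v lam x < 0" if "xm < x" "x < xp" using neg[OF that] unfolding q_def by simp
 show "(v2 has_real_derivative v3 x) (at x)" if "\<bar>x - xp\<bar> < 2 * d" using v3b(1) Rb(1) nb(1)[OF that] by blast
 show "1 / M <= v1 x & v1 x <= M & \<bar>v2 x\<bar> <= M & \<bar>v3 x\<bar> <= M" if n: "\<bar>x - xp\<bar> < 2 * d"
 proof -
 have "c < v1 x" "\<bar>v1 x\<bar> <= D1" "\<bar>v2 x\<bar> <= D2" "\<bar>v3 x\<bar> <= D3" using Rb(2) nb[OF n] D1 D2 D3 by blast+
 then show ?thesis using M Mi by (linarith | argo)
 qed
 show "1 / M <= q v lam x" if "xp + d <= x"
 proof -
 have "lam0 + eta <= v x" using that xp(1) ds by (intro outer) (auto simp: abs_less_iff)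
 then show ?thesis using lamb Mi(3) unfolding q_def by argo
 qed
 show "- M <= q v lam x & q v lam x <= - 1 / M & \<bar>v1 x\<bar> <= M & \<bar>v2 x\<bar> <= M" if x: "x1 <= x" "x <= xp - d"
 proof -
 have xs: "a + s <= x" "x <= b - s" "x \<in> {x1..b + r}" using x xp(1) ds r by (auto simp: abs_less_iff)
 have "\<bar>v x - lam0\<bar> <= D0" "\<bar>v1 x\<bar> <= D1" "\<bar>v2 x\<bar> <= D2" using D0 D1 D2 xs by blast+
 moreover have "v x <= lam0 - eta" by (rule inner[OF xs(1,2)])
 moreover have "- 1 / M = - (1 / M)" by simp
 moreover have "- D0 <= v x - lam0" "\<bar>v1 x\<bar> <= M" "\<bar>v2 x\<bar> <= M" using calculation M(6,7) by linarith+
 moreover have "- M <= v x - lam" using calculation M(5) lamc by argo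
 moreover have "v x - lam <= - (1 / M)" using calculation Mi(3) lamb by argo
 ultimately show ?thesis unfolding q_def by simp
 qed
 show "(v1 x)\<^sup>2 <= M * (q v lam x) ^ 3 * (1 + integral {xp..x} (%y. sqrt (q v lam y))) powr (- min r0 2) &
 \<bar>v2 x\<bar> <= M * (q v lam x)\<^sup>2 * (1 + integral {xp..x} (%y. sqrt (q v lam y))) powr (- min r0 2)" if x: "xp + d <= x"
 proof -
 have px: "b - s <= xp" "xp <= b + s" "b + s <= x" using x xp(1) ds by (auto simp: abs_less_iff)
 have ge: "\<forall>y\<ge>xp. lam <= v y" using posv xp(2) by (metis less_eq_real_def)
 note mm = Md(2)[OF less_imp_le[OF lam] px ge]
 have q0: "0 <= v x - lam" using ge px x ds by auto
 have up: "A <= M * B * E" if "A <= Md * B * E" "0 <= B" "0 <= E" for A B E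
 proof -
 have "Md * B * E <= M * B * E" using that M(10) by (intro mult_right_mono) auto
 then show ?thesis using that by (linarith | argo)
 qed
 show ?thesis unfolding q_def using mm q0 by (intro conjI up) auto
 qed
 qed
 then show "turning M d (min r0 2) (x_minus v lam) x1 (x_plus v lam) (q v lam) (deriv v) (deriv (deriv v)) (deriv (deriv (deriv v)))"
 unfolding tp(1,2) v1_def v2_def v3_def .
 qed
qed

section \<open>Uniqueness of recessive solutions and real eigenfunctions\<close>

lemma abs_double_mult_le: "\<bar>2 * (a * b)\<bar> <= a\<^sup>2 + b\<^sup>2" for a b :: real
proof -
 have "0 <= (a - b)\<^sup>2" "0 <= (a + b)\<^sup>2" by simp_all
 then show ?thesis unfolding abs_le_iff power2_diff power2_sum by (intro conjI; argo)
qed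

lemma DERIV_mult_exp:
 fixes E E' :: "real => real"
 assumes E: "(E has_real_derivative E' y) (at y)"
 shows "((%y. E y * exp (c * (y - a))) has_real_derivative (E' y + c * E y) * exp (c * (y - a))) (at y)"
proof -
 have "((%y. exp (c * (y - a))) has_real_derivative exp (c * (y - a)) * c) (at y)" by (auto intro!: derivative_eq_intros)
 from DERIV_mult[OF E this] show ?thesis by (rule DERIV_cong) (simp add: algebra_simps)
qed

text \<open>Uniqueness for the initial value problem by Gronwall's inequality for u^2 + u'^2, with
  rate 1 + sup |Q| on the interval between the two points.\<close>

lemma energy_zero:
 fixes u u1 Q :: "real => real"
 assumes u: "!!x. (u has_real_derivative u1 x) (at x)" and u1: "!!x. (u1 has_real_derivative Q x * u x) (at x)"
 and Q: "continuous_on UNIV Q" and a: "u a = 0" "u1 a = 0"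
 shows "u x = 0"
proof -
 define s where "s = min a x"
 define t where "t = max a x"
 have st: "s <= a" "a <= t" "s <= x" "x <= t" unfolding s_def t_def by auto
 obtain C where C: "\<forall>y\<in>{s..t}. \<bar>Q y\<bar> <= C" using compact_bound[OF continuous_on_subset[OF Q subset_UNIV]] by blast
 define L where "L = 1 + C"
 define E where "E y = (u y)\<^sup>2 + (u1 y)\<^sup>2" for y
 define E' where "E' y = 2 * (u y * u1 y) * (1 + Q y)" for y
 have E: "(E has_real_derivative E' y) (at y)" for y
 proof -
 have "((%y. u y * u y + u1 y * u1 y) has_real_derivative (u1 y * u y + u1 y * u y) + (Q y * u y * u1 y + Q y * u y * u1 y)) (at y)"
 by (intro DERIV_add DERIV_mult u u1)
 then show ?thesis unfolding E_def[abs_def] E'_def by (simp add: power2_eq_square algebra_simps)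
 qed
 have E'b: "\<bar>E' y\<bar> <= L * E y" if "s <= y" "y <= t" for y
 proof -
 have "\<bar>2 * (u y * u1 y)\<bar> <= E y" unfolding E_def by (rule abs_double_mult_le)
 moreover have "\<bar>Q y\<bar> <= C" using C that by simp
 then have "\<bar>1 + Q y\<bar> <= L" unfolding L_def by linarith
 ultimately have "\<bar>2 * (u y * u1 y)\<bar> * \<bar>1 + Q y\<bar> <= E y * L" by (rule mult_mono) (auto simp: E_def)
 then show ?thesis unfolding E'_def by (simp add: abs_mult mult.commute)
 qed
 have Ea: "E a = 0" unfolding E_def using a by simp
 have "E x <= 0"
 proof (cases "a <= x")
 case True
 have "E x * exp (- L * (x - a)) <= E a * exp (- L * (a - a))"
 proof (rule DERIV_nonpos_mono[where f = "%y. E y * exp (- L * (y - a))" and f' = "%y. (E' y + (- L) * E y) * exp (- L * (y - a))"])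
 fix y assume y: "y \<in> {a..x}"
 show "((%y. E y * exp (- L * (y - a))) has_real_derivative (E' y + (- L) * E y) * exp (- L * (y - a))) (at y)" by (rule DERIV_mult_exp[OF E])
 have "s <= y" "y <= t" using y st True by auto
 from E'b[OF this] have "E' y + (- L) * E y <= 0" by simp
 then show "(E' y + (- L) * E y) * exp (- L * (y - a)) <= 0" by (rule mult_nonpos_nonneg) simp
 qed (use True in auto)
 then show ?thesis unfolding Ea by (simp add: mult_le_0_iff)
 next
 case False
 have "E x * exp (L * (x - a)) <= E a * exp (L * (a - a))"
 proof (rule DERIV_nonneg_mono[where f = "%y. E y * exp (L * (y - a))" and f' = "%y. (E' y + L * E y) * exp (L * (y - a))"])
 fix y assume y: "y \<in> {x..a}"
 show "((%y. E y * exp (L * (y - a))) has_real_derivative (E' y + L * E y) * exp (L * (y - a))) (at y)" by (rule DERIV_mult_exp[OF E])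
 have "s <= y" "y <= t" using y st False by auto
 from E'b[OF this] have "0 <= E' y + L * E y" by simp
 then show "0 <= (E' y + L * E y) * exp (L * (y - a))" by (rule mult_nonneg_nonneg) simp
 qed (use False in auto)
 then show ?thesis unfolding Ea by (simp add: mult_le_0_iff)
 qed
 then show ?thesis unfolding E_def by (simp add: sum_power2_le_zero_iff)
qed

text \<open>If the values stayed at least 1, the integral would exceed the length of every interval.
  In this weak form square integrability enters the decay arguments.\<close>

lemma square_integrable_small:
 fixes u :: "real => real"
 assumes int: "integrable lborel (%x. (u x)\<^sup>2)" shows "\<exists>x\<ge>b. (u x)\<^sup>2 < 1"
proof (rule ccontr)
 assume "\<not> ?thesis"
 then have ge: "!!x. b <= x ==> 1 <= (u x)\<^sup>2" by force
 have "real n <= (LINT x|lborel. (u x)\<^sup>2)" for n :: nat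
 proof -
 have "(LINT x|lborel. indicator {b..b + real n} x) <= (LINT x|lborel. (u x)\<^sup>2)"
 proof (rule integral_mono[OF _ int])
 show "integrable lborel (indicator {b..b + real n} :: real => real)" by (rule integrable_real_indicator) auto
 show "indicator {b..b + real n} x <= (u x)\<^sup>2" for x using ge[of x] by (cases "x \<in> {b..b + real n}") auto
 qed
 then show ?thesis by simp
 qed
 then show False using reals_Archimedean2[of "LINT x|lborel. (u x)\<^sup>2"] by (metis not_le)
qed

lemma homogeneous_solution_iff:
 "homogeneous_solution v lam h u \<longleftrightarrow>
 (\<exists>u1. \<forall>x. (u has_real_derivative u1 x) (at x) & (u1 has_real_derivative q v lam x / h\<^sup>2 * u x) (at x))"
 (is "?L \<longleftrightarrow> ?R")
proof
 assume ?L
 then obtain u1 u2 where *: "!!x. (u has_vector_derivative u1 x) (at x)" "!!x. (u1 has_vector_derivative u2 x) (at x)"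
 "!!x. - u2 x + q v lam x / h\<^sup>2 * u x = 0"
 unfolding homogeneous_solution_def has_second_deriv_def by blast
 have "u2 x = q v lam x / h\<^sup>2 * u x" for x using *(3)[of x] by simp
 with * show ?R by (intro exI[of _ u1]) (simp add: has_real_derivative_iff_has_vector_derivative)
next
 assume ?R
 then obtain u1 where "\<forall>x. (u has_real_derivative u1 x) (at x) & (u1 has_real_derivative q v lam x / h\<^sup>2 * u x) (at x)" by blast
 then show ?L unfolding homogeneous_solution_def has_second_deriv_def
 by (intro exI[of _ "%x. q v lam x / h\<^sup>2 * u x"] conjI exI[of _ u1]) (auto simp: has_real_derivative_iff_has_vector_derivative)
qed

lemma homogeneous_solution_scale:
 assumes "homogeneous_solution v lam h u" shows "homogeneous_solution v lam h (%x. c * u x)"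
proof -
 obtain u1 where *: "!!x. (u has_real_derivative u1 x) (at x)" "!!x. (u1 has_real_derivative q v lam x / h\<^sup>2 * u x) (at x)"
 using assms unfolding homogeneous_solution_iff by blast
 have "((%x. c * u1 x) has_real_derivative q v lam x / h\<^sup>2 * (c * u x)) (at x)" for x
 by (rule DERIV_cong[OF DERIV_cmult[OF *(2)] mult.left_commute])
 then show ?thesis unfolding homogeneous_solution_iff by (intro exI[of _ "%x. c * u1 x"]) (auto intro!: DERIV_cmult *(1))
qed

lemma eigenfunction_iff:
 fixes \<psi> :: "real => real"
 assumes h: "0 < h"
 shows "eigenfunction v lam h \<psi> \<longleftrightarrow> homogeneous_solution v lam h \<psi> & (\<exists>x. \<psi> x ~= 0) & integrable lborel (%x. (\<psi> x)\<^sup>2)"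
proof -
 have e: "(- (h\<^sup>2 *\<^sub>R p) + v x *\<^sub>R f = lam *\<^sub>R f) \<longleftrightarrow> (- p + q v lam x / h\<^sup>2 * f = 0)" for p f x :: real
 proof -
 have "- p + (b - c) / s * f = 0 \<longleftrightarrow> - (s * p) + b * f = c * f" if "0 < s" for b c s :: real
 proof -
 have "s * (- p + (b - c) / s * f) = - (s * p) + b * f - c * f" using that by (simp add: field_simps)
 then show ?thesis using that by (metis eq_iff_diff_eq_0 less_irrefl mult_eq_0_iff)
 qed
 from this[of "h\<^sup>2" "v x" lam] h show ?thesis unfolding q_def by simp
 qed
 have m: "\<psi> \<in> borel_measurable lborel" if hs: "homogeneous_solution v lam h \<psi>"
 proof -
 obtain u1 where "!!x. (\<psi> has_real_derivative u1 x) (at x)" using hs unfolding homogeneous_solution_iff by blast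
 then have "\<forall>x\<in>UNIV. isCont \<psi> x" using DERIV_isCont by blast
 then have "continuous_on UNIV \<psi>" by (rule continuous_at_imp_continuous_on)
 then show ?thesis by (simp add: borel_measurable_continuous_onI)
 qed
 show ?thesis unfolding eigenfunction_def e homogeneous_solution_def[symmetric] real_norm_def power2_abs using m by blast
qed

text \<open>Meant for real and imaginary part: one of them does not vanish identically and is a real
  eigenfunction.\<close>

lemma eigenfunction_linear_image:
 fixes f :: "complex => real" and \<psi> :: "real => complex"
 assumes f: "bounded_linear f" and fb: "!!z. \<bar>f z\<bar> <= norm z" and h: "0 < h"
 and e: "eigenfunction v lam h \<psi>" and nz: "f (\<psi> x) ~= 0"
 shows "eigenfunction v lam h (%x. f (\<psi> x))"
proof -
 have lin: "linear f" by (rule bounded_linear.linear[OF f])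
 obtain p1 p2 where p1: "!!x. (\<psi> has_vector_derivative p1 x) (at x)" "!!x. (p1 has_vector_derivative p2 x) (at x)"
 and p2: "!!x. - ((h\<^sup>2) *\<^sub>R p2 x) + v x *\<^sub>R \<psi> x = lam *\<^sub>R \<psi> x"
 and m: "\<psi> \<in> borel_measurable lborel" and i: "integrable lborel (%x. (norm (\<psi> x))\<^sup>2)"
 using e unfolding eigenfunction_def has_second_deriv_def by blast
 have fm: "(%x. f (\<psi> x)) \<in> borel_measurable lborel"
 by (rule measurable_compose[OF m]) (simp add: borel_measurable_continuous_onI linear_continuous_on f)
 show ?thesis unfolding eigenfunction_def
 proof (intro conjI exI[of _ "%x. f (p2 x)"] allI)
 show "has_second_deriv (%x. f (\<psi> x)) (%x. f (p2 x))"
 unfolding has_second_deriv_def by (rule exI[of _ "%x. f (p1 x)"]) (intro allI conjI bounded_linear.has_vector_derivative[OF f] p1)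
 fix x
 have "f (- ((h\<^sup>2) *\<^sub>R p2 x) + v x *\<^sub>R \<psi> x) = f (lam *\<^sub>R \<psi> x)" by (simp only: p2)
 then show "- (h\<^sup>2 *\<^sub>R f (p2 x)) + v x *\<^sub>R f (\<psi> x) = lam *\<^sub>R f (\<psi> x)"
 by (simp only: linear_add[OF lin] linear_neg[OF lin] linear_scale[OF lin])
 next
 show "\<exists>x. f (\<psi> x) ~= 0" using nz by blast
 show "(%x. f (\<psi> x)) \<in> borel_measurable lborel" by (rule fm)
 show "integrable lborel (%x. (norm (f (\<psi> x)))\<^sup>2)"
 proof (rule Bochner_Integration.integrable_bound[OF i])
 show "(%x. (norm (f (\<psi> x)))\<^sup>2) \<in> borel_measurable lborel" using fm by measurable
 show "AE x in lborel. norm ((norm (f (\<psi> x)))\<^sup>2) <= norm ((norm (\<psi> x))\<^sup>2)"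
 proof (rule AE_I2)
 fix x
 have "\<bar>f (\<psi> x)\<bar>\<^sup>2 <= (norm (\<psi> x))\<^sup>2" by (rule power_mono[OF fb abs_ge_zero])
 then show "norm ((norm (f (\<psi> x)))\<^sup>2) <= norm ((norm (\<psi> x))\<^sup>2)" by simp
 qed
 qed
 qed
qed

lemma real_eigenfunction_exists:
 assumes "is_eigenvalue v h lam" "0 < h" shows "\<exists>\<psi>::real => real. eigenfunction v lam h \<psi>"
proof -
 obtain \<psi> :: "real => complex" where e: "eigenfunction v lam h \<psi>" using assms unfolding is_eigenvalue_def by blast
 then obtain x where "\<psi> x ~= 0" unfolding eigenfunction_def by blast
 then have "Re (\<psi> x) ~= 0 \<or> Im (\<psi> x) ~= 0" by (auto simp: complex_eq_iff)
 then show ?thesis using eigenfunction_linear_image[OF bounded_linear_Re abs_Re_le_cmod assms(2) e]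
 eigenfunction_linear_image[OF bounded_linear_Im abs_Im_le_cmod assms(2) e] by blast
qed

text \<open>Far out both solutions are positive and bounded, so their Wronskian vanishes and they
  are proportional; the limit of the quotient forces the factor 1.\<close>

lemma recessive_solution_unique:
 fixes u u1 w w1 Q :: "real => real"
 assumes u: "!!x. (u has_real_derivative u1 x) (at x)" "!!x. (u1 has_real_derivative Q x * u x) (at x)"
 and w: "!!x. (w has_real_derivative w1 x) (at x)" "!!x. (w1 has_real_derivative Q x * w x) (at x)"
 and Q: "continuous_on UNIV Q" and pos: "!!x. a <= x ==> 0 < u x" and dec: "!!x. a <= x ==> u1 x <= 0"
 and lim: "((%x. w x / u x) \<longlongrightarrow> 1) at_top"
 shows "w = u"
proof -
 have "eventually (%x. w x / u x < 2) at_top" "eventually (%x. 0 < w x / u x) at_top" using order_tendstoD[OF lim] by auto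
 then obtain b where b: "a <= b" "!!x. b <= x ==> w x / u x < 2" "!!x. b <= x ==> 0 < w x / u x"
 using eventually_conj[of _ at_top] unfolding eventually_at_top_linorder by (metis max.bounded_iff max.cobounded1 linorder_le_cases)
 have le: "u x <= u a" if "a <= x" for x by (rule DERIV_nonpos_mono[where f = u and f' = u1]) (use that u dec in auto)
 have "u1 b * w b = u b * w1 b"
 proof (rule recessive_wronskian_zero[where y = w and a = b and Q = Q and My = "2 * u a" and M\<psi> = "u a"])
 fix x assume x: "b <= x"
 then have ax: "a <= x" using b by simp
 show "0 < u x" "u x <= u a" "u1 x <= 0" using pos[OF ax] le[OF ax] dec[OF ax] by auto
 show "0 < w x" using b(3)[OF x] pos[OF ax] by (simp add: zero_less_divide_iff)
 have "w x < 2 * u x" using b(2)[OF x] pos[OF ax] by (simp add: divide_less_eq)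
 then show "w x <= 2 * u a" using le[OF ax] by linarith
 qed (use u w in auto)
 then have wr: "w1 b = w b / u b * u1 b" using pos[OF b(1)] by (simp add: field_simps)
 define t where "t = w b / u b"
 have z: "w x - t * u x = 0" for x
 proof (rule energy_zero[where a = b and Q = Q and u = "%x. w x - t * u x" and ?u1.0 = "%x. w1 x - t * u1 x"])
 show "((%x. w x - t * u x) has_real_derivative w1 x - t * u1 x) (at x)" for x by (intro DERIV_diff DERIV_cmult u w)
 have "((%x. w1 x - t * u1 x) has_real_derivative Q x * w x - t * (Q x * u x)) (at x)" for x by (intro DERIV_diff DERIV_cmult u w)
 then show "((%x. w1 x - t * u1 x) has_real_derivative Q x * (w x - t * u x)) (at x)" for x by (simp add: algebra_simps)
 show "w b - t * u b = 0" unfolding t_def using pos[OF b(1)] by simp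
 show "w1 b - t * u1 b = 0" unfolding wr t_def by simp
 qed (rule Q)
 have "eventually (%x. w x / u x = t) at_top" using eventually_ge_at_top[of a]
 proof eventually_elim
 case (elim x) then show ?case using z[of x] pos[of x] by (simp add: field_simps)
 qed
 then have "((%x. w x / u x) \<longlongrightarrow> t) at_top" by (rule tendsto_eventually)
 then have "t = 1" using lim by (rule tendsto_unique[OF trivial_limit_at_top_linorder])
 then show ?thesis using z by (auto simp: fun_eq_iff)
qed

context langer
begin

text \<open>2 B / rho covers the relative error \<open>2 * Gam\<close>, and B covers
  \<open>beta\<close> at the turning point, where \<open>zeta\<close> equals
  \<open>k\<close>.\<close>

definition G0 :: real where "G0 = 2 * B / rho + B"

lemma G0_nonneg: "0 <= G0" unfolding G0_def using B_pos rho by simp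

lemma Q_nonneg: "x0 <= x ==> 0 <= Q x" using Q_eq[of x] xi_nonneg[of x] x1_less_x0 by simp

lemma beta_x0: assumes k: "0 < k" shows "beta k x0 <= G0 * k\<^sup>2 * xi1 x0"
proof -
 have z: "zeta k x0 = k" unfolding zeta_def xi_x0 using k by simp
 have x: "0 < xi1 x0" using xi1_pos x1_less_x0 by simp
 have "(1 + k) powr (- 2 * rho - 1) <= 1" using powr_mono[of "- 2 * rho - 1" 0 "1 + k"] k rho by simp
 then have "B * k ^ 3 * (xi1 x0 / k * (1 + k) powr (- 2 * rho - 1)) <= B * k ^ 3 * (xi1 x0 / k * 1)" using B_pos k x by (intro mult_left_mono) auto
 also have "... = B * k\<^sup>2 * xi1 x0" using k by (simp add: eval_nat_numeral)
 also have "... <= G0 * k\<^sup>2 * xi1 x0" unfolding G0_def using B_pos rho x by (intro mult_right_mono) auto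
 finally show ?thesis unfolding beta_def z .
qed

text \<open>A zero right of \<open>x0\<close> would persist and make the solution vanish
  identically. Hence the sign is constant, and after normalizing it the solution is positive and
  decreasing, as the comparison with \<open>Y\<close> requires.\<close>

lemma decaying_solution:
 fixes \<psi> \<psi>1 :: "real => real"
 assumes k: "0 < k" "k <= 1" "3 * K * k\<^sup>2 <= airy_slope" "B * k ^ 3 <= rho" "G0 * k ^ 3 <= 1"
 and \<psi>: "!!x. (\<psi> has_real_derivative \<psi>1 x) (at x)" "!!x. (\<psi>1 has_real_derivative Q x / k ^ 6 * \<psi> x) (at x)"
 and Q: "continuous_on UNIV Q" and small: "!!b. \<exists>x\<ge>b. (\<psi> x)\<^sup>2 < 1" and nz: "\<psi> x2 ~= 0"
 obtains c where "c ~= 0" "langer_solution K rho x1 x0 Q xi xi1 l l1 k G0 (%x. c * \<psi> x) (%x. c * \<psi>1 x)"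
 "((%x. c * \<psi> x / Y k x) \<longlongrightarrow> 1) at_top" "!!x. x0 <= x ==> 0 < c * \<psi> x"
 "!!x. x0 <= x ==> \<bar>c * \<psi> x / Y k x - 1\<bar> <= G0 * k ^ 3 * (1 + xi x) powr (- rho)"
proof -
 have Qc: "continuous_on UNIV (%x. Q x / k ^ 6)" using k(1) by (intro continuous_intros Q) auto
 have Qp: "0 <= Q x / k ^ 6" if "x0 <= x" for x using Q_nonneg[OF that] k(1) by simp
 have nz0: "\<psi> b ~= 0" if b: "x0 <= b" for b
 proof
 assume z: "\<psi> b = 0"
 have zz: "\<psi> x = 0" if "b <= x" for x
 using recessive_zero[where a = x0 and Q = "%x. Q x / k ^ 6" and u = \<psi> and ?u1.0 = \<psi>1 and b = b] \<psi> Qp small b z that by blast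
 have "(\<psi> has_real_derivative 0) (at (b + 1))"
 by (rule has_field_derivative_transform_within_open[OF DERIV_const[of 0], of "{b<..}"]) (use zz in auto)
 then have "\<psi>1 (b + 1) = 0" using \<psi>(1) DERIV_unique by blast
 then have "\<psi> x2 = 0" using energy_zero[OF \<psi> Qc, of "b + 1"] zz[of "b + 1"] by simp
 then show False using nz by simp
 qed
 define s where "s = sgn (\<psi> x0)"
 have s: "s\<^sup>2 = 1" "s ~= 0" "0 < s * \<psi> x0" unfolding s_def using nz0[of x0] by (auto simp: sgn_if)
 have d: "((%x. s * \<psi> x) has_real_derivative s * \<psi>1 x) (at x)" for x by (intro DERIV_cmult \<psi>)
 have d1: "((%x. s * \<psi>1 x) has_real_derivative Q x / k ^ 6 * (s * \<psi> x)) (at x)" for x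
 by (rule DERIV_cong[OF DERIV_cmult[OF \<psi>(2)] mult.left_commute])
 have sm: "\<exists>x\<ge>b. (s * \<psi> x)\<^sup>2 < 1" for b using small[of b] s(1) by (simp add: power_mult_distrib)
 have nzs: "s * \<psi> x ~= 0" if "x0 <= x" for x using nz0[OF that] s(2) by simp
 have pos: "0 < s * \<psi> x" and dec: "s * \<psi>1 x <= 0" if "x0 <= x" for x
 by (rule recessive_sign[where a = x0 and c = x0 and Q = "%x. Q x / k ^ 6" and u = "%x. s * \<psi> x" and ?u1.0 = "%x. s * \<psi>1 x", OF d d1 Qp sm nzs order_refl s(3) that]; assumption)+
 obtain c0 where c0: "0 < c0" "((%x. s * \<psi> x / Y k x) \<longlongrightarrow> c0) at_top"
 "!!x. x0 <= x ==> \<bar>s * \<psi> x / (c0 * Y k x) - 1\<bar> <= 2 * Gam k x"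
 "\<bar>s * \<psi>1 x0 * Y k x0 - s * \<psi> x0 * Y1 k x0\<bar> <= beta k x0 * (s * \<psi> x0 * Y k x0)"
 using right_asymptotics[OF k(1-4) d d1 pos dec] by blast
 define c where "c = s / c0"
 have c: "c ~= 0" "!!t. c * t = s * t / c0" unfolding c_def using s c0(1) by auto
 have b: "\<bar>c * \<psi> x / Y k x - 1\<bar> <= G0 * k ^ 3 * (1 + xi x) powr (- rho)" if "x0 <= x" for x
 proof -
 have "\<bar>c * \<psi> x / Y k x - 1\<bar> <= 2 * Gam k x" using c0(3)[OF that] unfolding c(2) by (simp add: mult.commute)
 also have "... <= 2 * (B * k ^ 3 / rho * (1 + xi x) powr (- rho))" using Gam_le[of x k] that k by simp
 also have "... = (2 * B / rho) * k ^ 3 * (1 + xi x) powr (- rho)" by simp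
 also have "... <= G0 * k ^ 3 * (1 + xi x) powr (- rho)" unfolding G0_def using B_pos k(1) by (intro mult_right_mono) auto
 finally show ?thesis .
 qed
 have pc: "0 < c * \<psi> x" "c * \<psi>1 x <= 0" if "x0 <= x" for x
 unfolding c(2) using pos[OF that] dec[OF that] c0(1) by (auto simp: divide_le_0_iff)
 have ls: "langer_solution K rho x1 x0 Q xi xi1 l l1 k G0 (%x. c * \<psi> x) (%x. c * \<psi>1 x)"
 proof (intro langer_solution.intro langer_axioms langer_solution_axioms.intro)
 show "0 < k" "k <= 1" "0 <= G0" "G0 * k ^ 3 <= 1" using k G0_nonneg by auto
 fix x
 show "((%x. c * \<psi> x) has_real_derivative c * \<psi>1 x) (at x)" by (intro DERIV_cmult \<psi>)
 show "((%x. c * \<psi>1 x) has_real_derivative Q x / k ^ 6 * (c * \<psi> x)) (at x)"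
 by (rule DERIV_cong[OF DERIV_cmult[OF \<psi>(2)] mult.left_commute])
 show "c * \<psi>1 x <= 0" if "x0 <= x" by (rule pc(2)[OF that])
 show "\<bar>c * \<psi> x / Y k x - 1\<bar> <= G0 * k ^ 3" if x: "x0 <= x"
 proof -
 have "(1 + xi x) powr (- rho) <= 1" using powr_mono[of "- rho" 0 "1 + xi x"] xi_nonneg[OF x] rho by simp
 then have "G0 * k ^ 3 * (1 + xi x) powr (- rho) <= G0 * k ^ 3 * 1" using G0_nonneg k(1) by (intro mult_left_mono) auto
 then show ?thesis using b[OF x] by simp
 qed
 next
 have "\<bar>c * \<psi>1 x0 * Y k x0 - c * \<psi> x0 * Y1 k x0\<bar> = \<bar>s * \<psi>1 x0 * Y k x0 - s * \<psi> x0 * Y1 k x0\<bar> / c0"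
 unfolding c(2) using c0(1) by (simp add: diff_divide_distrib[symmetric] abs_divide)
 also have "... <= beta k x0 * (s * \<psi> x0 * Y k x0) / c0" using c0(1,4) by (intro divide_right_mono) auto
 also have "... = beta k x0 * (c * \<psi> x0 * Y k x0)" unfolding c(2) by simp
 also have "... <= G0 * k\<^sup>2 * xi1 x0 * (c * \<psi> x0 * Y k x0)"
 using beta_x0[OF k(1)] pc(1)[of x0] Y_pos[of x0 k] k(1) by (intro mult_right_mono) auto
 finally show "\<bar>c * \<psi>1 x0 * Y k x0 - c * \<psi> x0 * Y1 k x0\<bar> <= G0 * k\<^sup>2 * xi1 x0 * (c * \<psi> x0 * Y k x0)" .
 qed
 have "((%x. s * \<psi> x / Y k x / c0) \<longlongrightarrow> c0 / c0) at_top" using c0(1) by (intro tendsto_divide c0(2) tendsto_const) auto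
 then have lim: "((%x. c * \<psi> x / Y k x) \<longlongrightarrow> 1) at_top" unfolding c(2) using c0(1) by (simp add: mult.commute)
 show ?thesis by (rule that[OF c(1) ls lim pc(1) b])
qed

text \<open>The factor 1 / (2 sqrt pi) of Ai at plus infinity is the one in the normalization of
  \<open>u_plus\<close>, so \<open>Y\<close> is asymptotic to the WKB form with constant exactly
  1.\<close>

lemma Y_asymp:
 assumes k: "0 < k"
 shows "((%x. Y k x / (1 / (2 * sqrt pi) * (k ^ 3) powr (1/6) * Q x powr (-1/4) * exp (- (1 / k ^ 3) * (2/3 * xi x powr (3/2))))) \<longlongrightarrow> 1) at_top"
proof -
 have s_top: "filterlim (%x. xi x / k\<^sup>2) at_top at_top"
 proof -
 have "filterlim (%x. 1 / k\<^sup>2 * xi x) at_top at_top" by (rule filterlim_tendsto_pos_mult_at_top[OF tendsto_const _ xi_at_top]) (use k in simp)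
 then show ?thesis by simp
 qed
 have "((%x. 2 * sqrt pi * (Airy_Ai (xi x / k\<^sup>2) * (xi x / k\<^sup>2) powr (1/4) * exp (2/3 * (xi x / k\<^sup>2) powr (3/2)))) \<longlongrightarrow> 2 * sqrt pi * (1 / (2 * sqrt pi))) at_top"
 by (intro tendsto_mult tendsto_const filterlim_compose[OF Airy_Ai_asymp s_top])
 then have lim: "((%x. 2 * sqrt pi * (Airy_Ai (xi x / k\<^sup>2) * (xi x / k\<^sup>2) powr (1/4) * exp (2/3 * (xi x / k\<^sup>2) powr (3/2)))) \<longlongrightarrow> 1) at_top" by simp
 have ev: "eventually (%x. x0 < x) at_top" by (rule eventually_gt_at_top)
 have ev2: "eventually (%x. 0 < xi x) at_top" using xi_at_top by (simp add: filterlim_at_top_dense)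
 show ?thesis
 proof (rule Lim_transform_eventually[OF lim])
 show "\<forall>\<^sub>F x in at_top. 2 * sqrt pi * (Airy_Ai (xi x / k\<^sup>2) * (xi x / k\<^sup>2) powr (1/4) * exp (2/3 * (xi x / k\<^sup>2) powr (3/2)))
 = Y k x / (1 / (2 * sqrt pi) * (k ^ 3) powr (1/6) * Q x powr (-1/4) * exp (- (1 / k ^ 3) * (2/3 * xi x powr (3/2))))" using ev ev2
 proof eventually_elim
 case (elim x)
 then have x: "x1 <= x" using x1_less_x0 by simp
 define X where "X = xi x"
 define Z where "Z = xi1 x"
 have p: "0 < X" "0 < Z" using elim xi1_pos[OF x] unfolding X_def Z_def by auto
 have kp: "k powr a = exp (a * ln k)" for a using k by (simp add: powr_def)
 have k2: "k\<^sup>2 = k powr 2" and k3: "k ^ 3 = k powr 3" using k by simp_all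
 have 1: "(X / k\<^sup>2) powr (1/4) = X powr (1/4) / k powr (1/2)" unfolding k2 by (simp add: powr_divide powr_powr)
 have 2: "(X / k\<^sup>2) powr (3/2) = X powr (3/2) / k ^ 3" unfolding k2 k3 by (simp add: powr_divide powr_powr)
 have 3: "(k ^ 3) powr (1/6) = k powr (1/2)" unfolding k3 powr_powr by simp
 have 4: "Q x powr (-1/4) = X powr (-1/4) * Z powr (-1/2)"
 proof -
 have "Z\<^sup>2 = Z powr 2" using p by simp
 then have "Q x = X * Z powr 2" using Q_eq[OF x] unfolding X_def Z_def by simp
 then show ?thesis by (simp add: powr_mult powr_powr)
 qed
 have 5: "X powr (-1/4) = 1 / X powr (1/4)" "Z powr (-1/2) = 1 / sqrt Z"
 using p powr_minus_divide[of X "1/4"] powr_minus_divide[of Z "1/2"] by (simp_all add: powr_half_sqrt)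
 have 6: "exp (- (1 / k ^ 3) * (2/3 * X powr (3/2))) = 1 / exp (2/3 * (X powr (3/2) / k ^ 3))" by (simp add: exp_minus inverse_eq_divide mult_ac)
 have g: "2 * sp * (A * (a / b) * e) = A / z / (1 / (2 * sp) * b * (1 / a * (1 / z)) * (1 / e))"
 if "0 < sp" "0 < a" "0 < b" "0 < e" "0 < z" for A a b e sp z :: real using that by (simp add: field_simps)
 show ?case unfolding Y_def sig_def X_def[symmetric] Z_def[symmetric] 1 2 3 4 5 6 by (rule g) (use p k in auto)
 qed
 qed
qed

end

section \<open>Estimates for the right turning point, uniform in the parameters\<close>

lemma turning_xi_eq_xi_plus:
 assumes T: "turning M d kap xl x1 (x_plus v lam) (q v lam) v1 v2 v3" and c: "continuous_on UNIV v"
 shows "turning.xi (x_plus v lam) (q v lam) = xi_plus v lam"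
proof
 interpret T: turning M d kap xl x1 "x_plus v lam" "q v lam" v1 v2 v3 by (rule T)
 fix x
 have cq: "continuous_on S (q v lam)" for S by (rule T.cont_q)
 show "T.xi x = xi_plus v lam x"
 proof (cases "x_plus v lam <= x")
 case True
 have "(LBINT y=x_plus v lam..x. sqrt (q v lam y)) = integral {x_plus v lam..x} (%y. sqrt (q v lam y))"
 using True by (intro interval_integral_continuous continuous_intros cq)
 then show ?thesis unfolding T.xi_def T.S_def xi_plus_def using True by simp
 next
 case False
 have "(LBINT y=x..x_plus v lam. sqrt \<bar>q v lam y\<bar>) = integral {x..x_plus v lam} (%y. sqrt \<bar>q v lam y\<bar>)"
 using False by (intro interval_integral_continuous continuous_intros cq) auto
 then show ?thesis unfolding T.xi_def T.S_def xi_plus_def using False by simp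
 qed
qed

definition airy_approx :: "(real => real) => real => real => real" where
 "airy_approx xi k x = \<bar>deriv xi x\<bar> powr (-1/2) * Airy_Ai (xi x / k\<^sup>2)"

definition wkb_plus :: "(real => real) => real => real => real => real" where
 "wkb_plus v lam h x = 1 / (2 * sqrt pi) * h powr (1/6) * q v lam x powr (-1/4) *
 exp (- (1 / h) * (LBINT y=x_plus v lam..x. sqrt (q v lam y)))"

text \<open>The semiclassical parameter is written \<open>h = k\<^sup>3\<close>, so that all its fractional powers that occur
 are polynomials in \<open>k\<close> and \<open>sqrt k\<close>.\<close>

definition plus_estimates :: "(real => real) => real => real => real => real => real => bool" where
 "plus_estimates v lam k x1 rho C \<longleftrightarrow>
 (let u = u_plus v lam (k ^ 3); x0 = x_plus v lam; xi = xi_plus v lam;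
 I = LBINT x=x1..x0. (lam - v x) powr (-1/2) in
 (\<forall>w. homogeneous_solution v lam (k ^ 3) w & w \<sim>[at_top] wkb_plus v lam (k ^ 3) \<longleftrightarrow> w = u) &
 (\<forall>\<psi>. eigenfunction v lam (k ^ 3) \<psi> --> (\<exists>c. c ~= 0 & (\<forall>x. \<psi> x = c * u x))) &
 (\<forall>x\<ge>x0. 0 < airy_approx xi k x & \<bar>u x / airy_approx xi k x - 1\<bar> <= C * k ^ 3 * (1 + \<bar>xi x\<bar>) powr (- rho)) &
 (\<forall>x\<in>{x1<..<x0}. \<bar>u x - airy_approx xi k x\<bar> <= C * (k ^ 3 * sqrt k) * (k\<^sup>2 + \<bar>x - x0\<bar>) powr (-1/4)) &
 (\<forall>x. \<bar>x - x0\<bar> <= 1 / C --> \<bar>u x\<bar> <= C * sqrt k * (k\<^sup>2 + \<bar>x - x0\<bar>) powr (-1/4)) &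
 (\<exists>u1. (u has_real_derivative u1) (at x1) &
 \<bar>k ^ 6 * u1\<^sup>2 / sqrt (lam - v x1) + sqrt (lam - v x1) * (u x1)\<^sup>2 - k / pi\<bar> <= C * k\<^sup>2) &
 set_integrable lborel (einterval x1 x0) (%x. (lam - v x) powr (-1/2)) & 1 / C <= I & I <= C &
 (set_integrable lborel {x1..} (%x. (u x)\<^sup>2) -->
 \<bar>(LINT x:{x1..}|lborel. (u x)\<^sup>2) - k / (2 * pi) * I\<bar> <= C * k\<^sup>2))"

lemma power_cube_square: "(k ^ 3)\<^sup>2 = (k::real) ^ 6" by (simp flip: power_mult)

text \<open>The constants exported from the locales depend on \<open>K\<close> and
  \<open>rho\<close> alone, so the maximum is the same for all \<open>lam\<close> and
  \<open>k\<close>.\<close>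

definition side_consts :: "real => real => real set" where
 "side_consts K rho = (let G = langer.G0 K rho in {1, K, K ^ 3, 6 * K ^ 5, G, 2 * K\<^sup>2 * sqrt (langer.D K G),
 2 * K\<^sup>2 * (sqrt (langer_solution.N K G) + airy_R), langer_solution.CE K G, langer_solution.CI K G})"

lemma side_consts:
 assumes C: "Max (side_consts K rho) <= C" and G: "G = langer.G0 K rho"
 shows "1 <= C" "K <= C" "K ^ 3 <= C" "6 * K ^ 5 <= C" "G <= C" "2 * K\<^sup>2 * sqrt (langer.D K G) <= C"
 "2 * K\<^sup>2 * (sqrt (langer_solution.N K G) + airy_R) <= C" "langer_solution.CE K G <= C" "langer_solution.CI K G <= C"
proof -
 have "finite (side_consts K rho)" unfolding side_consts_def Let_def by simp
 then have m: "x <= C" if "x \<in> side_consts K rho" for x using Max_ge[OF _ that] C by (meson order_trans)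
 show "1 <= C" "K <= C" "K ^ 3 <= C" "6 * K ^ 5 <= C" "G <= C" "2 * K\<^sup>2 * sqrt (langer.D K G) <= C"
 "2 * K\<^sup>2 * (sqrt (langer_solution.N K G) + airy_R) <= C" "langer_solution.CE K G <= C" "langer_solution.CI K G <= C"
 by (rule m, simp add: side_consts_def Let_def G)+
qed

text \<open>No decaying solution is constructed. The given eigenfunction, suitably scaled, satisfies
  the description defining \<open>u_plus\<close>; together with uniqueness this shows that the
  description denotes it, and all bounds proved for it are bounds for \<open>u_plus\<close>.\<close>

lemma plus_estimates_turning:
 fixes k M :: real and \<psi> :: "real => real"
 assumes T: "turning M d kap xl x1 (x_plus v lam) (q v lam) v1 v2 v3" and v: "continuous_on UNIV v"
 and K: "K = 100 * M ^ 12" and rho: "rho = 3/2 * (kap - 1)" and C: "Max (side_consts K rho) <= C"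
 and k: "0 < k" "k <= 1" "3 * K * k\<^sup>2 <= airy_slope" "langer.B K rho * k ^ 3 <= rho" "langer.G0 K rho * k ^ 3 <= 1"
 and \<psi>: "eigenfunction v lam (k ^ 3) \<psi>"
 shows "plus_estimates v lam k x1 rho C"
proof -
 define x0 where "x0 = x_plus v lam"
 interpret T: turning M d kap xl x1 x0 "q v lam" v1 v2 v3 unfolding x0_def by (rule T)
 interpret L: langer K rho x1 x0 "q v lam" T.xi T.xi1 T.l T.l1 unfolding K rho by (rule T.langer_geometry)
 note xi_eq = turning_xi_eq_xi_plus[OF T v, folded x0_def]
 define G where "G = langer.G0 K rho"
 note SC = side_consts[OF C G_def]
 have k3: "0 < k ^ 3" using k by simp
 have qc: "continuous_on UNIV (q v lam)" by (rule T.cont_q)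
 obtain p1 where p: "!!x. (\<psi> has_real_derivative p1 x) (at x)" "!!x. (p1 has_real_derivative q v lam x / k ^ 6 * \<psi> x) (at x)"
 and pi': "integrable lborel (%x. (\<psi> x)\<^sup>2)" and pn: "\<exists>x. \<psi> x ~= 0"
 using \<psi> unfolding eigenfunction_iff[OF k3] homogeneous_solution_iff power_cube_square by blast
 obtain z where z: "\<psi> z ~= 0" using pn by blast
 obtain c where c: "c ~= 0" and ls: "langer_solution K rho x1 x0 (q v lam) T.xi T.xi1 T.l T.l1 k G (%x. c * \<psi> x) (%x. c * p1 x)"
 and lim: "((%x. c * \<psi> x / L.Y k x) \<longlongrightarrow> 1) at_top" and pos: "!!x. x0 <= x ==> 0 < c * \<psi> x"
 and right: "!!x. x0 <= x ==> \<bar>c * \<psi> x / L.Y k x - 1\<bar> <= G * k ^ 3 * (1 + T.xi x) powr (- rho)"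
 by (rule L.decaying_solution[OF k p qc square_integrable_small[OF pi'] z, folded G_def]) blast
 define u where "u = (%x. c * \<psi> x)"
 define u1 where "u1 = (%x. c * p1 x)"
 interpret S: langer_solution K rho x1 x0 "q v lam" T.xi T.xi1 T.l T.l1 k G u u1 using ls unfolding u_def u1_def .
 have du: "(u has_real_derivative u1 x) (at x)" and du1: "(u1 has_real_derivative q v lam x / k ^ 6 * u x) (at x)" for x
 unfolding u_def u1_def by (rule DERIV_cmult[OF p(1)], rule DERIV_cong[OF DERIV_cmult[OF p(2)] mult.left_commute])
 have hu: "homogeneous_solution v lam (k ^ 3) u" unfolding homogeneous_solution_iff power_cube_square using du du1 by blast
 have Sxi: "(LBINT y=x0..x. sqrt (q v lam y)) = 2/3 * T.xi x powr (3/2)" if "x0 <= x" for x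
 proof -
 have "(LBINT y=x0..x. sqrt (q v lam y)) = integral {x0..x} (%y. sqrt (q v lam y))"
 using that by (intro interval_integral_continuous continuous_intros T.cont_q)
 then show ?thesis using T.S_eq_xi[OF that] that unfolding T.S_def by simp
 qed
 let ?g = "wkb_plus v lam (k ^ 3)"
 have gY: "((%x. L.Y k x / ?g x) \<longlongrightarrow> 1) at_top"
 proof (rule Lim_transform_eventually[OF L.Y_asymp[OF k(1)]])
 show "\<forall>\<^sub>F x in at_top. L.Y k x / (1 / (2 * sqrt pi) * (k ^ 3) powr (1/6) * q v lam x powr (-1/4) * exp (- (1 / k ^ 3) * (2/3 * T.xi x powr (3/2)))) = L.Y k x / ?g x"
 using eventually_ge_at_top[of x0]
 proof eventually_elim
 case (elim x)
 show ?case unfolding wkb_plus_def x0_def[symmetric] Sxi[OF elim] by (rule refl)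
 qed
 qed
 have gpos: "0 < ?g x" if "x0 < x" for x
 proof -
 have "0 < q v lam x" by (rule T.q_pos[OF that])
 then show ?thesis unfolding wkb_plus_def using k by simp
 qed
 have "((%x. u x / L.Y k x * (L.Y k x / ?g x)) \<longlongrightarrow> 1 * 1) at_top" unfolding u_def by (intro tendsto_mult lim gY)
 then have ug: "((%x. u x / ?g x) \<longlongrightarrow> 1) at_top"
 proof (rule Lim_transform_eventually[OF tendsto_eq_rhs])
 show "\<forall>\<^sub>F x in at_top. u x / L.Y k x * (L.Y k x / ?g x) = u x / ?g x" using eventually_ge_at_top[of x0]
 proof eventually_elim
 case (elim x) then show ?case using L.Y_pos[of x k] k by simp
 qed
 qed simp
 have asy: "w \<sim>[at_top] ?g \<longleftrightarrow> ((%x. w x / ?g x) \<longlongrightarrow> 1) at_top" for w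
 unfolding asymp_equiv_def
 proof (rule tendsto_cong)
 show "\<forall>\<^sub>F x in at_top. (if w x = 0 & ?g x = 0 then 1 else w x / ?g x) = w x / ?g x"
 using eventually_gt_at_top[of x0] by eventually_elim (use gpos in force)
 qed
 have uniq: "w = u" if w: "homogeneous_solution v lam (k ^ 3) w" "w \<sim>[at_top] ?g" for w
 proof -
 obtain w1 where w1: "!!x. (w has_real_derivative w1 x) (at x)" "!!x. (w1 has_real_derivative q v lam x / k ^ 6 * w x) (at x)"
 using w(1) unfolding homogeneous_solution_iff power_cube_square by blast
 have "((%x. w x / ?g x / (u x / ?g x)) \<longlongrightarrow> 1 / 1) at_top" using w(2) unfolding asy by (intro tendsto_divide ug) auto
 then have l: "((%x. w x / u x) \<longlongrightarrow> 1) at_top"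
 proof (rule Lim_transform_eventually[OF tendsto_eq_rhs])
 show "\<forall>\<^sub>F x in at_top. w x / ?g x / (u x / ?g x) = w x / u x"
 using eventually_gt_at_top[of x0] by eventually_elim (use gpos in \<open>force simp: divide_simps\<close>)
 qed simp
 show ?thesis
 proof (rule recessive_solution_unique[where Q = "%x. q v lam x / k ^ 6" and a = x0, OF du du1 w1 _ _ _ l])
 show "continuous_on UNIV (%x. q v lam x / k ^ 6)" using k(1) by (intro continuous_intros qc) auto
 show "0 < u x" if "x0 <= x" for x unfolding u_def by (rule pos[OF that])
 show "u1 x <= 0" if "x0 <= x" for x by (rule S.u_dec[OF that])
 qed
 qed
 have ex: "homogeneous_solution v lam (k ^ 3) w & w \<sim>[at_top] ?g \<longleftrightarrow> w = u" for w using uniq hu ug asy by blast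
 have up: "u_plus v lam (k ^ 3) = u"
 unfolding u_plus_def wkb_plus_def[symmetric] using ex by (intro the_equality) (auto simp: wkb_plus_def[abs_def])
 have dxi: "deriv (xi_plus v lam) = T.xi1" unfolding T.xi1_def xi_eq ..
 have aY: "airy_approx (xi_plus v lam) k x = L.Y k x" if "x1 <= x" for x
 proof -
 have "0 < T.xi1 x" by (rule L.xi1_pos[OF that])
 then have "\<bar>T.xi1 x\<bar> powr (-1/2) = 1 / sqrt (T.xi1 x)" using powr_minus_divide[of "T.xi1 x" "1/2"] by (simp add: powr_half_sqrt)
 then show ?thesis unfolding airy_approx_def L.Y_def L.sig_def dxi unfolding xi_eq by simp
 qed
 have x10: "x1 < x0" by (rule L.x1_less_x0)
 have K0: "1 <= K" by (rule L.K)
 have lv: "- q v lam x = lam - v x" for x unfolding q_def by simp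
 have kn: "0 <= k ^ 3 * sqrt k" "0 <= sqrt k" "0 <= k\<^sup>2" "0 <= k ^ 3" using k(1) by auto
 \<comment> \<open>Any other eigenfunction can be normalized against \<open>L.Y\<close> in the same
   way. It then has the same asymptotics as \<open>u\<close>, hence equals it.\<close>
 have eig: "\<exists>c. c ~= 0 & (\<forall>x. f x = c * u x)" if f: "eigenfunction v lam (k ^ 3) f" for f
 proof -
 obtain f1 where f1: "!!x. (f has_real_derivative f1 x) (at x)" "!!x. (f1 has_real_derivative q v lam x / k ^ 6 * f x) (at x)"
 and fi: "integrable lborel (%x. (f x)\<^sup>2)" and fn: "\<exists>x. f x ~= 0"
 using f unfolding eigenfunction_iff[OF k3] homogeneous_solution_iff power_cube_square by blast
 obtain z where z: "f z ~= 0" using fn by blast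
 obtain b where b: "b ~= 0" and lf: "((%x. b * f x / L.Y k x) \<longlongrightarrow> 1) at_top"
 by (rule L.decaying_solution[OF k f1 qc square_integrable_small[OF fi] z]) blast
 have "((%x. b * f x / L.Y k x * (L.Y k x / ?g x)) \<longlongrightarrow> 1 * 1) at_top" by (intro tendsto_mult lf gY)
 then have "((%x. b * f x / ?g x) \<longlongrightarrow> 1) at_top"
 proof (rule Lim_transform_eventually[OF tendsto_eq_rhs])
 show "\<forall>\<^sub>F x in at_top. b * f x / L.Y k x * (L.Y k x / ?g x) = b * f x / ?g x" using eventually_ge_at_top[of x0]
 proof eventually_elim
 case (elim x) then show ?case using L.Y_pos[of x k] k by simp
 qed
 qed simp
 moreover have "homogeneous_solution v lam (k ^ 3) (%x. b * f x)"
 using f unfolding eigenfunction_iff[OF k3] by (intro homogeneous_solution_scale) blast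
 ultimately have "(%x. b * f x) = u" using uniq asy by blast
 then have "f x = (1 / b) * u x" for x using b by (auto simp: fun_eq_iff field_simps)
 then show ?thesis using b by (intro exI[of _ "1 / b"]) auto
 qed
 show ?thesis
 unfolding plus_estimates_def Let_def up x0_def[symmetric]
 proof (intro conjI allI ballI impI)
 show "homogeneous_solution v lam (k ^ 3) w & w \<sim>[at_top] ?g \<longleftrightarrow> w = u" for w by (rule ex)
 show "\<exists>c. c ~= 0 & (\<forall>x. f x = c * u x)" if "eigenfunction v lam (k ^ 3) f" for f by (rule eig[OF that])
 next
 fix x assume x: "x0 <= x"
 then have x': "x1 <= x" using x10 by simp
 show "0 < airy_approx (xi_plus v lam) k x" unfolding aY[OF x'] by (rule L.Y_pos[OF x k(1)])
 have "0 <= T.xi x" by (rule L.xi_nonneg[OF x])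
 moreover have "G * k ^ 3 * (1 + T.xi x) powr (- rho) <= C * k ^ 3 * (1 + T.xi x) powr (- rho)" using SC(5) kn by (intro mult_right_mono) auto
 ultimately show "\<bar>u x / airy_approx (xi_plus v lam) k x - 1\<bar> <= C * k ^ 3 * (1 + \<bar>xi_plus v lam x\<bar>) powr (- rho)"
 unfolding aY[OF x'] unfolding xi_eq[symmetric] using right[OF x] unfolding u_def by simp
 next
 fix x assume x: "x \<in> {x1<..<x0}"
 have "\<bar>u x - L.Y k x\<bar> <= 2 * K\<^sup>2 * sqrt (langer.D K G) * (k ^ 3 * sqrt k) * (k\<^sup>2 + \<bar>x - x0\<bar>) powr (-1/4)"
 using x by (intro S.left_error) auto
 also have "... <= C * (k ^ 3 * sqrt k) * (k\<^sup>2 + \<bar>x - x0\<bar>) powr (-1/4)" using SC(6) kn by (intro mult_right_mono) auto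
 finally show "\<bar>u x - airy_approx (xi_plus v lam) k x\<bar> <= C * (k ^ 3 * sqrt k) * (k\<^sup>2 + \<bar>x - x0\<bar>) powr (-1/4)"
 using aY[of x] x by simp
 next
 fix x assume x: "\<bar>x - x0\<bar> <= 1 / C"
 have "1 / C <= 1 / K" using SC(2) K0 by (intro divide_left_mono) auto
 then have "\<bar>x - x0\<bar> <= 1 / K" using x by simp
 then have "x1 <= x" "x <= x0 + 1 / K" using L.x1_x0(1) by linarith+
 then have "\<bar>u x\<bar> <= 2 * K\<^sup>2 * (sqrt (langer_solution.N K G) + airy_R) * sqrt k * (k\<^sup>2 + \<bar>x - x0\<bar>) powr (-1/4)"
 by (rule S.turning_bound)
 also have "... <= C * sqrt k * (k\<^sup>2 + \<bar>x - x0\<bar>) powr (-1/4)" using SC(7) kn by (intro mult_right_mono) auto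
 finally show "\<bar>u x\<bar> <= C * sqrt k * (k\<^sup>2 + \<bar>x - x0\<bar>) powr (-1/4)" .
 next
 have "langer_solution.CE K G * k\<^sup>2 <= C * k\<^sup>2" using SC(8) by (intro mult_right_mono) auto
 then show "\<exists>u1. (u has_real_derivative u1) (at x1) &
 \<bar>k ^ 6 * u1\<^sup>2 / sqrt (lam - v x1) + sqrt (lam - v x1) * (u x1)\<^sup>2 - k / pi\<bar> <= C * k\<^sup>2"
 using du[of x1] S.energy_at_x1 unfolding lv by (intro exI[of _ "u1 x1"]) auto
 next
 note V = S.Vint_integral[unfolded lv]
 show "set_integrable lborel (einterval x1 x0) (%x. (lam - v x) powr (-1/2))" by (rule V(1))
 have "1 / C <= 1 / K ^ 3" using SC(3) K0 by (intro frac_le) auto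
 then show "1 / C <= (LBINT x=x1..x0. (lam - v x) powr (-1/2))" unfolding V(2) using S.Vint_bounds(1) by linarith
 show "(LBINT x=x1..x0. (lam - v x) powr (-1/2)) <= C" unfolding V(2) using S.Vint_bounds(2) SC(4) by linarith
 assume i: "set_integrable lborel {x1..} (%x. (u x)\<^sup>2)"
 have "langer_solution.CI K G * k\<^sup>2 <= C * k\<^sup>2" using SC(9) by (intro mult_right_mono) auto
 then show "\<bar>(LINT x:{x1..}|lborel. (u x)\<^sup>2) - k / (2 * pi) * (LBINT x=x1..x0. (lam - v x) powr (-1/2))\<bar> <= C * k\<^sup>2"
 unfolding V(2) using S.total_mass[OF i] by linarith
 qed
qed

lemma small_parameter:
 fixes a b c e :: real
 assumes "0 <= a" "0 < b" "0 <= c" "0 < e" "0 <= g"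
 shows "\<exists>k0>0. \<forall>k. 0 < k & k <= k0 --> k <= 1 & a * k\<^sup>2 <= b & c * k ^ 3 <= e & g * k ^ 3 <= 1"
proof (intro exI[of _ "min 1 (min (b / (a + 1)) (min (e / (c + 1)) (1 / (g + 1))))"] conjI allI impI)
 show "0 < min 1 (min (b / (a + 1)) (min (e / (c + 1)) (1 / (g + 1))))" using assms by auto
 fix k assume k: "0 < k & k <= min 1 (min (b / (a + 1)) (min (e / (c + 1)) (1 / (g + 1))))"
 then have k1: "0 < k" "k <= 1" "k <= b / (a + 1)" "k <= e / (c + 1)" "k <= 1 / (g + 1)" by auto
 have pw: "k\<^sup>2 <= k" "k ^ 3 <= k" using k1 power_decreasing[of 1 2 k] power_decreasing[of 1 3 k] by auto
 have gen: "m * p <= t" if "0 <= m" "p <= k" "k <= t / (m + 1)" "0 <= p" for m p t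
 proof -
 have "m * p <= (m + 1) * k" using that by (intro mult_mono) auto
 also have "... <= t" using that by (simp add: field_simps)
 finally show ?thesis .
 qed
 show "k <= 1" "a * k\<^sup>2 <= b" "c * k ^ 3 <= e" "g * k ^ 3 <= 1" using gen assms pw k1 by auto
qed

lemma plus_side:
 assumes A: "assumption_A v lam0 r0" and B: "assumption_B v lam0" and x1: "x1 \<in> {x_minus v lam0<..<x_plus v lam0}"
 and rho: "rho = 3/2 * min (r0 - 1) 1"
 shows "\<exists>e>0. \<exists>k0>0. \<exists>C0\<ge>1. \<forall>lam. \<bar>lam - lam0\<bar> < e --> assumption_B v lam & x1 \<in> {x_minus v lam<..<x_plus v lam} &
 (\<forall>k. 0 < k & k <= k0 --> (\<exists>\<psi>::real => real. eigenfunction v lam (k ^ 3) \<psi>) --> (\<forall>C\<ge>C0. plus_estimates v lam k x1 rho C))"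
proof -
 obtain e M d where e: "0 < e" and T: "!!lam. \<bar>lam - lam0\<bar> < e ==> assumption_B v lam & x1 \<in> {x_minus v lam<..<x_plus v lam} &
 turning M d (min r0 2) (x_minus v lam) x1 (x_plus v lam) (q v lam) (deriv v) (deriv (deriv v)) (deriv (deriv (deriv v)))"
 using turning_geometry[OF A B x1] by blast
 have "continuous_on UNIV v" using A Ck_on_2_D(1) unfolding assumption_A_def by (blast intro: continuous_at_imp_continuous_on DERIV_isCont)
 note v = this
 define K where "K = 100 * M ^ 12"
 have rho': "rho = 3/2 * (min r0 2 - 1)" unfolding rho by (simp add: min_def)
 have T0: "turning M d (min r0 2) (x_minus v lam0) x1 (x_plus v lam0) (q v lam0) (deriv v) (deriv (deriv v)) (deriv (deriv (deriv v)))"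
 using T[of lam0] e by simp
 \<comment> \<open>Instantiated at \<open>lam0\<close> to obtain the signs of \<open>B\<close> and
   \<open>G0\<close>, which are the same constants for all \<open>lam\<close>.\<close>
 interpret T: turning M d "min r0 2" "x_minus v lam0" x1 "x_plus v lam0" "q v lam0" "deriv v" "deriv (deriv v)" "deriv (deriv (deriv v))" by (rule T0)
 interpret L: langer K rho x1 "x_plus v lam0" "q v lam0" T.xi T.xi1 T.l T.l1 unfolding K_def rho' by (rule T.langer_geometry)
 obtain k0 where k0: "0 < k0" "!!k. 0 < k ==> k <= k0 ==> k <= 1 & 3 * K * k\<^sup>2 <= airy_slope & langer.B K rho * k ^ 3 <= rho & langer.G0 K rho * k ^ 3 <= 1"
 using small_parameter[of "3 * K" airy_slope "langer.B K rho" rho "langer.G0 K rho"] L.K_pos airy_slope(1) L.B_pos L.rho L.G0_nonneg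
 by (metis less_imp_le mult_nonneg_nonneg zero_le_numeral)
 show ?thesis
 proof (rule exI[of _ e], rule conjI[OF e], rule exI[of _ k0], rule conjI[OF k0(1)], rule exI[of _ "Max (side_consts K rho)"],
 rule conjI[OF side_consts(1)[OF order_refl refl]], intro allI impI conjI)
 fix lam assume l: "\<bar>lam - lam0\<bar> < e"
 show "assumption_B v lam" "x1 \<in> {x_minus v lam<..<x_plus v lam}" using T[OF l] by auto
 fix k assume k: "0 < k & k <= k0" and "\<exists>\<psi>::real => real. eigenfunction v lam (k ^ 3) \<psi>"
 then obtain \<psi> :: "real => real" where \<psi>: "eigenfunction v lam (k ^ 3) \<psi>" by blast
 fix C assume "Max (side_consts K rho) <= C"
 then show "plus_estimates v lam k x1 rho C"
 using plus_estimates_turning[OF conjunct2[OF conjunct2[OF T[OF l]]] v K_def rho' _ _ _ _ _ _ \<psi>] k k0(2)[of k] by blast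
 qed
qed

section \<open>Reflection to the left turning point\<close>

lemma DERIV_uminus_arg:
 fixes f :: "real => real"
 assumes "(f has_real_derivative D) (at (- x))" shows "((%x. f (- x)) has_real_derivative - D) (at x)"
proof -
 have "((%x. - x) has_real_derivative -1) (at x)" by (auto intro!: derivative_eq_intros)
 from DERIV_chain2[where g = "%x. - x", OF assms this] show ?thesis by (rule DERIV_cong) simp
qed

lemma deriv_uminus:
 fixes f :: "real => real"
 assumes "f differentiable at (- x)" shows "((%y. f (- y)) has_real_derivative - deriv f (- x)) (at x)"
 using assms by (intro DERIV_uminus_arg) (simp add: DERIV_deriv_iff_real_differentiable)

lemma iterated_deriv_uminus:
 fixes v :: "real => real"
 assumes S: "open S" and d: "!!i x. i < k ==> x \<in> S ==> (deriv ^^ i) v differentiable at x"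
 shows "i <= k ==> - x \<in> S ==> (deriv ^^ i) (%y. v (- y)) x = (-1) ^ i * (deriv ^^ i) v (- x)"
proof (induction i arbitrary: x)
 case (Suc i)
 let ?S' = "uminus -` S"
 have o: "open ?S'" using S by (intro open_vimage continuous_intros) auto
 have "((%y. (-1) ^ i * (deriv ^^ i) v (- y)) has_real_derivative (-1) ^ i * (- deriv ((deriv ^^ i) v) (- x))) (at x)"
 using Suc.prems by (intro DERIV_cmult deriv_uminus d) auto
 then have "((deriv ^^ i) (%y. v (- y)) has_real_derivative (-1) ^ i * (- deriv ((deriv ^^ i) v) (- x))) (at x)"
 by (rule has_field_derivative_transform_within_open[OF _ o]) (use Suc in auto)
 from DERIV_imp_deriv[OF this] show ?case by simp
qed simp

lemma Ck_on_uminus: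
 assumes S: "open S" and C: "Ck_on k v S" shows "Ck_on k (%y. v (- y)) (uminus -` S)"
proof -
 have d: "!!i x. i < k ==> x \<in> S ==> (deriv ^^ i) v differentiable at x" and c: "continuous_on S ((deriv ^^ k) v)"
 using C unfolding Ck_on_def by auto
 let ?S' = "uminus -` S"
 have o: "open ?S'" using S by (intro open_vimage continuous_intros) auto
 note I = iterated_deriv_uminus[OF S d]
 show ?thesis unfolding Ck_on_def
 proof (intro conjI allI impI ballI)
 fix i x assume i: "i < k" and x: "x \<in> ?S'"
 have "((%y. (-1) ^ i * (deriv ^^ i) v (- y)) has_real_derivative (-1) ^ i * (- deriv ((deriv ^^ i) v) (- x))) (at x)"
 using i x by (intro DERIV_cmult deriv_uminus d) auto
 then have "((deriv ^^ i) (%y. v (- y)) has_real_derivative (-1) ^ i * (- deriv ((deriv ^^ i) v) (- x))) (at x)"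
 by (rule has_field_derivative_transform_within_open[OF _ o]) (use i x I in auto)
 then show "(deriv ^^ i) (%y. v (- y)) differentiable at x" using real_differentiable_def by blast
 next
 have "continuous_on ?S' (%x. (-1) ^ k * (deriv ^^ k) v (- x))" by (intro continuous_intros continuous_on_compose2[OF c]) auto
 then show "continuous_on ?S' ((deriv ^^ k) (%y. v (- y)))" by (rule continuous_on_eq) (use I in auto)
 qed
qed

lemma interval_integral_uminus:
 "(LBINT y=ereal a..ereal b. f (- y)) = (LBINT y=ereal (- b)..ereal (- a). f y)" for f :: "real => real"
 using interval_integral_reflect[of "ereal (- b)" "ereal (- a)" f] by simp

lemma assumption_A_uminus:
 assumes A: "assumption_A v lam r0" shows "assumption_A (%x. v (- x)) lam r0"
proof -
 let ?w = "%x. v (- x)"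
 have C: "Ck_on 2 v UNIV" and r0: "1 < r0" using A unfolding assumption_A_def by auto
 have Cw: "Ck_on 2 ?w UNIV" using Ck_on_uminus[OF open_UNIV C] by simp
 have w1: "deriv ?w x = - deriv v (- x)" for x using iterated_deriv_uminus[OF open_UNIV, of 2 v 1 x] C unfolding Ck_on_def by simp
 have w2: "deriv (deriv ?w) x = deriv (deriv v) (- x)" for x
 using iterated_deriv_uminus[OF open_UNIV, of 2 v 2 x] C unfolding Ck_on_def by (simp add: numeral_2_eq_2)
 obtain BB R where BB: "!!x. R <= \<bar>x\<bar> ==>
 \<bar>((deriv v x)\<^sup>2 / \<bar>q v lam x\<bar> ^ 3 + \<bar>deriv (deriv v) x\<bar> / (q v lam x)\<^sup>2)
 * \<bar>LBINT y=0..x. sqrt \<bar>q v lam y\<bar>\<bar> powr r0\<bar> <= BB"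
 using A unfolding assumption_A_def deriv_q[OF Ck_on_2_D(1)[OF C]] by blast
 have qw: "q ?w lam x = q v lam (- x)" for x unfolding q_def by simp
 have i: "\<bar>LBINT y=0..ereal x. sqrt \<bar>q v lam (- y)\<bar>\<bar> = \<bar>LBINT y=0..ereal (- x). sqrt \<bar>q v lam y\<bar>\<bar>" for x :: real
 proof -
 have "(LBINT y=0..ereal x. sqrt \<bar>q v lam (- y)\<bar>) = (LBINT y=ereal (- x)..0. sqrt \<bar>q v lam y\<bar>)"
 using interval_integral_uminus[of 0 x "%y. sqrt \<bar>q v lam y\<bar>"] by (simp add: zero_ereal_def)
 also have "... = - (LBINT y=0..ereal (- x). sqrt \<bar>q v lam y\<bar>)" by (rule interval_integral_endpoints_reverse)
 finally show ?thesis by simp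
 qed
 show ?thesis unfolding assumption_A_def deriv_q[OF Ck_on_2_D(1)[OF Cw]]
 proof (intro conjI Cw r0, rule exI[of _ BB], rule exI[of _ R], intro allI impI)
 fix x :: real assume "R <= \<bar>x\<bar>"
 then have "R <= \<bar>- x\<bar>" by simp
 from BB[OF this]
 show "\<bar>((deriv ?w x)\<^sup>2 / \<bar>q ?w lam x\<bar> ^ 3 + \<bar>deriv (deriv ?w) x\<bar> / (q ?w lam x)\<^sup>2)
 * \<bar>LBINT y=0..x. sqrt \<bar>q ?w lam y\<bar>\<bar> powr r0\<bar> <= BB" unfolding w1 w2 qw i by simp
 qed
qed

lemma turning_points_uminus:
 assumes B: "assumption_B v lam"
 shows "x_minus (%x. v (- x)) lam = - x_plus v lam" "x_plus (%x. v (- x)) lam = - x_minus v lam"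
 "card {x. v (- x) = lam} = 2"
proof -
 note D = assumption_B_D[OF B]
 have "{x. v (- x) = lam} = uminus ` {x. v x = lam}" by (auto simp: image_iff) (metis minus_minus)
 also have "... = {- x_plus v lam, - x_minus v lam}" unfolding D(4) by auto
 finally have s: "{x. v (- x) = lam} = {- x_plus v lam, - x_minus v lam}" .
 have "- x_plus v lam < - x_minus v lam" using D(1) by simp
 note t = turning_points_pair[of "%x. v (- x)", OF s this]
 show "x_minus (%x. v (- x)) lam = - x_plus v lam" "x_plus (%x. v (- x)) lam = - x_minus v lam"
 "card {x. v (- x) = lam} = 2" by (fact t)+
qed

lemma assumption_B_uminus:
 assumes A: "Ck_on 2 v UNIV" and B: "assumption_B v lam" shows "assumption_B (%x. v (- x)) lam"
proof -
 note T = turning_points_uminus[OF B]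
 have b: "!!x. x_minus v lam < x ==> x < x_plus v lam ==> v x < lam"
 "!!x. x \<notin> {x_minus v lam..x_plus v lam} ==> lam < v x"
 "Liminf at_infinity (%x. ereal (v x)) > ereal lam" "0 < deriv v (x_plus v lam)" "0 < - deriv v (x_minus v lam)"
 using B unfolding assumption_B_def by auto
 obtain Sa where Sa: "open Sa" "x_minus v lam \<in> Sa" "Ck_on 3 v Sa" using B unfolding assumption_B_def by blast
 obtain Sb where Sb: "open Sb" "x_plus v lam \<in> Sb" "Ck_on 3 v Sb" using B unfolding assumption_B_def by blast
 have o: "open (uminus -` S)" if "open S" for S :: "real set" using that by (intro open_vimage continuous_intros) auto
 have dw: "deriv (%x. v (- x)) x = - deriv v (- x)" for x using iterated_deriv_uminus[OF open_UNIV, of 2 v 1 x] A unfolding Ck_on_def by simp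
 obtain z where z: "ereal lam < ereal z" "ereal z < Liminf at_infinity (%x. ereal (v x))" using ereal_dense2[OF b(3)] by blast
 from less_LiminfD[OF z(2)] obtain R where R: "!!x. R <= \<bar>x\<bar> ==> z < v x" by (auto simp: at_infinity_abs)
 have "ereal z <= Liminf at_infinity (%x. ereal (v (- x)))"
 by (rule Liminf_bounded) (use R in \<open>auto simp: at_infinity_abs intro!: exI[of _ R] less_imp_le\<close>)
 then have L: "ereal lam < Liminf at_infinity (%x. ereal (v (- x)))" using z(1) by (rule less_le_trans[rotated])
 show ?thesis unfolding assumption_B_def T(1,2) dw
 proof (intro conjI ballI allI impI)
 show "card {x. v (- x) = lam} = 2" by (rule T(3))
 show "\<exists>S. open S & - x_plus v lam \<in> S & Ck_on 3 (%x. v (- x)) S"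
 using Ck_on_uminus[OF Sb(1,3)] o[OF Sb(1)] Sb(2) by (intro exI[of _ "uminus -` Sb"]) auto
 show "\<exists>S. open S & - x_minus v lam \<in> S & Ck_on 3 (%x. v (- x)) S"
 using Ck_on_uminus[OF Sa(1,3)] o[OF Sa(1)] Sa(2) by (intro exI[of _ "uminus -` Sa"]) auto
 qed (use b L in auto)
qed

lemma q_uminus: "q (%x. v (- x)) lam x = q v lam (- x)"
 unfolding q_def by simp

lemma homogeneous_solution_uminus:
 assumes "homogeneous_solution v lam h u" shows "homogeneous_solution (%x. v (- x)) lam h (%x. u (- x))"
proof -
 obtain u1 where *: "!!x. (u has_real_derivative u1 x) (at x)" "!!x. (u1 has_real_derivative q v lam x / h\<^sup>2 * u x) (at x)"
 using assms unfolding homogeneous_solution_iff by blast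
 have 1: "((%x. u (- x)) has_real_derivative - u1 (- x)) (at x)" for x by (rule DERIV_uminus_arg[OF *(1)])
 have "((%x. u1 (- x)) has_real_derivative - (q v lam (- x) / h\<^sup>2 * u (- x))) (at x)" for x by (rule DERIV_uminus_arg[OF *(2)])
 from DERIV_minus[OF this] have 2: "((%x. - u1 (- x)) has_real_derivative q v lam (- x) / h\<^sup>2 * u (- x)) (at x)" for x by simp
 show ?thesis unfolding homogeneous_solution_iff q_uminus using 1 2 by (intro exI[of _ "%x. - u1 (- x)"]) auto
qed

lemma eigenfunction_uminus:
 fixes \<psi> :: "real => real"
 assumes h: "0 < h" and e: "eigenfunction v lam h \<psi>" shows "eigenfunction (%x. v (- x)) lam h (%x. \<psi> (- x))"
proof -
 have "integrable lborel (%x. (\<psi> (- x))\<^sup>2)"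
 using e lborel_integrable_real_affine[of "%x. (\<psi> x)\<^sup>2" "-1" 0] unfolding eigenfunction_iff[OF h] by simp
 moreover have "\<exists>x. \<psi> (- x) ~= 0" using e unfolding eigenfunction_iff[OF h] by (metis minus_minus)
 ultimately show ?thesis using e homogeneous_solution_uminus unfolding eigenfunction_iff[OF h] by blast
qed

lemma xi_minus_uminus:
 assumes B: "assumption_B v lam" shows "xi_plus (%x. v (- x)) lam x = xi_minus v lam (- x)"
 unfolding xi_plus_def xi_minus_def turning_points_uminus[OF B] q_uminus using interval_integral_uminus[of "- x_minus v lam" x "%y. sqrt (q v lam y)"]
 interval_integral_uminus[of x "- x_minus v lam" "%y. sqrt \<bar>q v lam y\<bar>"] by auto

lemma asymp_equiv_uminus:
 fixes f g :: "real => real"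
 shows "f \<sim>[at_bot] g \<longleftrightarrow> (%x. f (- x)) \<sim>[at_top] (%x. g (- x))"
 unfolding asymp_equiv_def filterlim_at_bot_mirror by (rule refl)

text \<open>Both sides are definite descriptions, so unique existence for the reflected problem
  enters as hypothesis \<open>u\<close>; reflection then matches the two descriptions.\<close>

lemma u_minus_uminus:
 assumes B: "assumption_B v lam"
 and u: "!!w. homogeneous_solution (%x. v (- x)) lam h w & w \<sim>[at_top] wkb_plus (%x. v (- x)) lam h \<longleftrightarrow> w = u_plus (%x. v (- x)) lam h"
 shows "u_minus v lam h = (%x. u_plus (%x. v (- x)) lam h (- x))"
proof -
 let ?g = "%x. 1 / (2 * sqrt pi) * h powr (1/6) * q v lam x powr (-1/4) * exp ((1 / h) * (LBINT y=x_minus v lam..x. sqrt (q v lam y)))"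
 have g: "?g (- x) = wkb_plus (%x. v (- x)) lam h x" for x
 proof -
 have "(LBINT y=x_minus v lam..- x. sqrt (q v lam y)) = - (LBINT y=- x_minus v lam..x. sqrt (q v lam (- y)))"
 using interval_integral_uminus[of "- x_minus v lam" x "%y. sqrt (q v lam y)"]
 interval_integral_endpoints_reverse[of "ereal (x_minus v lam)" "ereal (- x)" "%y. sqrt (q v lam y)"] by simp
 then show ?thesis unfolding wkb_plus_def turning_points_uminus[OF B] q_uminus by simp
 qed
 have e: "homogeneous_solution v lam h w & w \<sim>[at_bot] ?g \<longleftrightarrow> (%x. w (- x)) = u_plus (%x. v (- x)) lam h" for w
 proof -
 have "homogeneous_solution v lam h w \<longleftrightarrow> homogeneous_solution (%x. v (- x)) lam h (%x. w (- x))"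
 using homogeneous_solution_uminus[of v lam h w] homogeneous_solution_uminus[of "%x. v (- x)" lam h "%x. w (- x)"] by auto
 moreover have "w \<sim>[at_bot] ?g \<longleftrightarrow> (%x. w (- x)) \<sim>[at_top] wkb_plus (%x. v (- x)) lam h"
 unfolding asymp_equiv_uminus g by (rule refl)
 ultimately show ?thesis using u by blast
 qed
 show ?thesis unfolding u_minus_def
 proof (rule the_equality)
 show "homogeneous_solution v lam h (%x. u_plus (%x. v (- x)) lam h (- x)) & (%x. u_plus (%x. v (- x)) lam h (- x)) \<sim>[at_bot] ?g"
 unfolding e by simp
 fix w assume "homogeneous_solution v lam h w & w \<sim>[at_bot] ?g"
 then have "w (- x) = u_plus (%x. v (- x)) lam h x" for x unfolding e by (auto simp: fun_eq_iff)
 from this[of "- x" for x] show "w = (%x. u_plus (%x. v (- x)) lam h (- x))" by (auto simp: fun_eq_iff)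
 qed
qed

text \<open>Where no derivative exists, \<open>deriv\<close> chooses from an unsatisfiable predicate
  and so takes the same value on both sides.\<close>

lemma abs_deriv_uminus:
 fixes f :: "real => real"
 shows "\<bar>deriv (%x. f (- x)) x\<bar> = \<bar>deriv f (- x)\<bar>"
proof (cases "\<exists>D. (f has_real_derivative D) (at (- x))")
 case True
 then obtain D where D: "(f has_real_derivative D) (at (- x))" by blast
 show ?thesis using DERIV_imp_deriv[OF D] DERIV_imp_deriv[OF DERIV_uminus_arg[OF D]] by simp
next
 case False
 have "\<not> ((%x. f (- x)) has_real_derivative D) (at x)" for D
 proof
 assume "((%x. f (- x)) has_real_derivative D) (at x)"
 then have "((%x. f (- x)) has_real_derivative D) (at (- (- x)))" by simp
 from DERIV_uminus_arg[OF this] have "(f has_real_derivative - D) (at (- x))" by simp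
 then show False using False by blast
 qed
 then show ?thesis using False unfolding deriv_def by simp
qed

lemma airy_approx_uminus:
 assumes B: "assumption_B v lam"
 shows "airy_approx (xi_plus (%x. v (- x)) lam) k x = airy_approx (xi_minus v lam) k (- x)"
proof -
 have x: "xi_plus (%x. v (- x)) lam = (%x. xi_minus v lam (- x))" using xi_minus_uminus[OF B] by auto
 show ?thesis unfolding airy_approx_def x abs_deriv_uminus by (rule refl)
qed

section \<open>Matching and normalization\<close>

lemma powr_cube:
 fixes k :: real
 assumes "0 < k"
 shows "(k ^ 3) powr (1/6) = sqrt k" "(k ^ 3) powr (-1/6) = 1 / sqrt k" "(k ^ 3) powr (2/3) = k\<^sup>2"
 "(k ^ 3) powr (-2/3) = 1 / k\<^sup>2" "(k ^ 3) powr (7/6) = k ^ 3 * sqrt k"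
proof -
 have k3: "k ^ 3 = k powr 3" using assms by simp
 have p: "(k ^ 3) powr a = k powr (3 * a)" for a unfolding k3 powr_powr ..
 have h: "k powr (1/2) = sqrt k" using assms by (simp add: powr_half_sqrt)
 show "(k ^ 3) powr (1/6) = sqrt k" unfolding p using h by simp
 have "k powr (3 * (-1/6)) = 1 / k powr (1/2)" using powr_minus_divide[of k "1/2"] by simp
 then show "(k ^ 3) powr (-1/6) = 1 / sqrt k" unfolding p h .
 have "k powr (3 * (2/3)) = k powr 2" by simp
 then show "(k ^ 3) powr (2/3) = k\<^sup>2" unfolding p using assms by simp
 have "k powr (3 * (-2/3)) = 1 / k powr 2" using powr_minus_divide[of k 2] by simp
 then show "(k ^ 3) powr (-2/3) = 1 / k\<^sup>2" unfolding p using assms by simp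
 have "k powr (3 * (7/6)) = k powr 3 * k powr (1/2)" unfolding powr_add[symmetric] by simp
 also have "... = k ^ 3 * sqrt k" unfolding h k3[symmetric] ..
 finally show "(k ^ 3) powr (7/6) = k ^ 3 * sqrt k" unfolding p .
qed

lemma airy_approx_eq:
 assumes "0 < k"
 shows "\<bar>deriv xi x\<bar> powr (-1/2) * Airy_Ai ((k ^ 3) powr (-2/3) * xi x) = airy_approx xi k x"
 unfolding airy_approx_def powr_cube(4)[OF assms] by simp

lemma mass_split:
 fixes f :: "real => real"
 assumes f: "integrable lborel f"
 shows "(LINT x|lborel. f x) = (LINT x:{a..}|lborel. f x) + (LINT x:{- a..}|lborel. f (- x))"
proof -
 let ?g = "%x. indicator {..a} x * f x"
 have "(LINT x|lborel. ?g x) = \<bar>-1\<bar> *\<^sub>R (LINT x|lborel. ?g (0 + -1 * x))" by (rule lborel_integral_real_affine) simp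
 also have "... = (LINT x|lborel. indicator {- a..} x * f (- x))" by (auto intro!: Bochner_Integration.integral_cong simp: indicator_def)
 finally have r: "(LINT x:{- a..}|lborel. f (- x)) = (LINT x|lborel. ?g x)" unfolding set_lebesgue_integral_def by simp
 have i: "integrable lborel (%x. indicator {a..} x * f x)" "integrable lborel ?g"
 using integrable_mult_indicator[of "{a..}" lborel f] integrable_mult_indicator[of "{..a}" lborel f] f by simp_all
 have "(LINT x|lborel. f x) = (LINT x|lborel. indicator {a..} x * f x + ?g x)"
 proof (rule integral_cong_AE)
 \<comment> \<open>The point \<open>a\<close> lies in both half lines, but it is a null set.\<close>
 show "AE x in lborel. f x = indicator {a..} x * f x + ?g x" using AE_lborel_singleton[of a] by eventually_elim (auto simp: indicator_def)
 qed (use f i in \<open>auto intro!: borel_measurable_integrable\<close>)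
 also have "... = (LINT x|lborel. indicator {a..} x * f x) + (LINT x|lborel. ?g x)" by (rule Bochner_Integration.integral_add[OF i])
 finally show ?thesis unfolding r unfolding set_lebesgue_integral_def by simp
qed

lemma set_integrable_singleton: "set_integrable lborel {a} (f :: real => real)"
proof -
 have "(%x. indicator {a} x *\<^sub>R f x) = (%x. f a * indicator {a} x)" by (auto simp: indicator_def)
 moreover have "integrable lborel (%x. f a * indicator {a} x)" by (intro integrable_mult_right integrable_real_indicator) auto
 ultimately show ?thesis unfolding set_integrable_def by simp
qed

lemma interval_integral_split_uminus:
 fixes a m b :: real and f :: "real => real"
 assumes l: "a < m" "m < b" and 1: "set_integrable lborel (einterval m b) f"
 and 2: "set_integrable lborel (einterval (- m) (- a)) (%x. f (- x))"
 shows "(LBINT x=a..b. f x) = (LBINT x=m..b. f x) + (LBINT x=- m..- a. f (- x))"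
proof -
 have "integrable lborel (%x. indicator (einterval (- m) (- a)) (0 + -1 * x) *\<^sub>R f (- (0 + -1 * x)))"
 using lborel_integrable_real_affine[OF 2[unfolded set_integrable_def], of "-1" 0] by simp
 moreover have "indicator (einterval (- m) (- a)) (0 + -1 * x) = (indicator (einterval a m) x :: real)" for x
 by (auto simp: indicator_def einterval_def)
 ultimately have 3: "set_integrable lborel (einterval a m) f" unfolding set_integrable_def by simp
 have "set_integrable lborel (einterval a m \<union> ({m} \<union> einterval m b)) f" by (intro set_integrable_Un 1 3 set_integrable_singleton) auto
 moreover have "einterval a m \<union> ({m} \<union> einterval m b) = einterval a b" using l by (auto simp: einterval_def)
 ultimately have "set_integrable lborel (einterval a b) f" by simp
 then have "interval_lebesgue_integrable lborel (min (ereal a) (min (ereal m) (ereal b))) (max (ereal a) (max (ereal m) (ereal b))) f"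
 using l unfolding interval_lebesgue_integrable_def by (simp add: min_def max_def)
 from interval_integral_sum[OF this] have "(LBINT x=a..m. f x) + (LBINT x=m..b. f x) = (LBINT x=a..b. f x)" .
 moreover have "(LBINT x=- m..- a. f (- x)) = (LBINT x=a..m. f x)" using interval_integral_uminus[of "- m" "- a" f] by simp
 ultimately show ?thesis by simp
qed

text \<open>The two unknown squared amplitudes are determined by the normalization and by the
 equality of the energies of both representations at the matching point.\<close>

lemma amplitude_bound:
 fixes a b k C I1 I2 :: real
 assumes C: "1 <= C" and k: "0 < k" "16 * C\<^sup>2 * k <= 1" and ab: "0 <= a" "0 <= b"
 and I: "1 / C <= I1" "I1 <= C" "1 / C <= I2" "I2 <= C"
 and e: "\<bar>e1\<bar> <= C * k" "\<bar>e2\<bar> <= C * k" "\<bar>e3\<bar> <= C * k" "\<bar>e4\<bar> <= C * k"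
 and mass: "a * (I1 / (2 * pi) + e3) + b * (I2 / (2 * pi) + e4) = 1"
 and energy: "a * (1 / pi + e1) = b * (1 / pi + e2)"
 shows "a <= 16 * C" "b <= 16 * C" "\<bar>sqrt a - sqrt (2 * pi / (I1 + I2))\<bar> <= 640 * C ^ 4 * k"
proof -
 have C0: "0 < C" using C by simp
 have pi: "3 < pi" "pi < 4" using pi_gt3 pi_less_4 by auto
 have Ck: "C * k <= 1 / (16 * C)" using k(2) C0 by (simp add: field_simps power2_eq_square)
 \<comment> \<open>Since 2 pi < 8 the main part is at least 1 / (8 C), and the smallness of
   \<open>k\<close> keeps the error below half of that.\<close>
 have coef: "1 / (16 * C) <= J / (2 * pi) + e" if "1 / C <= J" "\<bar>e\<bar> <= C * k" for J e
 proof -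
 have "1 / C / 8 <= J / (2 * pi)" using that(1) pi C0 by (intro frac_le) (auto intro: order_trans[rotated])
 moreover have "1 / C / 8 = 1 / (16 * C) + 1 / (16 * C)" using C0 by (simp add: field_simps)
 moreover have "- e <= 1 / (16 * C)" using that(2) Ck by linarith
 moreover have "w <= y + r" if "z <= y" "z = w + w" "- r <= w" for w y z r :: real using that by linarith
 ultimately show ?thesis by blast
 qed
 have c1: "a * (1 / (16 * C)) <= a * (I1 / (2 * pi) + e3)" by (rule mult_left_mono[OF coef[OF I(1) e(3)] ab(1)])
 have c2: "b * (1 / (16 * C)) <= b * (I2 / (2 * pi) + e4)" by (rule mult_left_mono[OF coef[OF I(3) e(4)] ab(2)])
 have n: "0 <= a * (1 / (16 * C))" "0 <= b * (1 / (16 * C))" using ab C0 by auto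
 have "a * (1 / (16 * C)) <= 1" "b * (1 / (16 * C)) <= 1" using c1 c2 n mass by linarith+
 then show a: "a <= 16 * C" and b: "b <= 16 * C" using C0 by (auto simp: field_simps)
 have pe: "\<bar>c * f\<bar> <= 16 * C\<^sup>2 * k" if "0 <= c" "c <= 16 * C" "\<bar>f\<bar> <= C * k" for c f
 proof -
 have "c * \<bar>f\<bar> <= 16 * C * (C * k)" using that C0 by (intro mult_mono) auto
 then show ?thesis using that(1) by (simp add: abs_mult power2_eq_square)
 qed
 \<comment> \<open>Equality of energies says that (a - b) / pi consists of error terms only.\<close>
 define t where "t = b * e2 - a * e1"
 have t: "\<bar>t\<bar> <= 32 * C\<^sup>2 * k" using pe[OF ab(1) a e(1)] pe[OF ab(2) b e(2)] unfolding t_def by linarith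
 have "(a - b) / pi = t" using energy unfolding t_def by (simp add: algebra_simps diff_divide_distrib)
 then have "a - b = pi * t" using pi by (simp add: field_simps)
 then have "\<bar>a - b\<bar> = pi * \<bar>t\<bar>" using pi by (simp add: abs_mult)
 also have "... <= 4 * (32 * C\<^sup>2 * k)" using t pi by (intro mult_mono) auto
 finally have d: "\<bar>a - b\<bar> <= 128 * C\<^sup>2 * k" by simp
 define J where "J = I1 + I2"
 have Ci: "0 < 1 / C" "2 / C = 1 / C + 1 / C" using C0 by simp_all
 have J: "2 / C <= J" "0 < J" using I Ci unfolding J_def by linarith+
 \<comment> \<open>The relative deviation of \<open>a\<close> from 2 pi / J. Replacing
   \<open>b\<close> by \<open>a\<close> in the mass equation costs a multiple of a - b, which is
   already known to be small.\<close>
 define s where "s = a * J / (2 * pi) - 1"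
 have "s = (a - b) * (I2 / (2 * pi)) - a * e3 - b * e4"
 proof -
 have "a * J / (2 * pi) = a * (I1 / (2 * pi)) + a * (I2 / (2 * pi))" unfolding J_def by (simp add: add_divide_distrib distrib_left)
 moreover have "a * p1 + a * p2 - 1 = (a - b) * p2 - a * e3 - b * e4" if "a * (p1 + e3) + b * (p2 + e4) = 1" for p1 p2
 using that by (simp add: algebra_simps)
 ultimately show ?thesis unfolding s_def using mass by presburger
 qed
 moreover have "\<bar>(a - b) * (I2 / (2 * pi))\<bar> <= 128 * C\<^sup>2 * k * C"
 proof -
 have i0: "0 <= I2" using I(3) C0 by (meson divide_nonneg_pos order_trans zero_le_one)
 have "I2 / (2 * pi) <= C / 1" using I(4) i0 pi C0 by (intro frac_le) auto
 then have "\<bar>a - b\<bar> * (I2 / (2 * pi)) <= 128 * C\<^sup>2 * k * C" using d i0 pi C0 k by (intro mult_mono) auto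
 then show ?thesis using i0 pi by (simp add: abs_mult)
 qed
 moreover have "128 * C\<^sup>2 * k * C = 128 * (C ^ 3 * k)" by (simp add: eval_nat_numeral)
 moreover have "16 * C\<^sup>2 * k <= 16 * (C ^ 3 * k)" using power_increasing[of 2 3 C] C k by simp
 ultimately have s: "\<bar>s\<bar> <= 160 * (C ^ 3 * k)" using pe[OF ab(1) a e(3)] pe[OF ab(2) b e(4)] by linarith
 define X where "X = 2 * pi / J"
 have X: "0 < X" "X <= 4 * C"
 proof -
 show "0 < X" unfolding X_def using J pi by simp
 have "2 * pi / J <= 8 / (2 / C)" using J pi C0 by (intro frac_le) auto
 then show "X <= 4 * C" unfolding X_def by simp
 qed
 have "a - X = X * s" unfolding s_def X_def using J pi by (simp add: field_simps)
 then have aX: "\<bar>a - X\<bar> = X * \<bar>s\<bar>" using X by (simp add: abs_mult)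
 have sX: "0 < sqrt X" using X by simp
 have "sqrt X <= sqrt ((4 * C)\<^sup>2)"
 proof (rule real_sqrt_le_mono)
 have "4 * C * 1 <= 4 * C * (4 * C)" using C by (intro mult_left_mono) auto
 then show "X <= (4 * C)\<^sup>2" using X(2) by (simp add: power2_eq_square)
 qed
 then have sXC: "sqrt X <= 4 * C" using C0 unfolding real_sqrt_abs by simp
 have "\<bar>sqrt a - sqrt X\<bar> * sqrt X <= \<bar>sqrt a - sqrt X\<bar> * (sqrt a + sqrt X)" using ab by (intro mult_left_mono) auto
 also have "... = \<bar>(sqrt a - sqrt X) * (sqrt a + sqrt X)\<bar>" using ab sX by (simp add: abs_mult)
 also have "(sqrt a - sqrt X) * (sqrt a + sqrt X) = a - X" using ab X by (simp add: algebra_simps)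
 also have "\<bar>a - X\<bar> = (sqrt X * \<bar>s\<bar>) * sqrt X" unfolding aX using X by simp
 finally have "\<bar>sqrt a - sqrt X\<bar> <= sqrt X * \<bar>s\<bar>" using sX by (simp add: mult.commute)
 also have "... <= 4 * C * (160 * (C ^ 3 * k))" using sXC s sX C0 by (intro mult_mono) auto
 also have "... = 640 * C ^ 4 * k" by (simp add: eval_nat_numeral)
 finally show "\<bar>sqrt a - sqrt (2 * pi / (I1 + I2))\<bar> <= 640 * C ^ 4 * k" unfolding X_def J_def .
qed

text \<open>At \<open>x1\<close> the eigenfunction is represented from both sides, so squared
  amplitude times energy agrees. The two half-line masses add up to 1, and the integrals over the
  two parts of the well add up to \<open>J\<close>.\<close>

lemma normalization_constants:
 fixes \<psi> :: "real => real"
 assumes B: "assumption_B v lam" and x1: "x1 \<in> {x_minus v lam<..<x_plus v lam}"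
 and P: "plus_estimates v lam k x1 rho C" and N: "plus_estimates (%x. v (- x)) lam k (- x1) rho C"
 and C: "1 <= C" and k: "0 < k" "16 * C\<^sup>2 * k <= 1"
 and \<psi>: "integrable lborel (%x. (\<psi> x)\<^sup>2)" "(LBINT x. (\<psi> x)\<^sup>2) = 1"
 and cp: "cp ~= 0" "!!x. \<psi> x = cp * u_plus v lam (k ^ 3) x"
 and cm: "cm ~= 0" "!!x. \<psi> (- x) = cm * u_plus (%x. v (- x)) lam (k ^ 3) x"
 defines "J \<equiv> LBINT x=x_minus v lam..x_plus v lam. (lam - v x) powr (-1/2)"
 shows "\<bar>\<bar>cp\<bar> - sqrt 2 * sqrt pi * (1 / sqrt k) * J powr (-1/2)\<bar> <= 640 * C ^ 4 * sqrt k"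
 "\<bar>\<bar>cm\<bar> - sqrt 2 * sqrt pi * (1 / sqrt k) * J powr (-1/2)\<bar> <= 640 * C ^ 4 * sqrt k"
 "\<bar>cp\<bar> * sqrt k <= 16 * C" "\<bar>cm\<bar> * sqrt k <= 16 * C"
proof -
 define u where "u = u_plus v lam (k ^ 3)"
 define w where "w = u_plus (%x. v (- x)) lam (k ^ 3)"
 define I1 where "I1 = (LBINT x=x1..x_plus v lam. (lam - v x) powr (-1/2))"
 define I2 where "I2 = (LBINT x=- x1..- x_minus v lam. (lam - v (- x)) powr (-1/2))"
 note TP = turning_points_uminus[OF B]
 have S1: "set_integrable lborel (einterval x1 (x_plus v lam)) (%x. (lam - v x) powr (-1/2))" "1 / C <= I1" "I1 <= C"
 and M1: "set_integrable lborel {x1..} (%x. (u x)\<^sup>2) --> \<bar>(LINT x:{x1..}|lborel. (u x)\<^sup>2) - k / (2 * pi) * I1\<bar> <= C * k\<^sup>2"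
 and E1: "\<exists>u1. (u has_real_derivative u1) (at x1) &
 \<bar>k ^ 6 * u1\<^sup>2 / sqrt (lam - v x1) + sqrt (lam - v x1) * (u x1)\<^sup>2 - k / pi\<bar> <= C * k\<^sup>2"
 using P unfolding plus_estimates_def Let_def u_def I1_def by blast+
 have S2: "set_integrable lborel (einterval (- x1) (- x_minus v lam)) (%x. (lam - v (- x)) powr (-1/2))" "1 / C <= I2" "I2 <= C"
 and M2: "set_integrable lborel {- x1..} (%x. (w x)\<^sup>2) --> \<bar>(LINT x:{- x1..}|lborel. (w x)\<^sup>2) - k / (2 * pi) * I2\<bar> <= C * k\<^sup>2"
 and E2: "\<exists>u1. (w has_real_derivative u1) (at (- x1)) &
 \<bar>k ^ 6 * u1\<^sup>2 / sqrt (lam - v (- (- x1))) + sqrt (lam - v (- (- x1))) * (w (- x1))\<^sup>2 - k / pi\<bar> <= C * k\<^sup>2"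
 using N unfolding plus_estimates_def Let_def w_def I2_def TP by blast+
 have J: "J = I1 + I2" unfolding J_def I1_def I2_def using interval_integral_split_uminus[OF _ _ S1(1), of "x_minus v lam"] S2(1) x1 by simp
 define A1 where "A1 = (LINT x:{x1..}|lborel. (u x)\<^sup>2)"
 define A2 where "A2 = (LINT x:{- x1..}|lborel. (w x)\<^sup>2)"
 have u2: "(u x)\<^sup>2 = (\<psi> x)\<^sup>2 / cp\<^sup>2" "(w x)\<^sup>2 = (\<psi> (- x))\<^sup>2 / cm\<^sup>2" for x
 using cp cm unfolding u_def w_def by (simp_all add: power_mult_distrib)
 have \<psi>r: "integrable lborel (%x. (\<psi> (- x))\<^sup>2)" using lborel_integrable_real_affine[OF \<psi>(1), of "-1" 0] by simp
 have "integrable lborel (%x. (u x)\<^sup>2)" "integrable lborel (%x. (w x)\<^sup>2)" unfolding u2 using \<psi>(1) \<psi>r by simp_all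
 then have si: "set_integrable lborel {x1..} (%x. (u x)\<^sup>2)" "set_integrable lborel {- x1..} (%x. (w x)\<^sup>2)"
 unfolding set_integrable_def by (intro integrable_mult_indicator; simp)+
 have "1 = (LINT x:{x1..}|lborel. (\<psi> x)\<^sup>2) + (LINT x:{- x1..}|lborel. (\<psi> (- x))\<^sup>2)"
 using mass_split[OF \<psi>(1), of x1] \<psi>(2) by simp
 moreover have "(LINT x:{x1..}|lborel. (\<psi> x)\<^sup>2) = cp\<^sup>2 * A1" "(LINT x:{- x1..}|lborel. (\<psi> (- x))\<^sup>2) = cm\<^sup>2 * A2"
 unfolding A1_def A2_def set_integral_mult_right[symmetric] u2 using cp(1) cm(1) by simp_all
 ultimately have mass: "cp\<^sup>2 * A1 + cm\<^sup>2 * A2 = 1" by simp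
 obtain u1 where u1: "(u has_real_derivative u1) (at x1)" "\<bar>k ^ 6 * u1\<^sup>2 / sqrt (lam - v x1) + sqrt (lam - v x1) * (u x1)\<^sup>2 - k / pi\<bar> <= C * k\<^sup>2"
 using E1 by blast
 obtain w1 where w1: "(w has_real_derivative w1) (at (- x1))" "\<bar>k ^ 6 * w1\<^sup>2 / sqrt (lam - v x1) + sqrt (lam - v x1) * (w (- x1))\<^sup>2 - k / pi\<bar> <= C * k\<^sup>2"
 using E2 unfolding minus_minus by blast
 define F1 where "F1 = k ^ 6 * u1\<^sup>2 / sqrt (lam - v x1) + sqrt (lam - v x1) * (u x1)\<^sup>2"
 define F2 where "F2 = k ^ 6 * w1\<^sup>2 / sqrt (lam - v x1) + sqrt (lam - v x1) * (w (- x1))\<^sup>2"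
 have e0: "cp * u x = cm * w (- x)" for x using cp(2)[of x] cm(2)[of "- x"] unfolding u_def w_def by simp
 \<comment> \<open>Reflection changes the sign of the derivative. The energy contains its square
   only, so this does no harm.\<close>
 have "((%x. cp * u x) has_real_derivative cp * u1) (at x1)" by (intro DERIV_cmult u1)
 moreover have "((%x. cm * w (- x)) has_real_derivative cm * (- w1)) (at x1)" by (intro DERIV_cmult DERIV_uminus_arg w1)
 ultimately have "cp * u1 = cm * (- w1)" unfolding e0 by (rule DERIV_unique)
 then have d2: "cp\<^sup>2 * u1\<^sup>2 = cm\<^sup>2 * w1\<^sup>2" by (metis power2_minus power_mult_distrib)
 have f2: "cp\<^sup>2 * (u x1)\<^sup>2 = cm\<^sup>2 * (w (- x1))\<^sup>2" using e0[of x1] by (metis power_mult_distrib)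
 have "cp\<^sup>2 * F1 = k ^ 6 * (cp\<^sup>2 * u1\<^sup>2) / sqrt (lam - v x1) + sqrt (lam - v x1) * (cp\<^sup>2 * (u x1)\<^sup>2)"
 unfolding F1_def by (simp add: distrib_left mult.left_commute)
 also have "... = cm\<^sup>2 * F2" unfolding d2 f2 F2_def by (simp add: distrib_left mult.left_commute)
 finally have energy: "cp\<^sup>2 * F1 = cm\<^sup>2 * F2" .
 define e1 where "e1 = (F1 - k / pi) / k"
 define e2 where "e2 = (F2 - k / pi) / k"
 define e3 where "e3 = (A1 - k / (2 * pi) * I1) / k"
 define e4 where "e4 = (A2 - k / (2 * pi) * I2) / k"
 have eb: "\<bar>t / k\<bar> <= C * k" if "\<bar>t\<bar> <= C * k\<^sup>2" for t
 using that k(1) by (simp add: abs_divide divide_le_eq power2_eq_square mult.assoc)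
 have e: "\<bar>e1\<bar> <= C * k" "\<bar>e2\<bar> <= C * k" "\<bar>e3\<bar> <= C * k" "\<bar>e4\<bar> <= C * k"
 unfolding e1_def e2_def e3_def e4_def
 by (rule eb[OF u1(2)[folded F1_def]], rule eb[OF w1(2)[folded F2_def]], rule eb[OF mp[OF M1 si(1), folded A1_def]],
 rule eb[OF mp[OF M2 si(2), folded A2_def]])
 have id: "c\<^sup>2 * k * (x / y + (A - k / y * x) / k) = c\<^sup>2 * A" for c x y A :: real using k(1) by (simp add: field_simps)
 \<comment> \<open>The amplitudes are of order k^(-1/2), so \<open>a\<close> and \<open>b\<close>
   are unknowns of order one; energies and masses are divided by k accordingly.\<close>
 define a where "a = cp\<^sup>2 * k"
 define b where "b = cm\<^sup>2 * k"
 have mass': "a * (I1 / (2 * pi) + e3) + b * (I2 / (2 * pi) + e4) = 1"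
 unfolding a_def b_def e3_def e4_def id by (rule mass)
 have energy': "a * (1 / pi + e1) = b * (1 / pi + e2)"
 unfolding a_def b_def e1_def e2_def by (simp only: id[of _ 1 pi, unfolded mult_1_right] energy)
 have ab: "0 <= a" "0 <= b" unfolding a_def b_def using k by auto
 note R1 = amplitude_bound[OF C k ab S1(2,3) S2(2,3) e mass' energy']
 note R2 = amplitude_bound[OF C k ab(2,1) S2(2,3) S1(2,3) e(2,1,4,3) _ energy'[symmetric]]
 have sq: "sqrt a = \<bar>cp\<bar> * sqrt k" "sqrt b = \<bar>cm\<bar> * sqrt k" unfolding a_def b_def by (simp_all add: real_sqrt_mult)
 have Jp: "0 < J" unfolding J using S1(2) S2(2) C by (auto intro!: add_pos_pos intro: less_le_trans[of 0 "1 / C"])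
 have sJ: "sqrt (2 * pi / J) = sqrt 2 * sqrt pi * J powr (-1/2)"
 using Jp powr_minus_divide[of J "1/2"] by (simp add: real_sqrt_divide real_sqrt_mult powr_half_sqrt)
 have tr: "\<bar>c - S * (1 / sqrt k) * T\<bar> <= D * sqrt k" if "\<bar>c * sqrt k - S * T\<bar> <= D * k" for c S T D
 proof -
 have sk: "0 < sqrt k" "sqrt k * sqrt k = k" using k(1) by auto
 have "\<bar>c - S * (1 / sqrt k) * T\<bar> * sqrt k = \<bar>(c - S * (1 / sqrt k) * T) * sqrt k\<bar>" using sk by (simp add: abs_mult)
 also have "(c - S * (1 / sqrt k) * T) * sqrt k = c * sqrt k - S * T" using sk(1) by (simp add: left_diff_distrib)
 finally have "\<bar>c - S * (1 / sqrt k) * T\<bar> * sqrt k <= (D * sqrt k) * sqrt k" using that sk(2) by (simp add: mult.assoc)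
 then show ?thesis using sk(1) by simp
 qed
 have ra: "\<bar>\<bar>cp\<bar> * sqrt k - sqrt 2 * sqrt pi * J powr (-1/2)\<bar> <= 640 * C ^ 4 * k" using R1(3) unfolding J[symmetric] sq sJ .
 have rb: "\<bar>\<bar>cm\<bar> * sqrt k - sqrt 2 * sqrt pi * J powr (-1/2)\<bar> <= 640 * C ^ 4 * k"
 using R2(3) mass' unfolding add.commute[of I2 I1] J[symmetric] sq sJ by (simp add: add.commute)
 show "\<bar>\<bar>cp\<bar> - sqrt 2 * sqrt pi * (1 / sqrt k) * J powr (-1/2)\<bar> <= 640 * C ^ 4 * sqrt k" by (rule tr[OF ra])
 show "\<bar>\<bar>cm\<bar> - sqrt 2 * sqrt pi * (1 / sqrt k) * J powr (-1/2)\<bar> <= 640 * C ^ 4 * sqrt k" by (rule tr[OF rb])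
 have le: "s * sqrt k <= 16 * C" if "s\<^sup>2 * k <= 16 * C" "0 <= s" for s
 proof (rule power2_le_imp_le)
 have "16 * C * 1 <= 16 * C * (16 * C)" using C by (intro mult_left_mono) auto
 moreover have "(s * sqrt k)\<^sup>2 = s\<^sup>2 * k" using k(1) by (simp add: power_mult_distrib)
 ultimately show "(s * sqrt k)\<^sup>2 <= (16 * C)\<^sup>2" unfolding power2_eq_square[of "16 * C"] using that(1) by linarith
 qed (use C in simp)
 show "\<bar>cp\<bar> * sqrt k <= 16 * C" "\<bar>cm\<bar> * sqrt k <= 16 * C"
 using le[of "\<bar>cp\<bar>"] le[of "\<bar>cm\<bar>"] R1(1,2) unfolding a_def b_def by simp_all
qed

lemma normalized_eigenfunction_exists:
 fixes \<psi> :: "real => real"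
 assumes h: "0 < h" and \<psi>: "eigenfunction v lam h \<psi>" shows "\<exists>\<phi>. normalized_eigenfunction v lam h \<phi>"
proof -
 have hs: "homogeneous_solution v lam h \<psi>" and nz: "\<exists>x. \<psi> x ~= 0" and i: "integrable lborel (%x. (\<psi> x)\<^sup>2)"
 using \<psi> unfolding eigenfunction_iff[OF h] by auto
 define m where "m = (LBINT x. (\<psi> x)\<^sup>2)"
 obtain u1 where "!!x. (\<psi> has_real_derivative u1 x) (at x)" using hs unfolding homogeneous_solution_iff by blast
 then have c: "isCont \<psi> x" for x by (rule DERIV_isCont)
 obtain z where z: "\<psi> z ~= 0" using nz by blast
 have "isCont (%x. (\<psi> x)\<^sup>2) z" using c by (intro continuous_intros)
 then have "((%x. (\<psi> x)\<^sup>2) \<longlongrightarrow> (\<psi> z)\<^sup>2) (at z)" by (simp add: isCont_def)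
 moreover have "(\<psi> z)\<^sup>2 / 2 < (\<psi> z)\<^sup>2" using z by simp
 ultimately have "eventually (%x. (\<psi> z)\<^sup>2 / 2 < (\<psi> x)\<^sup>2) (at z)" by (rule order_tendstoD(1))
 then obtain d where d: "0 < d" "!!x. x ~= z ==> dist x z < d ==> (\<psi> z)\<^sup>2 / 2 < (\<psi> x)\<^sup>2"
 unfolding eventually_at by auto
 have "(LINT x|lborel. (\<psi> z)\<^sup>2 / 2 * indicator {z<..<z + d} x) <= m" unfolding m_def
 proof (rule integral_mono[OF _ i])
 show "integrable lborel (%x. (\<psi> z)\<^sup>2 / 2 * indicator {z<..<z + d} x)"
 by (intro integrable_mult_right integrable_real_indicator) (use d(1) in auto)
 show "(\<psi> z)\<^sup>2 / 2 * indicator {z<..<z + d} x <= (\<psi> x)\<^sup>2" for x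
 using d(2)[of x] by (cases "x \<in> {z<..<z + d}") (auto simp: dist_real_def)
 qed
 moreover have "(LINT x|lborel. (\<psi> z)\<^sup>2 / 2 * indicator {z<..<z + d} x) = (\<psi> z)\<^sup>2 / 2 * d" using d(1) by simp
 moreover have "0 < (\<psi> z)\<^sup>2 / 2 * d" using z d(1) by simp
 ultimately have m: "0 < m" by linarith
 have sq: "(1 / sqrt m * \<psi> x)\<^sup>2 = (\<psi> x)\<^sup>2 / m" for x using m by (simp add: power_mult_distrib power_divide)
 have "eigenfunction v lam h (%x. 1 / sqrt m * \<psi> x)" unfolding eigenfunction_iff[OF h] sq
 using homogeneous_solution_scale[OF hs, of "1 / sqrt m"] z m i by auto
 moreover have "(LBINT x. (1 / sqrt m * \<psi> x)\<^sup>2) = 1" unfolding sq using m unfolding m_def by simp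
 ultimately show ?thesis unfolding normalized_eigenfunction_def by blast
qed

lemma same_norm_proportional:
 fixes f g u :: "real => real"
 assumes "!!x. f x = a * u x" "!!x. g x = b * u x" "(LBINT x. (f x)\<^sup>2) = 1" "(LBINT x. (g x)\<^sup>2) = 1"
 shows "g = f \<or> g = (%x. - f x)"
proof -
 have "a\<^sup>2 * (LBINT x. (u x)\<^sup>2) = 1" "b\<^sup>2 * (LBINT x. (u x)\<^sup>2) = 1" using assms(3,4) unfolding assms(1,2) power_mult_distrib by simp_all
 then have "a\<^sup>2 = b\<^sup>2" by (metis mult_cancel_right mult_zero_right zero_neq_one)
 then have "b = a \<or> b = - a" by (metis power2_eq_iff)
 then show ?thesis using assms(1,2) by (auto simp: fun_eq_iff)
qed

section \<open>Assembling the two sides\<close>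

lemma side_pair:
 assumes A: "assumption_A v lam0 r0" and B: "assumption_B v lam0" and x1: "x1 \<in> {x_minus v lam0<..<x_plus v lam0}"
 and rho: "rho = 3/2 * min (r0 - 1) 1"
 shows "\<exists>e>0. \<exists>k0>0. \<exists>C\<ge>1. \<forall>lam. \<bar>lam - lam0\<bar> < e --> assumption_B v lam & x1 \<in> {x_minus v lam<..<x_plus v lam} &
 (\<forall>k. 0 < k & k <= k0 --> (\<exists>\<psi>::real => real. eigenfunction v lam (k ^ 3) \<psi>) --> 16 * C\<^sup>2 * k <= 1 &
 plus_estimates v lam k x1 rho C & plus_estimates (%x. v (- x)) lam k (- x1) rho C)"
proof -
 let ?w = "%x. v (- x)"
 have C2: "Ck_on 2 v UNIV" using A unfolding assumption_A_def by blast
 obtain e1 k1 C1 where 1: "0 < e1" "0 < k1" "1 <= C1" "!!lam. \<bar>lam - lam0\<bar> < e1 ==> assumption_B v lam & x1 \<in> {x_minus v lam<..<x_plus v lam} &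
 (\<forall>k. 0 < k & k <= k1 --> (\<exists>\<psi>::real => real. eigenfunction v lam (k ^ 3) \<psi>) --> (\<forall>C\<ge>C1. plus_estimates v lam k x1 rho C))"
 using plus_side[OF A B x1 rho] by blast
 have x1': "- x1 \<in> {x_minus ?w lam0<..<x_plus ?w lam0}" unfolding turning_points_uminus[OF B] using x1 by simp
 obtain e2 k2 C2' where 2: "0 < e2" "0 < k2" "1 <= C2'" "!!lam. \<bar>lam - lam0\<bar> < e2 ==> assumption_B ?w lam & - x1 \<in> {x_minus ?w lam<..<x_plus ?w lam} &
 (\<forall>k. 0 < k & k <= k2 --> (\<exists>\<psi>::real => real. eigenfunction ?w lam (k ^ 3) \<psi>) --> (\<forall>C\<ge>C2'. plus_estimates ?w lam k (- x1) rho C))"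
 using plus_side[OF assumption_A_uminus[OF A] assumption_B_uminus[OF C2 B] x1' rho] by blast
 define C where "C = max C1 C2'"
 have C: "1 <= C" "C1 <= C" "C2' <= C" unfolding C_def using 1 by auto
 define k0 where "k0 = min (min k1 k2) (1 / (16 * C\<^sup>2))"
 have k0: "0 < k0" "k0 <= k1" "k0 <= k2" "k0 <= 1 / (16 * C\<^sup>2)" unfolding k0_def using 1 2 C by (auto simp: min_le_iff_disj)
 show ?thesis
 proof (rule exI[of _ "min e1 e2"], rule conjI, simp add: 1 2, rule exI[of _ k0], rule conjI[OF k0(1)], rule exI[of _ C], rule conjI[OF C(1)],
 intro allI impI)
 fix lam assume "\<bar>lam - lam0\<bar> < min e1 e2"
 then have l: "\<bar>lam - lam0\<bar> < e1" "\<bar>lam - lam0\<bar> < e2" by auto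
 have "16 * C\<^sup>2 * k <= 1 & plus_estimates v lam k x1 rho C & plus_estimates ?w lam k (- x1) rho C"
 if k: "0 < k" "k <= k0" and \<psi>: "eigenfunction v lam (k ^ 3) \<psi>" for k and \<psi> :: "real => real"
 proof (intro conjI)
 have "16 * C\<^sup>2 * k <= 16 * C\<^sup>2 * (1 / (16 * C\<^sup>2))" using k k0(4) by (intro mult_left_mono) auto
 then show "16 * C\<^sup>2 * k <= 1" using C(1) by simp
 have "k <= k1" "k <= k2" "0 < k ^ 3" using k k0 by auto
 show "plus_estimates v lam k x1 rho C" using 1(4)[OF l(1)] k(1) \<open>k <= k1\<close> \<psi> C(2) by blast
 show "plus_estimates ?w lam k (- x1) rho C"
 using 2(4)[OF l(2)] k(1) \<open>k <= k2\<close> eigenfunction_uminus[OF \<open>0 < k ^ 3\<close> \<psi>] C(3) by blast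
 qed
 then show "assumption_B v lam & x1 \<in> {x_minus v lam<..<x_plus v lam} &
 (\<forall>k. 0 < k & k <= k0 --> (\<exists>\<psi>::real => real. eigenfunction v lam (k ^ 3) \<psi>) --> 16 * C\<^sup>2 * k <= 1 &
 plus_estimates v lam k x1 rho C & plus_estimates ?w lam k (- x1) rho C)" using 1(4)[OF l(1)] by blast
 qed
qed

text \<open>The constant is dictated by the amplitude estimate; 640 C^4 also dominates C, from the
  estimates of \<open>u_plus\<close>, and 16 C^2, from the bound at the turning points.\<close>

lemma eigenfunction_asymptotics:
 fixes \<psi> :: "real => real"
 assumes B: "assumption_B v lam" and x1: "x1 \<in> {x_minus v lam<..<x_plus v lam}"
 and P: "plus_estimates v lam k x1 \<rho> C" and N: "plus_estimates (%x. v (- x)) lam k (- x1) \<rho> C"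
 and C: "1 <= C" and k: "0 < k" "16 * C\<^sup>2 * k <= 1" and h: "h = k ^ 3" and D: "D = 640 * C ^ 4"
 and \<psi>: "normalized_eigenfunction v lam h \<psi>"
 shows "(\<forall>\<phi>. normalized_eigenfunction v lam h \<phi> --> \<phi> = \<psi> \<or> \<phi> = (%x. - \<psi> x)) &
 (\<exists>c_plus c_minus.
 (\<forall>x. \<psi> x = c_plus * u_plus v lam h x) &
 (\<forall>x. \<psi> x = c_minus * u_minus v lam h x) &
 (\<forall>c\<in>{c_plus, c_minus}.
 \<bar>\<bar>c\<bar> - sqrt 2 * sqrt pi * h powr (-1/6) *
 (LBINT x=x_minus v lam..x_plus v lam. (lam - v x) powr (-1/2)) powr (-1/2)\<bar>
 <= D * h powr (1/6))) &
 (\<exists>\<epsilon>. \<forall>x\<ge>x_plus v lam.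
 u_plus v lam h x =
 \<bar>deriv (xi_plus v lam) x\<bar> powr (-1/2) *
 Airy_Ai (h powr (-2/3) * xi_plus v lam x) * (1 + \<epsilon> x) &
 \<bar>\<epsilon> x\<bar> <= D * h * (1 + \<bar>xi_plus v lam x\<bar>) powr (-\<rho>)) &
 (\<forall>x\<in>{x1<..<x_plus v lam}.
 \<bar>u_plus v lam h x -
 \<bar>deriv (xi_plus v lam) x\<bar> powr (-1/2) *
 Airy_Ai (h powr (-2/3) * xi_plus v lam x)\<bar>
 <= D * h powr (7/6) * (h powr (2/3) + \<bar>x - x_plus v lam\<bar>) powr (-1/4)) &
 (\<exists>\<epsilon>. \<forall>x\<le>x_minus v lam.
 u_minus v lam h x =
 \<bar>deriv (xi_minus v lam) x\<bar> powr (-1/2) *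
 Airy_Ai (h powr (-2/3) * xi_minus v lam x) * (1 + \<epsilon> x) &
 \<bar>\<epsilon> x\<bar> <= D * h * (1 + \<bar>xi_minus v lam x\<bar>) powr (-\<rho>)) &
 (\<forall>x\<in>{x_minus v lam<..<x1}.
 \<bar>u_minus v lam h x -
 \<bar>deriv (xi_minus v lam) x\<bar> powr (-1/2) *
 Airy_Ai (h powr (-2/3) * xi_minus v lam x)\<bar>
 <= D * h powr (7/6) * (h powr (2/3) + \<bar>x - x_minus v lam\<bar>) powr (-1/4)) &
 (\<forall>x0\<in>{x_plus v lam, x_minus v lam}. \<forall>x. \<bar>x - x0\<bar> <= 1 / C -->
 \<bar>\<psi> x\<bar> <= D * (h powr (2/3) + \<bar>x - x0\<bar>) powr (-1/4))"
proof -
 let ?w = "%x. v (- x)"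
 have h0: "0 < k ^ 3" using k by simp
 note pw = powr_cube[OF k(1)]
 note TP = turning_points_uminus[OF B]
 have CD: "C <= D" "16 * C\<^sup>2 <= D"
 unfolding D using power_increasing[of 1 4 C] power_increasing[of 2 4 C] C by auto
 note Pd = P[unfolded plus_estimates_def Let_def Ball_def greaterThanLessThan_iff]
 and Nd = N[unfolded plus_estimates_def Let_def Ball_def greaterThanLessThan_iff TP]
 have eP: "\<exists>c. c ~= 0 & (\<forall>x. f x = c * u_plus v lam (k ^ 3) x)" if "eigenfunction v lam (k ^ 3) f" for f using Pd that by blast
 have P3: "0 < airy_approx (xi_plus v lam) k x &
 \<bar>u_plus v lam (k ^ 3) x / airy_approx (xi_plus v lam) k x - 1\<bar> <= C * k ^ 3 * (1 + \<bar>xi_plus v lam x\<bar>) powr (- \<rho>)"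
 if "x_plus v lam <= x" for x using Pd that by blast
 have P4: "\<bar>u_plus v lam (k ^ 3) x - airy_approx (xi_plus v lam) k x\<bar> <= C * (k ^ 3 * sqrt k) * (k\<^sup>2 + \<bar>x - x_plus v lam\<bar>) powr (-1/4)"
 if "x1 < x" "x < x_plus v lam" for x using Pd that by blast
 have P5: "\<bar>u_plus v lam (k ^ 3) x\<bar> <= C * sqrt k * (k\<^sup>2 + \<bar>x - x_plus v lam\<bar>) powr (-1/4)"
 if "\<bar>x - x_plus v lam\<bar> <= 1 / C" for x using Pd that by blast
 have uN: "homogeneous_solution ?w lam (k ^ 3) f & f \<sim>[at_top] wkb_plus ?w lam (k ^ 3) \<longleftrightarrow> f = u_plus ?w lam (k ^ 3)" for f
 using Nd by blast
 have eN: "\<exists>c. c ~= 0 & (\<forall>x. f x = c * u_plus ?w lam (k ^ 3) x)" if "eigenfunction ?w lam (k ^ 3) f" for f using Nd that by blast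
 have N3': "0 < airy_approx (xi_plus ?w lam) k x &
 \<bar>u_plus ?w lam (k ^ 3) x / airy_approx (xi_plus ?w lam) k x - 1\<bar> <= C * k ^ 3 * (1 + \<bar>xi_plus ?w lam x\<bar>) powr (- \<rho>)"
 if "- x_minus v lam <= x" for x using Nd that by blast
 have N4': "\<bar>u_plus ?w lam (k ^ 3) x - airy_approx (xi_plus ?w lam) k x\<bar> <= C * (k ^ 3 * sqrt k) * (k\<^sup>2 + \<bar>x - - x_minus v lam\<bar>) powr (-1/4)"
 if "- x1 < x" "x < - x_minus v lam" for x using Nd that by blast
 have N5': "\<bar>u_plus ?w lam (k ^ 3) x\<bar> <= C * sqrt k * (k\<^sup>2 + \<bar>x - - x_minus v lam\<bar>) powr (-1/4)"
 if "\<bar>x - - x_minus v lam\<bar> <= 1 / C" for x using Nd that by blast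
 have um: "u_minus v lam (k ^ 3) x = u_plus ?w lam (k ^ 3) (- x)" for x using u_minus_uminus[OF B uN] by simp
 have am: "airy_approx (xi_plus ?w lam) k (- x) = airy_approx (xi_minus v lam) k x" for x using airy_approx_uminus[OF B, of k "- x"] by simp
 have xm: "xi_plus ?w lam (- x) = xi_minus v lam x" for x using xi_minus_uminus[OF B, of "- x"] by simp
 have ab: "\<bar>- x - - y\<bar> = \<bar>x - y\<bar>" for x y :: real by simp
 have N3: "0 < airy_approx (xi_minus v lam) k x &
 \<bar>u_minus v lam (k ^ 3) x / airy_approx (xi_minus v lam) k x - 1\<bar> <= C * k ^ 3 * (1 + \<bar>xi_minus v lam x\<bar>) powr (- \<rho>)"
 if "x <= x_minus v lam" for x using N3'[of "- x"] that unfolding am xm um by simp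
 have N4: "\<bar>u_minus v lam (k ^ 3) x - airy_approx (xi_minus v lam) k x\<bar> <= C * (k ^ 3 * sqrt k) * (k\<^sup>2 + \<bar>x - x_minus v lam\<bar>) powr (-1/4)"
 if "x_minus v lam < x" "x < x1" for x using N4'[of "- x"] that unfolding am um ab by simp
 have N5: "\<bar>u_minus v lam (k ^ 3) x\<bar> <= C * sqrt k * (k\<^sup>2 + \<bar>x - x_minus v lam\<bar>) powr (-1/4)" if "\<bar>x - x_minus v lam\<bar> <= 1 / C" for x
 using N5'[of "- x"] that unfolding um ab by simp
 have e\<psi>: "eigenfunction v lam (k ^ 3) \<psi>" and n\<psi>: "(LBINT x. (\<psi> x)\<^sup>2) = 1" using \<psi> unfolding normalized_eigenfunction_def h by auto
 obtain cp where cp: "cp ~= 0" "!!x. \<psi> x = cp * u_plus v lam (k ^ 3) x" using eP[OF e\<psi>] by blast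
 obtain cm where cm: "cm ~= 0" "!!x. \<psi> (- x) = cm * u_plus ?w lam (k ^ 3) x" using eN[OF eigenfunction_uminus[OF h0 e\<psi>]] by blast
 have cm': "\<psi> x = cm * u_minus v lam (k ^ 3) x" for x using cm(2)[of "- x"] unfolding um by simp
 have i\<psi>: "integrable lborel (%x. (\<psi> x)\<^sup>2)" using e\<psi> unfolding eigenfunction_iff[OF h0] by blast
 note NC = normalization_constants[OF B x1 P N C k i\<psi> n\<psi> cp cm]
 have uniq: "\<phi> = \<psi> \<or> \<phi> = (%x. - \<psi> x)" if "normalized_eigenfunction v lam h \<phi>" for \<phi>
 proof -
 have e: "eigenfunction v lam (k ^ 3) \<phi>" and n: "(LBINT x. (\<phi> x)\<^sup>2) = 1" using that unfolding normalized_eigenfunction_def h by auto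
 obtain c where "!!x. \<phi> x = c * u_plus v lam (k ^ 3) x" using eP[OF e] by blast
 from same_norm_proportional[OF cp(2) this n\<psi> n] show ?thesis .
 qed
 have err: "\<exists>\<epsilon>. \<forall>x\<in>S. u x = \<bar>deriv xi x\<bar> powr (-1/2) * Airy_Ai ((k ^ 3) powr (-2/3) * xi x) * (1 + \<epsilon> x) &
 \<bar>\<epsilon> x\<bar> <= D * k ^ 3 * (1 + \<bar>xi x\<bar>) powr (-\<rho>)"
 if a: "!!x. x \<in> S ==> 0 < airy_approx xi k x & \<bar>u x / airy_approx xi k x - 1\<bar> <= C * k ^ 3 * (1 + \<bar>xi x\<bar>) powr (- \<rho>)"
 for S and u xi :: "real => real"
 proof (rule exI[of _ "%x. u x / airy_approx xi k x - 1"], intro ballI conjI)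
 fix x assume x: "x \<in> S"
 show "u x = \<bar>deriv xi x\<bar> powr (-1/2) * Airy_Ai ((k ^ 3) powr (-2/3) * xi x) * (1 + (u x / airy_approx xi k x - 1))"
 unfolding airy_approx_eq[OF k(1)] using a[OF x] by simp
 have "C * k ^ 3 * (1 + \<bar>xi x\<bar>) powr (- \<rho>) <= D * k ^ 3 * (1 + \<bar>xi x\<bar>) powr (- \<rho>)"
 using CD(1) h0 by (intro mult_right_mono) auto
 then show "\<bar>u x / airy_approx xi k x - 1\<bar> <= D * k ^ 3 * (1 + \<bar>xi x\<bar>) powr (- \<rho>)" using a[OF x] by linarith
 qed
 have le: "t <= D * (k ^ 3 * sqrt k) * s" if "t <= C * (k ^ 3 * sqrt k) * s" "0 <= s" for t s
 proof -
 have "C * (k ^ 3 * sqrt k) * s <= D * (k ^ 3 * sqrt k) * s" using CD(1) k(1) that(2) by (intro mult_right_mono) auto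
 then show ?thesis using that(1) by linarith
 qed
 \<comment> \<open>The factor sqrt k in the bound on the decaying solution cancels against the
   amplitude, of which |c| sqrt k <= 16 C is known.\<close>
 have tb: "\<bar>c * t\<bar> <= D * s" if "\<bar>t\<bar> <= C * sqrt k * s" "\<bar>c\<bar> * sqrt k <= 16 * C" "0 <= s" for c t s
 proof -
 have "\<bar>c\<bar> * \<bar>t\<bar> <= \<bar>c\<bar> * (C * sqrt k * s)" using that(1) by (intro mult_left_mono) auto
 also have "... = (\<bar>c\<bar> * sqrt k) * (C * s)" by simp
 also have "... <= 16 * C * (C * s)" using that(2,3) C by (intro mult_right_mono) auto
 also have "... = 16 * C\<^sup>2 * s" by (simp add: power2_eq_square)
 also have "... <= D * s" using CD(2) that(3) by (intro mult_right_mono) auto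
 finally show ?thesis by (simp add: abs_mult)
 qed
 show ?thesis unfolding h
 proof (intro conjI)
 show "\<forall>\<phi>. normalized_eigenfunction v lam (k ^ 3) \<phi> --> \<phi> = \<psi> \<or> \<phi> = (%x. - \<psi> x)" using uniq unfolding h by blast
 show "\<exists>c_plus c_minus. (\<forall>x. \<psi> x = c_plus * u_plus v lam (k ^ 3) x) & (\<forall>x. \<psi> x = c_minus * u_minus v lam (k ^ 3) x) &
 (\<forall>c\<in>{c_plus, c_minus}. \<bar>\<bar>c\<bar> - sqrt 2 * sqrt pi * (k ^ 3) powr (-1/6) *
 (LBINT x=x_minus v lam..x_plus v lam. (lam - v x) powr (-1/2)) powr (-1/2)\<bar> <= D * (k ^ 3) powr (1/6))"
 by (rule exI[of _ cp], rule exI[of _ cm], unfold pw D) (use cp(2) cm' NC(1,2) in blast)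
 show "\<exists>\<epsilon>. \<forall>x\<ge>x_plus v lam. u_plus v lam (k ^ 3) x =
 \<bar>deriv (xi_plus v lam) x\<bar> powr (-1/2) * Airy_Ai ((k ^ 3) powr (-2/3) * xi_plus v lam x) * (1 + \<epsilon> x) &
 \<bar>\<epsilon> x\<bar> <= D * k ^ 3 * (1 + \<bar>xi_plus v lam x\<bar>) powr (-\<rho>)"
 by (rule err[of "{x_plus v lam..}" "xi_plus v lam" "u_plus v lam (k ^ 3)", unfolded Ball_def atLeast_iff, OF P3])
 show "\<exists>\<epsilon>. \<forall>x\<le>x_minus v lam. u_minus v lam (k ^ 3) x =
 \<bar>deriv (xi_minus v lam) x\<bar> powr (-1/2) * Airy_Ai ((k ^ 3) powr (-2/3) * xi_minus v lam x) * (1 + \<epsilon> x) &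
 \<bar>\<epsilon> x\<bar> <= D * k ^ 3 * (1 + \<bar>xi_minus v lam x\<bar>) powr (-\<rho>)"
 by (rule err[of "{..x_minus v lam}" "xi_minus v lam" "u_minus v lam (k ^ 3)", unfolded Ball_def atMost_iff, OF N3])
 show "\<forall>x\<in>{x1<..<x_plus v lam}. \<bar>u_plus v lam (k ^ 3) x - \<bar>deriv (xi_plus v lam) x\<bar> powr (-1/2) *
 Airy_Ai ((k ^ 3) powr (-2/3) * xi_plus v lam x)\<bar>
 <= D * (k ^ 3) powr (7/6) * ((k ^ 3) powr (2/3) + \<bar>x - x_plus v lam\<bar>) powr (-1/4)"
 unfolding airy_approx_eq[OF k(1)] unfolding pw using P4 by (auto intro!: le)
 show "\<forall>x\<in>{x_minus v lam<..<x1}. \<bar>u_minus v lam (k ^ 3) x - \<bar>deriv (xi_minus v lam) x\<bar> powr (-1/2) *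
 Airy_Ai ((k ^ 3) powr (-2/3) * xi_minus v lam x)\<bar>
 <= D * (k ^ 3) powr (7/6) * ((k ^ 3) powr (2/3) + \<bar>x - x_minus v lam\<bar>) powr (-1/4)"
 unfolding airy_approx_eq[OF k(1)] unfolding pw using N4 by (auto intro!: le)
 have "\<bar>\<psi> x\<bar> <= D * (k\<^sup>2 + \<bar>x - x_plus v lam\<bar>) powr (-1/4)" if "\<bar>x - x_plus v lam\<bar> <= 1 / C" for x
 unfolding cp(2) by (rule tb[OF P5[OF that] NC(3)]) simp
 moreover have "\<bar>\<psi> x\<bar> <= D * (k\<^sup>2 + \<bar>x - x_minus v lam\<bar>) powr (-1/4)" if "\<bar>x - x_minus v lam\<bar> <= 1 / C" for x
 unfolding cm' by (rule tb[OF N5[OF that] NC(4)]) simp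
 ultimately show "\<forall>x0\<in>{x_plus v lam, x_minus v lam}. \<forall>x. \<bar>x - x0\<bar> <= 1 / C --> \<bar>\<psi> x\<bar> <= D * ((k ^ 3) powr (2/3) + \<bar>x - x0\<bar>) powr (-1/4)"
 unfolding pw by blast
 qed
qed

theorem theorem4p4:
  fixes v :: "real \<Rightarrow> real" and lam0 \<rho>0 \<rho> x1 :: real
  assumes A: "assumption_A v lam0 \<rho>0"
    and B: "assumption_B v lam0"
    and rho: "\<rho> = 3/2 * min (\<rho>0 - 1) 1"
    and x1: "x1 \<in> {x_minus v lam0<..<x_plus v lam0}"
  shows "\<exists>U h0 C \<kappa>. open U \<and> lam0 \<in> U \<and> h0 > 0 \<and> C > 0 \<and> \<kappa> > 0 \<and>
    (\<forall>lam\<in>U. assumption_B v lam \<and> x1 \<in> {x_minus v lam<..<x_plus v lam}) \<and>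
    (\<forall>h\<in>{0<..h0}. \<forall>lam\<in>U. is_eigenvalue v h lam \<longrightarrow>
      (\<exists>\<psi>. normalized_eigenfunction v lam h \<psi>) \<and>
      (\<forall>\<psi>. normalized_eigenfunction v lam h \<psi> \<longrightarrow>
        (\<forall>\<phi>. normalized_eigenfunction v lam h \<phi> \<longrightarrow> \<phi> = \<psi> \<or> \<phi> = (\<lambda>x. - \<psi> x)) \<and>
        (\<exists>c_plus c_minus.
          (\<forall>x. \<psi> x = c_plus * u_plus v lam h x) \<and>
          (\<forall>x. \<psi> x = c_minus * u_minus v lam h x) \<and>
          (\<forall>c\<in>{c_plus, c_minus}.
            \<bar>\<bar>c\<bar> - sqrt 2 * sqrt pi * h powr (-1/6) *
              (LBINT x=x_minus v lam..x_plus v lam. (lam - v x) powr (-1/2)) powr (-1/2)\<bar>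
            \<le> C * h powr (1/6))) \<and>
        (\<exists>\<epsilon>. \<forall>x\<ge>x_plus v lam.
          u_plus v lam h x =
            \<bar>deriv (xi_plus v lam) x\<bar> powr (-1/2) *
            Airy_Ai (h powr (-2/3) * xi_plus v lam x) * (1 + \<epsilon> x) \<and>
          \<bar>\<epsilon> x\<bar> \<le> C * h * (1 + \<bar>xi_plus v lam x\<bar>) powr (-\<rho>)) \<and>
        (\<forall>x\<in>{x1<..<x_plus v lam}.
          \<bar>u_plus v lam h x -
            \<bar>deriv (xi_plus v lam) x\<bar> powr (-1/2) *
            Airy_Ai (h powr (-2/3) * xi_plus v lam x)\<bar>
          \<le> C * h powr (7/6) * (h powr (2/3) + \<bar>x - x_plus v lam\<bar>) powr (-1/4)) \<and>
        (\<exists>\<epsilon>. \<forall>x\<le>x_minus v lam.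
          u_minus v lam h x =
            \<bar>deriv (xi_minus v lam) x\<bar> powr (-1/2) *
            Airy_Ai (h powr (-2/3) * xi_minus v lam x) * (1 + \<epsilon> x) \<and>
          \<bar>\<epsilon> x\<bar> \<le> C * h * (1 + \<bar>xi_minus v lam x\<bar>) powr (-\<rho>)) \<and>
        (\<forall>x\<in>{x_minus v lam<..<x1}.
          \<bar>u_minus v lam h x -
            \<bar>deriv (xi_minus v lam) x\<bar> powr (-1/2) *
            Airy_Ai (h powr (-2/3) * xi_minus v lam x)\<bar>
          \<le> C * h powr (7/6) * (h powr (2/3) + \<bar>x - x_minus v lam\<bar>) powr (-1/4)) \<and>
        (\<forall>x0\<in>{x_plus v lam, x_minus v lam}. \<forall>x. \<bar>x - x0\<bar> \<le> \<kappa> \<longrightarrow>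
          \<bar>\<psi> x\<bar> \<le> C * (h powr (2/3) + \<bar>x - x0\<bar>) powr (-1/4))))"
proof -
 obtain e k0 C where e: "0 < e" "0 < k0" "1 <= C" and S: "!!lam. \<bar>lam - lam0\<bar> < e ==> assumption_B v lam & x1 \<in> {x_minus v lam<..<x_plus v lam} &
 (\<forall>k. 0 < k & k <= k0 --> (\<exists>\<psi>::real => real. eigenfunction v lam (k ^ 3) \<psi>) --> 16 * C\<^sup>2 * k <= 1 &
 plus_estimates v lam k x1 \<rho> C & plus_estimates (%x. v (- x)) lam k (- x1) \<rho> C)" using side_pair[OF A B x1 rho] by blast
 have U: "\<bar>lam - lam0\<bar> < e" if "lam \<in> {lam0 - e<..<lam0 + e}" for lam using that by (auto simp: abs_less_iff)
 show ?thesis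
 \<comment> \<open>\<open>C\<close> bounds the one-sided estimates: 640 C^4 is the constant of the
   conclusion, 1 / C the width of the windows at the turning points, and k0^3 the range of
   \<open>h\<close> because h = k^3.\<close>
 proof (rule exI[of _ "{lam0 - e<..<lam0 + e}"], rule exI[of _ "k0 ^ 3"], rule exI[of _ "640 * C ^ 4"], rule exI[of _ "1 / C"],
 intro conjI ballI impI, goal_cases)
 case 1 show ?case by simp
 next
 case 2 show ?case using e by simp
 next
 case 3 show ?case using e by simp
 next
 case 4 show ?case using e by simp
 next
 case 5 show ?case using e by simp
 next
 case (6 lam) show ?case using S[OF U[OF 6]] by blast
 next
 case (7 lam) show ?case using S[OF U[OF 7]] by blast
 next
 case (8 h lam)
 then have h0: "0 < h" by simp
 obtain f :: "real => real" where "eigenfunction v lam h f" using real_eigenfunction_exists[OF 8(3) h0] by blast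
 then show ?case by (rule normalized_eigenfunction_exists[OF h0])
 next
 case (9 h lam)
 note SL = S[OF U[OF 9(2)]]
 define k where "k = root 3 h"
 have h0: "0 < h" and k: "0 < k" "h = k ^ 3" using 9(1) unfolding k_def by auto
 have "root 3 h <= root 3 (k0 ^ 3)" using 9(1) by simp
 then have kk: "k <= k0" unfolding k_def using e(2) by (simp add: real_root_power_cancel)
 obtain f :: "real => real" where f: "eigenfunction v lam h f" using real_eigenfunction_exists[OF 9(3) h0] by blast
 have PN: "16 * C\<^sup>2 * k <= 1" "plus_estimates v lam k x1 \<rho> C" "plus_estimates (%x. v (- x)) lam k (- x1) \<rho> C"
 using SL k(1) kk f[unfolded k(2)] by blast+
 have B': "assumption_B v lam" and x1': "x1 \<in> {x_minus v lam<..<x_plus v lam}" using SL by auto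
 show ?case by (intro allI impI) (rule eigenfunction_asymptotics[OF B' x1' PN(2,3) e(3) k(1) PN(1) k(2) refl])
 qed
qed

end
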